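(* Consider the online graph partitioning problem with $\ell$ servers, server capacity $k$, and a fixed constant $\varepsilon$ with $(10/k)^{1/4}\le \varepsilon<1/4$, where the online algorithm may place up to $(1+\varepsilon)k$ vertices on each server. There is a randomized online algorithm with competitive ratio $O(\log \ell+\log k)$ against an oblivious adversary (the constant hidden in the $O$-notation may depend on $\varepsilon$).
   Context: Online graph partitioning problem: There is a vertex set $V$ with $|V|=\ell\cdot k$. Initially each vertex is assigned to one of $\ell$ servers so that every server holds exactly $k$ vertices, and the graph $G=(V,E)$ has $E=\emptyset$. Edges of $G$ are then revealed one by one in an online fashion. The request sequence is guaranteed to be such that at all times there exists an assignment of vertices to servers in which each server holds at most $k$ vertices and every connected component of the current graph lies entirely on one server. After each edge insertion, an online algorithm must (possibly) move vertices between servers so that every connected component of the revealed graph lies entirely on a single server (cc-condition), while each server holds at most $(1+\varepsilon)k$ vertices. Each vertex move costs $1/k$. The optimal offline algorithm $\mathrm{OPT}$ knows the whole sequence in advance and must keep at most $k$ vertices per server; its cost is the minimum total cost of moves needed. For a randomized online algorithm, an oblivious adversary fixes the request sequence without knowing the algorithm's random choices, and the competitive ratio is the supremum over request sequences of $\mathbb{E}[\mathrm{cost}(\mathrm{ONL})]/\mathrm{cost}(\mathrm{OPT})$. *)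

theory Defs
  imports "HOL-Probability.Probability"
begin

text \<open>
  Servers are the numbers below \<open>l\<close>, vertices are natural numbers, and an edge is a
  two-element set of vertices. An assignment maps each vertex to its server; its values
  outside the vertex set are irrelevant.
\<close>

type_synonym assignment = "nat \<Rightarrow> nat"
type_synonym edge = "nat set"

definition initial_assignment :: "nat set \<Rightarrow> nat \<Rightarrow> nat \<Rightarrow> assignment \<Rightarrow> bool" where
  "initial_assignment V l k f0 \<longleftrightarrow>
     finite V \<and> card V = l * k \<and>
     (\<forall>v\<in>V. f0 v < l) \<and> (\<forall>s<l. card {v \<in> V. f0 v = s} = k)"

definition components :: "nat set \<Rightarrow> edge set \<Rightarrow> nat set set" where
  "components V E = (\<lambda>v. {(u, w). {u, w} \<in> E}\<^sup>* `` {v}) ` V"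

definition valid_assignment ::
    "nat set \<Rightarrow> nat \<Rightarrow> real \<Rightarrow> edge set \<Rightarrow> assignment \<Rightarrow> bool" where
  "valid_assignment V l c E f \<longleftrightarrow>
     (\<forall>v\<in>V. f v < l) \<and>
     (\<forall>s<l. real (card {v \<in> V. f v = s}) \<le> c) \<and>
     (\<forall>K\<in>components V E. \<exists>s<l. \<forall>v\<in>K. f v = s)"

definition request_sequences :: "nat set \<Rightarrow> nat \<Rightarrow> nat \<Rightarrow> edge list set" where
  "request_sequences V l k =
     {\<sigma>. distinct \<sigma> \<and> (\<forall>e\<in>set \<sigma>. e \<subseteq> V \<and> card e = 2) \<and>
         (\<forall>t\<le>length \<sigma>. \<exists>f. valid_assignment V l (real k) (set (take t \<sigma>)) f)}"

text \<open>
  A schedule gives, for each \<open>t\<close>, the assignment held after the first \<open>t\<close> requests have been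
  served. Capacities are imposed after each request only, not between the individual moves
  made in response to it; so passing from one assignment to the next takes one move for each
  vertex whose server changes.
\<close>

definition valid_schedule ::
    "nat set \<Rightarrow> nat \<Rightarrow> real \<Rightarrow> assignment \<Rightarrow> edge list \<Rightarrow> (nat \<Rightarrow> assignment) \<Rightarrow> bool" where
  "valid_schedule V l c f0 \<sigma> F \<longleftrightarrow>
     F 0 = f0 \<and> (\<forall>t\<in>{1..length \<sigma>}. valid_assignment V l c (set (take t \<sigma>)) (F t))"

definition schedule_cost :: "nat set \<Rightarrow> nat \<Rightarrow> edge list \<Rightarrow> (nat \<Rightarrow> assignment) \<Rightarrow> real" where
  "schedule_cost V k \<sigma> F =
     (\<Sum>t<length \<sigma>. real (card {v \<in> V. F (Suc t) v \<noteq> F t v}) / real k)"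

text \<open>
  For a request sequence in \<open>request_sequences V l k\<close> the infimum is a minimum: a valid
  schedule exists, and all costs are natural multiples of \<open>1 / k\<close>.
\<close>

definition opt_cost :: "nat set \<Rightarrow> nat \<Rightarrow> nat \<Rightarrow> assignment \<Rightarrow> edge list \<Rightarrow> real" where
  "opt_cost V l k f0 \<sigma> =
     Inf {schedule_cost V k \<sigma> F | F. valid_schedule V l (real k) f0 \<sigma> F}"

text \<open>
  A deterministic online algorithm maps the nonempty list of edges revealed so far to an
  assignment. A randomized one is a probability distribution on deterministic ones. Discrete
  distributions suffice, since for a fixed \<open>V\<close> there are only finitely many request sequences.
\<close>

type_synonym online_algorithm = "edge list \<Rightarrow> assignment"

definition run :: "assignment \<Rightarrow> online_algorithm \<Rightarrow> edge list \<Rightarrow> nat \<Rightarrow> assignment" where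
  "run f0 A \<sigma> t = (if t = 0 then f0 else A (take t \<sigma>))"

definition randomized_online_algorithm ::
    "nat set \<Rightarrow> nat \<Rightarrow> nat \<Rightarrow> real \<Rightarrow> assignment \<Rightarrow> online_algorithm pmf \<Rightarrow> bool" where
  "randomized_online_algorithm V l k \<epsilon> f0 D \<longleftrightarrow>
     (\<forall>\<sigma>\<in>request_sequences V l k. \<forall>A\<in>set_pmf D.
        valid_schedule V l ((1 + \<epsilon>) * real k) f0 \<sigma> (run f0 A \<sigma>))"

text \<open>
  The cost is a bounded function of the algorithm, so the expectation is always a genuine
  integral. The quotient is taken in \<^typ>\<open>ennreal\<close>: for a request sequence of optimal cost
  \<open>0\<close> it is \<open>0\<close> if the expected online cost is \<open>0\<close>, and \<open>\<infinity>\<close> otherwise.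
\<close>

definition competitive_ratio ::
    "nat set \<Rightarrow> nat \<Rightarrow> nat \<Rightarrow> assignment \<Rightarrow> online_algorithm pmf \<Rightarrow> ennreal" where
  "competitive_ratio V l k f0 D =
     (SUP \<sigma>\<in>request_sequences V l k.
        ennreal (measure_pmf.expectation D (\<lambda>A. schedule_cost V k \<sigma> (run f0 A \<sigma>))) /
        ennreal (opt_cost V l k f0 \<sigma>))"

end

theory Submission
  imports Defs
begin

text \<open>
  An assignment \<open>g\<close> that is valid for the final graph is valid at all times, and every schedule ending in \<open>g\<close>
  moves at least the \<open>M\<close> vertices whose server under \<open>g\<close> differs from the initial one. So it suffices to
  bound the expected number of moves by \<open>O((ln l + ln k) * M)\<close> for each such \<open>g\<close>. Let \<open>q\<close> be a constant
  of order \<open>1 / \<epsilon>\<close>, and call a component large if it has at least \<open>k / q\<close> vertices.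

  A component has a home if most of its vertices, almost all of them if it is large, started on one
  server. A merge of components with
  different homes joins many pairs of vertices of different origin, in which \<open>g\<close> moves at least one
  vertex; such merges are charged to the sum of \<open>ln |K|\<close> over the moved vertices, \<open>K\<close> being
  their component. This bounds the cost of keeping all components at home by \<open>O(M * ln k)\<close>.

  Components stay at home, except on a set \<open>X\<close> of active servers, which host the large components
  without a home or with an active home. Whether \<open>X\<close> has room for them depends, up to rounding of
  sizes, on the number of servers of each type in \<open>X\<close>, where there are constantly many types. The set
  \<open>Xs\<close> of the servers that \<open>g\<close> changes substantially always has room, and \<open>k * card Xs = O(M)\<close>. As each
  server changes its type \<open>O(ln k)\<close> times, a random \<open>X\<close> can be maintained by multiplicative weights with
  \<open>O(card Xs * (ln l + ln k))\<close> expected changes, and by Dickson's lemma each of them is answered by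
  repacking constantly many active servers. Small components are evicted from a server only when its
  load exceeds \<open>(1 + \<epsilon>) * k\<close>, and then the excess over \<open>(1 + \<epsilon> / 2) * k\<close> pays for it.
\<close>

section \<open>Bundles of weighted servers\<close>

lemma weighted_pmf_exists:
  fixes w :: "'a \<Rightarrow> real"
  assumes "finite S" "S \<noteq> {}" "\<And>s. s \<in> S \<Longrightarrow> w s > 0"
  shows "\<exists>P. set_pmf P = S \<and> (\<forall>s\<in>S. pmf P s = w s / sum w S)"
proof -
  have W: "sum w S > 0" using assms by (intro sum_pos) auto
  define f where "f s = (if s \<in> S then w s / sum w S else 0)" for s
  have nn: "f s \<ge> 0" for s using W assms(3) by (auto simp: f_def less_imp_le)
  have "(\<integral>\<^sup>+ x. ennreal (f x) \<partial>count_space UNIV) = (\<Sum>x\<in>S. ennreal (f x))"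
    using assms(1) by (intro nn_integral_count_space') (auto simp: f_def)
  also have "\<dots> = ennreal (\<Sum>x\<in>S. f x)" using nn by simp
  also have "(\<Sum>x\<in>S. f x) = 1" using W by (simp add: f_def flip: sum_divide_distrib)
  finally have I: "(\<integral>\<^sup>+ x. ennreal (f x) \<partial>count_space UNIV) = 1" by simp
  show ?thesis
  proof (intro exI[of _ "embed_pmf f"] conjI ballI)
    show "pmf (embed_pmf f) s = w s / sum w S" if "s \<in> S" for s
      using that nn I by (simp add: pmf_embed_pmf f_def)
    have "w s \<noteq> 0" if "s \<in> S" for s using assms(3)[OF that] by simp
    thus "set_pmf (embed_pmf f) = S"
      using nn I W by (subst set_embed_pmf) (auto simp: f_def)
  qed
qed

lemma choice_function_pmf:
  fixes w :: "'a \<Rightarrow> real"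
  assumes "finite S" "\<And>s. s \<in> S \<Longrightarrow> w s > 0"
  shows "\<exists>D :: ('a set \<Rightarrow> 'a) pmf. finite (set_pmf D) \<and>
     (\<forall>F\<in>set_pmf D. \<forall>c. c \<subseteq> S \<longrightarrow> c \<noteq> {} \<longrightarrow> F c \<in> c \<and> (\<forall>c'\<subseteq>c. F c \<in> c' \<longrightarrow> F c' = F c)) \<and>
     (\<forall>c\<subseteq>S. \<forall>u\<in>c. pmf (map_pmf (\<lambda>F. F c) D) u = w u / sum w c)"
  using assms
proof (induction S rule: finite_psubset_induct)
  case (psubset S)
  show ?case
  proof (cases "S = {}")
    case True
    thus ?thesis by (intro exI[of _ "return_pmf undefined"]) auto
  next
    case False
    obtain P where P: "set_pmf P = S" "\<And>s. s \<in> S \<Longrightarrow> pmf P s = w s / sum w S"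
      using weighted_pmf_exists[OF psubset.hyps(1) False, of w] psubset.prems by metis
    define Q where "Q v D \<longleftrightarrow> finite (set_pmf D) \<and>
     (\<forall>F\<in>set_pmf D. \<forall>c. c \<subseteq> S - {v} \<longrightarrow> c \<noteq> {} \<longrightarrow> F c \<in> c \<and> (\<forall>c'\<subseteq>c. F c \<in> c' \<longrightarrow> F c' = F c)) \<and>
     (\<forall>c\<subseteq>S - {v}. \<forall>u\<in>c. pmf (map_pmf (\<lambda>F. F c) D) u = w u / sum w c)"
      for v and D :: "('a set \<Rightarrow> 'a) pmf"
    have "\<forall>v\<in>S. \<exists>D. Q v D"
      unfolding Q_def
    proof (rule ballI, rule psubset.IH)
      fix v assume v: "v \<in> S"
      show "S - {v} \<subset> S" using v by blast
      show "0 < w s" if "s \<in> S - {v}" for s using that psubset.prems by blast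
    qed
    from bchoice[OF this] obtain Dv where "\<forall>v\<in>S. Q v (Dv v)" by blast
    hence Dv0: "\<And>v. v \<in> S \<Longrightarrow> Q v (Dv v)" by simp
    have Dv: "\<And>v. v \<in> S \<Longrightarrow> finite (set_pmf (Dv v))"
      "\<And>v F c. v \<in> S \<Longrightarrow> F \<in> set_pmf (Dv v) \<Longrightarrow> c \<subseteq> S - {v} \<Longrightarrow> c \<noteq> {} \<Longrightarrow>
          F c \<in> c \<and> (\<forall>c'\<subseteq>c. F c \<in> c' \<longrightarrow> F c' = F c)"
      "\<And>v c u. v \<in> S \<Longrightarrow> c \<subseteq> S - {v} \<Longrightarrow> u \<in> c \<Longrightarrow> pmf (map_pmf (\<lambda>F. F c) (Dv v)) u = w u / sum w c"
      using Dv0 unfolding Q_def by blast+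
    define D where "D = bind_pmf P (\<lambda>v. map_pmf (\<lambda>F c. if v \<in> c then v else F c) (Dv v))"
    have 1: "finite (set_pmf D)" using Dv(1) psubset.hyps(1) P(1) by (auto simp: D_def)
    have 2: "G c \<in> c \<and> (\<forall>c'\<subseteq>c. G c \<in> c' \<longrightarrow> G c' = G c)"
      if G: "G \<in> set_pmf D" and c: "c \<subseteq> S" "c \<noteq> {}" for G c
    proof -
      from G obtain v F where v: "v \<in> S" "F \<in> set_pmf (Dv v)" "G = (\<lambda>c. if v \<in> c then v else F c)"
        using P(1) by (auto simp: D_def)
      show ?thesis
      proof (cases "v \<in> c")
        case True thus ?thesis using v by auto
      next
        case False
        hence "c \<subseteq> S - {v}" using c by auto
        note D2 = Dv(2)[OF v(1,2) this c(2)]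
        have eq: "G c' = F c'" if "c' \<subseteq> c" for c' using that False v(3) by auto
        have "G c = F c" using eq by blast
        moreover have "G c' = F c" if "c' \<subseteq> c" "F c \<in> c'" for c'
          using D2 that eq by metis
        ultimately show ?thesis using D2 by metis
      qed
    qed
    have 3: "pmf (map_pmf (\<lambda>F. F c) D) u = w u / sum w c" if c: "c \<subseteq> S" "u \<in> c" for c u
    proof -
      have fc: "finite c" using c psubset.hyps(1) finite_subset by blast
      have Wc: "sum w c > 0" using c psubset.prems fc by (intro sum_pos) auto
      have WS: "sum w S > 0" using False psubset.prems psubset.hyps(1) by (intro sum_pos) auto
      define h where "h v = (if v \<in> c then (if v = u then 1 else 0) else w u / sum w c)" for v
      have "map_pmf (\<lambda>F. F c) D = bind_pmf P (\<lambda>v. map_pmf (\<lambda>F. if v \<in> c then v else F c) (Dv v))"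
        by (simp add: D_def map_bind_pmf map_pmf_comp)
      hence "pmf (map_pmf (\<lambda>F. F c) D) u
          = (\<integral>v. pmf (map_pmf (\<lambda>F. if v \<in> c then v else F c) (Dv v)) u \<partial>measure_pmf P)"
        by (simp add: pmf_bind)
      also have "\<dots> = (\<Sum>v\<in>S. pmf (map_pmf (\<lambda>F. if v \<in> c then v else F c) (Dv v)) u * pmf P v)"
        using psubset.hyps(1) P(1) by (intro integral_measure_pmf_real) auto
      also have "\<dots> = (\<Sum>v\<in>S. h v * (w v / sum w S))"
      proof (rule sum.cong[OF refl])
        fix v assume v: "v \<in> S"
        have "pmf (map_pmf (\<lambda>F. if v \<in> c then v else F c) (Dv v)) u = h v"
        proof (cases "v \<in> c")
          case True thus ?thesis by (simp add: h_def map_pmf_const)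
        next
          case nv: False
          hence "c \<subseteq> S - {v}" using c by auto
          with Dv(3)[OF v this c(2)] nv show ?thesis by (simp add: h_def)
        qed
        thus "pmf (map_pmf (\<lambda>F. if v \<in> c then v else F c) (Dv v)) u * pmf P v = h v * (w v / sum w S)"
          using P(2)[OF v] by simp
      qed
      also have "\<dots> = (\<Sum>v\<in>c. h v * (w v / sum w S)) + (\<Sum>v\<in>S - c. h v * (w v / sum w S))"
        by (simp only: sum.subset_diff[OF c(1) psubset.hyps(1)] add.commute)
      also have "(\<Sum>v\<in>c. h v * (w v / sum w S)) = (\<Sum>v\<in>c. if v = u then w u / sum w S else 0)"
        by (intro sum.cong) (auto simp: h_def)
      also have "\<dots> = w u / sum w S" using c fc by simp
      also have "(\<Sum>v\<in>S - c. h v * (w v / sum w S)) = (\<Sum>v\<in>S - c. w u / sum w c / sum w S * w v)"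
        by (intro sum.cong) (auto simp: h_def)
      also have "\<dots> = w u / sum w c / sum w S * (sum w S - sum w c)"
        by (simp only: sum_diff[OF psubset.hyps(1) c(1)] sum_distrib_left[symmetric])
      also have "w u / sum w S + \<dots> = w u / sum w c" using Wc WS by (simp add: field_simps)
      finally show ?thesis .
    qed
    show ?thesis
    proof (intro exI[of _ D] conjI ballI allI impI)
      show "finite (set_pmf D)" by (rule 1)
    next
      fix G c assume "G \<in> set_pmf D" "c \<subseteq> S" "c \<noteq> {}"
      from 2[OF this] show "G c \<in> c" by (rule conjunct1)
    next
      fix G c c' assume a: "G \<in> set_pmf D" "c \<subseteq> S" "c \<noteq> {}" "c' \<subseteq> c" "G c \<in> c'"
      from conjunct2[OF 2[OF a(1-3)]] a(4,5) show "G c' = G c" by (elim allE impE)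
    next
      fix c u assume "c \<subseteq> S" "u \<in> c"
      from 3[OF this] show "pmf (map_pmf (\<lambda>F. F c) D) u = w u / sum w c" .
    qed
  qed
qed

lemma subset_sum_between:
  fixes y :: "'a \<Rightarrow> real"
  assumes "finite A" "\<And>s. s \<in> A \<Longrightarrow> y s < 1" "sum y A \<ge> 1"
  shows "\<exists>B\<subseteq>A. 1 \<le> sum y B \<and> sum y B < 2"
  using assms
proof (induction A rule: finite_induct)
  case (insert a A)
  show ?case
  proof (cases "sum y A \<ge> 1")
    case True
    then obtain B where "B \<subseteq> A" "1 \<le> sum y B" "sum y B < 2" using insert by blast
    thus ?thesis by blast
  next
    case False
    have "y a < 1" using insert by simp
    hence "sum y (insert a A) < 2" using insert.hyps False by simp
    thus ?thesis using insert by blast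
  qed
qed auto

lemma grouping:
  fixes y :: "'a \<Rightarrow> real"
  assumes "finite A" "\<And>s. s \<in> A \<Longrightarrow> 0 < y s \<and> y s < 1" "sum y A \<ge> 1"
  shows "\<exists>G. finite G \<and> \<Union>G = A \<and> (\<forall>b\<in>G. \<forall>c\<in>G. b \<noteq> c \<longrightarrow> b \<inter> c = {}) \<and>
             (\<forall>b\<in>G. 1 \<le> sum y b \<and> sum y b \<le> 3)"
  using assms
proof (induction A rule: finite_psubset_induct)
  case (psubset A)
  show ?case
  proof (cases "sum y A \<le> 3")
    case True
    thus ?thesis using psubset.prems by (intro exI[of _ "{A}"]) auto
  next
    case False
    obtain B where B: "B \<subseteq> A" "1 \<le> sum y B" "sum y B < 2"
      using subset_sum_between[OF psubset.hyps(1), of y] psubset.prems by blast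
    have "B \<noteq> {}" using B by auto
    have s: "sum y (A - B) = sum y A - sum y B" using B psubset.hyps(1) by (simp add: sum_diff)
    have "\<exists>G. finite G \<and> \<Union>G = A - B \<and> (\<forall>b\<in>G. \<forall>c\<in>G. b \<noteq> c \<longrightarrow> b \<inter> c = {}) \<and>
             (\<forall>b\<in>G. 1 \<le> sum y b \<and> sum y b \<le> 3)"
    proof (rule psubset.IH)
      show "A - B \<subset> A" using B \<open>B \<noteq> {}\<close> by blast
      show "0 < y s \<and> y s < 1" if "s \<in> A - B" for s using that psubset.prems(1) by blast
      show "1 \<le> sum y (A - B)" using s B False by linarith
    qed
    then obtain G where G: "finite G" "\<Union>G = A - B" "\<forall>b\<in>G. \<forall>c\<in>G. b \<noteq> c \<longrightarrow> b \<inter> c = {}"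
             "\<forall>b\<in>G. 1 \<le> sum y b \<and> sum y b \<le> 3" by (elim exE conjE)
    show ?thesis 
    proof (intro exI[of _ "insert B G"] conjI)
      show "finite (insert B G)" using G(1) by simp
      show "\<Union>(insert B G) = A" using G(2) B(1) by blast
      show "\<forall>b\<in>insert B G. \<forall>c\<in>insert B G. b \<noteq> c \<longrightarrow> b \<inter> c = {}"
      proof (intro ballI impI)
        fix b c assume bc: "b \<in> insert B G" "c \<in> insert B G" "b \<noteq> c"
        have "B \<inter> d = {}" if "d \<in> G" for d using that G(2) by blast
        thus "b \<inter> c = {}" using bc G(3) by (metis insertE inf_commute)
      qed
      show "\<forall>b\<in>insert B G. 1 \<le> sum y b \<and> sum y b \<le> 3" using G(4) B by simp
    qed
  qed
qed

text \<open>
  A bundle is a set of servers of one type and of total weight about 1, and the algorithm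
  activates one server of each bundle. A server whose weight has reached 1 is frozen: it forms a bundle of
  its own and its weight is not increased any more. The potential pays for the creation of bundles.
\<close>

definition penalty :: "real \<Rightarrow> real" where "penalty m = 3 * max 0 (1 - m) + 12 * max 0 (m - 3)"

definition bundle_value :: "('a \<Rightarrow> real) \<Rightarrow> 'a set \<Rightarrow> real" where
  "bundle_value y b = (if \<forall>s\<in>b. y s < 1 then penalty (sum y b) else if \<exists>s. b = {s} then -40 else 0)"

definition potential :: "'a set \<Rightarrow> ('a \<Rightarrow> real) \<Rightarrow> ('i \<times> 'a set) set \<Rightarrow> real" where
  "potential S y Bs = 120 * sum y S + 3 * sum y (S - \<Union>(snd ` Bs)) + (\<Sum>x\<in>Bs. bundle_value y (snd x))"

definition bundle_family :: "'a set \<Rightarrow> ('a \<Rightarrow> 't) \<Rightarrow> ('i \<times> 'a set) set \<Rightarrow> bool" where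
  "bundle_family S \<tau> Bs \<longleftrightarrow> finite Bs \<and> (\<forall>x\<in>Bs. snd x \<subseteq> S) \<and>
     (\<forall>x\<in>Bs. \<forall>x'\<in>Bs. x \<noteq> x' \<longrightarrow> snd x \<inter> snd x' = {}) \<and>
     (\<forall>x\<in>Bs. \<forall>s\<in>snd x. \<forall>s'\<in>snd x. \<tau> s = \<tau> s')"

definition ok_bundle :: "('a \<Rightarrow> real) \<Rightarrow> 'a set \<Rightarrow> bool" where
  "ok_bundle y b \<longleftrightarrow> (\<exists>s. b = {s} \<and> 1 \<le> y s) \<or> ((\<forall>s\<in>b. y s < 1) \<and> 1/2 \<le> sum y b \<and> sum y b \<le> 4)"

definition balanced :: "'a set \<Rightarrow> ('a \<Rightarrow> 't) \<Rightarrow> ('a \<Rightarrow> real) \<Rightarrow> ('i \<times> 'a set) set \<Rightarrow> bool" where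
  "balanced S \<tau> y Bs \<longleftrightarrow> bundle_family S \<tau> Bs \<and> (\<forall>x\<in>Bs. ok_bundle y (snd x)) \<and>
     (\<forall>s\<in>S. 1 \<le> y s \<longrightarrow> (\<exists>x\<in>Bs. snd x = {s})) \<and>
     (\<forall>a. sum y {s \<in> S - \<Union>(snd ` Bs). \<tau> s = a} < 1)"

lemma penalty_nonneg: "penalty m \<ge> 0"
  by (simp add: penalty_def)

lemma penalty_lipschitz: "penalty m' \<le> penalty m + 12 * \<bar>m' - m\<bar>"
  unfolding penalty_def by (smt (verit))

lemma dropped_bundle_bundle_value:
  assumes "finite b" "\<And>s. s \<in> b \<Longrightarrow> y s > 0" "sum y b \<le> 8" "\<not> ok_bundle y b"
  shows "(\<Sum>s\<in>b. if y s < 1 then 3 * y s else - 39) \<le> bundle_value y b"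
proof (cases "\<forall>s\<in>b. y s < 1")
  case True
  have "(\<Sum>s\<in>b. if y s < 1 then 3 * y s else - 39) = 3 * sum y b"
    unfolding sum_distrib_left using True by (intro sum.cong) auto
  moreover have "sum y b < 1/2 \<or> sum y b > 4" using assms(4) True by (auto simp: ok_bundle_def)
  ultimately show ?thesis using True by (auto simp: bundle_value_def penalty_def)
next
  case False
  then obtain s0 where s0: "s0 \<in> b" "y s0 \<ge> 1" by auto
  have n1: "\<nexists>s. b = {s}" using s0 assms(4) by (auto simp: ok_bundle_def)
  have "(\<Sum>s\<in>b - {s0}. if y s < 1 then 3 * y s else - 39) \<le> (\<Sum>s\<in>b - {s0}. 3 * y s)"
    using assms(2) by (intro sum_mono) (auto intro: order_trans[of _ 0] less_imp_le)
  also have "\<dots> \<le> 3 * sum y b"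
    unfolding sum_distrib_left[symmetric] using assms(1,2)
    by (intro mult_left_mono sum_mono2) (auto intro: less_imp_le)
  finally have "(\<Sum>s\<in>b - {s0}. if y s < 1 then 3 * y s else - 39) \<le> 24" using assms(3) by simp
  moreover have "(\<Sum>s\<in>b. if y s < 1 then 3 * y s else - 39) =
      -39 + (\<Sum>s\<in>b - {s0}. if y s < 1 then 3 * y s else - 39)"
    using s0 assms(1) by (simp add: sum.remove)
  moreover have "bundle_value y b = 0" using n1 False by (auto simp: bundle_value_def)
  ultimately show ?thesis by linarith
qed

lemma rebundle:
  fixes p :: 'i and \<tau> :: "'a \<Rightarrow> 't"
  assumes S: "finite S" and bundle_family: "bundle_family S \<tau> Bs" and y: "\<And>s. s \<in> S \<Longrightarrow> 0 < y s"
    and b8: "\<And>x. x \<in> Bs \<Longrightarrow> sum y (snd x) \<le> 8"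
  shows "\<exists>Bs'. balanced S \<tau> y Bs' \<and> (\<forall>x\<in>Bs'. x \<in> Bs \<or> fst x = p) \<and>
           potential S y Bs' + card (Bs' - Bs) \<le> potential S y Bs"
proof -
  define Keep where "Keep = {x \<in> Bs. ok_bundle y (snd x)}"
  define P0 where "P0 = S - \<Union>(snd ` Keep)"
  define Fz where "Fz = {s \<in> P0. 1 \<le> y s}"
  define P1 where "P1 = {s \<in> P0. y s < 1}"
  define A where "A a = {s \<in> P1. \<tau> s = a}" for a
  define TT where "TT = {a \<in> \<tau> ` P1. sum y (A a) \<ge> 1}"
  have fin: "finite P0" "finite Fz" "finite P1" "\<And>a. finite (A a)" "finite TT"
    using S by (auto simp: P0_def Fz_def P1_def A_def TT_def)
  have sub: "P0 \<subseteq> S" "Fz \<subseteq> P0" "P1 \<subseteq> P0" "\<And>a. A a \<subseteq> P1" by (auto simp: P0_def Fz_def P1_def A_def)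
  have P01: "P0 = P1 \<union> Fz" "P1 \<inter> Fz = {}" by (auto simp: Fz_def P1_def)
  have ypos: "0 < y s" if "s \<in> P0" for s using that sub(1) y by blast
  have wkD: "finite Bs" "\<And>x. x \<in> Bs \<Longrightarrow> snd x \<subseteq> S"
     "\<And>x x'. x \<in> Bs \<Longrightarrow> x' \<in> Bs \<Longrightarrow> x \<noteq> x' \<Longrightarrow> snd x \<inter> snd x' = {}"
     "\<And>x s s'. x \<in> Bs \<Longrightarrow> s \<in> snd x \<Longrightarrow> s' \<in> snd x \<Longrightarrow> \<tau> s = \<tau> s'"
    using bundle_family unfolding bundle_family_def by blast+
  have "\<forall>a\<in>TT. \<exists>G. finite G \<and> \<Union>G = A a \<and> (\<forall>b\<in>G. \<forall>c\<in>G. b \<noteq> c \<longrightarrow> b \<inter> c = {}) \<and>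
             (\<forall>b\<in>G. 1 \<le> sum y b \<and> sum y b \<le> 3)"
  proof
    fix a assume a: "a \<in> TT"
    show "\<exists>G. finite G \<and> \<Union>G = A a \<and> (\<forall>b\<in>G. \<forall>c\<in>G. b \<noteq> c \<longrightarrow> b \<inter> c = {}) \<and>
             (\<forall>b\<in>G. 1 \<le> sum y b \<and> sum y b \<le> 3)"
    proof (rule grouping)
      show "0 < y s \<and> y s < 1" if "s \<in> A a" for s
        using that ypos sub by (auto simp: A_def P1_def)
    qed (use a fin in \<open>auto simp: TT_def\<close>)
  qed
  from bchoice[OF this] obtain G where
    "\<forall>a\<in>TT. finite (G a) \<and> \<Union>(G a) = A a \<and> (\<forall>b\<in>G a. \<forall>c\<in>G a. b \<noteq> c \<longrightarrow> b \<inter> c = {}) \<and>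
             (\<forall>b\<in>G a. 1 \<le> sum y b \<and> sum y b \<le> 3)" by (elim exE)
  note G0 = bspec[OF this]
  note Ga = G0[THEN conjunct1] and Gb = G0[THEN conjunct2, THEN conjunct1]
    and Gc = G0[THEN conjunct2, THEN conjunct2, THEN conjunct1]
    and Gd0 = G0[THEN conjunct2, THEN conjunct2, THEN conjunct2]
  have G: "\<And>a. a \<in> TT \<Longrightarrow> finite (G a)" "\<And>a. a \<in> TT \<Longrightarrow> \<Union>(G a) = A a"
    "\<And>a b c. a \<in> TT \<Longrightarrow> b \<in> G a \<Longrightarrow> c \<in> G a \<Longrightarrow> b \<noteq> c \<Longrightarrow> b \<inter> c = {}"
    "\<And>a b. a \<in> TT \<Longrightarrow> b \<in> G a \<Longrightarrow> 1 \<le> sum y b \<and> sum y b \<le> 3"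
    by (rule Ga, assumption, rule Gb, assumption, metis Gc, metis Gd0)
  define GG where "GG = (\<Union>a\<in>TT. G a)"
  define Q where "Q = (\<Union>a\<in>TT. A a)"
  have GG: "finite GG" using G(1) fin by (simp add: GG_def)
  have GQ: "\<Union>GG = Q" by (auto simp: GG_def Q_def simp flip: G(2))
  have QP: "Q \<subseteq> P1" using sub(4) unfolding Q_def by blast
  have GA: "\<exists>a\<in>TT. b \<in> G a \<and> b \<subseteq> A a" if bG: "b \<in> GG" for b
  proof -
    obtain a where a: "a \<in> TT" "b \<in> G a" using bG by (auto simp: GG_def)
    thus ?thesis using G(2)[OF a(1)] by blast
  qed
  have Gs: "1 \<le> sum y b" "sum y b \<le> 3" "b \<noteq> {}" "b \<subseteq> P1" if bG: "b \<in> GG" for b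
  proof -
    obtain a where a: "a \<in> TT" "b \<in> G a" using bG by (auto simp: GG_def)
    show "1 \<le> sum y b" "sum y b \<le> 3" using G(4)[OF a] by simp_all
    thus "b \<noteq> {}" by auto
    show "b \<subseteq> P1" using bG GQ QP by blast
  qed
  have Gd: "b \<inter> c = {}" if bc: "b \<in> GG" "c \<in> GG" "b \<noteq> c" for b c
  proof -
    obtain a a' where a: "a \<in> TT" "b \<in> G a" "b \<subseteq> A a" "a' \<in> TT" "c \<in> G a'" "c \<subseteq> A a'"
      using GA[OF bc(1)] GA[OF bc(2)] by (elim bexE conjE)
    show ?thesis
    proof (cases "a = a'")
      case True
      with G(3)[OF a(1,2)] a(5) bc(3) show ?thesis by simp
    next
      case False
      hence "A a \<inter> A a' = {}" by (auto simp: A_def)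
      thus ?thesis using a(3,6) by (metis disjoint_eq_subset_Compl order_trans Compl_anti_mono)
    qed
  qed
  define N1 where "N1 = Pair p ` GG"
  define N2 where "N2 = (\<lambda>s. (p, {s})) ` Fz"
  define Bs' where "Bs' = Keep \<union> N1 \<union> N2"
  have finN: "finite Keep" "finite N1" "finite N2" using wkD(1) GG fin by (auto simp: Keep_def N1_def N2_def)
  have KU: "snd x \<inter> P0 = {}" if "x \<in> Keep" for x using that by (auto simp: P0_def)
  have N1P: "snd x \<subseteq> P1" "snd x \<in> GG" "fst x = p" "snd x \<noteq> {}" if xN: "x \<in> N1" for x
  proof -
    obtain b where b: "b \<in> GG" "x = (p, b)" using xN unfolding N1_def by (elim imageE)
    thus "snd x \<subseteq> P1" "snd x \<in> GG" "fst x = p" "snd x \<noteq> {}" using Gs(3,4)[OF b(1)] by simp_all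
  qed
  have N2P: "\<exists>s\<in>Fz. x = (p, {s})" if "x \<in> N2" for x using that by (auto simp: N2_def)
  have NP: "snd x \<subseteq> P0" if xN: "x \<in> N1 \<union> N2" for x
  proof (cases "x \<in> N1")
    case True thus ?thesis using N1P(1)[OF True] sub(3) by blast
  next
    case False
    then obtain s where "s \<in> Fz" "x = (p, {s})" using xN N2P[of x] by blast
    thus ?thesis using sub(2) by (simp add: subsetD)
  qed
  have dis: "Keep \<inter> N1 = {}" "(Keep \<union> N1) \<inter> N2 = {}"
  proof -
    have "False" if "x \<in> Keep" "x \<in> N1" for x using KU[OF that(1)] N1P[OF that(2)] sub by blast
    thus "Keep \<inter> N1 = {}" by blast
    have "False" if "x \<in> Keep" "x \<in> N2" for x using KU[OF that(1)] N2P[OF that(2)] sub by auto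
    moreover have "False" if "x \<in> N1" "x \<in> N2" for x using N1P(1)[OF that(1)] N2P[OF that(2)] P01(2) by (metis disjoint_iff insertI1 snd_conv subsetD)
    ultimately show "(Keep \<union> N1) \<inter> N2 = {}" by blast
  qed
  have U: "\<Union>(snd ` Bs') = \<Union>(snd ` Keep) \<union> Q \<union> Fz"
    by (simp add: Bs'_def image_Un Un_assoc GQ[symmetric] N1_def N2_def image_image)
  have pool': "S - \<Union>(snd ` Bs') = P1 - Q" unfolding U using P01 by (auto simp: P0_def)
  have wk': "bundle_family S \<tau> Bs'"
    unfolding bundle_family_def
  proof (intro conjI ballI impI)
    show "finite Bs'" using finN by (simp add: Bs'_def)
  next
    fix x assume x: "x \<in> Bs'"
    show "snd x \<subseteq> S"
    proof (cases "x \<in> Keep")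
      case True thus ?thesis using wkD(2)[of x] by (simp add: Keep_def)
    next
      case False
      hence "snd x \<subseteq> P0" using x NP[of x] by (simp add: Bs'_def)
      thus ?thesis using sub(1) by blast
    qed
  next
    fix x x' assume x: "x \<in> Bs'" "x' \<in> Bs'" "x \<noteq> x'"
    note a = NP
    have c1: "snd x \<inter> snd x' = {}" if "x \<in> Keep" "x' \<in> N1 \<union> N2" for x x' using KU[OF that(1)] a[OF that(2)] by blast
    have c2: "snd x \<inter> snd x' = {}" if n: "x \<in> N1" "x' \<in> N2" for x x'
    proof -
      obtain s where "s \<in> Fz" "x' = (p, {s})" using N2P[OF n(2)] by (elim bexE)
      thus ?thesis using N1P(1)[OF n(1)] P01(2) by auto
    qed
    have c3: "snd x \<inter> snd x' = {}" if n: "x \<in> N1" "x' \<in> N1" "x \<noteq> x'" for x x'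
    proof -
      have "snd x \<noteq> snd x'" using n(3) N1P(3)[OF n(1)] N1P(3)[OF n(2)] by (simp add: prod_eq_iff)
      thus ?thesis by (rule Gd[OF N1P(2)[OF n(1)] N1P(2)[OF n(2)]])
    qed
    have c4: "snd x \<inter> snd x' = {}" if n: "x \<in> N2" "x' \<in> N2" "x \<noteq> x'" for x x'
      using N2P[OF n(1)] N2P[OF n(2)] n(3) by auto
    have c5: "snd x \<inter> snd x' = {}" if "x \<in> Keep" "x' \<in> Keep" "x \<noteq> x'" for x x' 
    proof (rule wkD(3)[OF _ _ that(3)])
      show "x \<in> Bs" "x' \<in> Bs" using that by (simp_all add: Keep_def)
    qed
    have "x \<in> Keep \<or> x \<in> N1 \<or> x \<in> N2" "x' \<in> Keep \<or> x' \<in> N1 \<or> x' \<in> N2"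
      using x by (auto simp: Bs'_def)
    thus "snd x \<inter> snd x' = {}"
      using c1[of x x'] c1[of x' x] c2[of x x'] c2[of x' x] c3[OF _ _ x(3)] c4[OF _ _ x(3)] c5[OF _ _ x(3)]
      by (simp add: Int_commute) blast
  next
    fix x s s' assume x: "x \<in> Bs'" "s \<in> snd x" "s' \<in> snd x"
    consider "x \<in> Keep" | "x \<in> N1" | "x \<in> N2" using x by (auto simp: Bs'_def)
    thus "\<tau> s = \<tau> s'"
    proof cases
      case 1 
      hence "x \<in> Bs" by (simp add: Keep_def)
      thus ?thesis by (rule wkD(4)[OF _ x(2,3)])
    next
      case 2 
      then obtain a where "snd x \<subseteq> A a" using GA N1P(2) by blast
      thus ?thesis using x by (auto simp: A_def)
    next
      case 3
      from N2P[OF this] obtain s0 where "x = (p, {s0})" by (elim bexE)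
      thus ?thesis using x(2,3) by simp
    qed
  qed
  have ok': "ok_bundle y (snd x)" if xB: "x \<in> Bs'" for x
  proof -
    consider "x \<in> Keep" | "x \<in> N1" | "x \<in> N2" using xB by (auto simp: Bs'_def)
    thus ?thesis
    proof cases
      case 1 thus ?thesis by (simp add: Keep_def)
    next
      case 2
      hence "\<forall>s\<in>snd x. y s < 1" using N1P(1)[OF 2] by (auto simp: P1_def)
      thus ?thesis using Gs(1,2)[OF N1P(2)[OF 2]] by (simp add: ok_bundle_def)
    next
      case 3
      from N2P[OF this] obtain s0 where "s0 \<in> Fz" "x = (p, {s0})" by (elim bexE)
      thus ?thesis by (simp add: ok_bundle_def Fz_def)
    qed
  qed
  have fz': "\<exists>x\<in>Bs'. snd x = {s}" if s: "s \<in> S" "1 \<le> y s" for s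
  proof (cases "s \<in> P0")
    case True
    hence "(p, {s}) \<in> Bs'" using s by (simp add: Bs'_def N2_def Fz_def)
    thus ?thesis by force
  next
    case False
    then obtain x where x: "x \<in> Keep" "s \<in> snd x" using s by (auto simp: P0_def)
    hence "snd x = {s}" using s by (auto simp: Keep_def ok_bundle_def)
    thus ?thesis using x by (auto simp: Bs'_def)
  qed
  have pl': "sum y {s \<in> S - \<Union>(snd ` Bs'). \<tau> s = a} < 1" for a
  proof (cases "a \<in> TT")
    case True
    hence "{s \<in> P1 - Q. \<tau> s = a} = {}" by (auto simp: Q_def A_def)
    thus ?thesis unfolding pool' by (simp only: sum.empty zero_less_one)
  next
    case False
    have sb: "{s \<in> P1 - Q. \<tau> s = a} \<subseteq> A a" by (auto simp: A_def)
    have le: "sum y {s \<in> P1 - Q. \<tau> s = a} \<le> sum y (A a)"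
    proof (rule sum_mono2[OF fin(4) sb])
      show "0 \<le> y s" if "s \<in> A a - {s \<in> P1 - Q. \<tau> s = a}" for s
        using that sub(3) by (intro less_imp_le ypos) (auto simp: A_def)
    qed
    have "sum y (A a) < 1"
    proof (cases "a \<in> \<tau> ` P1")
      case True thus ?thesis using False by (simp add: TT_def)
    next
      case False
      hence "A a = {}" by (auto simp: A_def)
      thus ?thesis by simp
    qed
    thus ?thesis using le by (simp only: pool')
  qed
  have str: "balanced S \<tau> y Bs'" unfolding balanced_def using wk' ok' fz' pl' by blast
  define \<phi> where "\<phi> s = (if y s < 1 then 3 * y s else - 39)" for s
  have phi: "sum \<phi> P0 = 3 * sum y P1 - 39 * real (card Fz)"
  proof -
    have "sum \<phi> P0 = sum \<phi> P1 + sum \<phi> Fz" using P01 fin by (simp add: sum.union_disjoint)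
    also have "sum \<phi> P1 = 3 * sum y P1" unfolding sum_distrib_left by (intro sum.cong) (auto simp: \<phi>_def P1_def)
    also have "sum \<phi> Fz = (\<Sum>s\<in>Fz. -39)" by (intro sum.cong) (auto simp: \<phi>_def Fz_def)
    finally show ?thesis by simp
  qed
  define Drop where "Drop = Bs - Keep"
  define pool where "pool = S - \<Union>(snd ` Bs)"
  have BsKD: "Bs = Keep \<union> Drop" "Keep \<inter> Drop = {}" by (auto simp: Drop_def Keep_def)
  have fD: "finite Drop" using wkD(1) by (simp add: Drop_def)
  have P0D: "P0 = pool \<union> \<Union>(snd ` Drop)"
  proof
    show "P0 \<subseteq> pool \<union> \<Union>(snd ` Drop)" using BsKD(1) by (auto simp: P0_def pool_def)
    have "snd x \<subseteq> P0" if "x \<in> Drop" for x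
    proof -
      have "snd x \<inter> snd x' = {}" if "x' \<in> Keep" for x' using wkD(3)[of x x'] \<open>x \<in> Drop\<close> that BsKD by blast
      thus ?thesis using wkD(2)[of x] that BsKD by (auto simp: P0_def)
    qed
    moreover have "pool \<subseteq> P0" using BsKD(1) by (auto simp: P0_def pool_def)
    ultimately show "pool \<union> \<Union>(snd ` Drop) \<subseteq> P0" by blast
  qed
  have pd: "pool \<inter> \<Union>(snd ` Drop) = {}" using BsKD(1) by (auto simp: pool_def)
  have fb: "finite (snd x)" if "x \<in> Bs" for x using wkD(2)[OF that] S finite_subset by blast
  have "sum \<phi> P0 = sum \<phi> pool + sum \<phi> (\<Union>(snd ` Drop))"
    unfolding P0D using pd S fD fb BsKD by (intro sum.union_disjoint) (auto simp: pool_def)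
  also have "sum \<phi> (\<Union>(snd ` Drop)) = (\<Sum>x\<in>Drop. sum \<phi> (snd x))"
    using fD fb BsKD(1) wkD(3) by (intro sum.UNION_disjoint) auto
  also have "\<dots> \<le> (\<Sum>x\<in>Drop. bundle_value y (snd x))"
  proof (rule sum_mono)
    fix x assume "x \<in> Drop"
    hence x: "x \<in> Bs" "\<not> ok_bundle y (snd x)" by (auto simp: Drop_def Keep_def)
    show "sum \<phi> (snd x) \<le> bundle_value y (snd x)"
      unfolding \<phi>_def by (rule dropped_bundle_bundle_value[OF fb[OF x(1)] _ b8[OF x(1)] x(2)]) (use wkD(2)[OF x(1)] y in blast)
  qed
  also have "sum \<phi> pool \<le> (\<Sum>s\<in>pool. 3 * y s)"
  proof (rule sum_mono)
    fix s assume "s \<in> pool"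
    hence "y s > 0" using y by (simp add: pool_def)
    thus "\<phi> s \<le> 3 * y s" by (simp add: \<phi>_def)
  qed
  finally have main: "sum \<phi> P0 \<le> 3 * sum y pool + (\<Sum>x\<in>Drop. bundle_value y (snd x))" by (simp add: sum_distrib_left)
  have cG: "real (card GG) \<le> sum y Q"
  proof -
    have "real (card GG) = (\<Sum>b\<in>GG. 1)" by simp
    also have "\<dots> \<le> (\<Sum>b\<in>GG. sum y b)" using Gs(1) by (intro sum_mono)
    also have "\<dots> = sum y (\<Union>GG)"
    proof (subst sum.Union_disjoint)
      show "\<forall>A\<in>GG. finite A" using Gs(4) fin(3) finite_subset by blast
      show "\<forall>A\<in>GG. \<forall>B\<in>GG. A \<noteq> B \<longrightarrow> A \<inter> B = {}" using Gd by blast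
    qed simp
    finally show ?thesis by (simp add: GQ)
  qed
  have cN: "card (Bs' - Bs) \<le> card GG + card Fz"
  proof -
    have "Bs' - Bs \<subseteq> N1 \<union> N2" by (auto simp: Bs'_def Keep_def)
    hence "card (Bs' - Bs) \<le> card (N1 \<union> N2)" using finN by (intro card_mono) auto
    also have "\<dots> \<le> card N1 + card N2" by (rule card_Un_le)
    also have "\<dots> \<le> card GG + card Fz" using GG fin by (auto simp: N1_def N2_def intro: add_mono card_image_le)
    finally show ?thesis .
  qed
  have "(\<Sum>x\<in>Bs'. bundle_value y (snd x)) = (\<Sum>x\<in>Keep. bundle_value y (snd x)) + (\<Sum>x\<in>N1. bundle_value y (snd x)) + (\<Sum>x\<in>N2. bundle_value y (snd x))"
    unfolding Bs'_def using finN dis by (simp add: sum.union_disjoint)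
  also have "(\<Sum>x\<in>N1. bundle_value y (snd x)) = 0"
  proof (intro sum.neutral ballI)
    fix x assume x: "x \<in> N1"
    hence "\<forall>s\<in>snd x. y s < 1" using N1P(1)[OF x] by (auto simp: P1_def)
    thus "bundle_value y (snd x) = 0" using Gs(1,2)[OF N1P(2)[OF x]] by (simp add: bundle_value_def penalty_def)
  qed
  also have "(\<Sum>x\<in>N2. bundle_value y (snd x)) = (\<Sum>s\<in>Fz. - 40)"
    unfolding N2_def
    by (subst sum.reindex) (auto simp: inj_on_def bundle_value_def Fz_def intro!: sum.cong)
  finally have val': "(\<Sum>x\<in>Bs'. bundle_value y (snd x)) = (\<Sum>x\<in>Keep. bundle_value y (snd x)) - 40 * real (card Fz)" by simp
  have val: "(\<Sum>x\<in>Bs. bundle_value y (snd x)) = (\<Sum>x\<in>Keep. bundle_value y (snd x)) + (\<Sum>x\<in>Drop. bundle_value y (snd x))"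
    using sum.union_disjoint[OF finN(1) fD BsKD(2)] BsKD(1) by simp
  have yP1: "sum y (P1 - Q) = sum y P1 - sum y Q" using fin QP by (simp add: sum_diff)
  have "sum y Q \<ge> 0"
  proof (rule sum_nonneg)
    fix s assume "s \<in> Q"
    hence "s \<in> P1" using QP by (rule subsetD[rotated])
    hence "s \<in> P0" by (rule subsetD[OF sub(3)])
    thus "0 \<le> y s" by (intro less_imp_le ypos)
  qed
  moreover have "real (card (Bs' - Bs)) \<le> real (card GG) + real (card Fz)" using cN by linarith
  ultimately have "potential S y Bs' + card (Bs' - Bs) \<le> potential S y Bs"
    unfolding potential_def pool' val' val yP1 pool_def[symmetric]
    using main phi cG by argo
  moreover have "\<forall>x\<in>Bs'. x \<in> Bs \<or> fst x = p" by (auto simp: Bs'_def Keep_def N1_def N2_def)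
  ultimately show ?thesis using str by (intro exI[of _ Bs'] conjI)
qed

section \<open>Increasing the weights\<close>

lemma bundle_value_cong: "(\<And>s. s \<in> b \<Longrightarrow> y s = y' s) \<Longrightarrow> bundle_value y b = bundle_value y' b"
  unfolding bundle_value_def by (auto cong: sum.cong ball_cong)

definition unfrozen_mass :: "'a set \<Rightarrow> ('a \<Rightarrow> 't) \<Rightarrow> ('a \<Rightarrow> real) \<Rightarrow> 't \<Rightarrow> real" where
  "unfrozen_mass S \<tau> y a = sum y {s \<in> S. \<tau> s = a \<and> y s < 1}"

text \<open>
  The factor is chosen so that one application adds less than 1 to the weight of each type.
\<close>

definition raise :: "'a set \<Rightarrow> ('a \<Rightarrow> 't) \<Rightarrow> ('a \<Rightarrow> real) \<Rightarrow> 'a \<Rightarrow> real" where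
  "raise S \<tau> y s = (if y s < 1 then y s * (1 + 1 / (unfrozen_mass S \<tau> y (\<tau> s) + 1)) else y s)"

definition representatives :: "'a set \<Rightarrow> ('i \<times> 'a set) set \<Rightarrow> bool" where
  "representatives X Bs \<longleftrightarrow> (\<exists>r. (\<forall>x\<in>Bs. r x \<in> snd x) \<and> X = r ` Bs)"

context
  fixes S :: "'a set" and T :: "'t set" and \<tau> :: "'a \<Rightarrow> 't" and y :: "'a \<Rightarrow> real" and Bs :: "('i \<times> 'a set) set"
  assumes S: "finite S" and T: "finite T" and TT: "\<tau> ` S \<subseteq> T"
    and str: "balanced S \<tau> y Bs"
    and y0': "\<forall>s\<in>S. 0 < y s" and y2': "\<forall>s\<in>S. y s < 2"
begin

lemmas y0 = bspec[OF y0'] and y2 = bspec[OF y2']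

lemma bundle_facts:
  shows "finite Bs" "\<And>x. x \<in> Bs \<Longrightarrow> snd x \<subseteq> S"
     "\<And>x x'. x \<in> Bs \<Longrightarrow> x' \<in> Bs \<Longrightarrow> x \<noteq> x' \<Longrightarrow> snd x \<inter> snd x' = {}"
     "\<And>x s s'. x \<in> Bs \<Longrightarrow> s \<in> snd x \<Longrightarrow> s' \<in> snd x \<Longrightarrow> \<tau> s = \<tau> s'"
     "\<And>x. x \<in> Bs \<Longrightarrow> ok_bundle y (snd x)"
     "\<And>s. s \<in> S \<Longrightarrow> 1 \<le> y s \<Longrightarrow> \<exists>x\<in>Bs. snd x = {s}"
     "\<And>a. sum y {s \<in> S - \<Union>(snd ` Bs). \<tau> s = a} < 1"
     "\<And>x. x \<in> Bs \<Longrightarrow> finite (snd x)"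
proof -
  show "finite Bs" "\<And>x. x \<in> Bs \<Longrightarrow> snd x \<subseteq> S"
     "\<And>x x'. x \<in> Bs \<Longrightarrow> x' \<in> Bs \<Longrightarrow> x \<noteq> x' \<Longrightarrow> snd x \<inter> snd x' = {}"
     "\<And>x s s'. x \<in> Bs \<Longrightarrow> s \<in> snd x \<Longrightarrow> s' \<in> snd x \<Longrightarrow> \<tau> s = \<tau> s'"
     "\<And>x. x \<in> Bs \<Longrightarrow> ok_bundle y (snd x)"
     "\<And>s. s \<in> S \<Longrightarrow> 1 \<le> y s \<Longrightarrow> \<exists>x\<in>Bs. snd x = {s}"
     "\<And>a. sum y {s \<in> S - \<Union>(snd ` Bs). \<tau> s = a} < 1"
  proof -
    note str' = str[unfolded balanced_def]
    note w = str'[THEN conjunct1, unfolded bundle_family_def]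
    note a = str'[THEN conjunct2, THEN conjunct1] and b = str'[THEN conjunct2, THEN conjunct2, THEN conjunct1]
      and c = str'[THEN conjunct2, THEN conjunct2, THEN conjunct2]
    note w1 = w[THEN conjunct1] and w2 = w[THEN conjunct2, THEN conjunct1]
      and w3 = w[THEN conjunct2, THEN conjunct2, THEN conjunct1]
      and w4 = w[THEN conjunct2, THEN conjunct2, THEN conjunct2]
    show "finite Bs" by (rule w1)
    show "\<And>x. x \<in> Bs \<Longrightarrow> snd x \<subseteq> S" by (rule w2[rule_format])
    show "\<And>x x'. x \<in> Bs \<Longrightarrow> x' \<in> Bs \<Longrightarrow> x \<noteq> x' \<Longrightarrow> snd x \<inter> snd x' = {}" by (rule w3[rule_format])
    show "\<And>x s s'. x \<in> Bs \<Longrightarrow> s \<in> snd x \<Longrightarrow> s' \<in> snd x \<Longrightarrow> \<tau> s = \<tau> s'" by (rule w4[rule_format])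
    show "\<And>x. x \<in> Bs \<Longrightarrow> ok_bundle y (snd x)" by (rule a[rule_format])
    show "\<And>s. s \<in> S \<Longrightarrow> 1 \<le> y s \<Longrightarrow> \<exists>x\<in>Bs. snd x = {s}" by (rule b[rule_format])
    show "\<And>a. sum y {s \<in> S - \<Union>(snd ` Bs). \<tau> s = a} < 1" by (rule c[rule_format])
  qed
  from this(2) show "finite (snd x)" if "x \<in> Bs" for x by (rule finite_subset) (rule that, rule S)
qed

lemma unfrozen_mass_nonneg: "unfrozen_mass S \<tau> y a \<ge> 0"
  unfolding unfrozen_mass_def by (intro sum_nonneg less_imp_le y0) simp

lemma raise_ge: "s \<in> S \<Longrightarrow> y s \<le> raise S \<tau> y s"
  using y0[of s] unfrozen_mass_nonneg[of "\<tau> s"] by (simp add: raise_def field_simps)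

lemma raise_lt2: "s \<in> S \<Longrightarrow> raise S \<tau> y s < 2"
proof -
  assume s: "s \<in> S"
  have f: "1 + 1 / (unfrozen_mass S \<tau> y (\<tau> s) + 1) \<le> 2" using unfrozen_mass_nonneg[of "\<tau> s"] by simp
  show ?thesis
  proof (cases "y s < 1")
    case True
    have "y s * (1 + 1 / (unfrozen_mass S \<tau> y (\<tau> s) + 1)) \<le> y s * 2"
      using f y0[OF s] by (intro mult_left_mono) auto
    thus ?thesis using True by (simp add: raise_def)
  next
    case False thus ?thesis using y2[OF s] by (simp add: raise_def)
  qed
qed

lemma raise_le_double: "s \<in> S \<Longrightarrow> raise S \<tau> y s \<le> 2 * y s"
proof -
  assume s: "s \<in> S"
  have f: "1 + 1 / (unfrozen_mass S \<tau> y (\<tau> s) + 1) \<le> 2" using unfrozen_mass_nonneg[of "\<tau> s"] by simp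
  show ?thesis
  proof (cases "y s < 1")
    case True
    have "y s * (1 + 1 / (unfrozen_mass S \<tau> y (\<tau> s) + 1)) \<le> y s * 2"
      using f y0[OF s] by (intro mult_left_mono) auto
    thus ?thesis using True by (simp add: raise_def)
  next
    case False thus ?thesis using y0[OF s] by (simp add: raise_def)
  qed
qed

lemma raise_total: "(\<Sum>s\<in>S. raise S \<tau> y s - y s) \<le> card T"
proof -
  have "(\<Sum>s\<in>S. raise S \<tau> y s - y s) = (\<Sum>a\<in>T. \<Sum>s\<in>{s\<in>S. \<tau> s = a}. raise S \<tau> y s - y s)"
    by (rule sum.group[OF S T TT, symmetric])
  also have "\<dots> \<le> (\<Sum>a\<in>T. 1)"
  proof (rule sum_mono)
    fix a
    have "(\<Sum>s\<in>{s\<in>S. \<tau> s = a}. raise S \<tau> y s - y s)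
        = (\<Sum>s\<in>{s\<in>S. \<tau> s = a \<and> y s < 1}. y s / (unfrozen_mass S \<tau> y a + 1))"
      using S unfrozen_mass_nonneg[of a] by (intro sum.mono_neutral_cong_right) (auto simp: raise_def field_simps)
    also have "\<dots> = unfrozen_mass S \<tau> y a / (unfrozen_mass S \<tau> y a + 1)"
      by (simp add: unfrozen_mass_def sum_divide_distrib)
    also have "\<dots> \<le> 1" using unfrozen_mass_nonneg[of a] by simp
    finally show "(\<Sum>s\<in>{s\<in>S. \<tau> s = a}. raise S \<tau> y s - y s) \<le> 1" .
  qed
  finally show ?thesis by simp
qed

lemma raise_bundle_value:
  assumes x: "x \<in> Bs"
  shows "bundle_value (raise S \<tau> y) (snd x) \<le> bundle_value y (snd x) + 12 * (\<Sum>s\<in>snd x. raise S \<tau> y s - y s)"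
proof (cases "\<forall>s\<in>snd x. y s < 1")
  case True
  have nn: "(\<Sum>s\<in>snd x. raise S \<tau> y s - y s) \<ge> 0"
  proof (rule sum_nonneg)
    fix s assume "s \<in> snd x"
    hence "s \<in> S" using bundle_facts(2)[OF x] by blast
    from raise_ge[OF this] show "0 \<le> raise S \<tau> y s - y s" by simp
  qed
  have b: "bundle_value y (snd x) = penalty (sum y (snd x))" using True by (simp add: bundle_value_def)
  have d: "(\<Sum>s\<in>snd x. raise S \<tau> y s - y s) = sum (raise S \<tau> y) (snd x) - sum y (snd x)"
    by (rule sum_subtractf)
  show ?thesis
  proof (cases "\<forall>s\<in>snd x. raise S \<tau> y s < 1")
    case True
    hence "bundle_value (raise S \<tau> y) (snd x) = penalty (sum (raise S \<tau> y) (snd x))" by (simp add: bundle_value_def)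
    thus ?thesis using penalty_lipschitz[of "sum (raise S \<tau> y) (snd x)" "sum y (snd x)"] nn
      unfolding b d by simp
  next
    case False
    hence "bundle_value (raise S \<tau> y) (snd x) \<le> 0" by (auto simp: bundle_value_def)
    thus ?thesis using nn penalty_nonneg[of "sum y (snd x)"] unfolding b by linarith
  qed
next
  case False
  then obtain s where s: "snd x = {s}" "1 \<le> y s" using bundle_facts(5)[OF x] by (auto simp: ok_bundle_def)
  have e: "raise S \<tau> y s = y s" using s by (simp add: raise_def)
  have "bundle_value (raise S \<tau> y) (snd x) = bundle_value y (snd x)" by (rule bundle_value_cong) (use s e in auto)
  thus ?thesis using e s by simp
qed

lemma raise_potential: "potential S (raise S \<tau> y) Bs \<le> potential S y Bs + 135 * card T"
proof -
  let ?d = "\<lambda>s. raise S \<tau> y s - y s"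
  have dn: "0 \<le> ?d s" if "s \<in> S" for s using raise_ge[OF that] by simp
  have 1: "sum (raise S \<tau> y) S = sum y S + sum ?d S" by (simp add: sum_subtractf)
  have 2: "sum (raise S \<tau> y) (S - \<Union>(snd ` Bs)) \<le> sum y (S - \<Union>(snd ` Bs)) + sum ?d S"
  proof -
    have "sum ?d (S - \<Union>(snd ` Bs)) \<le> sum ?d S" by (rule sum_mono2[OF S]) (use dn in auto)
    thus ?thesis by (simp add: sum_subtractf)
  qed
  have "(\<Sum>x\<in>Bs. bundle_value (raise S \<tau> y) (snd x)) \<le> (\<Sum>x\<in>Bs. bundle_value y (snd x) + 12 * sum ?d (snd x))"
    by (rule sum_mono) (rule raise_bundle_value)
  also have "\<dots> = (\<Sum>x\<in>Bs. bundle_value y (snd x)) + 12 * (\<Sum>x\<in>Bs. sum ?d (snd x))"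
    by (simp add: sum.distrib sum_distrib_left)
  also have "(\<Sum>x\<in>Bs. sum ?d (snd x)) = sum ?d (\<Union>x\<in>Bs. snd x)"
  proof (rule sum.UNION_disjoint[symmetric])
    show "\<forall>i\<in>Bs. finite (snd i)" using bundle_facts(8) by (intro ballI)
    show "\<forall>i\<in>Bs. \<forall>j\<in>Bs. i \<noteq> j \<longrightarrow> snd i \<inter> snd j = {}" by (intro ballI impI bundle_facts(3))
  qed (rule bundle_facts(1))
  also have "sum ?d (\<Union>x\<in>Bs. snd x) \<le> sum ?d S"
  proof (rule sum_mono2[OF S])
    show "(\<Union>x\<in>Bs. snd x) \<subseteq> S" by (intro UN_least bundle_facts(2))
  qed (use dn in blast)
  finally show ?thesis unfolding potential_def using 1 2 raise_total by linarith
qed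

lemma raise_sum8:
  assumes x: "x \<in> Bs"
  shows "sum (raise S \<tau> y) (snd x) \<le> 8"
proof -
  have "sum (raise S \<tau> y) (snd x) \<le> (\<Sum>s\<in>snd x. 2 * y s)"
    by (intro sum_mono raise_le_double) (use bundle_facts(2)[OF x] in blast)
  also have "\<dots> = 2 * sum y (snd x)" by (simp add: sum_distrib_left)
  also have "sum y (snd x) \<le> 4"
  proof (cases "\<exists>s. snd x = {s} \<and> 1 \<le> y s")
    case True
    then obtain s where "snd x = {s}" by (elim exE conjE)
    moreover have "s \<in> S" using calculation bundle_facts(2)[OF x] by blast
    ultimately show ?thesis using y2[of s] by simp
  next
    case False thus ?thesis using bundle_facts(5)[OF x] by (auto simp: ok_bundle_def)
  qed
  finally show ?thesis by simp
qed

lemma raise_scale: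
  assumes x: "x \<in> Bs"
  shows "\<exists>c>0. \<forall>s\<in>snd x. raise S \<tau> y s = c * y s"
proof (cases "\<exists>s. snd x = {s} \<and> 1 \<le> y s")
  case True thus ?thesis by (intro exI[of _ 1]) (auto simp: raise_def)
next
  case False
  hence l: "\<forall>s\<in>snd x. y s < 1" "1/2 \<le> sum y (snd x)" using bundle_facts(5)[OF x] by (auto simp: ok_bundle_def)
  then obtain s0 where s0: "s0 \<in> snd x" by fastforce
  have "raise S \<tau> y s = (1 + 1 / (unfrozen_mass S \<tau> y (\<tau> s0) + 1)) * y s" if s: "s \<in> snd x" for s
    using l(1) s bundle_facts(4)[OF x s s0] by (simp add: raise_def)
  moreover have "1 + 1 / (unfrozen_mass S \<tau> y (\<tau> s0) + 1) > 0" using unfrozen_mass_nonneg[of "\<tau> s0"] by (simp add: add_pos_nonneg)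
  ultimately show ?thesis by blast
qed

lemma raise_gain:
  assumes Xs: "Xs \<subseteq> S" and representatives: "representatives X1 Bs"
    and less: "card {s \<in> X1. \<tau> s = a} < card {s \<in> Xs. \<tau> s = a}"
  shows "(\<Sum>s\<in>Xs. ln (raise S \<tau> y s)) \<ge> (\<Sum>s\<in>Xs. ln (y s)) + 1 / 4"
proof -
  obtain r where r: "\<And>x. x \<in> Bs \<Longrightarrow> r x \<in> snd x" "X1 = r ` Bs" using representatives by (auto simp: representatives_def)
  define Ba where "Ba = {x \<in> Bs. \<tau> (r x) = a}"
  define Fr where "Fr = {s \<in> S. \<tau> s = a \<and> 1 \<le> y s}"
  define Uf where "Uf = {s \<in> S. \<tau> s = a \<and> y s < 1}"
  define Bf where "Bf = {x \<in> Ba. \<exists>s. snd x = {s} \<and> 1 \<le> y s}"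
  define mm where "mm = card (Xs \<inter> Uf)"
  let ?W = "unfrozen_mass S \<tau> y a"
  have fin: "finite Ba" "finite Fr" "finite Uf" "finite Bf" "finite Xs"
    using bundle_facts(1) S finite_subset[OF Xs S] by (auto simp: Ba_def Fr_def Uf_def Bf_def)
  have injr: "inj_on r Bs"
  proof (rule inj_onI, rule ccontr)
    fix x x' assume h: "x \<in> Bs" "x' \<in> Bs" "r x = r x'" "x \<noteq> x'"
    from bundle_facts(3)[OF h(1,2,4)] r(1)[OF h(1)] r(1)[OF h(2)] h(3) show False by auto
  qed
  have "{s \<in> X1. \<tau> s = a} = r ` Ba" unfolding r(2) Ba_def by auto
  hence c1: "card {s \<in> X1. \<tau> s = a} = card Ba"
    using card_image[OF inj_on_subset[OF injr, of Ba]] by (simp add: Ba_def)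
  have "\<forall>s\<in>Fr. \<exists>x. x \<in> Bs \<and> snd x = {s}" using bundle_facts(6) unfolding Fr_def by blast
  from bchoice[OF this] obtain q where q: "\<And>s. s \<in> Fr \<Longrightarrow> q s \<in> Bs \<and> snd (q s) = {s}" by blast
  have "q ` Fr \<subseteq> Bf"
  proof
    fix x assume "x \<in> q ` Fr"
    then obtain s where s: "s \<in> Fr" "x = q s" by blast
    have x: "x \<in> Bs" "snd x = {s}" using q[OF s(1)] s(2) by simp_all
    have "r x = s" using r(1)[OF x(1)] x(2) by simp
    thus "x \<in> Bf" using x s(1) by (auto simp: Bf_def Ba_def Fr_def)
  qed
  moreover have "inj_on q Fr"
  proof (rule inj_onI)
    fix s s' assume h: "s \<in> Fr" "s' \<in> Fr" "q s = q s'"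
    have "{s} = snd (q s')" using conjunct2[OF q[OF h(1)]] h(3) by (simp only:)
    also have "\<dots> = {s'}" by (rule conjunct2[OF q[OF h(2)]])
    finally show "s = s'" by (rule singleton_inject)
  qed
  ultimately have c2: "card Fr \<le> card Bf" by (intro card_inj_on_le[OF _ _ fin(4)])
  have "{s \<in> Xs. \<tau> s = a} \<subseteq> Fr \<union> (Xs \<inter> Uf)" using Xs by (auto simp: Fr_def Uf_def)
  hence "card {s \<in> Xs. \<tau> s = a} \<le> card (Fr \<union> (Xs \<inter> Uf))" using fin by (intro card_mono) auto
  also have "\<dots> \<le> card Fr + mm" unfolding mm_def by (rule card_Un_le)
  finally have c3: "card {s \<in> Xs. \<tau> s = a} \<le> card Fr + mm" .
  have BfBa: "Bf \<subseteq> Ba" by (auto simp: Bf_def)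
  have c4: "card (Ba - Bf) + 1 \<le> mm"
    using c1 c2 c3 less card_mono[OF fin(1) BfBa] by (simp add: card_Diff_subset[OF fin(4) BfBa])
  have "Uf \<subseteq> {s \<in> S - \<Union>(snd ` Bs). \<tau> s = a} \<union> (\<Union>x\<in>Ba - Bf. snd x)"
  proof
    fix s assume s: "s \<in> Uf"
    show "s \<in> {s \<in> S - \<Union>(snd ` Bs). \<tau> s = a} \<union> (\<Union>x\<in>Ba - Bf. snd x)"
    proof (cases "s \<in> \<Union>(snd ` Bs)")
      case True
      then obtain x where x: "x \<in> Bs" "s \<in> snd x" by blast
      have "\<tau> (r x) = \<tau> s" by (rule bundle_facts(4)[OF x(1) r(1)[OF x(1)] x(2)])
      hence "x \<in> Ba" using s x by (simp add: Ba_def Uf_def)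
      moreover have "x \<notin> Bf" using s x(2) by (auto simp: Bf_def Uf_def)
      ultimately show ?thesis using x by blast
    next
      case False thus ?thesis using s by (simp add: Uf_def)
    qed
  qed
  hence "sum y Uf \<le> sum y ({s \<in> S - \<Union>(snd ` Bs). \<tau> s = a} \<union> (\<Union>x\<in>Ba - Bf. snd x))"
  proof (rule sum_mono2[rotated])
    show "finite ({s \<in> S - \<Union>(snd ` Bs). \<tau> s = a} \<union> (\<Union>x\<in>Ba - Bf. snd x))"
      using S fin(1) bundle_facts(8) by (auto simp: Ba_def)
    fix s assume "s \<in> {s \<in> S - \<Union>(snd ` Bs). \<tau> s = a} \<union> (\<Union>x\<in>Ba - Bf. snd x) - Uf"
    hence "s \<in> S" using bundle_facts(2) by (auto simp: Ba_def)
    thus "0 \<le> y s" using y0 by (simp add: less_imp_le)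
  qed
  also have "\<dots> = sum y {s \<in> S - \<Union>(snd ` Bs). \<tau> s = a} + sum y (\<Union>x\<in>Ba - Bf. snd x)"
    by (rule sum.union_disjoint) (use S fin(1) bundle_facts(8) in \<open>auto simp: Ba_def\<close>)
  also have "sum y (\<Union>x\<in>Ba - Bf. snd x) = (\<Sum>x\<in>Ba - Bf. sum y (snd x))"
  proof (rule sum.UNION_disjoint)
    show "finite (Ba - Bf)" using fin by simp
    show "\<forall>i\<in>Ba - Bf. finite (snd i)" using bundle_facts(8) by (simp add: Ba_def)
    show "\<forall>i\<in>Ba - Bf. \<forall>j\<in>Ba - Bf. i \<noteq> j \<longrightarrow> snd i \<inter> snd j = {}"
      by (intro ballI impI bundle_facts(3)) (simp_all add: Ba_def)
  qed
  also have "\<dots> \<le> (\<Sum>x\<in>Ba - Bf. 4)"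
  proof (rule sum_mono)
    fix x assume x: "x \<in> Ba - Bf"
    hence "x \<in> Bs" "\<not> (\<exists>s. snd x = {s} \<and> 1 \<le> y s)" by (auto simp: Ba_def Bf_def)
    thus "sum y (snd x) \<le> 4" using bundle_facts(5)[of x] by (auto simp: ok_bundle_def)
  qed
  finally have W: "?W \<le> 1 + 4 * real (card (Ba - Bf))"
    using bundle_facts(7)[of a] by (simp add: unfrozen_mass_def Uf_def)
  have W2: "?W + 2 \<le> 4 * real mm" using W c4 by linarith
  have o1: "real mm \<ge> 1" using c4 by simp
  have g: "ln (raise S \<tau> y s) \<ge> ln (y s) + (if s \<in> Uf then 1 / (?W + 2) else 0)" if s: "s \<in> Xs" for s
  proof (cases "s \<in> Uf")
    case True
    have sS: "s \<in> S" using s Xs by blast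
    define z where "z = 1 + 1 / (?W + 1)"
    have z: "z > 0" "1 - 1 / z = 1 / (?W + 2)" using unfrozen_mass_nonneg[of a] by (auto simp: z_def field_simps add_pos_nonneg)
    have "ln (1 / z) \<le> 1 / z - 1" using z by (intro ln_le_minus_one) simp
    hence "ln z \<ge> 1 - 1 / z" using z by (simp add: ln_div)
    moreover have "raise S \<tau> y s = y s * z" using True by (simp add: raise_def z_def Uf_def)
    ultimately show ?thesis using True z y0[OF sS] by (simp add: ln_mult)
  next
    case False
    have sS: "s \<in> S" using s Xs by blast
    show ?thesis using False raise_ge[OF sS] y0[OF sS] by simp
  qed
  have "1 / 4 \<le> real mm / (?W + 2)" using W2 unfrozen_mass_nonneg[of a] o1 by (simp add: field_simps)
  also have "\<dots> = (\<Sum>s\<in>Xs. if s \<in> Uf then 1 / (?W + 2) else 0)"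
    using fin(5) by (simp add: mm_def flip: sum.inter_restrict)
  finally have "(\<Sum>s\<in>Xs. ln (y s)) + 1 / 4 \<le> (\<Sum>s\<in>Xs. ln (y s) + (if s \<in> Uf then 1 / (?W + 2) else 0))"
    by (simp add: sum.distrib)
  also have "\<dots> \<le> (\<Sum>s\<in>Xs. ln (raise S \<tau> y s))" by (rule sum_mono) (rule g)
  finally show ?thesis .
qed

end

lemma hit_step:
  fixes \<tau> \<tau>' :: "'a \<Rightarrow> 't" and Bs :: "('i \<times> 'a set) set"
  assumes S: "finite S" and str: "balanced S \<tau> y Bs" and y0b: "\<forall>s\<in>S. 0 < y s"
    and H: "H \<subseteq> S" and \<tau>b: "\<forall>s\<in>S - H. \<tau>' s = \<tau> s"
    and y'_def: "y' = (\<lambda>s. if s \<in> H then y s / 2 else y s)"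
    and Bs'_def: "Bs' = (\<lambda>x. (fst x, snd x - H)) ` {x \<in> Bs. \<not> snd x \<subseteq> H}"
    and y2b: "\<forall>s\<in>S. y s < 2"
  shows "bundle_family S \<tau>' Bs'" and "potential S y' Bs' + 18 * sum y H \<le> potential S y Bs"
    and "\<And>x. x \<in> Bs' \<Longrightarrow> sum y' (snd x) \<le> 8"
    and "\<And>x. x \<in> Bs' \<Longrightarrow> \<exists>b. (fst x, b) \<in> Bs \<and> snd x = b - H"
proof -
  note y0 = bspec[OF y0b] and y2 = bspec[OF y2b]
  have \<tau>': "\<tau>' s = \<tau> s" if "s \<in> S" "s \<notin> H" for s using bspec[OF \<tau>b, of s] that by simp
  have nnS: "0 \<le> y s" if "s \<in> S" for s using y0[OF that] by simp
  note D = bundle_facts[OF S finite_imageI[OF S] subset_refl str y0b y2b]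
  have fH: "finite H" using H S finite_subset by blast
  have B': "\<exists>b. (fst x, b) \<in> Bs \<and> snd x = b - H \<and> \<not> b \<subseteq> H" if "x \<in> Bs'" for x
    using that unfolding Bs'_def by force
  thus "\<exists>b. (fst x, b) \<in> Bs \<and> snd x = b - H" if "x \<in> Bs'" for x using that by blast
  define B0 where "B0 = {x \<in> Bs. \<not> snd x \<subseteq> H}"
  have dis0: "x = x'" if h: "x \<in> Bs" "x' \<in> Bs" "snd x \<inter> snd x' \<noteq> {}" for x x'
    using D(3)[OF h(1,2)] h(3) by blast
  have inj: "inj_on (\<lambda>x. (fst x, snd x - H)) B0"
  proof (rule inj_onI)
    fix x x' assume h: "x \<in> B0" "x' \<in> B0" "(fst x, snd x - H) = (fst x', snd x' - H)"
    from h(1) obtain s where s: "s \<in> snd x" "s \<notin> H" by (auto simp: B0_def)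
    hence "s \<in> snd x' - H" using h(3) by auto
    thus "x = x'" using s h(1,2) by (intro dis0) (auto simp: B0_def)
  qed
  show "bundle_family S \<tau>' Bs'"
    unfolding bundle_family_def
  proof (intro conjI ballI impI)
    show "finite Bs'" using D(1) by (simp add: Bs'_def)
  next
    fix x assume "x \<in> Bs'"
    from B'[OF this] obtain b where b: "(fst x, b) \<in> Bs" "snd x = b - H" by (elim exE conjE)
    from D(2)[OF b(1)] b(2) show "snd x \<subseteq> S" by auto
  next
    fix x x' assume x: "x \<in> Bs'" "x' \<in> Bs'" "x \<noteq> x'"
    obtain b where b: "(fst x, b) \<in> Bs" "snd x = b - H" using B'[OF x(1)] by (elim exE conjE)
    obtain b' where b': "(fst x', b') \<in> Bs" "snd x' = b' - H" using B'[OF x(2)] by (elim exE conjE)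
    have "(fst x, b) \<noteq> (fst x', b')" using x(3) b(2) b'(2) by (auto simp: prod_eq_iff)
    from D(3)[OF b(1) b'(1) this] b(2) b'(2) show "snd x \<inter> snd x' = {}" by auto
  next
    fix x s s' assume x: "x \<in> Bs'" "s \<in> snd x" "s' \<in> snd x"
    obtain b where b: "(fst x, b) \<in> Bs" "snd x = b - H" using B'[OF x(1)] by (elim exE conjE)
    have s: "s \<in> b" "s \<notin> H" "s' \<in> b" "s' \<notin> H" using x(2,3) b(2) by auto
    have "b \<subseteq> S" using D(2)[OF b(1)] by simp
    hence "s \<in> S" "s' \<in> S" using s by auto
    moreover have "\<tau> s = \<tau> s'" using D(4)[OF b(1)] s by (metis snd_conv)
    ultimately show "\<tau>' s = \<tau>' s'" using \<tau>' s by metis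
  qed
  show "sum y' (snd x) \<le> 8" if x: "x \<in> Bs'" for x
  proof -
    obtain b where b: "(fst x, b) \<in> Bs" "snd x = b - H" using B'[OF x] by (elim exE conjE)
    have bS: "b \<subseteq> S" "finite b" "ok_bundle y b" using D(2)[OF b(1)] D(8)[OF b(1)] D(5)[OF b(1)] by simp_all
    have "sum y' (snd x) = sum y (b - H)" unfolding b(2) by (intro sum.cong) (auto simp: y'_def)
    also have "\<dots> \<le> sum y b" by (intro sum_mono2[OF bS(2)]) (use bS(1) y0 in \<open>auto intro: less_imp_le\<close>)
    also have "\<dots> \<le> 4"
    proof (cases "\<exists>s. b = {s} \<and> 1 \<le> y s")
      case True
      then obtain s where "b = {s}" by (elim exE conjE)
      thus ?thesis using y2[of s] bS(1) by simp
    next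
      case False thus ?thesis using bS(3) by (auto simp: ok_bundle_def)
    qed
    finally show ?thesis by simp
  qed
  have e: "bundle_value y' (b - H) = bundle_value y (b - H)" for b by (rule bundle_value_cong) (simp add: y'_def)
  have con: "(if x \<in> B0 then bundle_value y (snd x - H) else 0) \<le> bundle_value y (snd x) + 40 * sum y (snd x \<inter> H)" if x: "x \<in> Bs" for x
  proof (cases "\<exists>s. snd x = {s} \<and> 1 \<le> y s")
    case True
    then obtain s where s: "snd x = {s}" "1 \<le> y s" by (elim exE conjE)
    have v: "bundle_value y (snd x) = -40" using s by (auto simp: bundle_value_def)
    show ?thesis
    proof (cases "s \<in> H")
      case True thus ?thesis using s v by (simp add: B0_def)
    next
      case False
      hence "snd x - H = snd x" "snd x \<inter> H = {}" using s by auto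
      moreover have "x \<in> B0" using x s False by (simp add: B0_def)
      ultimately show ?thesis using v by simp
    qed
  next
    case False
    hence l: "\<forall>s\<in>snd x. y s < 1" using D(5)[OF x] by (auto simp: ok_bundle_def)
    have fx: "finite (snd x)" "snd x \<subseteq> S" using D(2,8)[OF x] by simp_all
    have v: "bundle_value y (snd x) = penalty (sum y (snd x))" "bundle_value y (snd x - H) = penalty (sum y (snd x - H))" using l by (auto simp: bundle_value_def)
    have nn: "sum y (snd x \<inter> H) \<ge> 0" by (intro sum_nonneg less_imp_le y0) (use fx in auto)
    have "sum y (snd x) = sum y (snd x \<inter> H) + sum y (snd x - H)" by (rule sum.Int_Diff[OF fx(1)])
    hence "penalty (sum y (snd x - H)) \<le> penalty (sum y (snd x)) + 12 * sum y (snd x \<inter> H)"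
      using penalty_lipschitz[of "sum y (snd x - H)" "sum y (snd x)"] nn by simp
    thus ?thesis using v nn penalty_nonneg[of "sum y (snd x)"] by auto
  qed
  have "(\<Sum>x\<in>Bs'. bundle_value y' (snd x)) = (\<Sum>x\<in>B0. bundle_value y' (snd x - H))"
    unfolding Bs'_def B0_def[symmetric] by (subst sum.reindex[OF inj]) simp
  also have "\<dots> = (\<Sum>x\<in>Bs. if x \<in> B0 then bundle_value y (snd x - H) else 0)"
    unfolding e using D(1) by (intro sum.mono_neutral_cong_left) (auto simp: B0_def)
  also have "\<dots> \<le> (\<Sum>x\<in>Bs. bundle_value y (snd x) + 40 * sum y (snd x \<inter> H))" by (rule sum_mono) (rule con)
  also have "\<dots> = (\<Sum>x\<in>Bs. bundle_value y (snd x)) + 40 * (\<Sum>x\<in>Bs. sum y (snd x \<inter> H))"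
    by (simp add: sum.distrib sum_distrib_left)
  also have "(\<Sum>x\<in>Bs. sum y (snd x \<inter> H)) = sum y (\<Union>x\<in>Bs. snd x \<inter> H)"
  proof (rule sum.UNION_disjoint[symmetric])
    show "finite Bs" using D(1) by simp
    show "\<forall>i\<in>Bs. finite (snd i \<inter> H)" using fH by simp
    show "\<forall>i\<in>Bs. \<forall>j\<in>Bs. i \<noteq> j \<longrightarrow> snd i \<inter> H \<inter> (snd j \<inter> H) = {}"
    proof (intro ballI impI)
      fix i j assume "i \<in> Bs" "j \<in> Bs" "i \<noteq> j"
      from D(3)[OF this] show "snd i \<inter> H \<inter> (snd j \<inter> H) = {}" by blast
    qed
  qed
  also have "\<dots> \<le> sum y H" by (rule sum_mono2[OF fH]) (use H nnS in blast)+
  finally have A: "(\<Sum>x\<in>Bs'. bundle_value y' (snd x)) \<le> (\<Sum>x\<in>Bs. bundle_value y (snd x)) + 40 * sum y H" by simp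
  have yH: "sum y' H = sum y H / 2" unfolding sum_divide_distrib by (intro sum.cong) (auto simp: y'_def)
  have nH: "sum y H \<ge> 0" by (intro sum_nonneg less_imp_le y0) (use H in auto)
  have "sum y' S = sum y' (S - H) + sum y' H" by (rule sum.subset_diff[OF H S])
  also have "sum y' (S - H) = sum y (S - H)" by (intro sum.cong) (auto simp: y'_def)
  also have "\<dots> = sum y S - sum y H" by (rule sum_diff[OF S H])
  finally have B: "sum y' S = sum y S - sum y H / 2" using yH by simp
  let ?pool = "S - \<Union>(snd ` Bs)"
  have "S - \<Union>(snd ` Bs') \<subseteq> ?pool \<union> H"
  proof
    fix s assume s: "s \<in> S - \<Union>(snd ` Bs')"
    show "s \<in> ?pool \<union> H"
    proof (rule ccontr)
      assume n: "s \<notin> ?pool \<union> H"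
      then obtain x where x: "x \<in> Bs" "s \<in> snd x" "s \<notin> H" using s by auto
      hence "(fst x, snd x - H) \<in> Bs'" unfolding Bs'_def by (intro image_eqI[of _ _ x]) auto
      thus False using s x by force
    qed
  qed
  hence "S - \<Union>(snd ` Bs') \<subseteq> (?pool - H) \<union> H" by blast
  hence "sum y' (S - \<Union>(snd ` Bs')) \<le> sum y' ((?pool - H) \<union> H)"
  proof (rule sum_mono2[rotated])
    show "finite ((?pool - H) \<union> H)" using S fH by simp
    fix s assume "s \<in> (?pool - H) \<union> H - (S - \<Union>(snd ` Bs'))"
    hence "s \<in> S" using H by blast
    from y0[OF this] show "0 \<le> y' s" by (simp add: y'_def)
  qed
  also have "\<dots> = sum y' (?pool - H) + sum y' H" using S fH by (intro sum.union_disjoint) auto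
  also have "sum y' (?pool - H) = sum y (?pool - H)" by (intro sum.cong) (auto simp: y'_def)
  also have "\<dots> \<le> sum y ?pool"
    by (rule sum_mono2) (use S nnS in auto)
  finally have C: "sum y' (S - \<Union>(snd ` Bs')) \<le> sum y ?pool + sum y H / 2" using yH by simp
  show "potential S y' Bs' + 18 * sum y H \<le> potential S y Bs"
    unfolding potential_def using A B C nH by argo
qed

definition count_monotone :: "'a set \<Rightarrow> 't set \<Rightarrow> ('a \<Rightarrow> 't) \<Rightarrow> ('a set \<Rightarrow> bool) \<Rightarrow> bool" where
  "count_monotone S T \<tau> good \<longleftrightarrow> (\<forall>X0 X. X0 \<subseteq> S \<longrightarrow> X \<subseteq> S \<longrightarrow> good X0 \<longrightarrow>
     (\<forall>a\<in>T. card {s\<in>X0. \<tau> s = a} \<le> card {s\<in>X. \<tau> s = a}) \<longrightarrow> good X)"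

lemma count_monotoneD:
  "count_monotone S T \<tau> good \<Longrightarrow> X0 \<subseteq> S \<Longrightarrow> X \<subseteq> S \<Longrightarrow> good X0 \<Longrightarrow>
   (\<And>a. a \<in> T \<Longrightarrow> card {s\<in>X0. \<tau> s = a} \<le> card {s\<in>X. \<tau> s = a}) \<Longrightarrow> good X"
  unfolding count_monotone_def by (drule spec[of _ X0], drule spec[of _ X]) (elim impE; blast)

definition loop_post where
  "loop_post S T \<tau> good p y Bs n y' Bs' \<longleftrightarrow>
     balanced S \<tau> y' Bs' \<and> (\<forall>s\<in>S. y s \<le> y' s \<and> y' s < 2) \<and>
     (\<forall>X. representatives X Bs' \<longrightarrow> good X) \<and>
     potential S y' Bs' + card {x \<in> Bs'. fst x = p} \<le> potential S y Bs + card {x \<in> Bs. fst x = p} + 135 * card T * real n \<and>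
     (n = 0 \<longrightarrow> y' = y) \<and>
     (\<forall>Xs\<subseteq>S. good Xs \<longrightarrow> (\<Sum>s\<in>Xs. ln (y s)) + real n / 4 \<le> (\<Sum>s\<in>Xs. ln (y' s))) \<and>
     (\<forall>x\<in>Bs'. fst x = p \<or> x \<in> Bs \<and> (\<exists>c>0. \<forall>s\<in>snd x. y' s = c * y s))"

lemmas loop_postD =
  loop_post_def[THEN iffD1, THEN conjunct1]
  loop_post_def[THEN iffD1, THEN conjunct2, THEN conjunct1]
  loop_post_def[THEN iffD1, THEN conjunct2, THEN conjunct2, THEN conjunct1]
  loop_post_def[THEN iffD1, THEN conjunct2, THEN conjunct2, THEN conjunct2, THEN conjunct1]
  loop_post_def[THEN iffD1, THEN conjunct2, THEN conjunct2, THEN conjunct2, THEN conjunct2, THEN conjunct1]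
  loop_post_def[THEN iffD1, THEN conjunct2, THEN conjunct2, THEN conjunct2, THEN conjunct2, THEN conjunct2, THEN conjunct1]
  loop_post_def[THEN iffD1, THEN conjunct2, THEN conjunct2, THEN conjunct2, THEN conjunct2, THEN conjunct2, THEN conjunct2]

lemma raise_loop:
  fixes \<tau> :: "'a \<Rightarrow> 't" and p :: 'i
  assumes S: "finite S" and T: "finite T" and TT: "\<tau> ` S \<subseteq> T"
    and dom: "count_monotone S T \<tau> good"
    and goodS: "good S"
  shows "balanced S \<tau> y Bs \<Longrightarrow> \<forall>s\<in>S. 0 < y s \<Longrightarrow> \<forall>s\<in>S. y s < 2 \<Longrightarrow>
     4 * (\<Sum>s\<in>S. ln 2 - ln (y s)) \<le> real m \<Longrightarrow>
     \<exists>n y' Bs'. loop_post S T \<tau> good p y Bs n y' Bs'"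
proof (induction m arbitrary: y Bs)
  case main: (0 y Bs)
  show ?case
  proof (cases "\<forall>X. representatives X Bs \<longrightarrow> good X")
    case True
    have "loop_post S T \<tau> good p y Bs 0 y Bs"
      unfolding loop_post_def using True main by (auto intro!: exI[of _ "1::real"])
    thus ?thesis by blast
  next
    case False
    then obtain X1 where X1: "representatives X1 Bs" "\<not> good X1" by blast
    note ctx = S T TT main(1,2,3)
    have X1S: "X1 \<subseteq> S" using X1(1) bundle_facts(2)[OF S T TT main(1-3)] unfolding representatives_def by blast
    have "\<exists>a\<in>T. card {s\<in>X1. \<tau> s = a} < card {s\<in>S. \<tau> s = a}"
      using count_monotoneD[OF dom subset_refl X1S goodS] X1(2) by (meson not_le)
    then obtain a where a: "card {s\<in>X1. \<tau> s = a} < card {s\<in>S. \<tau> s = a}" by (elim bexE)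
    have g: "(\<Sum>s\<in>S. ln (raise S \<tau> y s)) \<ge> (\<Sum>s\<in>S. ln (y s)) + 1 / 4"
      by (rule raise_gain[OF S T TT main(1-3) subset_refl X1(1) a])
    have "(\<Sum>s\<in>S. ln (raise S \<tau> y s)) \<le> (\<Sum>s\<in>S. ln 2)"
    proof (rule sum_mono)
      fix s assume s: "s \<in> S"
      have "0 < raise S \<tau> y s" using raise_ge[OF S T TT main(1-3) s] bspec[OF main(2) s] by linarith
      thus "ln (raise S \<tau> y s) \<le> ln 2" using raise_lt2[OF S T TT main(1-3) s] by simp
    qed
    hence False using g main(4) by (simp add: sum_subtractf)
    thus ?thesis ..
  qed
next
  case main: (Suc m y Bs)
  show ?case
  proof (cases "\<forall>X. representatives X Bs \<longrightarrow> good X")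
    case True
    have "loop_post S T \<tau> good p y Bs 0 y Bs"
      unfolding loop_post_def using True main by (auto intro!: exI[of _ "1::real"])
    thus ?thesis by blast
  next
    case False
    then obtain X1 where X1: "representatives X1 Bs" "\<not> good X1" by blast
    have X1S: "X1 \<subseteq> S" using X1(1) bundle_facts(2)[OF S T TT main(2-4)] unfolding representatives_def by blast
    define y1 where "y1 = raise S \<tau> y"
    have gain: "(\<Sum>s\<in>Xs. ln (y1 s)) \<ge> (\<Sum>s\<in>Xs. ln (y s)) + 1 / 4" if Xs: "Xs \<subseteq> S" "good Xs" for Xs
    proof -
      have "\<exists>a\<in>T. card {s\<in>X1. \<tau> s = a} < card {s\<in>Xs. \<tau> s = a}"
        using count_monotoneD[OF dom Xs(1) X1S Xs(2)] X1(2) by (meson not_le)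
      then obtain a where a: "card {s\<in>X1. \<tau> s = a} < card {s\<in>Xs. \<tau> s = a}" by (elim bexE)
      show ?thesis unfolding y1_def by (rule raise_gain[OF S T TT main(2-4) Xs(1) X1(1) a])
    qed
    have y1: "y s \<le> y1 s" "y1 s < 2" "0 < y1 s" if s: "s \<in> S" for s
      unfolding y1_def using raise_ge[OF S T TT main(2-4) s] raise_lt2[OF S T TT main(2-4) s] bspec[OF main(3) s] by linarith+
    have bundle_family: "bundle_family S \<tau> Bs" using main(2) by (simp add: balanced_def)
    have b8: "sum y1 (snd x) \<le> 8" if "x \<in> Bs" for x unfolding y1_def by (rule raise_sum8[OF S T TT main(2-4) that])
    obtain B1 where B1: "balanced S \<tau> y1 B1" "\<forall>x\<in>B1. x \<in> Bs \<or> fst x = p" "potential S y1 B1 + card (B1 - Bs) \<le> potential S y1 Bs"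
      using rebundle[OF S bundle_family y1(3) b8] by blast
    have pot1: "potential S y1 Bs \<le> potential S y Bs + 135 * card T" unfolding y1_def by (rule raise_potential[OF S T TT main(2-4)])
    have "4 * (\<Sum>s\<in>S. ln 2 - ln (y1 s)) \<le> real m"
      using gain[OF subset_refl goodS] main(5) by (simp add: sum_subtractf)
    from main.IH[OF B1(1) _ _ this] y1(2,3)
    obtain n y' Bs' where L: "loop_post S T \<tau> good p y1 B1 n y' Bs'" by blast
    have f: "finite Bs" "finite B1" using bundle_facts(1)[OF S T TT main(2-4)] B1(1) by (simp_all add: balanced_def bundle_family_def)
    have c: "card {x \<in> B1. fst x = p} \<le> card {x \<in> Bs. fst x = p} + card (B1 - Bs)"
    proof -
      have "card {x \<in> B1. fst x = p} \<le> card ({x \<in> Bs. fst x = p} \<union> (B1 - Bs))" using f by (intro card_mono) auto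
      thus ?thesis using card_Un_le order_trans by blast
    qed
    have "loop_post S T \<tau> good p y Bs (Suc n) y' Bs'"
      unfolding loop_post_def
    proof (intro conjI)
      show "balanced S \<tau> y' Bs'" "\<forall>X. representatives X Bs' \<longrightarrow> good X" by (rule loop_postD(1)[OF L], rule loop_postD(3)[OF L])
      show "\<forall>s\<in>S. y s \<le> y' s \<and> y' s < 2" using loop_postD(2)[OF L] y1(1) by (meson order_trans)
      have "potential S y' Bs' + card {x \<in> Bs'. fst x = p} \<le> potential S y1 B1 + card {x \<in> B1. fst x = p} + 135 * card T * real n"
        by (rule loop_postD(4)[OF L])
      also have "\<dots> \<le> potential S y Bs + real (card {x \<in> Bs. fst x = p}) + 135 * card T + 135 * card T * real n"
        using c B1(3) pot1 by linarith
      finally show "potential S y' Bs' + card {x \<in> Bs'. fst x = p} \<le> potential S y Bs + card {x \<in> Bs. fst x = p} + 135 * card T * real (Suc n)"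
        by (simp add: algebra_simps)
      show "Suc n = 0 \<longrightarrow> y' = y" by simp
      show "\<forall>Xs\<subseteq>S. good Xs \<longrightarrow> (\<Sum>s\<in>Xs. ln (y s)) + real (Suc n) / 4 \<le> (\<Sum>s\<in>Xs. ln (y' s))"
      proof (intro allI impI)
        fix Xs assume Xs: "Xs \<subseteq> S" "good Xs"
        have "(\<Sum>s\<in>Xs. ln (y1 s)) + real n / 4 \<le> (\<Sum>s\<in>Xs. ln (y' s))" using loop_postD(6)[OF L] Xs by blast
        thus "(\<Sum>s\<in>Xs. ln (y s)) + real (Suc n) / 4 \<le> (\<Sum>s\<in>Xs. ln (y' s))" using gain[OF Xs] by (simp add: field_simps)
      qed
      show "\<forall>x\<in>Bs'. fst x = p \<or> x \<in> Bs \<and> (\<exists>c>0. \<forall>s\<in>snd x. y' s = c * y s)"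
      proof
        fix x assume x: "x \<in> Bs'"
        show "fst x = p \<or> x \<in> Bs \<and> (\<exists>c>0. \<forall>s\<in>snd x. y' s = c * y s)"
        proof (cases "fst x = p")
          case False
          then obtain c where c: "x \<in> B1" "c > 0" "\<forall>s\<in>snd x. y' s = c * y1 s"
            using loop_postD(7)[OF L] x by blast
          have xB: "x \<in> Bs" using B1(2) c(1) False by blast
          obtain d where d: "d > 0" "\<forall>s\<in>snd x. y1 s = d * y s"
            using raise_scale[OF S T TT main(2-4) xB] unfolding y1_def by blast
          have "\<forall>s\<in>snd x. y' s = (c * d) * y s" using c(3) d(2) by (simp add: mult.assoc)
          moreover have "c * d > 0" using c d by simp
          ultimately show ?thesis using xB by blast
        qed simp
      qed
    qed
    thus ?thesis by blast
  qed
qed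

definition step_post where
  "step_post S T \<tau>' good H p y Bs n y' Bs' \<longleftrightarrow>
     balanced S \<tau>' y' Bs' \<and> (\<forall>s\<in>S. 0 < y' s \<and> y' s < 2) \<and>
     (\<forall>X. representatives X Bs' \<longrightarrow> good X) \<and>
     potential S y' Bs' + card {x \<in> Bs'. fst x = p} + 18 * sum y H \<le> potential S y Bs + 135 * card T * real n \<and>
     (n = 0 \<longrightarrow> sum y' S \<le> sum y S) \<and>
     (\<forall>Xs\<subseteq>S. good Xs \<longrightarrow> (\<Sum>s\<in>Xs. ln (y s)) + real n / 4 \<le> (\<Sum>s\<in>Xs. ln (y' s)) + ln 2 * card (Xs \<inter> H)) \<and>
     (\<forall>x\<in>Bs'. fst x = p \<or> (\<exists>b c. (fst x, b) \<in> Bs \<and> snd x = b - H \<and> c > 0 \<and> (\<forall>s\<in>snd x. y' s = c * y s)))"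

lemmas step_postD =
  step_post_def[THEN iffD1, THEN conjunct1]
  step_post_def[THEN iffD1, THEN conjunct2, THEN conjunct1]
  step_post_def[THEN iffD1, THEN conjunct2, THEN conjunct2, THEN conjunct1]
  step_post_def[THEN iffD1, THEN conjunct2, THEN conjunct2, THEN conjunct2, THEN conjunct1]
  step_post_def[THEN iffD1, THEN conjunct2, THEN conjunct2, THEN conjunct2, THEN conjunct2, THEN conjunct1]
  step_post_def[THEN iffD1, THEN conjunct2, THEN conjunct2, THEN conjunct2, THEN conjunct2, THEN conjunct2, THEN conjunct1]
  step_post_def[THEN iffD1, THEN conjunct2, THEN conjunct2, THEN conjunct2, THEN conjunct2, THEN conjunct2, THEN conjunct2]

lemma cover_step:
  fixes \<tau> \<tau>' :: "'a \<Rightarrow> 't" and p :: 'i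
  assumes S: "finite S" and T: "finite T" and TT: "\<tau>' ` S \<subseteq> T"
    and dom: "count_monotone S T \<tau>' good"
    and goodS: "good S"
    and str: "balanced S \<tau> y Bs" and y0b: "\<forall>s\<in>S. 0 < y s" and y2b: "\<forall>s\<in>S. y s < 2"
    and H: "H \<subseteq> S" and \<tau>b: "\<forall>s\<in>S - H. \<tau>' s = \<tau> s"
    and lab: "\<And>x. x \<in> Bs \<Longrightarrow> fst x \<noteq> p"
  shows "\<exists>n y' Bs'. step_post S T \<tau>' good H p y Bs n y' Bs'"
proof -
  define y1 where "y1 = (\<lambda>s. if s \<in> H then y s / 2 else y s)"
  define B1 where "B1 = (\<lambda>x. (fst x, snd x - H)) ` {x \<in> Bs. \<not> snd x \<subseteq> H}"
  note y0 = bspec[OF y0b] and y2 = bspec[OF y2b]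
  note h = hit_step[OF S str y0b H \<tau>b y1_def B1_def y2b]
  have y1: "0 < y1 s" "y1 s < 2" if "s \<in> S" for s using y0[OF that] y2[OF that] by (auto simp: y1_def)
  hence y1b: "\<forall>s\<in>S. 0 < y1 s" "\<forall>s\<in>S. y1 s < 2" by simp_all
  obtain B2 where B2: "balanced S \<tau>' y1 B2" "\<forall>x\<in>B2. x \<in> B1 \<or> fst x = p" "potential S y1 B2 + card (B2 - B1) \<le> potential S y1 B1"
    using rebundle[OF S h(1) y1(1) h(3)] by blast
  obtain m :: nat where m: "4 * (\<Sum>s\<in>S. ln 2 - ln (y1 s)) \<le> real m" using real_arch_simple by blast
  obtain n y' Bs' where L: "loop_post S T \<tau>' good p y1 B2 n y' Bs'"
    using raise_loop[OF S T TT dom goodS B2(1) y1b m] by blast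
  have lab1: "fst x \<noteq> p" if "x \<in> B1" for x using h(4)[OF that] lab by fastforce
  have f: "finite B2" using B2(1) by (simp add: balanced_def bundle_family_def)
  have "{x \<in> B2. fst x = p} \<subseteq> B2 - B1" using lab1 by blast
  hence c: "card {x \<in> B2. fst x = p} \<le> card (B2 - B1)" using f by (intro card_mono) auto
  have "step_post S T \<tau>' good H p y Bs n y' Bs'"
    unfolding step_post_def
  proof (intro conjI)
    show "balanced S \<tau>' y' Bs'" "\<forall>X. representatives X Bs' \<longrightarrow> good X" by (rule loop_postD(1)[OF L], rule loop_postD(3)[OF L])
    show "\<forall>s\<in>S. 0 < y' s \<and> y' s < 2" using loop_postD(2)[OF L] y1(1) by (meson less_le_trans)
    have "potential S y' Bs' + card {x \<in> Bs'. fst x = p} \<le> potential S y1 B2 + card {x \<in> B2. fst x = p} + 135 * card T * real n"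
      by (rule loop_postD(4)[OF L])
    thus "potential S y' Bs' + card {x \<in> Bs'. fst x = p} + 18 * sum y H \<le> potential S y Bs + 135 * card T * real n"
      using c B2(3) h(2) by linarith
    have "sum y1 S \<le> sum y S" by (rule sum_mono) (use y0 in \<open>auto simp: y1_def less_imp_le\<close>)
    thus "n = 0 \<longrightarrow> sum y' S \<le> sum y S" using loop_postD(5)[OF L] by blast
    show "\<forall>Xs\<subseteq>S. good Xs \<longrightarrow> (\<Sum>s\<in>Xs. ln (y s)) + real n / 4 \<le> (\<Sum>s\<in>Xs. ln (y' s)) + ln 2 * card (Xs \<inter> H)"
    proof (intro allI impI)
      fix Xs assume Xs: "Xs \<subseteq> S" "good Xs"
      have fX: "finite Xs" using Xs(1) S finite_subset by blast
      have "(\<Sum>s\<in>Xs. ln (y1 s)) + real n / 4 \<le> (\<Sum>s\<in>Xs. ln (y' s))" using loop_postD(6)[OF L] Xs by blast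
      moreover have "(\<Sum>s\<in>Xs. ln (y1 s)) = (\<Sum>s\<in>Xs. ln (y s) - (if s \<in> H then ln 2 else 0))"
      proof (rule sum.cong[OF refl])
        fix s assume "s \<in> Xs"
        hence "0 < y s" using Xs(1) y0 by blast
        thus "ln (y1 s) = ln (y s) - (if s \<in> H then ln 2 else 0)" by (simp add: y1_def ln_div)
      qed
      moreover have "\<dots> = (\<Sum>s\<in>Xs. ln (y s)) - ln 2 * card (Xs \<inter> H)"
        using fX by (simp add: sum_subtractf flip: sum.inter_restrict)
      ultimately show "(\<Sum>s\<in>Xs. ln (y s)) + real n / 4 \<le> (\<Sum>s\<in>Xs. ln (y' s)) + ln 2 * card (Xs \<inter> H)" by linarith
    qed
    show "\<forall>x\<in>Bs'. fst x = p \<or> (\<exists>b c. (fst x, b) \<in> Bs \<and> snd x = b - H \<and> c > 0 \<and> (\<forall>s\<in>snd x. y' s = c * y s))"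
    proof
      fix x assume x: "x \<in> Bs'"
      show "fst x = p \<or> (\<exists>b c. (fst x, b) \<in> Bs \<and> snd x = b - H \<and> c > 0 \<and> (\<forall>s\<in>snd x. y' s = c * y s))"
      proof (cases "fst x = p")
        case False
        then obtain c where c: "x \<in> B2" "c > 0" "\<forall>s\<in>snd x. y' s = c * y1 s"
          using loop_postD(7)[OF L] x by blast
        have "x \<in> B1" using B2(2) c(1) False by blast
        from h(4)[OF this] obtain b where b: "(fst x, b) \<in> Bs" "snd x = b - H" by (elim exE conjE)
        have "\<forall>s\<in>snd x. y' s = c * y s" using c(3) b(2) by (simp add: y1_def)
        thus ?thesis using b c(2) by blast
      qed simp
    qed
  qed
  thus ?thesis by blast
qed

section \<open>Randomized covering\<close>

lemma prefix_choice:
  assumes "I [] s0"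
    and step: "\<And>p e s. Q (p @ [e]) \<Longrightarrow> I p s \<Longrightarrow> \<exists>s'. I (p @ [e]) s' \<and> R p e s s'"
    and closed: "\<And>p e. Q (p @ [e]) \<Longrightarrow> Q p"
  shows "\<exists>F. F [] = s0 \<and> (\<forall>p. Q p \<longrightarrow> I p (F p)) \<and> (\<forall>p e. Q (p @ [e]) \<longrightarrow> R p e (F p) (F (p @ [e])))"
proof -
  define G where "G = rec_list s0 (\<lambda>e es s. SOME s'. I (rev es @ [e]) s' \<and> R (rev es) e s s')"
  define F where "F p = G (rev p)" for p
  have F0: "F [] = s0" by (simp add: F_def G_def)
  have F1: "F (p @ [e]) = (SOME s'. I (p @ [e]) s' \<and> R p e (F p) s')" for p e
    by (simp add: F_def G_def)
  have IF: "Q p \<longrightarrow> I p (F p)" for p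
  proof (induction p rule: rev_induct)
    case Nil thus ?case using F0 assms(1) by simp
  next
    case (snoc e p)
    show ?case
    proof
      assume q: "Q (p @ [e])"
      hence "I p (F p)" using snoc closed by blast
      from someI_ex[OF step[OF q this]] show "I (p @ [e]) (F (p @ [e]))" unfolding F1 by (rule conjunct1)
    qed
  qed
  have "R p e (F p) (F (p @ [e]))" if q: "Q (p @ [e])" for p e
  proof -
    have "I p (F p)" using IF closed[OF q] by blast
    from someI_ex[OF step[OF q this]] show ?thesis unfolding F1 by (rule conjunct2)
  qed
  thus ?thesis using F0 IF by blast
qed

lemma potential_nonneg:
  assumes S: "finite S" and str: "balanced S \<tau> y Bs" and y0b: "\<forall>s\<in>S. 0 < y s" and y2b: "\<forall>s\<in>S. y s < 2"
  shows "potential S y Bs \<ge> 0"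
proof -
  note D = bundle_facts[OF S finite_imageI[OF S] subset_refl str y0b y2b]
  have nn: "0 \<le> y s" if "s \<in> S" for s using bspec[OF y0b that] by simp
  have "(\<Sum>x\<in>Bs. - 40 * sum y (snd x)) \<le> (\<Sum>x\<in>Bs. bundle_value y (snd x))"
  proof (rule sum_mono)
    fix x assume x: "x \<in> Bs"
    have n: "0 \<le> sum y (snd x)" by (rule sum_nonneg) (use D(2)[OF x] nn in blast)
    show "- 40 * sum y (snd x) \<le> bundle_value y (snd x)"
    proof (cases "\<exists>s. snd x = {s} \<and> 1 \<le> y s")
      case True
      then obtain s where "snd x = {s}" "1 \<le> y s" by (elim exE conjE)
      thus ?thesis by (simp add: bundle_value_def)
    next
      case False
      hence "bundle_value y (snd x) = penalty (sum y (snd x))" using D(5)[OF x] by (auto simp: ok_bundle_def bundle_value_def)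
      hence "0 \<le> bundle_value y (snd x)" by (simp add: penalty_nonneg)
      thus ?thesis using n by linarith
    qed
  qed
  also have "(\<Sum>x\<in>Bs. - 40 * sum y (snd x)) = - 40 * (\<Sum>x\<in>Bs. sum y (snd x))" by (simp only: sum_distrib_left)
  also have "(\<Sum>x\<in>Bs. sum y (snd x)) = sum y (\<Union>x\<in>Bs. snd x)"
  proof (rule sum.UNION_disjoint[symmetric])
    show "\<forall>i\<in>Bs. finite (snd i)" using D(8) by (intro ballI)
    show "\<forall>i\<in>Bs. \<forall>j\<in>Bs. i \<noteq> j \<longrightarrow> snd i \<inter> snd j = {}" by (intro ballI impI D(3))
  qed (rule D(1))
  finally have "- 40 * sum y (\<Union>x\<in>Bs. snd x) \<le> (\<Sum>x\<in>Bs. bundle_value y (snd x))" .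
  moreover have "sum y (\<Union>x\<in>Bs. snd x) \<le> sum y S"
  proof (rule sum_mono2[OF S])
    show "(\<Union>x\<in>Bs. snd x) \<subseteq> S" by (intro UN_least D(2))
  qed (use nn in blast)
  moreover have "0 \<le> sum y S" by (rule sum_nonneg) (rule nn)
  moreover have "0 \<le> sum y (S - \<Union>(snd ` Bs))" by (rule sum_nonneg) (use nn in blast)
  ultimately show ?thesis unfolding potential_def by linarith
qed

lemma balanced_mass:
  assumes S: "finite S" and str: "balanced S \<tau> y Bs" and y0b: "\<forall>s\<in>S. 0 < y s" and y2b: "\<forall>s\<in>S. y s < 2"
    and x: "x \<in> Bs"
  shows "1/2 \<le> sum y (snd x)" "snd x \<noteq> {}" "snd x \<subseteq> S" "finite (snd x)" "sum y (snd x) \<le> sum y S"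
proof -
  note D = bundle_facts[OF S finite_imageI[OF S] subset_refl str y0b y2b]
  show h: "1/2 \<le> sum y (snd x)" using D(5)[OF x] by (auto simp: ok_bundle_def)
  thus "snd x \<noteq> {}" by auto
  show sS: "snd x \<subseteq> S" by (rule D(2)[OF x])
  show "finite (snd x)" by (rule D(8)[OF x])
  show "sum y (snd x) \<le> sum y S"
    by (rule sum_mono2[OF S sS]) (use y0b in \<open>auto intro: less_imp_le\<close>)
qed

text \<open>
  Multiplicative weights: a weight is halved when its server is hit, and each application of
  \<open>raise\<close> increases \<open>\<Sum>s\<in>Xs. ln (y s)\<close> by at least \<open>1 / 4\<close> for every good \<open>Xs\<close>. It starts at
  \<open>- card Xs * ln (4 * card S)\<close>, loses \<open>ln 2\<close> with each hit of a server of \<open>Xs\<close>, and is at most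
  \<open>card Xs * ln 2\<close>, so \<open>raise\<close> is applied \<open>O(card Xs * (ln (card S) + L))\<close> times.
\<close>

theorem randomized_covering:
  fixes S :: "'a set" and T :: "'t set" and \<tau> :: "'e list \<Rightarrow> 'a \<Rightarrow> 't" and H :: "'e list \<Rightarrow> 'a set"
    and good :: "'e list \<Rightarrow> 'a set \<Rightarrow> bool" and PP :: "'e list set"
  assumes S: "finite S" "S \<noteq> {}" and T: "finite T" and PP: "finite PP"
    and closed: "\<And>p e. p @ [e] \<in> PP \<Longrightarrow> p \<in> PP"
    and TT: "\<And>p. p \<in> PP \<Longrightarrow> \<tau> p ` S \<subseteq> T"
    and H: "\<And>p. H p \<subseteq> S"
    and type_change: "\<And>p e s. p @ [e] \<in> PP \<Longrightarrow> s \<in> S \<Longrightarrow> s \<notin> H (p @ [e]) \<Longrightarrow> \<tau> (p @ [e]) s = \<tau> p s"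
    and dom: "\<And>p. p \<in> PP \<Longrightarrow> count_monotone S T (\<tau> p) (good p)"
    and goodS: "\<And>p. p \<in> PP \<Longrightarrow> p \<noteq> [] \<Longrightarrow> good p S"
  shows "\<exists>D :: ('e list \<Rightarrow> 'a set) pmf. finite (set_pmf D) \<and>
    (\<forall>X\<in>set_pmf D. X [] = {} \<and> (\<forall>p\<in>PP. X p \<subseteq> S \<and> (p \<noteq> [] \<longrightarrow> good p (X p)))) \<and>
    (\<forall>\<sigma>\<in>PP. \<forall>Xs L. Xs \<subseteq> S \<longrightarrow> (\<forall>t\<in>{1..length \<sigma>}. good (take t \<sigma>) Xs) \<longrightarrow>
      (\<Sum>t<length \<sigma>. card (Xs \<inter> H (take (Suc t) \<sigma>))) \<le> L * real (card Xs) \<longrightarrow>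
      measure_pmf.expectation D (\<lambda>X. \<Sum>t<length \<sigma>.
        real (card (X (take t \<sigma>) - X (take (Suc t) \<sigma>)) + card (X (take (Suc t) \<sigma>) - X (take t \<sigma>))
          + card (X (take t \<sigma>) \<inter> H (take (Suc t) \<sigma>))))
      \<le> 8000 * (real (card T) + 1) * real (card Xs) * (1 + ln (real (card S)) + L))"
proof -
  define l where "l = real (card S)"
  have l: "l \<ge> 1" using S by (simp add: l_def Suc_le_eq card_gt_0_iff)
  define y0 :: "'a \<Rightarrow> real" where "y0 s = 1 / (4 * l)" for s
  have sy0: "sum y0 A = real (card A) / (4 * l)" for A by (simp add: y0_def)
  define I where "I p st \<longleftrightarrow> balanced S (\<tau> p) (fst st) (snd st) \<and> (\<forall>s\<in>S. 0 < fst st s) \<and> (\<forall>s\<in>S. fst st s < 2) \<and>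
      (p \<noteq> [] \<longrightarrow> (\<forall>X. representatives X (snd st) \<longrightarrow> good p X)) \<and>
      (\<forall>x\<in>snd st. length (fst x) \<le> length p \<and> fst x \<in> PP)" for p and st :: "('a \<Rightarrow> real) \<times> ('e list \<times> 'a set) set"
  define R where "R p e st st' \<longleftrightarrow> (\<exists>n. step_post S T (\<tau> (p @ [e])) (good (p @ [e])) (H (p @ [e])) (p @ [e])
      (fst st) (snd st) n (fst st') (snd st'))" for p e and st st' :: "('a \<Rightarrow> real) \<times> ('e list \<times> 'a set) set"
  have "\<exists>F. F [] = (y0, {}) \<and> (\<forall>p. p \<in> PP \<longrightarrow> I p (F p)) \<and> (\<forall>p e. p @ [e] \<in> PP \<longrightarrow> R p e (F p) (F (p @ [e])))"
  proof (rule prefix_choice[where Q = "\<lambda>p. p \<in> PP"])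
    have "sum y0 {s \<in> S - \<Union> (snd ` {}). \<tau> [] s = a} < 1" for a
    proof -
      have "card {s \<in> S. \<tau> [] s = a} \<le> card S" by (intro card_mono) (use S in auto)
      thus ?thesis using l by (simp add: sy0 l_def divide_simps)
    qed
    moreover have "y0 s < 1" "0 < y0 s" for s using l by (simp_all add: y0_def)
    ultimately show "I [] (y0, {})" unfolding I_def balanced_def bundle_family_def
      by (auto simp: not_le intro: less_trans[of _ 1])
  next
    fix p e st assume p: "p @ [e] \<in> PP" and i: "I p st"
    have lab: "fst x \<noteq> p @ [e]" if "x \<in> snd st" for x using i that unfolding I_def by auto
    have "\<forall>s\<in>S - H (p @ [e]). \<tau> (p @ [e]) s = \<tau> p s" using type_change[OF p] by blast
    from cover_step[OF S(1) T TT[OF p] dom[OF p] goodS[OF p] _ _ _ H this lab, of "fst st"] i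
    obtain n y' Bs' where st: "step_post S T (\<tau> (p @ [e])) (good (p @ [e])) (H (p @ [e])) (p @ [e]) (fst st) (snd st) n y' Bs'"
      unfolding I_def by blast
    have "I (p @ [e]) (y', Bs')"
      unfolding I_def fst_conv snd_conv
    proof (intro conjI)
      show "balanced S (\<tau> (p @ [e])) y' Bs'" by (rule step_postD(1)[OF st])
      show "\<forall>s\<in>S. 0 < y' s" "\<forall>s\<in>S. y' s < 2" using step_postD(2)[OF st] by blast+
      show "p @ [e] \<noteq> [] \<longrightarrow> (\<forall>X. representatives X Bs' \<longrightarrow> good (p @ [e]) X)" using step_postD(3)[OF st] by blast
      show "\<forall>x\<in>Bs'. length (fst x) \<le> length (p @ [e]) \<and> fst x \<in> PP"
      proof
        fix x assume "x \<in> Bs'"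
        with step_postD(7)[OF st] consider "fst x = p @ [e]" | b where "(fst x, b) \<in> snd st" by blast
        thus "length (fst x) \<le> length (p @ [e]) \<and> fst x \<in> PP"
        proof cases
          case 1 thus ?thesis using p by simp
        next
          case 2 thus ?thesis using i unfolding I_def by fastforce
        qed
      qed
    qed
    thus "\<exists>s'. I (p @ [e]) s' \<and> R p e st s'" unfolding R_def using st by (intro exI[of _ "(y', Bs')"]) auto
  next
    fix p e assume "p @ [e] \<in> PP" thus "p \<in> PP" by (rule closed)
  qed
  then obtain F where F: "F [] = (y0, {})" "\<And>p. p \<in> PP \<Longrightarrow> I p (F p)" "\<And>p e. p @ [e] \<in> PP \<Longrightarrow> R p e (F p) (F (p @ [e]))"
    by blast
  define Y where "Y p = fst (F p)" for p
  define B where "B p = snd (F p)" for p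
  have str: "balanced S (\<tau> p) (Y p) (B p)" and Y0: "\<forall>s\<in>S. 0 < Y p s" and Y2: "\<forall>s\<in>S. Y p s < 2"
    and gB: "p \<noteq> [] \<Longrightarrow> representatives X (B p) \<Longrightarrow> good p X" and labB: "\<And>x. x \<in> B p \<Longrightarrow> fst x \<in> PP" if "p \<in> PP" for p X
    using F(2)[OF that] unfolding I_def Y_def B_def by blast+
  have "\<forall>pe\<in>{pe. fst pe @ [snd pe] \<in> PP}. \<exists>n. step_post S T (\<tau> (fst pe @ [snd pe])) (good (fst pe @ [snd pe])) (H (fst pe @ [snd pe])) (fst pe @ [snd pe])
      (Y (fst pe)) (B (fst pe)) n (Y (fst pe @ [snd pe])) (B (fst pe @ [snd pe]))"
    using F(3) unfolding R_def Y_def B_def by blast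
  from bchoice[OF this] obtain N0 where "\<forall>pe\<in>{pe. fst pe @ [snd pe] \<in> PP}. step_post S T (\<tau> (fst pe @ [snd pe])) (good (fst pe @ [snd pe])) (H (fst pe @ [snd pe])) (fst pe @ [snd pe])
      (Y (fst pe)) (B (fst pe)) (N0 pe) (Y (fst pe @ [snd pe])) (B (fst pe @ [snd pe]))" by blast
  hence st: "step_post S T (\<tau> (p @ [e])) (good (p @ [e])) (H (p @ [e])) (p @ [e]) (Y p) (B p) (N0 (p, e)) (Y (p @ [e])) (B (p @ [e]))"
    if "p @ [e] \<in> PP" for p e using that by fastforce
  have ratio: "p \<in> PP \<longrightarrow> (\<forall>x\<in>B p. \<exists>c>0. \<forall>s\<in>snd x. Y p s = c * Y (fst x) s)" for p
  proof (induction p rule: rev_induct)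
    case Nil thus ?case by (simp add: B_def F(1))
  next
    case (snoc e p)
    show ?case
    proof (intro impI ballI)
      fix x assume q: "p @ [e] \<in> PP" and x: "x \<in> B (p @ [e])"
      have IH: "\<forall>x\<in>B p. \<exists>c>0. \<forall>s\<in>snd x. Y p s = c * Y (fst x) s" using snoc closed[OF q] by blast
      from step_postD(7)[OF st[OF q]] x
      consider "fst x = p @ [e]" | b c where "(fst x, b) \<in> B p" "snd x = b - H (p @ [e])" "c > 0" "\<forall>s\<in>snd x. Y (p @ [e]) s = c * Y p s"
        by blast
      thus "\<exists>c>0. \<forall>s\<in>snd x. Y (p @ [e]) s = c * Y (fst x) s"
      proof cases
        case 1 thus ?thesis by (intro exI[of _ 1]) simp
      next
        case 2
        from bspec[OF IH 2(1)] obtain d where d: "d > 0" "\<forall>s\<in>b. Y p s = d * Y (fst x) s" by auto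
        have "\<forall>s\<in>snd x. Y (p @ [e]) s = (c * d) * Y (fst x) s" using 2(2,4) d(2) by simp
        moreover have "c * d > 0" using 2(3) d(1) by simp
        ultimately show ?thesis by blast
      qed
    qed
  qed
  have "\<forall>p\<in>PP. \<exists>D :: ('a set \<Rightarrow> 'a) pmf. finite (set_pmf D) \<and>
     (\<forall>F\<in>set_pmf D. \<forall>c. c \<subseteq> S \<longrightarrow> c \<noteq> {} \<longrightarrow> F c \<in> c \<and> (\<forall>c'\<subseteq>c. F c \<in> c' \<longrightarrow> F c' = F c)) \<and>
     (\<forall>c\<subseteq>S. \<forall>u\<in>c. pmf (map_pmf (\<lambda>F. F c) D) u = Y p u / sum (Y p) c)" (is "\<forall>p\<in>PP. \<exists>D. ?C p D")
  proof
    fix p assume p: "p \<in> PP"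
    show "\<exists>D. ?C p D" by (rule choice_function_pmf[OF S(1)]) (use Y0[OF p] in blast)
  qed
  from bchoice[OF this] obtain Dc where Dc0: "\<forall>p\<in>PP. ?C p (Dc p)" by (elim exE)
  note Dc = bspec[OF Dc0, THEN conjunct1] bspec[OF Dc0, THEN conjunct2, THEN conjunct1] bspec[OF Dc0, THEN conjunct2, THEN conjunct2]
  define DD where "DD = Pi_pmf PP (\<lambda>_. undefined) Dc"
  define X where "X \<omega> p = (\<lambda>x. \<omega> (fst x) (snd x)) ` B p" for \<omega> :: "'e list \<Rightarrow> 'a set \<Rightarrow> 'a" and p
  have setDD: "set_pmf DD = PiE_dflt PP (\<lambda>_. undefined) (set_pmf \<circ> Dc)" unfolding DD_def by (rule set_Pi_pmf[OF PP])
  have finDD: "finite (set_pmf DD)" unfolding setDD using Dc(1) PP by (intro finite_PiE_dflt) auto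
  have comp: "\<omega> p \<in> set_pmf (Dc p)" if "\<omega> \<in> set_pmf DD" "p \<in> PP" for \<omega> p
    using that unfolding setDD by (auto simp: PiE_dflt_def)
  have rep: "\<omega> (fst x) (snd x) \<in> snd x" "\<And>c. c \<subseteq> snd x \<Longrightarrow> \<omega> (fst x) (snd x) \<in> c \<Longrightarrow> \<omega> (fst x) c = \<omega> (fst x) (snd x)"
    if "\<omega> \<in> set_pmf DD" "p \<in> PP" "x \<in> B p" for \<omega> p x
  proof -
    note m = balanced_mass[OF S(1) str[OF that(2)] Y0[OF that(2)] Y2[OF that(2)] that(3)]
    note h = mp[OF mp[OF spec[OF bspec[OF Dc(2)[OF labB[OF that(2,3)]] comp[OF that(1) labB[OF that(2,3)]]]] m(3)] m(2)]
    show "\<omega> (fst x) (snd x) \<in> snd x" by (rule conjunct1[OF h])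
    show "\<omega> (fst x) c = \<omega> (fst x) (snd x)" if "c \<subseteq> snd x" "\<omega> (fst x) (snd x) \<in> c" for c
      using conjunct2[OF h] that by (elim allE impE)
  qed
  have marg: "measure_pmf.prob DD {\<omega>. \<omega> (fst x) (snd x) \<in> A} \<le> 2 * sum (Y p) (snd x \<inter> A)"
    if px: "p \<in> PP" "x \<in> B p" for p x A
  proof -
    note m = balanced_mass[OF S(1) str[OF px(1)] Y0[OF px(1)] Y2[OF px(1)] px(2)]
    have q: "fst x \<in> PP" by (rule labB[OF px])
    obtain c where c: "c > 0" "\<forall>s\<in>snd x. Y p s = c * Y (fst x) s" using bspec[OF mp[OF ratio px(1)] px(2)] by (elim exE conjE)
    have mp: "map_pmf (\<lambda>\<omega>. \<omega> (fst x)) DD = Dc (fst x)" unfolding DD_def by (rule Pi_pmf_component[OF PP, of "fst x", THEN trans]) (use q in simp)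
    have mp2: "map_pmf (\<lambda>\<omega>. \<omega> (fst x) (snd x)) DD = map_pmf (\<lambda>F. F (snd x)) (Dc (fst x))"
      unfolding mp[symmetric] by (simp add: map_pmf_comp)
    have "measure_pmf.prob DD {\<omega>. \<omega> (fst x) (snd x) \<in> A}
        = measure_pmf.prob (map_pmf (\<lambda>\<omega>. \<omega> (fst x) (snd x)) DD) A"
      by (simp add: vimage_def)
    also have "\<dots> = measure_pmf.prob (map_pmf (\<lambda>\<omega>. \<omega> (fst x) (snd x)) DD) (snd x \<inter> A)"
    proof (rule measure_prob_cong_0)
      fix s assume "s \<in> A - (snd x \<inter> A)"
      hence "s \<notin> set_pmf (map_pmf (\<lambda>\<omega>. \<omega> (fst x) (snd x)) DD)" using rep(1)[OF _ px] by auto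
      thus "pmf (map_pmf (\<lambda>\<omega>. \<omega> (fst x) (snd x)) DD) s = 0" by (simp only: set_pmf_iff not_not)
    qed auto
    also have "\<dots> = (\<Sum>s\<in>snd x \<inter> A. pmf (map_pmf (\<lambda>F. F (snd x)) (Dc (fst x))) s)"
      unfolding mp2 by (rule measure_measure_pmf_finite) (use m(4) in simp)
    also have "\<dots> = (\<Sum>s\<in>snd x \<inter> A. Y p s / sum (Y p) (snd x))"
    proof (rule sum.cong[OF refl])
      fix s assume s: "s \<in> snd x \<inter> A"
      have "pmf (map_pmf (\<lambda>F. F (snd x)) (Dc (fst x))) s = Y (fst x) s / sum (Y (fst x)) (snd x)"
        using Dc(3)[OF q] m(3) s by blast
      also have "\<dots> = (c * Y (fst x) s) / (c * sum (Y (fst x)) (snd x))" using c(1) by simp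
      also have "c * sum (Y (fst x)) (snd x) = sum (Y p) (snd x)" unfolding sum_distrib_left using c(2) by (intro sum.cong) auto
      finally show "pmf (map_pmf (\<lambda>F. F (snd x)) (Dc (fst x))) s = Y p s / sum (Y p) (snd x)" using c(2) s by simp
    qed
    also have "\<dots> = sum (Y p) (snd x \<inter> A) / sum (Y p) (snd x)" by (simp add: sum_divide_distrib)
    also have "\<dots> \<le> sum (Y p) (snd x \<inter> A) / (1/2)"
    proof (rule divide_left_mono)
      show "0 \<le> sum (Y p) (snd x \<inter> A)" by (rule sum_nonneg) (use Y0[OF px(1)] m(3) in \<open>auto intro: less_imp_le\<close>)
      show "0 < sum (Y p) (snd x) * (1/2)" using m(1) by simp
    qed (rule m(1))
    finally show ?thesis by simp
  qed
  define D where "D = map_pmf X DD"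
  have finD: "finite (set_pmf D)" using finDD by (simp add: D_def)
  have valid: "X \<omega> [] = {} \<and> (\<forall>p\<in>PP. X \<omega> p \<subseteq> S \<and> (p \<noteq> [] \<longrightarrow> good p (X \<omega> p)))" if w: "\<omega> \<in> set_pmf DD" for \<omega>
  proof (intro conjI ballI impI)
    show "X \<omega> [] = {}" by (simp add: X_def B_def F(1))
    fix p assume p: "p \<in> PP"
    show "X \<omega> p \<subseteq> S"
      using rep(1)[OF w p] balanced_mass(3)[OF S(1) str[OF p] Y0[OF p] Y2[OF p]] unfolding X_def by blast
    assume "p \<noteq> []"
    moreover have "representatives (X \<omega> p) (B p)" unfolding representatives_def X_def
      by (intro exI[of _ "\<lambda>x. \<omega> (fst x) (snd x)"]) (use rep(1)[OF w p] in blast)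
    ultimately show "good p (X \<omega> p)" by (rule gB[OF p])
  qed
  have disj_sum: "(\<Sum>x\<in>B p. sum (Y p) (snd x \<inter> A)) \<le> sum (Y p) A" if p: "p \<in> PP" and A: "A \<subseteq> S" for p A
  proof -
    note DD' = bundle_facts[OF S(1) finite_imageI[OF S(1)] subset_refl str[OF p] Y0[OF p] Y2[OF p]]
    have fA: "finite A" using A S finite_subset by blast
    have "(\<Sum>x\<in>B p. sum (Y p) (snd x \<inter> A)) = sum (Y p) (\<Union>x\<in>B p. snd x \<inter> A)"
    proof (rule sum.UNION_disjoint[symmetric, OF DD'(1)])
      show "\<forall>i\<in>B p. finite (snd i \<inter> A)" using fA by simp
      show "\<forall>i\<in>B p. \<forall>j\<in>B p. i \<noteq> j \<longrightarrow> snd i \<inter> A \<inter> (snd j \<inter> A) = {}"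
      proof (intro ballI impI)
        fix i j assume "i \<in> B p" "j \<in> B p" "i \<noteq> j"
        from DD'(3)[OF this] show "snd i \<inter> A \<inter> (snd j \<inter> A) = {}" by blast
      qed
    qed
    also have "\<dots> \<le> sum (Y p) A" by (rule sum_mono2[OF fA]) (use A Y0[OF p] in \<open>auto intro: less_imp_le\<close>)
    finally show ?thesis .
  qed
  have finB: "finite (B p)" if "p \<in> PP" for p using str[OF that] by (simp add: balanced_def bundle_family_def)
  define fr where "fr p = real (card {x \<in> B p. fst x = p})" for p
  define ind where "ind \<omega> p e = (\<Sum>x\<in>B p. indicator {\<omega>. \<omega> (fst x) (snd x) \<in> H (p @ [e])} \<omega> :: real)" for \<omega> p e
  have Eind: "measure_pmf.expectation DD (\<lambda>\<omega>. ind \<omega> p e) \<le> 2 * sum (Y p) (H (p @ [e]))" if p: "p \<in> PP" for p e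
  proof -
    have "measure_pmf.expectation DD (\<lambda>\<omega>. ind \<omega> p e) = (\<Sum>x\<in>B p. measure_pmf.prob DD {\<omega>. \<omega> (fst x) (snd x) \<in> H (p @ [e])})"
      unfolding ind_def by (subst Bochner_Integration.integral_sum) (auto intro: integrable_measure_pmf_finite finDD)
    also have "\<dots> \<le> (\<Sum>x\<in>B p. 2 * sum (Y p) (snd x \<inter> H (p @ [e])))" by (rule sum_mono) (rule marg[OF p])
    also have "\<dots> = 2 * (\<Sum>x\<in>B p. sum (Y p) (snd x \<inter> H (p @ [e])))" by (simp add: sum_distrib_left)
    also have "\<dots> \<le> 2 * sum (Y p) (H (p @ [e]))" using disj_sum[OF p H] by simp
    finally show ?thesis .
  qed
  have ind_card: "ind \<omega> p e = card {x \<in> B p. \<omega> (fst x) (snd x) \<in> H (p @ [e])}" if "p \<in> PP" for \<omega> p e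
    unfolding ind_def using finB[OF that] by (simp add: indicator_def of_bool_def[symmetric] sum.If_cases Int_def)
  have hitc: "card (X \<omega> p \<inter> H (p @ [e])) \<le> ind \<omega> p e" if "p \<in> PP" for \<omega> p e
  proof -
    have "X \<omega> p \<inter> H (p @ [e]) \<subseteq> (\<lambda>x. \<omega> (fst x) (snd x)) ` {x \<in> B p. \<omega> (fst x) (snd x) \<in> H (p @ [e])}" unfolding X_def by blast
    hence "card (X \<omega> p \<inter> H (p @ [e])) \<le> card {x \<in> B p. \<omega> (fst x) (snd x) \<in> H (p @ [e])}"
      using finB[OF that] by (intro surj_card_le) auto
    thus ?thesis using ind_card[OF that] by simp
  qed
  have newc: "card (X \<omega> (p @ [e]) - X \<omega> p) \<le> fr (p @ [e]) + ind \<omega> p e" if w: "\<omega> \<in> set_pmf DD" and q: "p @ [e] \<in> PP" for \<omega> p e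
  proof -
    have p: "p \<in> PP" by (rule closed[OF q])
    define A1 where "A1 = {x \<in> B (p @ [e]). fst x = p @ [e]}"
    define A2 where "A2 = {x \<in> B p. \<omega> (fst x) (snd x) \<in> H (p @ [e])}"
    have f: "finite A1" "finite A2" using finB[OF p] finB[OF q] by (auto simp: A1_def A2_def)
    have "X \<omega> (p @ [e]) - X \<omega> p \<subseteq> (\<lambda>x. \<omega> (fst x) (snd x)) ` A1 \<union> (\<lambda>x. \<omega> (fst x) (snd x - H (p @ [e]))) ` A2"
    proof
      fix s assume s: "s \<in> X \<omega> (p @ [e]) - X \<omega> p"
      then obtain x where x: "x \<in> B (p @ [e])" "s = \<omega> (fst x) (snd x)" unfolding X_def by blast
      show "s \<in> (\<lambda>x. \<omega> (fst x) (snd x)) ` A1 \<union> (\<lambda>x. \<omega> (fst x) (snd x - H (p @ [e]))) ` A2"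
      proof (cases "fst x = p @ [e]")
        case True thus ?thesis using x by (auto simp: A1_def)
      next
        case False
        then obtain b where b: "(fst x, b) \<in> B p" "snd x = b - H (p @ [e])"
          using step_postD(7)[OF st[OF q]] x(1) by blast
        have "\<omega> (fst x) b \<in> H (p @ [e])"
        proof (rule ccontr)
          assume n: "\<omega> (fst x) b \<notin> H (p @ [e])"
          have "\<omega> (fst x) b \<in> b" using rep(1)[OF w p b(1)] by simp
          hence "\<omega> (fst x) (snd x) = \<omega> (fst x) b" using rep(2)[OF w p b(1), of "snd x"] n b(2) by auto
          hence "s \<in> X \<omega> p" unfolding X_def using b(1) x(2) by force
          thus False using s by blast
        qed
        hence "(fst x, b) \<in> A2" using b(1) by (simp add: A2_def)
        moreover have "s = \<omega> (fst (fst x, b)) (snd (fst x, b) - H (p @ [e]))" using x(2) b(2) by simp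
        ultimately show ?thesis by blast
      qed
    qed
    hence "card (X \<omega> (p @ [e]) - X \<omega> p) \<le> card ((\<lambda>x. \<omega> (fst x) (snd x)) ` A1 \<union> (\<lambda>x. \<omega> (fst x) (snd x - H (p @ [e]))) ` A2)"
      using f by (intro card_mono) auto
    also have "\<dots> \<le> card ((\<lambda>x. \<omega> (fst x) (snd x)) ` A1) + card ((\<lambda>x. \<omega> (fst x) (snd x - H (p @ [e]))) ` A2)" by (rule card_Un_le)
    also have "\<dots> \<le> card A1 + card A2" by (intro add_mono card_image_le f)
    finally show ?thesis unfolding fr_def ind_card[OF p] A1_def A2_def by linarith
  qed
  have main: "measure_pmf.expectation D (\<lambda>X. \<Sum>t<length \<sigma>.
        real (card (X (take t \<sigma>) - X (take (Suc t) \<sigma>)) + card (X (take (Suc t) \<sigma>) - X (take t \<sigma>))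
          + card (X (take t \<sigma>) \<inter> H (take (Suc t) \<sigma>))))
      \<le> 8000 * (real (card T) + 1) * real (card Xs) * (1 + ln (real (card S)) + L)"
    if \<sigma>: "\<sigma> \<in> PP" and Xs: "Xs \<subseteq> S" and gX: "\<forall>t\<in>{1..length \<sigma>}. good (take t \<sigma>) Xs"
      and hitL: "(\<Sum>t<length \<sigma>. card (Xs \<inter> H (take (Suc t) \<sigma>))) \<le> L * real (card Xs)" for \<sigma> Xs L
  proof -
    have takePP: "take t \<sigma> \<in> PP" for t
    proof (induction "length \<sigma> - t" arbitrary: t)
      case 0 thus ?case using \<sigma> by simp
    next
      case (Suc d)
      hence "t < length \<sigma>" by simp
      moreover have "take (Suc t) \<sigma> \<in> PP" using Suc by simp
      ultimately show ?case using closed by (simp add: take_Suc_conv_app_nth)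
    qed
    define n where "n = length \<sigma>"
    have tk: "take (Suc t) \<sigma> = take t \<sigma> @ [\<sigma> ! t]" if "t < n" for t using that by (simp add: n_def take_Suc_conv_app_nth)
    define P where "P t = take t \<sigma>" for t
    define yt where "yt t = Y (P t)" for t
    define nt where "nt t = N0 (P t, \<sigma> ! t)" for t
    define h where "h t = sum (yt t) (H (P (Suc t)))" for t
    have Pt: "P t \<in> PP" for t by (simp add: P_def takePP)
    have stt: "step_post S T (\<tau> (P (Suc t))) (good (P (Suc t))) (H (P (Suc t))) (P (Suc t)) (yt t) (B (P t)) (nt t) (yt (Suc t)) (B (P (Suc t)))"
      if "t < n" for t
      using st[of "P t" "\<sigma> ! t"] Pt[of "Suc t"] tk[OF that] by (simp add: P_def yt_def nt_def)
    have hn: "0 \<le> h t" for t unfolding h_def yt_def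
    proof (rule sum_nonneg)
      fix s assume "s \<in> H (P (Suc t))"
      hence "s \<in> S" by (rule subsetD[OF H])
      thus "0 \<le> Y (P t) s" using bspec[OF Y0[OF Pt]] by (intro less_imp_le) simp
    qed
    define Nn where "Nn = (\<Sum>t<n. real (nt t))"
    have pots: "potential S (yt m) (B (P m)) + (\<Sum>t<m. fr (P (Suc t)) + 18 * h t) \<le> potential S (yt 0) (B (P 0)) + 135 * card T * (\<Sum>t<m. real (nt t))"
      if "m \<le> n" for m using that
    proof (induction m)
      case (Suc m)
      have m: "m < n" using Suc.prems by simp
      from step_postD(4)[OF stt[OF m]] Suc show ?case by (simp add: fr_def h_def algebra_simps)
    qed simp
    have y00: "yt 0 = y0" "B (P 0) = {}" by (simp_all add: yt_def P_def Y_def B_def F(1))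
    have pot0: "potential S (yt 0) (B (P 0)) \<le> 31" using l by (simp add: y00 potential_def sy0 l_def)
    have potn: "potential S (yt n) (B (P n)) \<ge> 0" unfolding yt_def by (rule potential_nonneg[OF S(1) str[OF Pt] Y0[OF Pt] Y2[OF Pt]])
    have A: "(\<Sum>t<n. fr (P (Suc t)) + 18 * h t) \<le> 31 + 135 * card T * Nn"
      using pots[of n] pot0 potn by (simp add: Nn_def)
    have fX: "finite Xs" using Xs S finite_subset by blast
    have logs: "(\<Sum>s\<in>Xs. ln (yt 0 s)) + (\<Sum>t<m. real (nt t)) / 4 \<le> (\<Sum>s\<in>Xs. ln (yt m s)) + ln 2 * (\<Sum>t<m. real (card (Xs \<inter> H (P (Suc t)))))"
      if "m \<le> n" for m using that
    proof (induction m)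
      case (Suc m)
      have m: "m < n" using Suc.prems by simp
      have "good (P (Suc m)) Xs" using gX m by (simp add: P_def n_def)
      hence "(\<Sum>s\<in>Xs. ln (yt m s)) + real (nt m) / 4 \<le> (\<Sum>s\<in>Xs. ln (yt (Suc m) s)) + ln 2 * card (Xs \<inter> H (P (Suc m)))"
        using step_postD(6)[OF stt[OF m]] Xs by blast
      thus ?case using Suc by (simp add: algebra_simps add_divide_distrib)
    qed simp
    have b1: "(\<Sum>s\<in>Xs. ln (yt n s)) \<le> (\<Sum>s\<in>Xs. ln 2)"
    proof (rule sum_mono)
      fix s assume "s \<in> Xs"
      hence "s \<in> S" using Xs by blast
      hence "0 < yt n s" "yt n s < 2" using Y0[OF Pt] Y2[OF Pt] by (auto simp: yt_def)
      thus "ln (yt n s) \<le> ln 2" by simp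
    qed
    have b2: "(\<Sum>s\<in>Xs. ln (yt 0 s)) = - (real (card Xs) * (ln 4 + ln l))"
      using l by (simp add: y00 y0_def ln_div ln_mult algebra_simps)
    have b3: "ln 2 * (\<Sum>t<n. real (card (Xs \<inter> H (P (Suc t))))) \<le> ln 2 * (L * real (card Xs))"
      using hitL by (intro mult_left_mono) (simp_all add: n_def P_def)
    have b4: "(\<Sum>s\<in>Xs. ln (2::real)) = real (card Xs) * ln 2" by simp
    have b5: "real (card Xs) * (ln 2 + ln 4 + ln l + ln 2 * L) = real (card Xs) * ln 2 + real (card Xs) * (ln 4 + ln l) + ln 2 * (L * real (card Xs))"
      by (simp add: algebra_simps)
    have Nb0: "Nn / 4 \<le> real (card Xs) * (ln 2 + ln 4 + ln l + ln 2 * L)"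
      unfolding b5 Nn_def using logs[of n] b1 b2 b3 b4 by linarith
    have l2: "ln 2 \<le> (1::real)" "ln 4 \<le> (2::real)" "ln l \<ge> 0"
      using ln_2_less_1 ln_mult[of 2 "2::real"] l by simp_all
    have Lc: "0 \<le> L * real (card Xs)" using hitL by (meson of_nat_0_le_iff order_trans)
    have "ln 2 * L * real (card Xs) \<le> 1 * (L * real (card Xs))" using l2(1) Lc by (simp only: mult.assoc) (intro mult_right_mono, auto)
    moreover have "real (card Xs) * (ln 2 + ln 4 + ln l) \<le> real (card Xs) * (3 + 3 * ln l)" using l2 by (intro mult_left_mono) auto
    ultimately have Nb: "Nn \<le> 12 * (real (card Xs) * (1 + ln l + L))"
      using Nb0 Lc by (simp add: algebra_simps)
    have E: "measure_pmf.expectation D (\<lambda>X. \<Sum>t<length \<sigma>.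
        real (card (X (take t \<sigma>) - X (take (Suc t) \<sigma>)) + card (X (take (Suc t) \<sigma>) - X (take t \<sigma>))
          + card (X (take t \<sigma>) \<inter> H (take (Suc t) \<sigma>)))) \<le> (\<Sum>t<n. 2 * fr (P (Suc t)) + 6 * h t)"
    proof -
      have "measure_pmf.expectation D (\<lambda>X. \<Sum>t<length \<sigma>.
        real (card (X (take t \<sigma>) - X (take (Suc t) \<sigma>)) + card (X (take (Suc t) \<sigma>) - X (take t \<sigma>))
          + card (X (take t \<sigma>) \<inter> H (take (Suc t) \<sigma>))))
        = measure_pmf.expectation DD (\<lambda>\<omega>. \<Sum>t<n. real (card (X \<omega> (P t) - X \<omega> (P (Suc t))) + card (X \<omega> (P (Suc t)) - X \<omega> (P t))
          + card (X \<omega> (P t) \<inter> H (P (Suc t)))))"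
        by (simp add: D_def n_def P_def)
      also have "\<dots> \<le> measure_pmf.expectation DD (\<lambda>\<omega>. \<Sum>t<n. 2 * fr (P (Suc t)) + 3 * ind \<omega> (P t) (\<sigma> ! t))"
      proof (rule integral_mono_AE)
        show "AE \<omega> in measure_pmf DD. (\<Sum>t<n. real (card (X \<omega> (P t) - X \<omega> (P (Suc t))) + card (X \<omega> (P (Suc t)) - X \<omega> (P t))
          + card (X \<omega> (P t) \<inter> H (P (Suc t))))) \<le> (\<Sum>t<n. 2 * fr (P (Suc t)) + 3 * ind \<omega> (P t) (\<sigma> ! t))"
        proof (rule AE_pmfI)
          fix \<omega> assume w: "\<omega> \<in> set_pmf DD"
          have fX: "finite (X \<omega> p)" if "p \<in> PP" for p unfolding X_def using finB[OF that] by simp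
          have tel: "card (X \<omega> (P m)) + (\<Sum>t<m. card (X \<omega> (P t) - X \<omega> (P (Suc t)))) = (\<Sum>t<m. card (X \<omega> (P (Suc t)) - X \<omega> (P t)))" for m
          proof (induction m)
            case 0 show ?case by (simp add: P_def X_def B_def F(1))
          next
            case (Suc m)
            have "card (X \<omega> (P m)) = card (X \<omega> (P m) - X \<omega> (P (Suc m))) + card (X \<omega> (P m) \<inter> X \<omega> (P (Suc m)))"
              using card_Int_Diff[OF fX[OF Pt], of m "X \<omega> (P (Suc m))"] by simp
            moreover have "card (X \<omega> (P (Suc m))) = card (X \<omega> (P (Suc m)) - X \<omega> (P m)) + card (X \<omega> (P m) \<inter> X \<omega> (P (Suc m)))"
              using card_Int_Diff[OF fX[OF Pt], of "Suc m" "X \<omega> (P m)"] by (simp add: Int_commute)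
            ultimately show ?case using Suc by simp
          qed
          have "(\<Sum>t<n. real (card (X \<omega> (P t) - X \<omega> (P (Suc t))) + card (X \<omega> (P (Suc t)) - X \<omega> (P t)) + card (X \<omega> (P t) \<inter> H (P (Suc t)))))
            = real (\<Sum>t<n. card (X \<omega> (P t) - X \<omega> (P (Suc t)))) + real (\<Sum>t<n. card (X \<omega> (P (Suc t)) - X \<omega> (P t))) + (\<Sum>t<n. real (card (X \<omega> (P t) \<inter> H (P (Suc t)))))"
            by (simp add: sum.distrib)
          also have "\<dots> \<le> 2 * real (\<Sum>t<n. card (X \<omega> (P (Suc t)) - X \<omega> (P t))) + (\<Sum>t<n. real (card (X \<omega> (P t) \<inter> H (P (Suc t)))))"
            using tel[of n] by linarith
          also have "\<dots> = (\<Sum>t<n. 2 * real (card (X \<omega> (P (Suc t)) - X \<omega> (P t))) + real (card (X \<omega> (P t) \<inter> H (P (Suc t)))))"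
            by (simp add: sum.distrib sum_distrib_left)
          also have "\<dots> \<le> (\<Sum>t<n. 2 * fr (P (Suc t)) + 3 * ind \<omega> (P t) (\<sigma> ! t))"
          proof (rule sum_mono)
            fix t assume "t \<in> {..<n}"
            hence e: "P (Suc t) = P t @ [\<sigma> ! t]" using tk by (simp add: P_def)
            have "card (X \<omega> (P (Suc t)) - X \<omega> (P t)) \<le> fr (P (Suc t)) + ind \<omega> (P t) (\<sigma> ! t)"
              unfolding e by (rule newc[OF w]) (use Pt[of "Suc t"] e in simp)
            moreover have "card (X \<omega> (P t) \<inter> H (P (Suc t))) \<le> ind \<omega> (P t) (\<sigma> ! t)" unfolding e by (rule hitc[OF Pt])
            ultimately show "2 * real (card (X \<omega> (P (Suc t)) - X \<omega> (P t))) + real (card (X \<omega> (P t) \<inter> H (P (Suc t)))) \<le> 2 * fr (P (Suc t)) + 3 * ind \<omega> (P t) (\<sigma> ! t)"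
              by linarith
          qed
          finally show "(\<Sum>t<n. real (card (X \<omega> (P t) - X \<omega> (P (Suc t))) + card (X \<omega> (P (Suc t)) - X \<omega> (P t))
          + card (X \<omega> (P t) \<inter> H (P (Suc t))))) \<le> (\<Sum>t<n. 2 * fr (P (Suc t)) + 3 * ind \<omega> (P t) (\<sigma> ! t))" .
        qed
      qed (rule integrable_measure_pmf_finite[OF finDD])+
      also have "\<dots> = (\<Sum>t<n. 2 * fr (P (Suc t)) + 3 * measure_pmf.expectation DD (\<lambda>\<omega>. ind \<omega> (P t) (\<sigma> ! t)))"
        by (subst Bochner_Integration.integral_sum)
           (auto intro!: integrable_measure_pmf_finite finDD sum.cong simp: Bochner_Integration.integral_add[OF integrable_measure_pmf_finite[OF finDD] integrable_measure_pmf_finite[OF finDD]])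
      also have "\<dots> \<le> (\<Sum>t<n. 2 * fr (P (Suc t)) + 6 * h t)"
      proof (rule sum_mono)
        fix t assume "t \<in> {..<n}"
        hence e: "P (Suc t) = P t @ [\<sigma> ! t]" using tk by (simp add: P_def)
        show "2 * fr (P (Suc t)) + 3 * measure_pmf.expectation DD (\<lambda>\<omega>. ind \<omega> (P t) (\<sigma> ! t)) \<le> 2 * fr (P (Suc t)) + 6 * h t"
          using Eind[OF Pt, of t "\<sigma> ! t"] unfolding h_def yt_def e by simp
      qed
      finally show ?thesis .
    qed
    have frn: "fr p \<ge> 0" for p by (simp add: fr_def)
    have E2: "(\<Sum>t<n. 2 * fr (P (Suc t)) + 6 * h t) \<le> 2 * (\<Sum>t<n. fr (P (Suc t)) + 18 * h t)"
      unfolding sum_distrib_left by (rule sum_mono) (use hn in simp)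
    have Nb': "Nn \<le> 12 * (real (card Xs) * (1 + ln (real (card S)) + L))" using Nb by (simp add: l_def)
    show ?thesis
    proof (cases "Nn \<ge> 1")
      case True
      have "(\<Sum>t<n. fr (P (Suc t)) + 18 * h t) \<le> 31 * Nn + 135 * card T * Nn" using A True by linarith
      also have "\<dots> \<le> 166 * (real (card T) + 1) * Nn" using True by (simp add: algebra_simps)
      also have "\<dots> \<le> 166 * (real (card T) + 1) * (12 * (real (card Xs) * (1 + ln (real (card S)) + L)))"
        by (rule mult_left_mono[OF Nb']) simp
      also have "\<dots> = 1992 * ((real (card T) + 1) * (real (card Xs) * (1 + ln (real (card S)) + L)))"
      proof -
        have "166 * (a + 1) * (12 * w) = 1992 * ((a + 1) * w)" for a w :: real by (simp add: algebra_simps)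
        thus ?thesis .
      qed
      finally have "2 * (\<Sum>t<n. fr (P (Suc t)) + 18 * h t) \<le> 3984 * ((real (card T) + 1) * (real (card Xs) * (1 + ln (real (card S)) + L)))"
        by linarith
      also have "\<dots> \<le> 8000 * ((real (card T) + 1) * (real (card Xs) * (1 + ln (real (card S)) + L)))"
      proof (rule mult_right_mono)
        have "0 \<le> real (card Xs) * (1 + ln (real (card S)) + L)" using Nb' True by linarith
        thus "0 \<le> (real (card T) + 1) * (real (card Xs) * (1 + ln (real (card S)) + L))" by simp
      qed simp
      also have "\<dots> = 8000 * (real (card T) + 1) * real (card Xs) * (1 + ln (real (card S)) + L)"
        by (simp only: mult.assoc)
      finally show ?thesis using E E2 by linarith
    next
      case False
      have Nint: "Nn = real (\<Sum>t<n. nt t)" by (simp add: Nn_def)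
      hence "(\<Sum>t<n. nt t) = 0" using False by linarith
      hence nt0: "nt t = 0" if "t < n" for t using that by simp
      have mass: "sum (yt m) S \<le> 1/4" if "m \<le> n" for m using that
      proof (induction m)
        case 0 show ?case using l by (simp add: y00 sy0 l_def)
      next
        case (Suc m)
        hence m: "m < n" by simp
        show ?case using step_postD(5)[OF stt[OF m]] nt0[OF m] Suc by linarith
      qed
      have Bem: "B (P m) = {}" if "m \<le> n" for m
      proof (rule ccontr)
        assume "B (P m) \<noteq> {}"
        then obtain x where x: "x \<in> B (P m)" by blast
        note mm = balanced_mass[OF S(1) str[OF Pt] Y0[OF Pt] Y2[OF Pt] x]
        show False using mm(1,5) mass[OF that] by (simp add: yt_def)
      qed
      have "measure_pmf.expectation D (\<lambda>X. \<Sum>t<length \<sigma>.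
        real (card (X (take t \<sigma>) - X (take (Suc t) \<sigma>)) + card (X (take (Suc t) \<sigma>) - X (take t \<sigma>))
          + card (X (take t \<sigma>) \<inter> H (take (Suc t) \<sigma>)))) = measure_pmf.expectation DD (\<lambda>_. 0)"
        unfolding D_def integral_map_pmf
      proof (rule Bochner_Integration.integral_cong[OF refl])
        fix \<omega>
        have "X \<omega> (P m) = {}" if "m \<le> n" for m unfolding X_def Bem[OF that] by simp
        thus "(\<Sum>t<length \<sigma>.
        real (card (X \<omega> (take t \<sigma>) - X \<omega> (take (Suc t) \<sigma>)) + card (X \<omega> (take (Suc t) \<sigma>) - X \<omega> (take t \<sigma>))
          + card (X \<omega> (take t \<sigma>) \<inter> H (take (Suc t) \<sigma>)))) = 0"
          by (intro sum.neutral) (simp add: P_def n_def)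
      qed
      moreover have "0 \<le> 8000 * (real (card T) + 1) * real (card Xs) * (1 + ln (real (card S)) + L)"
      proof -
        have "0 \<le> real (card Xs) * (1 + ln l) + L * real (card Xs)" using Lc l2(3) by simp
        hence "0 \<le> real (card Xs) * (1 + ln (real (card S)) + L)" by (simp add: l_def algebra_simps)
        hence "0 \<le> 8000 * (real (card T) + 1) * (real (card Xs) * (1 + ln (real (card S)) + L))" by (rule mult_nonneg_nonneg[rotated]) simp
        thus ?thesis by (simp only: mult.assoc)
      qed
      ultimately show ?thesis by simp
    qed
  qed
  show ?thesis
  proof (intro exI[of _ D] conjI)
    show "finite (set_pmf D)" by (rule finD)
    show "\<forall>X\<in>set_pmf D. X [] = {} \<and> (\<forall>p\<in>PP. X p \<subseteq> S \<and> (p \<noteq> [] \<longrightarrow> good p (X p)))"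
      unfolding D_def set_map_pmf using valid by blast
  qed (intro ballI allI impI, rule main, assumption+)
qed

section \<open>Packings with bounded repacking\<close>

lemma dickson:
  fixes P :: "('a \<Rightarrow> nat) \<Rightarrow> bool"
  assumes "finite I"
  shows "\<exists>M. finite M \<and> (\<forall>m\<in>M. P m) \<and> (\<forall>x. P x \<longrightarrow> (\<exists>m\<in>M. \<forall>i\<in>I. m i \<le> x i))"
  using assms
proof (induction I arbitrary: P rule: finite_psubset_induct)
  case (psubset I)
  show ?case
  proof (cases "\<exists>x0. P x0")
    case False
    thus ?thesis by (intro exI[of _ "{}"]) simp
  next
    case True
    then obtain x0 where x0: "P x0" by (elim exE)
    have "\<forall>iv\<in>(SIGMA i:I. {..<x0 i}). \<exists>M. finite M \<and> (\<forall>m\<in>M. P m \<and> m (fst iv) = snd iv) \<and>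
        (\<forall>x. P x \<and> x (fst iv) = snd iv \<longrightarrow> (\<exists>m\<in>M. \<forall>i\<in>I - {fst iv}. m i \<le> x i))"
      (is "\<forall>iv\<in>_. \<exists>M. ?Q iv M")
    proof
      fix iv assume "iv \<in> (SIGMA i:I. {..<x0 i})"
      hence "fst iv \<in> I" by (rule SigmaE) simp
      hence "I - {fst iv} \<subset> I" by blast
      from psubset.IH[OF this, of "\<lambda>x. P x \<and> x (fst iv) = snd iv"]
      show "\<exists>M. ?Q iv M" .
    qed
    from bchoice[OF this] obtain M where M: "\<forall>iv\<in>(SIGMA i:I. {..<x0 i}). ?Q iv (M iv)" by (elim exE)
    define N where "N = insert x0 (\<Union>iv\<in>(SIGMA i:I. {..<x0 i}). M iv)"
    have "finite (SIGMA i:I. {..<x0 i})" using psubset.hyps(1) by (intro finite_SigmaI) auto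
    hence 1: "finite N" using M unfolding N_def by blast
    have 2: "\<forall>m\<in>N. P m" using M x0 unfolding N_def by blast
    have 3: "\<exists>m\<in>N. \<forall>i\<in>I. m i \<le> x i" if x: "P x" for x
    proof (cases "\<forall>i\<in>I. x0 i \<le> x i")
      case True thus ?thesis unfolding N_def by blast
    next
      case False
      then obtain i where i: "i \<in> I" "x i < x0 i" by (auto simp: not_le)
      hence iv: "(i, x i) \<in> (SIGMA i:I. {..<x0 i})" by simp
      from bspec[OF M iv] x obtain m where m: "m \<in> M (i, x i)" "m i = x i" "\<forall>j\<in>I - {i}. m j \<le> x j"
        by (metis fst_conv snd_conv)
      have "m \<in> N" unfolding N_def using iv m(1) by blast
      moreover have "\<forall>j\<in>I. m j \<le> x j" using m(2,3) by (metis DiffI empty_iff insert_iff le_refl)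
      ultimately show ?thesis by blast
    qed
    show ?thesis using 1 2 3 by blast
  qed
qed

definition items :: "('r \<Rightarrow> nat) set \<Rightarrow> (('r \<Rightarrow> nat) \<Rightarrow> nat) \<Rightarrow> 'r \<Rightarrow> nat" where
  "items Cf P r = (\<Sum>c\<in>Cf. P c * c r)"

definition packable :: "('r \<Rightarrow> nat) set \<Rightarrow> ('r \<Rightarrow> nat) \<Rightarrow> nat \<Rightarrow> bool" where
  "packable Cf n b \<longleftrightarrow> (\<exists>P. items Cf P = n \<and> sum P Cf = b)"

text \<open>
  The pairs \<open>(P, P')\<close> with the given difference have finitely many minimal elements by Dickson's
  lemma; a minimal pair below \<open>(P, P')\<close> contains all that has to be changed.
\<close>

lemma repacking_fixed_difference:
  fixes d :: "'r \<Rightarrow> int" and e :: int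
  assumes "finite Cf"
  shows "\<exists>K. \<forall>P P'. (\<forall>r. int (items Cf P' r) - int (items Cf P r) = d r) \<longrightarrow>
      int (sum P' Cf) - int (sum P Cf) = e \<longrightarrow>
      (\<exists>P''. items Cf P'' = items Cf P' \<and> sum P'' Cf = sum P' Cf \<and> (\<Sum>c\<in>Cf. P c - P'' c) \<le> K)"
proof -
  define Q where "Q x \<longleftrightarrow> (\<forall>r. int (items Cf (\<lambda>c. x (c, False)) r) - int (items Cf (\<lambda>c. x (c, True)) r) = d r)
     \<and> int (\<Sum>c\<in>Cf. x (c, False)) - int (\<Sum>c\<in>Cf. x (c, True)) = e" for x :: "('r \<Rightarrow> nat) \<times> bool \<Rightarrow> nat"
  obtain M where M: "finite M" "\<And>m. m \<in> M \<Longrightarrow> Q m" "\<And>x. Q x \<Longrightarrow> \<exists>m\<in>M. \<forall>i\<in>Cf \<times> UNIV. m i \<le> x i"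
    using dickson[of "Cf \<times> (UNIV :: bool set)" Q] assms by (metis finite_cartesian_product finite_code)
  define K where "K = (\<Sum>m\<in>M. \<Sum>c\<in>Cf. m (c, True))"
  show ?thesis
  proof (intro exI[of _ K] allI impI)
    fix P P' assume h: "\<forall>r. int (items Cf P' r) - int (items Cf P r) = d r" "int (sum P' Cf) - int (sum P Cf) = e"
    define x where "x i = (if snd i then P (fst i) else P' (fst i))" for i
    have "Q x" using h by (simp add: Q_def x_def)
    from M(3)[OF this] obtain m where m: "m \<in> M" "\<forall>i\<in>Cf \<times> UNIV. m i \<le> x i" by (elim bexE)
    have mP: "m (c, True) \<le> P c" "m (c, False) \<le> P' c" if "c \<in> Cf" for c
      using bspec[OF m(2), of "(c, True)"] bspec[OF m(2), of "(c, False)"] that by (simp_all add: x_def)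
    define P'' where "P'' c = P c - m (c, True) + m (c, False)" for c
    have P'': "int (P'' c) = int (P c) - int (m (c, True)) + int (m (c, False))" if "c \<in> Cf" for c
      using mP[OF that] by (simp add: P''_def)
    have Qm: "int (items Cf (\<lambda>c. m (c, False)) r) - int (items Cf (\<lambda>c. m (c, True)) r) = d r"
       "int (\<Sum>c\<in>Cf. m (c, False)) - int (\<Sum>c\<in>Cf. m (c, True)) = e" for r
      using M(2)[OF m(1)] unfolding Q_def by blast+
    have "int (items Cf P'' r) = int (items Cf P' r)" for r
    proof -
      have "int (items Cf P'' r) = (\<Sum>c\<in>Cf. int (P'' c) * int (c r))" by (simp add: items_def)
      also have "\<dots> = (\<Sum>c\<in>Cf. (int (P c) - int (m (c, True)) + int (m (c, False))) * int (c r))"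
        by (intro sum.cong) (simp_all add: P'')
      also have "\<dots> = int (items Cf P r) - int (items Cf (\<lambda>c. m (c, True)) r) + int (items Cf (\<lambda>c. m (c, False)) r)"
        by (simp add: items_def algebra_simps sum.distrib sum_subtractf)
      also have "\<dots> = int (items Cf P r) + d r" using Qm(1)[of r] by linarith
      finally show ?thesis using h(1) by (metis add.commute diff_add_cancel)
    qed
    hence i: "items Cf P'' = items Cf P'" by (intro ext) (metis of_nat_eq_iff)
    have "int (sum P'' Cf) = (\<Sum>c\<in>Cf. int (P c) - int (m (c, True)) + int (m (c, False)))"
      unfolding of_nat_sum by (intro sum.cong) (simp_all add: P'')
    also have "\<dots> = int (sum P Cf) - int (\<Sum>c\<in>Cf. m (c, True)) + int (\<Sum>c\<in>Cf. m (c, False))"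
      by (simp add: sum.distrib sum_subtractf)
    also have "\<dots> = int (sum P' Cf)" using Qm(2) h(2) by linarith
    finally have s: "sum P'' Cf = sum P' Cf" by (metis of_nat_eq_iff)
    have "(\<Sum>c\<in>Cf. P c - P'' c) \<le> (\<Sum>c\<in>Cf. m (c, True))"
      by (intro sum_mono) (simp add: P''_def)
    also have "\<dots> \<le> K" unfolding K_def using M(1) m(1)
      by (intro member_le_sum[of m M "\<lambda>m. \<Sum>c\<in>Cf. m (c, True)"]) auto
    finally show "\<exists>P''. items Cf P'' = items Cf P' \<and> sum P'' Cf = sum P' Cf \<and> (\<Sum>c\<in>Cf. P c - P'' c) \<le> K"
      using i s by blast
  qed
qed

lemma repacking:
  assumes fin: "finite Cf" and Rs: "finite Rs" "\<And>c r. c \<in> Cf \<Longrightarrow> r \<notin> Rs \<Longrightarrow> c r = 0"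
  shows "\<exists>K. \<forall>P n b. packable Cf n b \<longrightarrow>
      (\<forall>r\<in>Rs. \<bar>int (n r) - int (items Cf P r)\<bar> \<le> D) \<longrightarrow> \<bar>int b - int (sum P Cf)\<bar> \<le> D \<longrightarrow>
      (\<exists>P''. items Cf P'' = n \<and> sum P'' Cf = b \<and> (\<Sum>c\<in>Cf. P c - P'' c) \<le> K)"
proof -
  define Ds where "Ds = (PiE_dflt Rs 0 (\<lambda>_. {-D..D})) \<times> {-D..D}"
  have Ds: "finite Ds" unfolding Ds_def using Rs(1) by (intro finite_cartesian_product finite_PiE_dflt) auto
  define K0 where "K0 de = (SOME K. \<forall>P P'. (\<forall>r. int (items Cf P' r) - int (items Cf P r) = fst de r) \<longrightarrow>
      int (sum P' Cf) - int (sum P Cf) = snd de \<longrightarrow>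
      (\<exists>P''. items Cf P'' = items Cf P' \<and> sum P'' Cf = sum P' Cf \<and> (\<Sum>c\<in>Cf. P c - P'' c) \<le> K))" for de
  have K0: "\<exists>P''. items Cf P'' = items Cf P' \<and> sum P'' Cf = sum P' Cf \<and> (\<Sum>c\<in>Cf. P c - P'' c) \<le> K0 de"
    if "\<forall>r. int (items Cf P' r) - int (items Cf P r) = fst de r" "int (sum P' Cf) - int (sum P Cf) = snd de" for P P' de
    using someI_ex[OF repacking_fixed_difference[OF fin, of "fst de" "snd de"]] that unfolding K0_def by simp
  have z: "items Cf P r = 0" if "r \<notin> Rs" for P r
    unfolding items_def using Rs(2)[OF _ that] by (intro sum.neutral) simp
  show ?thesis
  proof (intro exI[of _ "\<Sum>de\<in>Ds. K0 de"] allI impI)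
    fix P n b assume h: "packable Cf n b" "\<forall>r\<in>Rs. \<bar>int (n r) - int (items Cf P r)\<bar> \<le> D" "\<bar>int b - int (sum P Cf)\<bar> \<le> D"
    obtain P' where P': "items Cf P' = n" "sum P' Cf = b" using h(1) unfolding packable_def by (elim exE conjE)
    define de where "de = (\<lambda>r. int (items Cf P' r) - int (items Cf P r), int (sum P' Cf) - int (sum P Cf))"
    have "de \<in> Ds" unfolding Ds_def de_def using h(2,3) P' z by (auto simp: PiE_dflt_def abs_le_iff)
    hence "K0 de \<le> (\<Sum>de\<in>Ds. K0 de)" using Ds by (intro member_le_sum) auto
    moreover from K0[of P' P de] obtain P'' where "items Cf P'' = items Cf P'" "sum P'' Cf = sum P' Cf" "(\<Sum>c\<in>Cf. P c - P'' c) \<le> K0 de"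
      unfolding de_def fst_conv snd_conv by blast
    ultimately show "\<exists>P''. items Cf P'' = n \<and> sum P'' Cf = b \<and> (\<Sum>c\<in>Cf. P c - P'' c) \<le> (\<Sum>de\<in>Ds. K0 de)"
      using P' by (metis order_trans)
  qed
qed

lemma sum_card_fibres:
  assumes "finite A" "finite X" "h ` A \<subseteq> X"
  shows "(\<Sum>s\<in>X. card {a \<in> A. h a = s}) = card A"
proof -
  have "(\<Sum>s\<in>X. \<Sum>a\<in>{a \<in> A. h a = s}. 1) = (\<Sum>a\<in>A. 1::nat)" by (rule sum.group[OF assms])
  thus ?thesis by simp
qed

lemma map_with_fibre_sizes:
  assumes "finite I" "finite R" "(\<Sum>i\<in>I. d i) = card R"
  shows "\<exists>m. m ` R \<subseteq> I \<and> (\<forall>i\<in>I. card {x \<in> R. m x = i} = d i)"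
  using assms
proof (induction I arbitrary: R rule: finite_induct)
  case empty
  hence "R = {}" by simp
  thus ?case by simp
next
  case (insert i I)
  have "d i \<le> card R" using insert by simp
  then obtain R1 where R1: "R1 \<subseteq> R" "card R1 = d i" by (rule obtain_subset_with_card_n)
  have f: "finite R1" "finite (R - R1)" using R1 insert finite_subset by auto
  have "(\<Sum>i\<in>I. d i) = card (R - R1)" using insert R1 f by (simp add: card_Diff_subset)
  from insert.IH[OF f(2) this] obtain m where m: "m ` (R - R1) \<subseteq> I" "\<forall>j\<in>I. card {x \<in> R - R1. m x = j} = d j" by blast
  define m' where "m' x = (if x \<in> R1 then i else m x)" for x
  have "{x \<in> R. m' x = i} = R1" using m(1) insert(2) R1(1) by (auto simp: m'_def split: if_splits)
  hence 1: "card {x \<in> R. m' x = i} = d i" using R1 by simp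
  have 2: "card {x \<in> R. m' x = j} = d j" if j: "j \<in> I" for j
  proof -
    have "{x \<in> R. m' x = j} = {x \<in> R - R1. m x = j}" using j insert(2) by (auto simp: m'_def)
    thus ?thesis using m(2) j by simp
  qed
  have "m' ` R \<subseteq> insert i I" using m(1) by (auto simp: m'_def)
  thus ?case using 1 2 by (intro exI[of _ m']) auto
qed

lemma labelling_with_counts:
  assumes fin: "finite U" "finite Cf" and c: "\<And>s. s \<in> U \<Longrightarrow> c s \<in> Cf" and X: "X \<subseteq> U" and P: "sum P Cf = card X"
  shows "\<exists>c'. (\<forall>s\<in>X. c' s \<in> Cf) \<and> (\<forall>d\<in>Cf. card {s \<in> X. c' s = d} = P d) \<and>
     card {s \<in> X. c' s \<noteq> c s} \<le> (\<Sum>d\<in>Cf. card {s \<in> U. c s = d} - P d)"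
proof -
  have fX: "finite X" using X fin(1) finite_subset by blast
  have "\<forall>d\<in>Cf. \<exists>Z. Z \<subseteq> {s \<in> X. c s = d} \<and> card Z = min (P d) (card {s \<in> X. c s = d})"
    by (meson min.cobounded2 obtain_subset_with_card_n)
  from bchoice[OF this] obtain Z where Z: "\<And>d. d \<in> Cf \<Longrightarrow> Z d \<subseteq> {s \<in> X. c s = d}"
     "\<And>d. d \<in> Cf \<Longrightarrow> card (Z d) = min (P d) (card {s \<in> X. c s = d})" by blast
  define Y where "Y = (\<Union>d\<in>Cf. Z d)"
  have YX: "Y \<subseteq> X" using Z(1) by (fastforce simp: Y_def)
  have fY: "finite Y" using YX fX finite_subset by blast
  have cls: "{s \<in> Y. c s = d} = Z d" if "d \<in> Cf" for d using Z(1) that by (fastforce simp: Y_def)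
  have cY: "(\<Sum>d\<in>Cf. card (Z d)) = card Y"
  proof -
    have "(\<Sum>d\<in>Cf. card {s \<in> Y. c s = d}) = card Y"
      using fY fin(2) by (rule sum_card_fibres) (use c YX X in auto)
    thus ?thesis using cls by (simp cong: sum.cong)
  qed
  have cX: "(\<Sum>d\<in>Cf. card {s \<in> X. c s = d}) = card X"
    using fX fin(2) by (rule sum_card_fibres) (use c X in auto)
  have "(\<Sum>d\<in>Cf. P d - card (Z d)) = sum P Cf - (\<Sum>d\<in>Cf. card (Z d))"
    by (rule sum_subtractf_nat) (simp add: Z(2))
  also have "\<dots> = card (X - Y)" using P cY YX fY by (simp add: card_Diff_subset)
  finally obtain m where m: "m ` (X - Y) \<subseteq> Cf" "\<forall>d\<in>Cf. card {x \<in> X - Y. m x = d} = P d - card (Z d)"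
    using map_with_fibre_sizes[OF fin(2), of "X - Y" "\<lambda>d. P d - card (Z d)"] fX by auto
  define c' where "c' s = (if s \<in> Y then c s else m s)" for s
  have 1: "c' s \<in> Cf" if "s \<in> X" for s using that m(1) c X by (auto simp: c'_def)
  have 2: "card {s \<in> X. c' s = d} = P d" if d: "d \<in> Cf" for d
  proof -
    have "{s \<in> X. c' s = d} = {s \<in> Y. c s = d} \<union> {x \<in> X - Y. m x = d}" using YX by (auto simp: c'_def)
    hence "card {s \<in> X. c' s = d} = card ({s \<in> Y. c s = d} \<union> {x \<in> X - Y. m x = d})" by simp
    also have "\<dots> = card {s \<in> Y. c s = d} + card {x \<in> X - Y. m x = d}"
      using fX fY by (intro card_Un_disjoint) auto
    also have "\<dots> = card (Z d) + (P d - card (Z d))" using cls[OF d] m(2) d by simp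
    finally show ?thesis using Z(2)[OF d] by simp
  qed
  have "card {s \<in> X. c' s \<noteq> c s} \<le> card (X - Y)" using fX by (intro card_mono) (auto simp: c'_def)
  also have "\<dots> = card X - card Y" using YX fY by (simp add: card_Diff_subset)
  also have "\<dots> = (\<Sum>d\<in>Cf. card {s \<in> X. c s = d} - card (Z d))"
    unfolding cX[symmetric] cY[symmetric] by (rule sum_subtractf_nat[symmetric]) (simp add: Z(2))
  also have "\<dots> \<le> (\<Sum>d\<in>Cf. card {s \<in> U. c s = d} - P d)"
  proof (rule sum_mono)
    fix d assume d: "d \<in> Cf"
    have "card {s \<in> X. c s = d} \<le> card {s \<in> U. c s = d}" using fin(1) X by (intro card_mono) auto
    thus "card {s \<in> X. c s = d} - card (Z d) \<le> card {s \<in> U. c s = d} - P d" unfolding Z(2)[OF d] by linarith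
  qed
  finally show ?thesis using 1 2 by (intro exI[of _ c']) auto
qed

lemma items_with_labels:
  fixes rk :: "'a \<Rightarrow> 'r" and h :: "'a \<Rightarrow> 's" and c' :: "'s \<Rightarrow> 'r \<Rightarrow> nat"
  defines "c \<equiv> \<lambda>I h s r. card {K \<in> I. h K = s \<and> rk K = r}"
  assumes fin: "finite I" "finite I'" "finite X" "finite Rs" and rk: "rk ` I \<subseteq> Rs" "rk ` I' \<subseteq> Rs"
    and tot: "\<And>r. (\<Sum>s\<in>X. c' s r) = card {K \<in> I'. rk K = r}"
    and M: "\<And>s. s \<in> X \<Longrightarrow> (\<Sum>r\<in>Rs. c' s r) \<le> M"
  shows "\<exists>h'. (\<forall>K\<in>I'. h' K \<in> X) \<and> (\<forall>s\<in>X. c I' h' s = c' s) \<and>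
     card {K \<in> I'. K \<notin> I \<or> h' K \<noteq> h K} \<le> M * card {s \<in> X. c' s \<noteq> c I h s} + card (I - I')"
proof -
  define Stay where "Stay = {s \<in> X. c' s = c I h s}"
  define kept where "kept = {K \<in> I \<inter> I'. h K \<in> Stay}"
  have fk: "finite kept" using fin by (simp add: kept_def)
  have fStay: "finite Stay" using fin by (simp add: Stay_def)
  have kX: "h ` kept \<subseteq> X" and kI: "kept \<subseteq> I'" by (auto simp: kept_def Stay_def)
  have le: "card {K \<in> kept. h K = s \<and> rk K = r} \<le> c' s r" if s: "s \<in> X" for s r
  proof (cases "s \<in> Stay")
    case True
    have "card {K \<in> kept. h K = s \<and> rk K = r} \<le> c I h s r"
      unfolding c_def using fin(1) by (intro card_mono) (auto simp: kept_def)
    moreover have "c' s = c I h s" using True unfolding Stay_def by blast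
    ultimately show ?thesis by simp
  next
    case False
    have "{K \<in> kept. h K = s \<and> rk K = r} = {}" using False by (auto simp: kept_def)
    thus ?thesis by (simp only: card.empty)
  qed
  define R where "R r = {K \<in> I' - kept. rk K = r}" for r
  have fR: "finite (R r)" for r using fin by (simp add: R_def)
  have "\<exists>m. m ` R r \<subseteq> X \<and> (\<forall>s\<in>X. card {K \<in> R r. m K = s} = c' s r - card {K \<in> kept. h K = s \<and> rk K = r})" for r
  proof (rule map_with_fibre_sizes[OF fin(3) fR])
    have "(\<Sum>s\<in>X. c' s r - card {K \<in> kept. h K = s \<and> rk K = r}) = (\<Sum>s\<in>X. c' s r) - (\<Sum>s\<in>X. card {K \<in> kept. h K = s \<and> rk K = r})"
      using le by (rule sum_subtractf_nat)
    also have "(\<Sum>s\<in>X. card {K \<in> kept. h K = s \<and> rk K = r}) = (\<Sum>s\<in>X. card {K \<in> {K \<in> kept. rk K = r}. h K = s})"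
      by (intro sum.cong arg_cong[of _ _ card]) auto
    also have "\<dots> = card {K \<in> kept. rk K = r}" by (rule sum_card_fibres) (use fk fin(3) kX in auto)
    also have "(\<Sum>s\<in>X. c' s r) = card {K \<in> I'. rk K = r}" by (rule tot)
    also have "card {K \<in> I'. rk K = r} - card {K \<in> kept. rk K = r} = card ({K \<in> I'. rk K = r} - {K \<in> kept. rk K = r})"
      by (rule card_Diff_subset[symmetric]) (use fk kI in auto)
    also have "{K \<in> I'. rk K = r} - {K \<in> kept. rk K = r} = R r" by (auto simp: R_def)
    finally show "(\<Sum>s\<in>X. c' s r - card {K \<in> kept. h K = s \<and> rk K = r}) = card (R r)" .
  qed
  hence "\<forall>r. \<exists>m. m ` R r \<subseteq> X \<and> (\<forall>s\<in>X. card {K \<in> R r. m K = s} = c' s r - card {K \<in> kept. h K = s \<and> rk K = r})" by blast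
  from choice[OF this] obtain m where m': "\<forall>r. m r ` R r \<subseteq> X \<and> (\<forall>s\<in>X. card {K \<in> R r. m r K = s} = c' s r - card {K \<in> kept. h K = s \<and> rk K = r})" by (elim exE)
  have m: "m r ` R r \<subseteq> X" "s \<in> X \<Longrightarrow> card {K \<in> R r. m r K = s} = c' s r - card {K \<in> kept. h K = s \<and> rk K = r}" for r s
    by (rule conjunct1[OF spec[OF m']], rule bspec[OF conjunct2[OF spec[OF m']]])
  define h' where "h' K = (if K \<in> kept then h K else m (rk K) K)" for K
  have 1: "h' K \<in> X" if K: "K \<in> I'" for K
  proof (cases "K \<in> kept")
    case True thus ?thesis by (simp add: h'_def kept_def Stay_def)
  next
    case False
    hence "K \<in> R (rk K)" using K by (simp add: R_def)
    thus ?thesis using m(1) False by (auto simp: h'_def)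
  qed
  have 2: "c I' h' s = c' s" if s: "s \<in> X" for s
  proof
    fix r
    have "{K \<in> I'. h' K = s \<and> rk K = r} = {K \<in> kept. h K = s \<and> rk K = r} \<union> {K \<in> R r. m r K = s}"
      by (auto simp: h'_def R_def kept_def)
    hence "c I' h' s r = card ({K \<in> kept. h K = s \<and> rk K = r} \<union> {K \<in> R r. m r K = s})" by (simp add: c_def)
    also have "\<dots> = card {K \<in> kept. h K = s \<and> rk K = r} + card {K \<in> R r. m r K = s}"
    proof (rule card_Un_disjoint)
      have "R r \<inter> kept = {}" by (auto simp: R_def)
      thus "{K \<in> kept. h K = s \<and> rk K = r} \<inter> {K \<in> R r. m r K = s} = {}" by blast
    qed (use fk fR[of r] in auto)
    also have "\<dots> = c' s r" using m(2)[OF s] le[OF s] by simp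
    finally show "c I' h' s r = c' s r" .
  qed
  have cI: "card I' = (\<Sum>s\<in>X. \<Sum>r\<in>Rs. c' s r)"
  proof -
    have "card I' = (\<Sum>r\<in>Rs. card {K \<in> I'. rk K = r})" by (rule sum_card_fibres[OF fin(2,4) rk(2), symmetric])
    also have "\<dots> = (\<Sum>r\<in>Rs. \<Sum>s\<in>X. c' s r)" by (simp only: tot)
    finally show ?thesis by (simp only: sum.swap[of _ Rs])
  qed
  have "(\<Sum>s\<in>Stay. \<Sum>r\<in>Rs. c' s r) = (\<Sum>s\<in>Stay. card {K \<in> {K \<in> I. h K \<in> Stay}. h K = s})"
  proof (rule sum.cong[OF refl])
    fix s assume s: "s \<in> Stay"
    have "(\<Sum>r\<in>Rs. c' s r) = (\<Sum>r\<in>Rs. card {K \<in> {K \<in> I. h K = s}. rk K = r})"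
      using s by (intro sum.cong) (auto simp: Stay_def c_def conj_assoc)
    also have "\<dots> = card {K \<in> I. h K = s}" using fin(1,4) rk(1) by (intro sum_card_fibres) auto
    also have "{K \<in> I. h K = s} = {K \<in> {K \<in> I. h K \<in> Stay}. h K = s}" using s by auto
    finally show "(\<Sum>r\<in>Rs. c' s r) = card {K \<in> {K \<in> I. h K \<in> Stay}. h K = s}" .
  qed
  also have "\<dots> = card {K \<in> I. h K \<in> Stay}" using fin(1) fStay by (intro sum_card_fibres) auto
  also have "\<dots> \<le> card (kept \<union> (I - I'))" using fin(1) fk by (intro card_mono) (auto simp: kept_def)
  also have "\<dots> \<le> card kept + card (I - I')" by (rule card_Un_le)
  finally have u: "(\<Sum>s\<in>Stay. \<Sum>r\<in>Rs. c' s r) \<le> card kept + card (I - I')" .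
  have "(\<Sum>s\<in>X - Stay. \<Sum>r\<in>Rs. c' s r) \<le> (\<Sum>s\<in>X - Stay. M)" by (rule sum_mono) (use M in auto)
  moreover have "X - Stay = {s \<in> X. c' s \<noteq> c I h s}" by (auto simp: Stay_def)
  ultimately have v: "(\<Sum>s\<in>X - Stay. \<Sum>r\<in>Rs. c' s r) \<le> M * card {s \<in> X. c' s \<noteq> c I h s}" by (simp add: mult.commute)
  have "(\<Sum>s\<in>X. \<Sum>r\<in>Rs. c' s r) = (\<Sum>s\<in>X - Stay. \<Sum>r\<in>Rs. c' s r) + (\<Sum>s\<in>Stay. \<Sum>r\<in>Rs. c' s r)"
    by (rule sum.subset_diff) (use fin in \<open>auto simp: Stay_def\<close>)
  hence w: "card I' \<le> M * card {s \<in> X. c' s \<noteq> c I h s} + (card kept + card (I - I'))" using u v cI by linarith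
  have "card {K \<in> I'. K \<notin> I \<or> h' K \<noteq> h K} \<le> card (I' - kept)"
    using fin(2) by (intro card_mono) (auto simp: h'_def kept_def)
  also have "\<dots> = card I' - card kept" using fk by (intro card_Diff_subset) (auto simp: kept_def)
  finally have 3: "card {K \<in> I'. K \<notin> I \<or> h' K \<noteq> h K} \<le> M * card {s \<in> X. c' s \<noteq> c I h s} + card (I - I')"
    using w by linarith
  show ?thesis by (intro exI[of _ h'] conjI ballI 1 2 3)
qed

definition load :: "('a \<Rightarrow> real) \<Rightarrow> 'a set \<Rightarrow> ('a \<Rightarrow> nat) \<Rightarrow> nat \<Rightarrow> real" where
  "load w S f s = (\<Sum>K\<in>{K \<in> S. f K = s}. w K)"

definition overload :: "('a \<Rightarrow> real) \<Rightarrow> 'a set \<Rightarrow> nat \<Rightarrow> real \<Rightarrow> ('a \<Rightarrow> nat) \<Rightarrow> real" where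
  "overload w S l a f = (\<Sum>s<l. max 0 (load w S f s - a))"

definition relocated :: "('a \<Rightarrow> real) \<Rightarrow> 'a set \<Rightarrow> ('a \<Rightarrow> nat) \<Rightarrow> ('a \<Rightarrow> nat) \<Rightarrow> real" where
  "relocated w S f f' = (\<Sum>K\<in>S. if f K \<noteq> f' K then w K else 0)"

lemma load_total: "finite S \<Longrightarrow> \<forall>K\<in>S. f K < l \<Longrightarrow> (\<Sum>s<l. load w S f s) = sum w S"
  unfolding load_def by (intro sum.group) auto

lemma greedy_placement:
  fixes w :: "'a \<Rightarrow> real"
  assumes "finite Ev" "finite D" "D \<inter> Ev = {}" "\<forall>K\<in>D. f K < l" "\<forall>K\<in>Ev. w K \<le> a - b" "\<forall>K\<in>Ev. 0 \<le> w K"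
    and "sum w (D \<union> Ev) \<le> real l * b" "l \<ge> 1"
  shows "\<exists>f'. (\<forall>K. K \<notin> Ev \<longrightarrow> f' K = f K) \<and> (\<forall>K\<in>Ev. f' K < l) \<and> (\<forall>s<l. load w (D \<union> Ev) f' s \<le> max a (load w D f s))"
  using assms
proof (induction Ev rule: finite_induct)
  case empty thus ?case by (intro exI[of _ f]) simp
next
  case (insert K Ev)
  have s0: "sum w (D \<union> insert K Ev) = w K + sum w (D \<union> Ev)" using insert.hyps insert.prems by simp
  have "sum w (D \<union> Ev) \<le> real l * b" using s0 insert.prems by simp
  then obtain f' where f': "\<forall>K. K \<notin> Ev \<longrightarrow> f' K = f K" "\<forall>K\<in>Ev. f' K < l" "\<forall>s<l. load w (D \<union> Ev) f' s \<le> max a (load w D f s)"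
    using insert.IH insert.prems by auto
  have fS: "finite (D \<union> Ev)" using insert by simp
  have "\<exists>s<l. load w (D \<union> Ev) f' s \<le> b"
  proof (rule ccontr)
    assume "\<not> ?thesis"
    hence "(\<Sum>s<l. b) < (\<Sum>s<l. load w (D \<union> Ev) f' s)" using insert.prems(7) by (intro sum_strict_mono) (auto simp: not_le lessThan_empty_iff)
    also have "\<dots> = sum w (D \<union> Ev)" by (rule load_total[OF fS]) (use f'(1,2) insert.prems(3) in \<open>metis Un_iff\<close>)
    also have "\<dots> \<le> real l * b" by (rule \<open>sum w (D \<union> Ev) \<le> real l * b\<close>)
    finally show False by simp
  qed
  then obtain s where s: "s < l" "load w (D \<union> Ev) f' s \<le> b" by blast
  have KD: "K \<notin> D \<union> Ev" using insert by auto
  have ld: "load w (D \<union> insert K Ev) (f'(K := s)) s' = load w (D \<union> Ev) f' s' + (if s' = s then w K else 0)" for s'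
  proof -
    have "{J \<in> D \<union> insert K Ev. (f'(K := s)) J = s'} = (if s' = s then insert K {J \<in> D \<union> Ev. f' J = s'} else {J \<in> D \<union> Ev. f' J = s'})"
      using KD by auto
    thus ?thesis unfolding load_def using KD fS by simp
  qed
  have "load w (D \<union> insert K Ev) (f'(K := s)) s' \<le> max a (load w D f s')" if "s' < l" for s'
    using f'(3) that s(2) insert.prems(4) unfolding ld by (cases "s' = s") auto
  moreover have "(f'(K := s)) J = f J" if "J \<notin> insert K Ev" for J using that f'(1) by auto
  moreover have "(f'(K := s)) J < l" if "J \<in> insert K Ev" for J using that f'(2) s(1) by auto
  ultimately show ?case by (intro exI[of _ "f'(K := s)"]) blast
qed

lemma rebalance:
  fixes w :: "'a \<Rightarrow> real" and \<epsilon> b :: real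
  defines "a \<equiv> (1 + \<epsilon> / 2) * b"
  assumes fin: "finite S" and w: "\<forall>K\<in>S. 0 \<le> w K" and f: "\<forall>K\<in>S. f K < l" and Sm: "Sm \<subseteq> S" "\<forall>K\<in>Sm. w K \<le> \<epsilon> / 2 * b"
    and base: "\<forall>s<l. load w (S - Sm) f s \<le> a" and tot: "sum w S \<le> real l * b" and l: "l \<ge> 1" and eps: "0 < \<epsilon>" "\<epsilon> < 1 / 4" and b: "0 < b"
  shows "\<exists>f'. (\<forall>K. K \<notin> Sm \<longrightarrow> f' K = f K) \<and> (\<forall>K\<in>S. f' K < l) \<and> (\<forall>s<l. load w S f' s \<le> (1 + \<epsilon>) * b) \<and>
     relocated w S f f' \<le> 4 / \<epsilon> * (overload w S l a f - overload w S l a f')"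
proof -
  define Ev where "Ev = {K \<in> Sm. (1 + \<epsilon>) * b < load w S f (f K)}"
  define D where "D = S - Ev"
  have ES: "Ev \<subseteq> S" using Sm(1) by (auto simp: Ev_def)
  have fE: "finite Ev" "finite D" "D \<inter> Ev = {}" "D \<union> Ev = S"
    using finite_subset[OF ES fin] fin ES by (auto simp: D_def)
  have ab: "a - b = \<epsilon> / 2 * b" by (simp add: a_def algebra_simps)
  have aleb: "a \<le> (1 + \<epsilon>) * b" unfolding a_def using eps b by (intro mult_right_mono) auto
  have "\<exists>f'. (\<forall>K. K \<notin> Ev \<longrightarrow> f' K = f K) \<and> (\<forall>K\<in>Ev. f' K < l) \<and> (\<forall>s<l. load w (D \<union> Ev) f' s \<le> max a (load w D f s))"
    by (rule greedy_placement[OF fE(1,2,3), where b = b]) (use f w Sm tot l fE(4) ab in \<open>auto simp: D_def Ev_def\<close>)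
  then obtain f' where f': "\<forall>K. K \<notin> Ev \<longrightarrow> f' K = f K" "\<forall>K\<in>Ev. f' K < l" "\<forall>s<l. load w S f' s \<le> max a (load w D f s)"
    unfolding fE(4) by blast
  have hi: "load w D f s \<le> a" if s: "s < l" "(1 + \<epsilon>) * b < load w S f s" for s
  proof -
    have "{K \<in> D. f K = s} = {K \<in> S - Sm. f K = s}" using s(2) Sm(1) by (auto simp: D_def Ev_def)
    thus ?thesis using base s(1) by (simp add: load_def)
  qed
  have lo: "load w D f s = load w S f s" if s: "\<not> (1 + \<epsilon>) * b < load w S f s" for s
  proof -
    have "{K \<in> D. f K = s} = {K \<in> S. f K = s}" using s by (auto simp: D_def Ev_def)
    thus ?thesis by (simp add: load_def)
  qed
  have ld: "load w S f' s \<le> (1 + \<epsilon>) * b" if s: "s < l" for s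
  proof (cases "(1 + \<epsilon>) * b < load w S f s")
    case True
    hence "load w S f' s \<le> a" using f'(3) hi[OF s True] s by fastforce
    thus ?thesis using aleb by linarith
  next
    case False
    have "load w S f' s \<le> max a (load w S f s)" using f'(3) s lo[OF False] by auto
    thus ?thesis using aleb False by linarith
  qed
  have per: "(if (1 + \<epsilon>) * b < load w S f s then load w S f s else 0) \<le> 4 / \<epsilon> * (max 0 (load w S f s - a) - max 0 (load w S f' s - a))"
    if s: "s < l" for s
  proof (cases "(1 + \<epsilon>) * b < load w S f s")
    case True
    have "load w S f' s \<le> a" using f'(3) hi[OF s True] s by fastforce
    hence 1: "max 0 (load w S f s - a) - max 0 (load w S f' s - a) = load w S f s - a" using True aleb by simp
    have "(4 - \<epsilon>) * ((1 + \<epsilon>) * b) \<le> (4 - \<epsilon>) * load w S f s" using True eps by (intro mult_left_mono) auto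
    moreover have "4 * a \<le> (4 - \<epsilon>) * ((1 + \<epsilon>) * b)"
    proof -
      have "(4 - \<epsilon>) * ((1 + \<epsilon>) * b) - 4 * a = \<epsilon> * (1 - \<epsilon>) * b" by (simp add: a_def algebra_simps power2_eq_square)
      moreover have "0 \<le> \<epsilon> * (1 - \<epsilon>) * b" using eps b by simp
      ultimately show ?thesis by linarith
    qed
    ultimately have "\<epsilon> * load w S f s \<le> 4 * (load w S f s - a)" by (simp add: algebra_simps)
    hence "load w S f s \<le> 4 / \<epsilon> * (load w S f s - a)" using eps by (simp add: field_simps)
    thus ?thesis using True 1 by simp
  next
    case False
    have "load w S f' s \<le> max a (load w S f s)" using f'(3) s lo[OF False] by auto
    hence "max 0 (load w S f' s - a) \<le> max 0 (load w S f s - a)" by linarith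
    thus ?thesis using False eps by simp
  qed
  have "relocated w S f f' \<le> (\<Sum>K\<in>S. if K \<in> Ev then w K else 0)"
    unfolding relocated_def by (rule sum_mono) (use f'(1) w in auto)
  also have "\<dots> = (\<Sum>s<l. \<Sum>K\<in>{K \<in> S. f K = s}. if K \<in> Ev then w K else 0)"
    using fin f by (intro sum.group[symmetric]) auto
  also have "\<dots> \<le> (\<Sum>s<l. if (1 + \<epsilon>) * b < load w S f s then load w S f s else 0)"
  proof (rule sum_mono)
    fix s assume "s \<in> {..<l}"
    show "(\<Sum>K\<in>{K \<in> S. f K = s}. if K \<in> Ev then w K else 0) \<le> (if (1 + \<epsilon>) * b < load w S f s then load w S f s else 0)"
    proof (cases "(1 + \<epsilon>) * b < load w S f s")
      case True thus ?thesis unfolding load_def using w by (auto intro!: sum_mono)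
    next
      case False
      hence "(\<Sum>K\<in>{K \<in> S. f K = s}. if K \<in> Ev then w K else 0) = 0" by (intro sum.neutral) (auto simp: Ev_def)
      thus ?thesis using False by simp
    qed
  qed
  also have "\<dots> \<le> (\<Sum>s<l. 4 / \<epsilon> * (max 0 (load w S f s - a) - max 0 (load w S f' s - a)))"
    by (rule sum_mono) (use per in auto)
  also have "\<dots> = 4 / \<epsilon> * (overload w S l a f - overload w S l a f')"
    unfolding overload_def by (simp only: sum_subtractf sum_distrib_left right_diff_distrib)
  finally have rl: "relocated w S f f' \<le> 4 / \<epsilon> * (overload w S l a f - overload w S l a f')" .
  have "f' K < l" if "K \<in> S" for K using f'(1,2) f that by metis
  moreover have "f' K = f K" if "K \<notin> Sm" for K using f'(1) that by (auto simp: Ev_def)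
  ultimately show ?thesis using ld rl by (intro exI[of _ f']) blast
qed

lemma overload_relocated:
  assumes fin: "finite S" and w: "\<forall>K\<in>S. 0 \<le> w K" and f: "\<forall>K\<in>S. f' K < l"
  shows "overload w S l a f' \<le> overload w S l a f + relocated w S f f'"
proof -
  define D where "D s = {K \<in> S. f' K = s \<and> f K \<noteq> s}" for s
  have "load w S f' s \<le> load w S f s + sum w (D s)" for s
  proof -
    have "load w S f' s \<le> sum w ({K \<in> S. f K = s} \<union> D s)"
      unfolding load_def by (rule sum_mono2) (use fin w in \<open>auto simp: D_def\<close>)
    also have "\<dots> = load w S f s + sum w (D s)" unfolding load_def
      by (rule sum.union_disjoint) (use fin in \<open>auto simp: D_def\<close>)
    finally show ?thesis .
  qed
  moreover have "0 \<le> sum w (D s)" for s by (rule sum_nonneg) (use w in \<open>auto simp: D_def\<close>)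
  ultimately have "max 0 (load w S f' s - a) \<le> max 0 (load w S f s - a) + sum w (D s)" for s
    by (smt (verit))
  hence "overload w S l a f' \<le> (\<Sum>s<l. max 0 (load w S f s - a) + sum w (D s))" unfolding overload_def by (intro sum_mono)
  also have "\<dots> = overload w S l a f + (\<Sum>s<l. sum w (D s))" by (simp add: sum.distrib overload_def)
  also have "(\<Sum>s<l. sum w (D s)) = (\<Sum>s<l. \<Sum>K\<in>{K \<in> S. f' K = s}. if f K \<noteq> f' K then w K else 0)"
  proof (rule sum.cong[OF refl])
    fix s
    have "sum w (D s) = (\<Sum>K\<in>{K \<in> {K \<in> S. f' K = s}. f K \<noteq> f' K}. w K)" by (intro sum.cong) (auto simp: D_def)
    also have "\<dots> = (\<Sum>K\<in>{K \<in> S. f' K = s}. if f K \<noteq> f' K then w K else 0)"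
      using fin by (intro sum.inter_filter) simp
    finally show "sum w (D s) = (\<Sum>K\<in>{K \<in> S. f' K = s}. if f K \<noteq> f' K then w K else 0)" .
  qed
  also have "\<dots> = relocated w S f f'" unfolding relocated_def using fin f by (intro sum.group) auto
  finally show ?thesis .
qed

lemma relocated_triangle:
  assumes "\<forall>K\<in>S. 0 \<le> w K"
  shows "relocated w S f f'' \<le> relocated w S f f' + relocated w S f' f''"
  unfolding relocated_def sum.distrib[symmetric] by (rule sum_mono) (use assms in auto)

section \<open>Components and their homes\<close>

lemma rtrancl_insert_edge:
  assumes "sym r"
  shows "(x, y) \<in> (r \<union> {(a, b), (b, a)})\<^sup>* \<longleftrightarrow>
    (x, y) \<in> r\<^sup>* \<or> (x, a) \<in> r\<^sup>* \<and> (b, y) \<in> r\<^sup>* \<or> (x, b) \<in> r\<^sup>* \<and> (a, y) \<in> r\<^sup>*"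
proof -
  have "r \<union> {(a, b), (b, a)} = insert (b, a) (insert (a, b) r)" by blast
  hence "(r \<union> {(a, b), (b, a)})\<^sup>* = r\<^sup>* \<union> {(x, y). (x, a) \<in> r\<^sup>* \<and> (b, y) \<in> r\<^sup>*}
      \<union> {(x, y). (x, b) \<in> r\<^sup>* \<union> {(x, y). (x, a) \<in> r\<^sup>* \<and> (b, y) \<in> r\<^sup>*}
               \<and> (a, y) \<in> r\<^sup>* \<union> {(x, y). (x, a) \<in> r\<^sup>* \<and> (b, y) \<in> r\<^sup>*}}"
    by (simp only: rtrancl_insert)
  thus ?thesis by (auto intro: rtrancl_trans)
qed

definition adj :: "edge set \<Rightarrow> (nat \<times> nat) set" where "adj E = {(u, w). {u, w} \<in> E}"

lemma sym_adj: "sym (adj E)"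
  by (auto simp: sym_def adj_def insert_commute)

lemma sym_adj_rtrancl: "(x, y) \<in> (adj E)\<^sup>* \<Longrightarrow> (y, x) \<in> (adj E)\<^sup>*"
  using sym_rtrancl[OF sym_adj] by (auto simp: sym_def)

lemma components_adj: "components V E = (\<lambda>v. (adj E)\<^sup>* `` {v}) ` V"
  by (simp add: components_def adj_def)

lemma component_eq: "w \<in> (adj E)\<^sup>* `` {v} \<Longrightarrow> (adj E)\<^sup>* `` {w} = (adj E)\<^sup>* `` {v}"
  by (auto intro: rtrancl_trans sym_adj_rtrancl)

lemma components_disjoint:
  assumes "K \<in> components V E" "K' \<in> components V E" "K \<noteq> K'"
  shows "K \<inter> K' = {}"
proof (rule ccontr)
  assume "K \<inter> K' \<noteq> {}"
  then obtain w where w: "w \<in> K" "w \<in> K'" by blast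
  obtain v v' where v: "K = (adj E)\<^sup>* `` {v}" "K' = (adj E)\<^sup>* `` {v'}" using assms(1,2) unfolding components_adj by blast
  from component_eq[of w E v] component_eq[of w E v'] w v assms(3) show False by simp
qed

lemma components_nonempty: "K \<in> components V E \<Longrightarrow> K \<noteq> {}"
  unfolding components_adj by blast

lemma components_subset:
  assumes E: "\<And>e. e \<in> E \<Longrightarrow> e \<subseteq> V" and K: "K \<in> components V E"
  shows "K \<subseteq> V"
proof
  fix x assume "x \<in> K"
  then obtain v where v: "v \<in> V" "(v, x) \<in> (adj E)\<^sup>*" using K unfolding components_adj by blast
  from v(2,1) show "x \<in> V"
  proof (induction rule: rtrancl_induct)
    case (step y z)
    have "{y, z} \<in> E" using step(2) by (simp add: adj_def)
    thus ?case using E by blast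
  qed
qed

lemma components_Union:
  assumes E: "\<And>e. e \<in> E \<Longrightarrow> e \<subseteq> V"
  shows "\<Union>(components V E) = V"
proof
  show "\<Union>(components V E) \<subseteq> V" using components_subset[OF E] by blast
  show "V \<subseteq> \<Union>(components V E)" unfolding components_adj by blast
qed

lemma components_empty: "components V {} = (\<lambda>v. {v}) ` V"
  unfolding components_adj adj_def by auto

lemma components_insert:
  assumes V: "finite V" and e: "e \<subseteq> V" "card e = 2" and E: "\<And>e. e \<in> E \<Longrightarrow> e \<subseteq> V"
  shows "components V (insert e E) = components V E \<or>
    (\<exists>A B. A \<in> components V E \<and> B \<in> components V E \<and> A \<noteq> B \<and> card A \<le> card B \<and>
       components V (insert e E) = insert (A \<union> B) (components V E - {A, B}))"
proof -
  obtain a b where ab: "e = {a, b}" "a \<noteq> b" using e(2) by (meson card_2_iff)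
  have abV: "a \<in> V" "b \<in> V" using e(1) ab by auto
  let ?r = "(adj E)\<^sup>*"
  have "adj (insert e E) = adj E \<union> {(a, b), (b, a)}"
    unfolding adj_def ab(1) by (auto simp: doubleton_eq_iff)
  hence r': "(x, y) \<in> (adj (insert e E))\<^sup>* \<longleftrightarrow> (x, y) \<in> ?r \<or> (x, a) \<in> ?r \<and> (b, y) \<in> ?r \<or> (x, b) \<in> ?r \<and> (a, y) \<in> ?r" for x y
    using rtrancl_insert_edge[OF sym_adj] by simp
  define A where "A = ?r `` {a}"
  define B where "B = ?r `` {b}"
  have AC: "A \<in> components V E" "B \<in> components V E" using abV by (auto simp: components_adj A_def B_def)
  show ?thesis
  proof (cases "(a, b) \<in> ?r")
    case True
    have "(x, y) \<in> (adj (insert e E))\<^sup>* \<longleftrightarrow> (x, y) \<in> ?r" for x y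
      unfolding r' using True sym_adj_rtrancl[OF True] by (meson rtrancl_trans)
    hence "(adj (insert e E))\<^sup>* = ?r" by auto
    thus ?thesis by (simp add: components_adj)
  next
    case False
    have ne: "A \<noteq> B"
    proof
      assume "A = B"
      hence "b \<in> A" by (simp add: B_def)
      thus False using False by (simp add: A_def)
    qed
    have c1: "(adj (insert e E))\<^sup>* `` {v} = A \<union> B" if "v \<in> A \<union> B" for v
    proof -
      have "(a, v) \<in> ?r \<or> (b, v) \<in> ?r" using that by (simp add: A_def B_def)
      hence v: "(v, a) \<in> ?r \<or> (v, b) \<in> ?r" using sym_adj_rtrancl by blast
      have "(v, y) \<in> (adj (insert e E))\<^sup>* \<longleftrightarrow> (a, y) \<in> ?r \<or> (b, y) \<in> ?r" for y
        unfolding r' using v by (meson rtrancl_trans sym_adj_rtrancl rtrancl.rtrancl_refl)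
      thus ?thesis unfolding A_def B_def by blast
    qed
    have c2: "(adj (insert e E))\<^sup>* `` {v} = ?r `` {v}" if "v \<notin> A \<union> B" for v
    proof -
      have "(v, a) \<notin> ?r" "(v, b) \<notin> ?r" using that sym_adj_rtrancl by (auto simp: A_def B_def)
      thus ?thesis using r' by auto
    qed
    have eq: "components V (insert e E) = insert (A \<union> B) (components V E - {A, B})"
    proof (rule set_eqI)
      fix K
      show "K \<in> components V (insert e E) \<longleftrightarrow> K \<in> insert (A \<union> B) (components V E - {A, B})"
      proof
        assume "K \<in> components V (insert e E)"
        then obtain v where v: "v \<in> V" "K = (adj (insert e E))\<^sup>* `` {v}" unfolding components_adj by blast
        show "K \<in> insert (A \<union> B) (components V E - {A, B})"
        proof (cases "v \<in> A \<union> B")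
          case True thus ?thesis using c1 v by simp
        next
          case False
          have "v \<in> K" using v by simp
          hence "K \<noteq> A" "K \<noteq> B" using False by auto
          moreover have "K \<in> components V E" using c2[OF False] v unfolding components_adj by blast
          ultimately show ?thesis by simp
        qed
      next
        assume "K \<in> insert (A \<union> B) (components V E - {A, B})"
        thus "K \<in> components V (insert e E)"
        proof
          assume "K = A \<union> B"
          moreover have "a \<in> A \<union> B" by (simp add: A_def)
          ultimately show ?thesis using c1[of a] abV unfolding components_adj by blast
        next
          assume K: "K \<in> components V E - {A, B}"
          then obtain v where v: "v \<in> V" "K = ?r `` {v}" unfolding components_adj by blast
          have "v \<in> K" using v by simp
          moreover have "K \<inter> A = {}" "K \<inter> B = {}" using components_disjoint[of K V E] K AC by blast+
          ultimately have "v \<notin> A \<union> B" by blast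
          from c2[OF this] show ?thesis using v unfolding components_adj by blast
        qed
      qed
    qed
    show ?thesis
    proof (cases "card A \<le> card B")
      case True thus ?thesis using AC ne eq by blast
    next
      case False
      hence "card B \<le> card A" by simp
      moreover have "components V (insert e E) = insert (B \<union> A) (components V E - {B, A})"
        using eq by (simp add: Un_commute insert_commute)
      ultimately show ?thesis using AC ne by blast
    qed
  qed
qed

locale homes =
  fixes l k q :: nat and f0 :: "nat \<Rightarrow> nat"
  assumes q1: "q \<ge> 1"
begin

definition native :: "nat set \<Rightarrow> nat \<Rightarrow> nat" where "native K s = card {v \<in> K. f0 v = s}"
definition foreign :: "nat set \<Rightarrow> nat \<Rightarrow> nat" where "foreign K s = card {v \<in> K. f0 v \<noteq> s}"
definition large :: "nat set \<Rightarrow> bool" where "large K \<longleftrightarrow> k \<le> q * card K"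

definition okhome :: "nat set \<Rightarrow> nat option \<Rightarrow> bool" where
  "okhome K h = (case h of
     Some c \<Rightarrow> c < l \<and> 3 * card K \<le> 4 * native K c \<and> (large K \<longrightarrow> 16 * q * foreign K c < k)
   | None \<Rightarrow> (\<forall>c. if large K then k \<le> 16 * q * foreign K c else card K \<le> 8 * foreign K c))"

text \<open>
  Hysteresis: a home is kept as long as three quarters of the component are native to it, but it
  is acquired only at seven eighths. The gap pays for moving the component to its new home.
\<close>

definition newhome :: "nat set \<Rightarrow> nat option \<Rightarrow> nat option" where
  "newhome K hB = (case hB of
     Some c \<Rightarrow> if 3 * card K \<le> 4 * native K c \<and> (large K \<longrightarrow> 16 * q * foreign K c < k) then Some c else None
   | None \<Rightarrow> if \<not> large K \<and> (\<exists>c<l. 7 * card K \<le> 8 * native K c) then Some (SOME c. c < l \<and> 7 * card K \<le> 8 * native K c) else None)"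

lemma native_foreign: "finite K \<Longrightarrow> native K s + foreign K s = card K"
proof -
  assume f: "finite K"
  have "K = {v \<in> K. f0 v = s} \<union> {v \<in> K. f0 v \<noteq> s}" by blast
  hence "card K = card ({v \<in> K. f0 v = s} \<union> {v \<in> K. f0 v \<noteq> s})" by simp
  also have "\<dots> = native K s + foreign K s" unfolding native_def foreign_def using f by (intro card_Un_disjoint) auto
  finally show ?thesis by simp
qed

lemma native_Un: "finite A \<Longrightarrow> finite B \<Longrightarrow> A \<inter> B = {} \<Longrightarrow> native (A \<union> B) s = native A s + native B s"
proof -
  assume h: "finite A" "finite B" "A \<inter> B = {}"
  have "{v \<in> A \<union> B. f0 v = s} = {v \<in> A. f0 v = s} \<union> {v \<in> B. f0 v = s}" by blast
  thus ?thesis unfolding native_def using h by (simp add: card_Un_disjoint disjoint_iff)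
qed

lemma native_le_foreign: "finite K \<Longrightarrow> c \<noteq> d \<Longrightarrow> native K c \<le> foreign K d"
  unfolding native_def foreign_def by (intro card_mono) auto

lemma foreign_mono: "finite K' \<Longrightarrow> K \<subseteq> K' \<Longrightarrow> foreign K c \<le> foreign K' c"
  unfolding foreign_def by (intro card_mono) auto

lemma okhomeD_Some:
  assumes "okhome K (Some c)"
  shows "c < l" "3 * card K \<le> 4 * native K c" "large K \<Longrightarrow> 16 * q * foreign K c < k"
  using assms by (auto simp: okhome_def)

lemma okhomeD_None:
  assumes "okhome K None"
  shows "large K \<Longrightarrow> k \<le> 16 * q * foreign K c" "\<not> large K \<Longrightarrow> card K \<le> 8 * foreign K c"
  using assms by (auto simp: okhome_def dest: spec[of _ c])

lemma okhomeD_None':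
  assumes "okhome K None" "card K \<le> k"
  shows "card K \<le> 16 * q * foreign K c"
proof (cases "large K")
  case True thus ?thesis using okhomeD_None(1)[OF assms(1)] assms(2) order_trans by blast
next
  case False
  have "card K \<le> 8 * foreign K c" by (rule okhomeD_None(2)[OF assms(1) False])
  also have "\<dots> \<le> 16 * q * foreign K c" using q1 by (intro mult_le_mono1) simp
  finally show ?thesis .
qed

lemma large_foreign:
  assumes "card K \<le> m * x" "m \<le> 16" "large K"
  shows "k \<le> 16 * q * x"
proof -
  have "k \<le> q * card K" using assms(3) by (simp add: large_def)
  also have "\<dots> \<le> q * (16 * x)" using assms(1,2) by (intro mult_le_mono2) (meson mult_le_mono1 order_trans)
  finally show ?thesis by simp
qed

lemma newhome_okhome:
  assumes f: "finite A" "finite B" "A \<inter> B = {}" and le: "card A \<le> card B"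
    and hB: "okhome B hB" and f0: "\<And>v. v \<in> A \<union> B \<Longrightarrow> f0 v < l"
  shows "okhome (A \<union> B) (newhome (A \<union> B) hB)"
proof -
  let ?K = "A \<union> B"
  have cK: "card ?K = card A + card B" using f by (simp add: card_Un_disjoint)
  hence K2: "card ?K \<le> 2 * card B" using le by simp
  have fK: "finite ?K" using f by simp
  show ?thesis
  proof (cases hB)
    case (Some c)
    note B = okhomeD_Some[OF hB[unfolded Some]]
    show ?thesis
    proof (cases "3 * card ?K \<le> 4 * native ?K c \<and> (large ?K \<longrightarrow> 16 * q * foreign ?K c < k)")
      case True thus ?thesis using B(1) by (simp add: okhome_def newhome_def Some)
    next
      case False
      have "if large ?K then k \<le> 16 * q * foreign ?K d else card ?K \<le> 8 * foreign ?K d" for d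
      proof (cases "d = c")
        case False
        have "native B c \<le> foreign ?K d" using native_le_foreign[OF f(2), of c d] False foreign_mono[OF fK, of B d] by simp
        hence 1: "card ?K \<le> 8 * foreign ?K d" using B(2) K2 by linarith
        thus ?thesis using large_foreign[OF 1] by simp
      next
        case True
        consider "4 * native ?K c < 3 * card ?K" | "large ?K" "k \<le> 16 * q * foreign ?K c" using \<open>\<not> (_ \<and> _)\<close> by fastforce
        thus ?thesis
        proof cases
          case 1
          hence 2: "card ?K \<le> 4 * foreign ?K d" using native_foreign[OF fK, of d] True by simp
          hence "card ?K \<le> 8 * foreign ?K d" by simp
          thus ?thesis using large_foreign[OF 2] by simp
        next
          case 2 thus ?thesis using True by simp
        qed
      qed
      thus ?thesis using False by (simp add: okhome_def newhome_def Some)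
    qed
  next
    case None
    note B = okhomeD_None[OF hB[unfolded None]]
    show ?thesis
    proof (cases "large ?K")
      case True
      have "k \<le> 16 * q * foreign ?K d" for d
      proof -
        have m: "foreign B d \<le> foreign ?K d" by (rule foreign_mono[OF fK]) simp
        show ?thesis
        proof (cases "large B")
          case True
          have "16 * q * foreign B d \<le> 16 * q * foreign ?K d" using m by (rule mult_le_mono2)
          thus ?thesis using B(1)[OF True, of d] by linarith
        next
          case False
          have "card ?K \<le> 16 * foreign ?K d" using B(2)[OF False, of d] K2 m by linarith
          thus ?thesis using large_foreign[OF _ order_refl True] by simp
        qed
      qed
      thus ?thesis using True by (simp add: okhome_def newhome_def None)
    next
      case nl: False
      show ?thesis
      proof (cases "\<exists>c<l. 7 * card ?K \<le> 8 * native ?K c")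
        case True
        define c where "c = (SOME c. c < l \<and> 7 * card ?K \<le> 8 * native ?K c)"
        have c: "c < l \<and> 7 * card ?K \<le> 8 * native ?K c" unfolding c_def using True by (rule someI_ex)
        have "newhome ?K hB = Some c" using nl True by (simp add: newhome_def None c_def)
        thus ?thesis using c nl by (simp add: okhome_def)
      next
        case False
        have "card ?K \<le> 8 * foreign ?K d" for d
        proof (cases "d < l")
          case True
          hence "8 * native ?K d < 7 * card ?K" using False by (meson not_le)
          thus ?thesis using native_foreign[OF fK, of d] by linarith
        next
          case False
          hence "{v \<in> ?K. f0 v = d} = {}" using f0 by auto
          hence "native ?K d = 0" by (simp only: native_def card.empty)
          thus ?thesis using native_foreign[OF fK, of d] by simp
        qed
        moreover have "newhome ?K hB = None" using False by (auto simp: newhome_def None)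
        ultimately show ?thesis using nl by (simp add: okhome_def)
      qed
    qed
  qed
qed

definition cross :: "nat set \<Rightarrow> nat set \<Rightarrow> nat" where
  "cross A B = card {(u, v). u \<in> A \<and> v \<in> B \<and> f0 u \<noteq> f0 v}"

lemma cross_left: "finite A \<Longrightarrow> finite B \<Longrightarrow> cross A B = (\<Sum>u\<in>A. foreign B (f0 u))"
proof -
  assume f: "finite A" "finite B"
  have "{(u, v). u \<in> A \<and> v \<in> B \<and> f0 u \<noteq> f0 v} = (SIGMA u:A. {v \<in> B. f0 v \<noteq> f0 u})" by auto
  thus ?thesis unfolding cross_def foreign_def using f by simp
qed

lemma cross_commute: "cross A B = cross B A"
proof -
  have "{(u, v). u \<in> B \<and> v \<in> A \<and> f0 u \<noteq> f0 v} = prod.swap ` {(u, v). u \<in> A \<and> v \<in> B \<and> f0 u \<noteq> f0 v}" by force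
  thus ?thesis unfolding cross_def by (simp add: card_image)
qed

lemma cross_lower:
  assumes f: "finite A" "finite B" and m: "\<And>c. m \<le> w * foreign B c"
  shows "card A * m \<le> w * cross A B"
proof -
  have "card A * m = (\<Sum>u\<in>A. m)" by simp
  also have "\<dots> \<le> (\<Sum>u\<in>A. w * foreign B (f0 u))" by (rule sum_mono) (rule m)
  also have "\<dots> = w * cross A B" by (simp add: cross_left[OF f] sum_distrib_left)
  finally show ?thesis .
qed

lemma cross_homes:
  assumes f: "finite A" "finite B" and le: "card A \<le> card B" and k: "card A \<le> k" "card B \<le> k"
    and hA: "okhome A hA" and hB: "okhome B hB" and ne: "\<not> (hA = hB \<and> hA \<noteq> None)"
  shows "card A * (card A + card B) \<le> 32 * q * cross A B"
proof -
  have "card A * card B \<le> 16 * q * cross A B"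
  proof (cases hB)
    case None
    show ?thesis by (rule cross_lower[OF f]) (rule okhomeD_None'[OF hB[unfolded None] k(2)])
  next
    case B: (Some c')
    show ?thesis
    proof (cases hA)
      case None
      have "card B * card A \<le> 16 * q * cross B A"
        by (rule cross_lower[OF f(2,1)]) (rule okhomeD_None'[OF hA[unfolded None] k(1)])
      thus ?thesis by (simp add: cross_commute mult.commute)
    next
      case A: (Some c)
      have cc: "c \<noteq> c'" using ne A B by simp
      have "native A c * native B c' = (\<Sum>u\<in>{u \<in> A. f0 u = c}. native B c')" by (simp add: native_def)
      also have "\<dots> \<le> (\<Sum>u\<in>{u \<in> A. f0 u = c}. foreign B (f0 u))"
        by (rule sum_mono) (use native_le_foreign[OF f(2), of c' c] cc in auto)
      also have "\<dots> \<le> (\<Sum>u\<in>A. foreign B (f0 u))" by (rule sum_mono2) (use f in auto)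
      finally have 1: "native A c * native B c' \<le> cross A B" by (simp add: cross_left[OF f])
      have "(3 * card A) * (3 * card B) \<le> (4 * native A c) * (4 * native B c')"
        by (rule mult_le_mono) (use okhomeD_Some(2)[OF hA[unfolded A]] okhomeD_Some(2)[OF hB[unfolded B]] in auto)
      hence "card A * card B \<le> 16 * cross A B" using 1 by simp
      also have "\<dots> \<le> 16 * q * cross A B" using q1 by (intro mult_le_mono1) simp
      finally show ?thesis .
    qed
  qed
  moreover have "card A * (card A + card B) \<le> card A * (2 * card B)" using le by (intro mult_le_mono2) simp
  ultimately show ?thesis by linarith
qed

definition slack :: "nat set \<Rightarrow> nat option \<Rightarrow> real" where
  "slack K h = (if h = None \<and> \<not> large K then 16 * Max (insert 0 ((\<lambda>c. real (native K c) - 3 / 4 * real (card K)) ` {..<l})) else 0)"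

definition natcost :: "nat set \<Rightarrow> nat set \<Rightarrow> nat option \<Rightarrow> nat option \<Rightarrow> real" where
  "natcost A B hA hB = (if hA = hB \<and> hA \<noteq> None then 0 else real (card A))
     + (if hB = None \<and> newhome (A \<union> B) hB \<noteq> None then 2 * real (card B) else 0)"

lemma slack_nonneg: "0 \<le> slack K h"
  by (simp add: slack_def)

lemma slack_ge:
  assumes "h = None" "\<not> large K" "c < l"
  shows "16 * (real (native K c) - 3 / 4 * real (card K)) \<le> slack K h"
proof -
  have m: "real (native K c) - 3 / 4 * real (card K) \<le> Max (insert 0 ((\<lambda>c. real (native K c) - 3 / 4 * real (card K)) ` {..<l}))"
    by (rule Max_ge) (use assms(3) in auto)
  have e: "slack K h = 16 * Max (insert 0 ((\<lambda>c. real (native K c) - 3 / 4 * real (card K)) ` {..<l}))"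
    unfolding slack_def using assms(1,2) by (simp only: simp_thms if_True)
  show ?thesis unfolding e by (rule mult_left_mono[OF m]) simp
qed

lemma slack_le:
  assumes "0 \<le> b" "\<And>c. c < l \<Longrightarrow> \<not> large K \<Longrightarrow> h = None \<Longrightarrow> 16 * (real (native K c) - 3 / 4 * real (card K)) \<le> b"
  shows "slack K h \<le> b"
proof (cases "h = None \<and> \<not> large K")
  case True
  have "Max (insert 0 ((\<lambda>c. real (native K c) - 3 / 4 * real (card K)) ` {..<l})) \<le> b / 16"
    using assms(1) assms(2)[of _] True by (subst Max_le_iff) (auto simp: field_simps)
  thus ?thesis using True by (simp add: slack_def)
next
  case False thus ?thesis using assms(1) by (simp only: slack_def if_False)
qed

lemma natcost_slack:
  assumes f: "finite A" "finite B" "A \<inter> B = {}" and le: "card A \<le> card B" and A0: "A \<noteq> {}"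
    and k: "card A \<le> k" "card B \<le> k" and hA: "okhome A hA" and hB: "okhome B hB"
  shows "natcost A B hA hB + slack (A \<union> B) (newhome (A \<union> B) hB)
     \<le> slack A hA + slack B hB + 160 * real q * (real (cross A B) / real (card A + card B))"
proof -
  let ?K = "A \<union> B"
  let ?x = "real q * (real (cross A B) / real (card A + card B))"
  have cK: "card ?K = card A + card B" using f by (simp add: card_Un_disjoint)
  have "card A > 0" using A0 f(1) by (simp add: card_gt_0_iff)
  hence Kpos: "real (card A + card B) > 0" by simp
  have charge: "real (card A) \<le> 32 * ?x" if "\<not> (hA = hB \<and> hA \<noteq> None)"
  proof -
    have "real (card A * (card A + card B)) \<le> real (32 * q * cross A B)"
      using cross_homes[OF f(1,2) le k hA hB that] by (rule of_nat_mono)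
    thus ?thesis using Kpos by (simp add: field_simps)
  qed
  have x0: "0 \<le> ?x" by simp
  show ?thesis
  proof (cases hB)
    case (Some c)
    note B = okhomeD_Some[OF hB[unfolded Some]]
    have s0: "slack ?K (newhome ?K hB) \<le> 0"
    proof (rule slack_le)
      fix d assume d: "d < l" "\<not> large ?K" "newhome ?K hB = None"
      hence n: "\<not> 3 * card ?K \<le> 4 * native ?K c" by (auto simp: newhome_def Some split: if_splits)
      have "4 * native ?K d \<le> 3 * card ?K"
      proof (cases "d = c")
        case True thus ?thesis using n by simp
      next
        case False
        have "native ?K c \<le> foreign ?K d" using native_le_foreign[of ?K c d] f False by simp
        moreover have "native B c \<le> native ?K c" using native_Un[OF f, of c] by simp
        ultimately show ?thesis using native_foreign[of ?K d] f B(2) le cK by simp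
      qed
      hence "4 * real (native ?K d) \<le> 3 * real (card ?K)" by linarith
      thus "16 * (real (native ?K d) - 3 / 4 * real (card ?K)) \<le> 0" by simp
    qed simp
    have "natcost A B hA hB = (if hA = hB \<and> hA \<noteq> None then 0 else real (card A))" by (simp add: natcost_def Some)
    also have "\<dots> \<le> 160 * ?x" using charge x0 by (auto intro: order_trans)
    finally show ?thesis using s0 slack_nonneg[of A hA] slack_nonneg[of B hB] by simp
  next
    case None
    have ch: "real (card A) \<le> 32 * ?x" using None by (intro charge) auto
    have n1: "natcost A B hA hB = real (card A) + (if newhome ?K hB \<noteq> None then 2 * real (card B) else 0)"
      by (auto simp: natcost_def None)
    have lB: "\<not> large ?K \<Longrightarrow> \<not> large B" using cK by (auto simp: large_def algebra_simps)
    show ?thesis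
    proof (cases "newhome ?K hB")
      case N: None
      have "slack ?K (newhome ?K hB) \<le> slack B hB + 4 * real (card A)"
      proof (rule slack_le)
        show "0 \<le> slack B hB + 4 * real (card A)" using slack_nonneg[of B hB] by simp
        fix d assume d: "d < l" "\<not> large ?K"
        have "16 * (real (native B d) - 3 / 4 * real (card B)) \<le> slack B hB" by (rule slack_ge[OF None lB[OF d(2)] d(1)])
        moreover have "real (native A d) \<le> real (card A)" using native_foreign[OF f(1), of d] by simp
        moreover have "16 * (real (native ?K d) - 3 / 4 * real (card ?K)) = 16 * (real (native B d) - 3 / 4 * real (card B)) + 16 * real (native A d) - 12 * real (card A)"
          unfolding native_Un[OF f] cK by (simp add: algebra_simps)
        ultimately show "16 * (real (native ?K d) - 3 / 4 * real (card ?K)) \<le> slack B hB + 4 * real (card A)"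
          by linarith
      qed
      moreover have "natcost A B hA hB = real (card A)" using n1 N by simp
      ultimately show ?thesis using ch slack_nonneg[of A hA] x0 by simp
    next
      case N: (Some c)
      hence e: "\<not> large ?K" "\<exists>c<l. 7 * card ?K \<le> 8 * native ?K c" by (auto simp: newhome_def None split: if_splits)
      obtain c where c: "c < l" "7 * card ?K \<le> 8 * native ?K c" using e(2) by blast
      have "16 * (real (native B c) - 3 / 4 * real (card B)) \<le> slack B hB" by (rule slack_ge[OF None lB[OF e(1)] c(1)])
      moreover have "native A c \<le> card A" using native_foreign[OF f(1), of c] by simp
      moreover have "real (7 * card ?K) \<le> real (8 * native ?K c)" using c(2) by (rule of_nat_mono)
      ultimately have "2 * real (card B) \<le> slack B hB + 4 * real (card A)"
        unfolding native_Un[OF f] cK by simp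
      moreover have "slack ?K (newhome ?K hB) = 0" by (simp add: slack_def N)
      ultimately show ?thesis using n1 N ch slack_nonneg[of A hA] x0 by simp
    qed
  qed
qed

lemma cross_le_moved:
  assumes f: "finite A" "finite B" and g: "\<And>u v. u \<in> A \<union> B \<Longrightarrow> v \<in> A \<union> B \<Longrightarrow> g u = g v"
  shows "cross A B \<le> card {v \<in> A. g v \<noteq> f0 v} * card B + card A * card {v \<in> B. g v \<noteq> f0 v}"
proof -
  have "{(u, v). u \<in> A \<and> v \<in> B \<and> f0 u \<noteq> f0 v} \<subseteq> {v \<in> A. g v \<noteq> f0 v} \<times> B \<union> A \<times> {v \<in> B. g v \<noteq> f0 v}"
  proof
    fix x assume "x \<in> {(u, v). u \<in> A \<and> v \<in> B \<and> f0 u \<noteq> f0 v}"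
    then obtain u v where x: "x = (u, v)" "u \<in> A" "v \<in> B" "f0 u \<noteq> f0 v" by blast
    have "g u = g v" by (rule g) (use x in auto)
    thus "x \<in> {v \<in> A. g v \<noteq> f0 v} \<times> B \<union> A \<times> {v \<in> B. g v \<noteq> f0 v}" using x by auto
  qed
  hence "cross A B \<le> card ({v \<in> A. g v \<noteq> f0 v} \<times> B \<union> A \<times> {v \<in> B. g v \<noteq> f0 v})"
    unfolding cross_def using f by (intro card_mono) auto
  also have "\<dots> \<le> card ({v \<in> A. g v \<noteq> f0 v} \<times> B) + card (A \<times> {v \<in> B. g v \<noteq> f0 v})" by (rule card_Un_le)
  finally show ?thesis by (simp add: card_cartesian_product)
qed

lemma cross_charge:
  assumes f: "finite A" "finite B" "A \<inter> B = {}" and ne: "A \<noteq> {}" "B \<noteq> {}"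
    and g: "\<And>u v. u \<in> A \<union> B \<Longrightarrow> v \<in> A \<union> B \<Longrightarrow> g u = g v"
  shows "real (cross A B) / real (card A + card B) \<le>
     real (card {v \<in> A \<union> B. g v \<noteq> f0 v}) * ln (card (A \<union> B))
     - real (card {v \<in> A. g v \<noteq> f0 v}) * ln (card A) - real (card {v \<in> B. g v \<noteq> f0 v}) * ln (card B)"
proof -
  define a where "a = real (card A)"
  define b where "b = real (card B)"
  define ma where "ma = real (card {v \<in> A. g v \<noteq> f0 v})"
  define mb where "mb = real (card {v \<in> B. g v \<noteq> f0 v})"
  have ab: "a > 0" "b > 0" using f ne by (auto simp: a_def b_def card_gt_0_iff)
  have m: "ma \<ge> 0" "mb \<ge> 0" by (auto simp: ma_def mb_def)
  have key: "y / (x + y) \<le> ln (x + y) - ln x" if "x > 0" "y > 0" for x y :: real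
  proof -
    have "ln (x / (x + y)) \<le> x / (x + y) - 1" using that by (intro ln_le_minus_one) simp
    thus ?thesis using that by (simp add: ln_div field_simps)
  qed
  have "{v \<in> A \<union> B. g v \<noteq> f0 v} = {v \<in> A. g v \<noteq> f0 v} \<union> {v \<in> B. g v \<noteq> f0 v}" by blast
  hence mK: "real (card {v \<in> A \<union> B. g v \<noteq> f0 v}) = ma + mb" using f by (simp add: ma_def mb_def card_Un_disjoint disjoint_iff)
  have cK: "real (card (A \<union> B)) = a + b" using f by (simp add: card_Un_disjoint a_def b_def)
  have "real (cross A B) \<le> ma * b + a * mb"
    using of_nat_mono[OF cross_le_moved[OF f(1,2) g], where ?'a = real] by (simp add: ma_def mb_def a_def b_def)
  hence "real (cross A B) / (a + b) \<le> (ma * b + a * mb) / (a + b)" using ab by (intro divide_right_mono) auto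
  also have "\<dots> = ma * (b / (a + b)) + mb * (a / (b + a))" by (simp add: add_divide_distrib mult.commute add.commute)
  also have "\<dots> \<le> ma * (ln (a + b) - ln a) + mb * (ln (b + a) - ln b)"
    by (intro add_mono mult_left_mono key ab m)
  finally show ?thesis unfolding mK cK by (simp add: a_def b_def ma_def mb_def algebra_simps)
qed

end

section \<open>Server types\<close>

locale inst = homes l k q f0 for l k q :: nat and f0 :: "nat \<Rightarrow> nat" +
  fixes V :: "nat set"
  assumes fV: "finite V" and l1: "l \<ge> 1" and k1: "k \<ge> 1" and f0l: "\<And>v. v \<in> V \<Longrightarrow> f0 v < l"
    and f0k: "\<And>s. s < l \<Longrightarrow> card {v \<in> V. f0 v = s} = k"
begin

definition PP :: "edge list set" where "PP = request_sequences V l k"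
definition C :: "edge list \<Rightarrow> nat set set" where "C p = components V (set p)"
definition merge :: "edge list \<Rightarrow> edge \<Rightarrow> nat set \<Rightarrow> nat set \<Rightarrow> bool" where
  "merge p e A B \<longleftrightarrow> A \<in> C p \<and> B \<in> C p \<and> A \<noteq> B \<and> card A \<le> card B \<and> C (p @ [e]) = insert (A \<union> B) (C p - {A, B})"

lemma PP_edges: "p \<in> PP \<Longrightarrow> e \<in> set p \<Longrightarrow> e \<subseteq> V \<and> card e = 2"
  by (simp add: PP_def request_sequences_def)

lemma PP_take: "p \<in> PP \<Longrightarrow> take t p \<in> PP"
proof -
  assume p: "p \<in> PP"
  have "\<exists>f. valid_assignment V l (real k) (set (take t' (take t p))) f" if "t' \<le> length (take t p)" for t'
  proof -
    have "min t' t \<le> length p" using that by simp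
    thus ?thesis using p unfolding PP_def request_sequences_def by (simp add: take_take)
  qed
  moreover have "set (take t p) \<subseteq> set p" by (rule set_take_subset)
  ultimately show ?thesis using p unfolding PP_def request_sequences_def by (auto simp del: take_take)
qed

lemma PP_closed: "p @ [e] \<in> PP \<Longrightarrow> p \<in> PP"
  using PP_take[of "p @ [e]" "length p"] by simp

lemma finite_PP: "finite PP"
proof (rule finite_subset)
  show "PP \<subseteq> {xs. set xs \<subseteq> Pow V \<and> distinct xs}" unfolding PP_def request_sequences_def by auto
  show "finite {xs. set xs \<subseteq> Pow V \<and> distinct xs}" using fV by (intro finite_subset_distinct) simp
qed

lemma PP_valid: "p \<in> PP \<Longrightarrow> \<exists>f. valid_assignment V l (real k) (set p) f"
proof -
  assume "p \<in> PP"
  hence "\<exists>f. valid_assignment V l (real k) (set (take (length p) p)) f" unfolding PP_def request_sequences_def by blast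
  thus ?thesis by simp
qed

lemma C_sub: "p \<in> PP \<Longrightarrow> K \<in> C p \<Longrightarrow> K \<subseteq> V"
  unfolding C_def by (rule components_subset[rotated]) (use PP_edges in blast)+

lemma C_fin: "p \<in> PP \<Longrightarrow> K \<in> C p \<Longrightarrow> finite K"
  using C_sub fV finite_subset by blast

lemma C_finite: "finite (C p)"
  unfolding C_def components_def using fV by simp

lemma C_ne: "K \<in> C p \<Longrightarrow> K \<noteq> {}"
  unfolding C_def by (rule components_nonempty)

lemma C_disj: "K \<in> C p \<Longrightarrow> K' \<in> C p \<Longrightarrow> K \<noteq> K' \<Longrightarrow> K \<inter> K' = {}"
  unfolding C_def by (rule components_disjoint)

lemma C_Union: "p \<in> PP \<Longrightarrow> \<Union>(C p) = V"
  unfolding C_def by (rule components_Union) (use PP_edges in blast)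

lemma C_pos: "p \<in> PP \<Longrightarrow> K \<in> C p \<Longrightarrow> card K \<ge> 1"
  using C_fin C_ne by (simp add: Suc_le_eq card_gt_0_iff)

lemma C_le_k: assumes "p \<in> PP" "K \<in> C p" shows "card K \<le> k"
proof -
  obtain f where f: "valid_assignment V l (real k) (set p) f" using PP_valid[OF assms(1)] by blast
  obtain s where s: "s < l" "\<forall>v\<in>K. f v = s" using f assms(2) unfolding valid_assignment_def C_def by blast
  have "card K \<le> card {v \<in> V. f v = s}" using s(2) C_sub[OF assms] fV by (intro card_mono) auto
  also have "\<dots> \<le> k" using f s(1) unfolding valid_assignment_def by (metis of_nat_le_iff)
  finally show ?thesis .
qed

lemma C_partition_sum: "p \<in> PP \<Longrightarrow> (\<Sum>K\<in>C p. sum \<phi> K) = sum \<phi> V"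
proof -
  assume p: "p \<in> PP"
  have "sum \<phi> (\<Union>(C p)) = (\<Sum>K\<in>C p. sum \<phi> K)"
    by (subst sum.Union_disjoint) (use C_fin[OF p] C_disj in auto)
  thus ?thesis using C_Union[OF p] by simp
qed

lemma C_partition_card: "p \<in> PP \<Longrightarrow> (\<Sum>K\<in>C p. card {v \<in> K. P v}) = card {v \<in> V. P v}"
proof -
  assume p: "p \<in> PP"
  have "card {v \<in> K. P v} = (\<Sum>v\<in>K. if P v then 1 else 0)" if "finite K" for K
    using that by (simp add: sum.If_cases Int_def)
  hence "(\<Sum>K\<in>C p. card {v \<in> K. P v}) = (\<Sum>K\<in>C p. \<Sum>v\<in>K. if P v then 1 else 0)"
    using C_fin[OF p] by (intro sum.cong) auto
  also have "\<dots> = (\<Sum>v\<in>V. if P v then 1 else 0)" by (rule C_partition_sum[OF p])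
  also have "\<dots> = card {v \<in> V. P v}" using fV by (simp add: sum.If_cases Int_def)
  finally show ?thesis .
qed

lemma C_Nil: "C [] = (\<lambda>v. {v}) ` V"
  by (simp add: C_def components_empty)

lemma step_cases:
  assumes p: "p @ [e] \<in> PP"
  shows "C (p @ [e]) = C p \<or> (\<exists>A B. merge p e A B)"
proof -
  have e: "e \<subseteq> V" "card e = 2" using PP_edges[OF p, of e] by auto
  have "C (p @ [e]) = components V (insert e (set p))" by (simp add: C_def)
  thus ?thesis using components_insert[OF fV e, of "set p"] PP_edges[OF PP_closed[OF p]] unfolding merge_def C_def by auto
qed

lemma mergeD:
  assumes "merge p e A B" "p @ [e] \<in> PP"
  shows "A \<in> C p" "B \<in> C p" "A \<noteq> B" "card A \<le> card B" "C (p @ [e]) = insert (A \<union> B) (C p - {A, B})"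
    "finite A" "finite B" "A \<inter> B = {}" "A \<noteq> {}" "B \<noteq> {}" "card A \<le> k" "card B \<le> k" "card (A \<union> B) \<le> k"
    "A \<union> B \<in> C (p @ [e])" "A \<union> B \<notin> C p" "card (A \<union> B) = card A + card B" "A \<union> B \<subseteq> V"
proof -
  have p: "p \<in> PP" by (rule PP_closed[OF assms(2)])
  show 1: "A \<in> C p" "B \<in> C p" "A \<noteq> B" "card A \<le> card B" "C (p @ [e]) = insert (A \<union> B) (C p - {A, B})"
    using assms(1) unfolding merge_def by blast+
  show 2: "finite A" "finite B" "A \<inter> B = {}" "A \<noteq> {}" "B \<noteq> {}" "card A \<le> k" "card B \<le> k"
    by (rule C_fin[OF p 1(1)], rule C_fin[OF p 1(2)], rule C_disj[OF 1(1,2,3)], rule C_ne[OF 1(1)], rule C_ne[OF 1(2)],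
        rule C_le_k[OF p 1(1)], rule C_le_k[OF p 1(2)])
  show 3: "A \<union> B \<in> C (p @ [e])" using 1 by simp
  show "card (A \<union> B) \<le> k" by (rule C_le_k[OF assms(2) 3])
  show "card (A \<union> B) = card A + card B" using 2 by (simp add: card_Un_disjoint)
  show "A \<union> B \<subseteq> V" by (rule C_sub[OF assms(2) 3])
  show "A \<union> B \<notin> C p"
  proof
    assume K: "A \<union> B \<in> C p"
    have "A \<union> B = A" using C_disj[OF K 1(1)] 2(4) by blast
    thus False using 2(3,5) by blast
  qed
qed

lemma sum_merge:
  fixes \<phi> \<phi>' :: "nat set \<Rightarrow> 'b :: comm_monoid_add"
  assumes m: "merge p e A B" "p @ [e] \<in> PP" and eq: "\<And>K. K \<in> C p \<Longrightarrow> K \<noteq> A \<Longrightarrow> K \<noteq> B \<Longrightarrow> \<phi>' K = \<phi> K"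
  shows "sum \<phi>' (C (p @ [e])) + (\<phi> A + \<phi> B) = sum \<phi> (C p) + \<phi>' (A \<union> B)"
proof -
  note D = mergeD[OF m]
  have f: "finite (C p - {A, B})" using C_finite by simp
  have "sum \<phi>' (C (p @ [e])) = \<phi>' (A \<union> B) + sum \<phi>' (C p - {A, B})"
    unfolding D(5) using D(15) f by (subst sum.insert) auto
  also have "sum \<phi>' (C p - {A, B}) = sum \<phi> (C p - {A, B})" using eq by (intro sum.cong) auto
  finally have 1: "sum \<phi>' (C (p @ [e])) = \<phi>' (A \<union> B) + sum \<phi> (C p - {A, B})" .
  have "C p = insert A (insert B (C p - {A, B}))" using D(1,2) by blast
  hence "sum \<phi> (C p) = sum \<phi> (insert A (insert B (C p - {A, B})))" by simp
  also have "\<dots> = \<phi> A + (\<phi> B + sum \<phi> (C p - {A, B}))" using D(3) f by (subst sum.insert) auto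
  finally show ?thesis using 1 by (simp add: ac_simps)
qed

definition home_step where
  "home_step p e st st' \<longleftrightarrow>
     (C (p @ [e]) = C p \<and> fst st' = fst st \<and> fst (snd st') = fst (snd st) \<and> snd (snd st') = None) \<or>
     (\<exists>A B. merge p e A B \<and> fst st' = (fst st)(A \<union> B := newhome (A \<union> B) (fst st B)) \<and>
        fst (snd st') = (\<lambda>s. fst (snd st) s + (if fst st A = Some s \<and> fst st B = Some s then card A else 0 :: nat)) \<and>
        snd (snd st') = Some (A, B))"

lemma homes_exist:
  "\<exists>F. F [] = (\<lambda>K. Some (f0 (the_elem K)), \<lambda>_. 0, None) \<and> (\<forall>p. p \<in> PP \<longrightarrow> (\<forall>K\<in>C p. okhome K (fst (F p) K))) \<and>
     (\<forall>p e. p @ [e] \<in> PP \<longrightarrow> home_step p e (F p) (F (p @ [e])))"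
proof (rule prefix_choice[where Q = "\<lambda>p. p \<in> PP"])
  show "\<forall>K\<in>C []. okhome K (fst (\<lambda>K. Some (f0 (the_elem K)), \<lambda>_. 0, None) K)"
  proof
    fix K assume "K \<in> C []"
    then obtain v where v: "v \<in> V" "K = {v}" by (auto simp: C_Nil)
    have "{w \<in> {v}. f0 w = f0 v} = {v}" "{w \<in> {v}. f0 w \<noteq> f0 v} = {}" by auto
    hence "native {v} (f0 v) = 1" "foreign {v} (f0 v) = 0" by (simp_all add: native_def foreign_def)
    thus "okhome K (fst (\<lambda>K. Some (f0 (the_elem K)), \<lambda>_. 0, None) K)"
      using f0l[OF v(1)] k1 by (simp add: okhome_def v(2))
  qed
next
  fix p e and st :: "(nat set \<Rightarrow> nat option) \<times> (nat \<Rightarrow> nat) \<times> (nat set \<times> nat set) option"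
  assume p: "p @ [e] \<in> PP" and I: "\<forall>K\<in>C p. okhome K (fst st K)"
  show "\<exists>st'. (\<forall>K\<in>C (p @ [e]). okhome K (fst st' K)) \<and> home_step p e st st'"
  proof (cases "C (p @ [e]) = C p")
    case True
    thus ?thesis using I by (intro exI[of _ "(fst st, fst (snd st), None)"]) (simp add: home_step_def)
  next
    case False
    then obtain A B where m: "merge p e A B" using step_cases[OF p] by blast
    note D = mergeD[OF m p]
    let ?N = "(fst st)(A \<union> B := newhome (A \<union> B) (fst st B))"
    have "okhome K (?N K)" if K: "K \<in> C (p @ [e])" for K
    proof (cases "K = A \<union> B")
      case True
      have "okhome (A \<union> B) (newhome (A \<union> B) (fst st B))"
        by (rule newhome_okhome[OF D(6,7,8,4)]) (use I D(2) D(17) f0l in auto)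
      thus ?thesis using True by simp
    next
      case False thus ?thesis using K I D(5) by simp
    qed
    thus ?thesis using m
      by (intro exI[of _ "(?N, \<lambda>s. fst (snd st) s + (if fst st A = Some s \<and> fst st B = Some s then card A else 0), Some (A, B))"])
         (auto simp: home_step_def)
  qed
next
  fix p e assume "p @ [e] \<in> PP" thus "p \<in> PP" by (rule PP_closed)
qed

end

locale housed = inst l k q f0 V for l k q f0 V +
  fixes F :: "edge list \<Rightarrow> (nat set \<Rightarrow> nat option) \<times> (nat \<Rightarrow> nat) \<times> (nat set \<times> nat set) option"
  assumes F0: "F [] = (\<lambda>K. Some (f0 (the_elem K)), \<lambda>_. 0, None)"
    and okF: "\<And>p K. p \<in> PP \<Longrightarrow> K \<in> C p \<Longrightarrow> okhome K (fst (F p) K)"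
    and stepF: "\<And>p e. p @ [e] \<in> PP \<Longrightarrow> home_step p e (F p) (F (p @ [e]))"
begin

definition N where "N p = fst (F p)"
definition W where "W p = fst (snd (F p))"
definition AB where "AB p = snd (snd (F p))"

lemma okN: "p \<in> PP \<Longrightarrow> K \<in> C p \<Longrightarrow> okhome K (N p K)"
  by (simp add: N_def okF)

lemma step_home:
  assumes "p @ [e] \<in> PP"
  obtains (same) "AB (p @ [e]) = None" "C (p @ [e]) = C p" "N (p @ [e]) = N p" "W (p @ [e]) = W p"
    | (merge) A B where "AB (p @ [e]) = Some (A, B)" "merge p e A B"
        "N (p @ [e]) (A \<union> B) = newhome (A \<union> B) (N p B)"
        "\<And>K. K \<in> C p \<Longrightarrow> N (p @ [e]) K = N p K"
        "\<And>s. W (p @ [e]) s = W p s + (if N p A = Some s \<and> N p B = Some s then card A else 0)"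
proof -
  from stepF[OF assms] consider
    "C (p @ [e]) = C p \<and> fst (F (p @ [e])) = fst (F p) \<and> fst (snd (F (p @ [e]))) = fst (snd (F p)) \<and> snd (snd (F (p @ [e]))) = None"
    | A B where "merge p e A B" "fst (F (p @ [e])) = (fst (F p))(A \<union> B := newhome (A \<union> B) (fst (F p) B))"
        "fst (snd (F (p @ [e]))) = (\<lambda>s. fst (snd (F p)) s + (if fst (F p) A = Some s \<and> fst (F p) B = Some s then card A else 0 :: nat))"
        "snd (snd (F (p @ [e]))) = Some (A, B)"
    unfolding home_step_def by blast
  thus ?thesis
  proof cases
    case 1 thus ?thesis by (intro same) (simp_all add: N_def W_def AB_def)
  next
    case (2 A B)
    show ?thesis
    proof (rule merge)
      show "AB (p @ [e]) = Some (A, B)" using 2(4) by (simp add: AB_def)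
      show "merge p e A B" by (rule 2(1))
      show "N (p @ [e]) (A \<union> B) = newhome (A \<union> B) (N p B)" using 2(2) by (simp add: N_def)
      show "N (p @ [e]) K = N p K" if "K \<in> C p" for K
      proof -
        have "K \<noteq> A \<union> B" using that mergeD(15)[OF 2(1) assms] by auto
        thus ?thesis using 2(2) by (simp add: N_def)
      qed
      show "W (p @ [e]) s = W p s + (if N p A = Some s \<and> N p B = Some s then card A else 0)" for s
        using 2(3) by (simp add: N_def W_def)
    qed
  qed
qed

text \<open>
  Sizes are rounded up to multiples of \<open>k / q\<^sup>2\<close>.
\<close>

definition size_class :: "nat set \<Rightarrow> nat" where "size_class K = (q * q * card K + (k - 1)) div k"
definition profile :: "nat set set \<Rightarrow> nat \<Rightarrow> nat" where "profile \<K> r = card {K \<in> \<K>. size_class K = r}"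
definition home_large where "home_large p s = {K \<in> C p. large K \<and> N p K = Some s}"
definition free_large where "free_large p = {K \<in> C p. large K \<and> N p K = None}"
definition displaced where "displaced p s = (\<Sum>K\<in>C p. if N p K = Some s then foreign K s else native K s)"
text \<open>
  Referring to all prefixes makes badness permanent, so each server becomes bad at most once.
\<close>

definition bad where "bad p s \<longleftrightarrow> (\<exists>t\<le>length p. k \<le> q * displaced (take t p) s)"
definition server_type where "server_type p s = (bad p s, profile (home_large p s))"
text \<open>
  \<open>W p s\<close> bounds the moves caused by merges of two components with home \<open>s\<close> if \<open>s\<close> is active. The
  condition on \<open>W\<close> charges these moves to hits, in portions of \<open>k\<close>.
\<close>

definition hit_servers where "hit_servers p = {s. s < l \<and> p \<noteq> [] \<and> (server_type p s \<noteq> server_type (butlast p) s \<or> W p s div k \<noteq> W (butlast p) s div k)}"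
text \<open>
  In units of \<open>k / q\<^sup>2\<close> a server has capacity \<open>q\<^sup>2\<close>; the excess \<open>3 * q\<close> covers the rounding and
  the displacement of a server that is not bad.
\<close>

definition feasible :: "(nat \<Rightarrow> nat) set" where
  "feasible = {c. (\<forall>r. r \<notin> {1..q*q} \<longrightarrow> c r = 0) \<and> (\<Sum>r\<in>{1..q*q}. r * c r) \<le> q * q + 3 * q}"
definition loose_profile where "loose_profile p X r = profile (free_large p) r + (\<Sum>s\<in>X. profile (home_large p s) r)"
definition good where
  "good p X \<longleftrightarrow> X \<subseteq> {..<l} \<and> (\<forall>s<l. bad p s \<longrightarrow> s \<in> X) \<and> packable feasible (loose_profile p X) (card X)"

lemma size_class_bounds:
  assumes "p \<in> PP" "K \<in> C p"
  shows "size_class K \<in> {1..q*q}" "k * size_class K \<le> q * q * card K + k" "q * q * card K \<le> k * size_class K"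
proof -
  have c: "1 \<le> card K" "card K \<le> k" using C_pos[OF assms] C_le_k[OF assms] by auto
  have "1 \<le> q * q * card K" using c(1) q1 by (simp add: Suc_le_eq)
  hence "k \<le> q * q * card K + (k - 1)" by linarith
  hence "1 \<le> size_class K" unfolding size_class_def using k1 by (simp add: Suc_le_eq div_greater_zero_iff)
  moreover have "q * q * card K + (k - 1) < k * (q * q + 1)"
  proof -
    have "q * q * card K \<le> q * q * k" using c(2) by (rule mult_le_mono2)
    moreover have "k * (q * q + 1) = q * q * k + k" by (simp add: algebra_simps)
    moreover have "k - 1 < k" using k1 by simp
    ultimately show ?thesis by linarith
  qed
  hence "size_class K < q * q + 1" unfolding size_class_def by (simp add: less_mult_imp_div_less mult.commute)
  ultimately show "size_class K \<in> {1..q*q}" by simp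
  show "k * size_class K \<le> q * q * card K + k"
    unfolding size_class_def using times_div_less_eq_dividend[of k "q * q * card K + (k - 1)"] by linarith
  have "q * q * card K + (k - 1) < k * (size_class K + 1)" unfolding size_class_def
    using k1 dividend_less_times_div[of k "q * q * card K + (k - 1)"] by simp
  thus "q * q * card K \<le> k * size_class K" using k1 by (simp add: algebra_simps)
qed

lemma size_class_mono: "card K \<le> card K' \<Longrightarrow> size_class K \<le> size_class K'"
  unfolding size_class_def by (intro div_le_mono add_mono mult_le_mono2) auto

lemma size_class_large_union:
  assumes "large A" "card A + card B \<le> card K"
  shows "size_class B < size_class K"
proof -
  have "q * q * card B + q * k \<le> q * q * card K"
  proof -
    have "q * k \<le> q * (q * card A)" using assms(1) by (intro mult_le_mono2) (simp add: large_def)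
    moreover have "q * q * (card A + card B) \<le> q * q * card K" using assms(2) by (rule mult_le_mono2)
    moreover have "q * q * (card A + card B) = q * (q * card A) + q * q * card B" by (simp add: algebra_simps)
    ultimately show ?thesis by linarith
  qed
  moreover have "k \<le> q * k" using q1 by simp
  ultimately have "q * q * card B + (k - 1) + k \<le> q * q * card K + (k - 1)" by linarith
  hence "(q * q * card B + (k - 1) + k) div k \<le> size_class K" unfolding size_class_def by (rule div_le_mono)
  moreover have "(x + k) div k = x div k + 1" for x using k1 by simp
  hence "(q * q * card B + (k - 1) + k) div k = size_class B + 1" unfolding size_class_def by blast
  ultimately show ?thesis by simp
qed

lemma profile_Un: "finite X \<Longrightarrow> finite Y \<Longrightarrow> X \<inter> Y = {} \<Longrightarrow> profile (X \<union> Y) r = profile X r + profile Y r"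
proof -
  assume h: "finite X" "finite Y" "X \<inter> Y = {}"
  have "{K \<in> X \<union> Y. size_class K = r} = {K \<in> X. size_class K = r} \<union> {K \<in> Y. size_class K = r}" by blast
  thus ?thesis unfolding profile_def using h by (simp add: card_Un_disjoint disjoint_iff)
qed

lemma profile_UN:
  assumes "finite X" "\<And>s. s \<in> X \<Longrightarrow> finite (\<K> s)" "\<And>s s'. s \<in> X \<Longrightarrow> s' \<in> X \<Longrightarrow> s \<noteq> s' \<Longrightarrow> \<K> s \<inter> \<K> s' = {}"
  shows "profile (\<Union>s\<in>X. \<K> s) r = (\<Sum>s\<in>X. profile (\<K> s) r)"
proof -
  have "{K \<in> (\<Union>s\<in>X. \<K> s). size_class K = r} = (\<Union>s\<in>X. {K \<in> \<K> s. size_class K = r})" by blast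
  hence "profile (\<Union>s\<in>X. \<K> s) r = card (\<Union>s\<in>X. {K \<in> \<K> s. size_class K = r})" by (simp only: profile_def)
  also have "\<dots> = (\<Sum>s\<in>X. card {K \<in> \<K> s. size_class K = r})"
  proof (rule card_UN_disjoint[OF assms(1)])
    show "\<forall>i\<in>X. finite {K \<in> \<K> i. size_class K = r}" using assms(2) by simp
    show "\<forall>i\<in>X. \<forall>j\<in>X. i \<noteq> j \<longrightarrow> {K \<in> \<K> i. size_class K = r} \<inter> {K \<in> \<K> j. size_class K = r} = {}"
    proof (intro ballI impI)
      fix i j assume "i \<in> X" "j \<in> X" "i \<noteq> j"
      from assms(3)[OF this] show "{K \<in> \<K> i. size_class K = r} \<inter> {K \<in> \<K> j. size_class K = r} = {}" by blast
    qed
  qed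
  finally show ?thesis by (simp only: profile_def)
qed

lemma profile_sum:
  assumes "p \<in> PP" "\<K> \<subseteq> C p"
  shows "(\<Sum>r\<in>{1..q*q}. r * profile \<K> r) = (\<Sum>K\<in>\<K>. size_class K)"
proof -
  have f: "finite \<K>" using assms(2) C_finite finite_subset by blast
  have "(\<Sum>r\<in>{1..q*q}. r * profile \<K> r) = (\<Sum>r\<in>{1..q*q}. \<Sum>K\<in>{K \<in> \<K>. size_class K = r}. size_class K)"
    by (intro sum.cong) (auto simp: profile_def)
  also have "\<dots> = (\<Sum>K\<in>\<K>. size_class K)" using f size_class_bounds(1)[OF assms(1)] assms(2) by (intro sum.group) auto
  finally show ?thesis .
qed

lemma profile_zero: "p \<in> PP \<Longrightarrow> \<K> \<subseteq> C p \<Longrightarrow> r \<notin> {1..q*q} \<Longrightarrow> profile \<K> r = 0"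
proof -
  assume h: "p \<in> PP" "\<K> \<subseteq> C p" "r \<notin> {1..q*q}"
  have "{K \<in> \<K>. size_class K = r} = {}" using size_class_bounds(1)[OF h(1)] h(2,3) by blast
  thus ?thesis by (simp only: profile_def card.empty)
qed

lemma profile_in_feasible:
  assumes p: "p \<in> PP" "\<K> \<subseteq> C p" and lg: "\<And>K. K \<in> \<K> \<Longrightarrow> large K" and vol: "q * (\<Sum>K\<in>\<K>. card K) \<le> q * k + k"
  shows "profile \<K> \<in> feasible"
proof -
  let ?v = "\<Sum>K\<in>\<K>. card K"
  have "k * (\<Sum>K\<in>\<K>. size_class K) = (\<Sum>K\<in>\<K>. k * size_class K)" by (simp add: sum_distrib_left)
  also have "\<dots> \<le> (\<Sum>K\<in>\<K>. q * q * card K + k)" by (rule sum_mono) (use size_class_bounds(2)[OF p(1)] p(2) in blast)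
  also have "\<dots> = q * q * ?v + (\<Sum>K\<in>\<K>. k)" by (simp only: sum.distrib sum_distrib_left[symmetric])
  also have "\<dots> \<le> q * q * ?v + q * ?v"
  proof (rule add_left_mono)
    have "(\<Sum>K\<in>\<K>. k) \<le> (\<Sum>K\<in>\<K>. q * card K)" by (rule sum_mono) (use lg in \<open>simp add: large_def\<close>)
    thus "(\<Sum>K\<in>\<K>. k) \<le> q * ?v" by (simp add: sum_distrib_left)
  qed
  also have "\<dots> \<le> q * (q * k + k) + (q * k + k)"
    using add_mono[OF mult_le_mono2[OF vol, of q] vol] by (simp only: mult.assoc)
  also have "\<dots> = k * (q * q + 2 * q + 1)" by (simp add: algebra_simps)
  finally have le: "k * (\<Sum>K\<in>\<K>. size_class K) \<le> k * (q * q + 2 * q + 1)" .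
  have "(\<Sum>K\<in>\<K>. size_class K) \<le> q * q + 2 * q + 1" using iffD1[OF nat_mult_le_cancel1 le] k1 by simp
  hence "(\<Sum>r\<in>{1..q*q}. r * profile \<K> r) \<le> q * q + 3 * q" unfolding profile_sum[OF p] using q1 by linarith
  thus ?thesis using profile_zero[OF p] by (simp add: feasible_def)
qed

lemma finite_feasible: "finite feasible"
proof (rule finite_subset)
  show "feasible \<subseteq> PiE_dflt {1..q*q} 0 (\<lambda>_. {..q * q + 3 * q})"
  proof
    fix c assume c: "c \<in> feasible"
    have "c r \<le> q * q + 3 * q" if r: "r \<in> {1..q*q}" for r
    proof -
      have "c r \<le> r * c r" using r by simp
      also have "\<dots> \<le> (\<Sum>r\<in>{1..q*q}. r * c r)" using r by (intro member_le_sum) auto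
      finally show ?thesis using c by (simp add: feasible_def)
    qed
    thus "c \<in> PiE_dflt {1..q*q} 0 (\<lambda>_. {..q * q + 3 * q})" using c by (auto simp: PiE_dflt_def feasible_def)
  qed
  show "finite (PiE_dflt {1..q*q} 0 (\<lambda>_. {..q * q + 3 * q}))" by (intro finite_PiE_dflt) auto
qed

lemma home_large_sub: "home_large p s \<subseteq> C p" and free_large_sub: "free_large p \<subseteq> C p"
  by (auto simp: home_large_def free_large_def)

lemma home_large_finite: "finite (home_large p s)" and free_large_finite: "finite (free_large p)"
  by (rule finite_subset[OF home_large_sub C_finite], rule finite_subset[OF free_large_sub C_finite])

lemma home_large_disj: "s \<noteq> s' \<Longrightarrow> home_large p s \<inter> home_large p s' = {}" and home_large_free_large_disj: "home_large p s \<inter> free_large p = {}"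
  by (auto simp: home_large_def free_large_def)

lemma home_load:
  assumes p: "p \<in> PP" and s: "s < l"
  shows "(\<Sum>K\<in>{K \<in> C p. N p K = Some s}. card K) \<le> k + displaced p s"
    and "k \<le> (\<Sum>K\<in>{K \<in> C p. N p K = Some s}. card K) + displaced p s"
proof -
  let ?A = "{K \<in> C p. N p K = Some s}" and ?B = "{K \<in> C p. N p K \<noteq> Some s}"
  have fin: "finite ?A" "finite ?B" using C_finite by auto
  have CU: "C p = ?A \<union> ?B" "?A \<inter> ?B = {}" by auto
  have d: "displaced p s = (\<Sum>K\<in>?A. foreign K s) + (\<Sum>K\<in>?B. native K s)"
    unfolding displaced_def using sum.union_disjoint[OF fin CU(2), of "\<lambda>K. if N p K = Some s then foreign K s else native K s"] CU(1) by simp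
  have "(\<Sum>K\<in>C p. native K s) = k" using C_partition_card[OF p, of "\<lambda>v. f0 v = s"] f0k[OF s] by (simp add: native_def)
  hence e: "(\<Sum>K\<in>?A. native K s) + (\<Sum>K\<in>?B. native K s) = k"
    using sum.union_disjoint[OF fin CU(2), of "\<lambda>K. native K s"] CU(1) by simp
  have "(\<Sum>K\<in>?A. card K) = (\<Sum>K\<in>?A. native K s + foreign K s)" by (intro sum.cong) (auto simp: native_foreign C_fin[OF p])
  hence "(\<Sum>K\<in>?A. card K) = (\<Sum>K\<in>?A. native K s) + (\<Sum>K\<in>?A. foreign K s)" by (simp add: sum.distrib)
  thus "(\<Sum>K\<in>?A. card K) \<le> k + displaced p s" "k \<le> (\<Sum>K\<in>?A. card K) + displaced p s" using d e by linarith+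
qed

lemma home_load_any:
  assumes p: "p \<in> PP" and s: "s < l"
  shows "3 * (\<Sum>K\<in>{K \<in> C p. N p K = Some s}. card K) \<le> 4 * k"
proof -
  let ?A = "{K \<in> C p. N p K = Some s}"
  have "3 * (\<Sum>K\<in>?A. card K) = (\<Sum>K\<in>?A. 3 * card K)" by (simp add: sum_distrib_left)
  also have "\<dots> \<le> (\<Sum>K\<in>?A. 4 * native K s)"
    by (rule sum_mono) (use okN[OF p] okhomeD_Some(2) in fastforce)
  also have "\<dots> \<le> (\<Sum>K\<in>C p. 4 * native K s)" using C_finite by (intro sum_mono2) auto
  also have "\<dots> = 4 * k" using C_partition_card[OF p, of "\<lambda>v. f0 v = s"] f0k[OF s] by (simp add: native_def flip: sum_distrib_left)
  finally show ?thesis .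
qed

lemma nonbad_displaced: "\<not> bad p s \<Longrightarrow> q * displaced p s < k"
  unfolding bad_def by (metis le_refl not_le take_all_iff)

lemma nonbad_load:
  assumes "p \<in> PP" "s < l" "\<not> bad p s"
  shows "q * (\<Sum>K\<in>{K \<in> C p. N p K = Some s}. card K) \<le> q * k + k"
  using mult_le_mono2[OF home_load(1)[OF assms(1,2)], of q] nonbad_displaced[OF assms(3)] by (simp add: algebra_simps)

lemma nonbad_feasible:
  assumes "p \<in> PP" "s < l" "\<not> bad p s"
  shows "profile (home_large p s) \<in> feasible"
proof (rule profile_in_feasible[OF assms(1) home_large_sub])
  show "large K" if "K \<in> home_large p s" for K using that by (simp add: home_large_def)
  have "(\<Sum>K\<in>home_large p s. card K) \<le> (\<Sum>K\<in>{K \<in> C p. N p K = Some s}. card K)"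
    using C_finite by (intro sum_mono2) (auto simp: home_large_def)
  thus "q * (\<Sum>K\<in>home_large p s. card K) \<le> q * k + k" using nonbad_load[OF assms] mult_le_mono2 order_trans by blast
qed

lemma packable_add:
  assumes "packable feasible n b" "c \<in> feasible"
  shows "packable feasible (\<lambda>r. n r + c r) (b + 1)"
proof -
  obtain P where P: "items feasible P = n" "sum P feasible = b" using assms(1) unfolding packable_def by blast
  define P' where "P' d = P d + (if d = c then 1 else 0)" for d
  have "items feasible P' r = n r + c r" for r
  proof -
    have "items feasible P' r = (\<Sum>d\<in>feasible. P d * d r + (if d = c then c r else 0))"
      unfolding items_def P'_def by (intro sum.cong) (auto simp: algebra_simps)
    also have "\<dots> = items feasible P r + c r" using assms(2) finite_feasible by (simp add: sum.distrib items_def)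
    finally show ?thesis using P(1) by simp
  qed
  moreover have "sum P' feasible = b + 1" unfolding P'_def using P(2) assms(2) finite_feasible by (simp add: sum.distrib)
  ultimately show ?thesis unfolding packable_def by (intro exI[of _ P']) auto
qed

lemma packable_extend:
  assumes p: "p \<in> PP" and fX: "finite X" and X1: "X1 \<subseteq> X" and Xl: "X \<subseteq> {..<l}" and nb: "\<And>s. s \<in> X - X1 \<Longrightarrow> \<not> bad p s"
    and pk: "packable feasible (loose_profile p X1) (card X1)"
  shows "packable feasible (loose_profile p X) (card X)"
proof -
  have "packable feasible (loose_profile p (X1 \<union> Y)) (card (X1 \<union> Y))" if "Y \<subseteq> X - X1" for Y
  proof -
    have "finite Y" using that fX finite_subset by blast
    thus ?thesis using that
    proof (induction Y rule: finite_induct)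
      case empty thus ?case using pk by simp
    next
      case (insert s Y)
      have f: "finite (X1 \<union> Y)" using X1 fX insert finite_subset by auto
      have n: "s \<notin> X1 \<union> Y" using insert by blast
      have "profile (home_large p s) \<in> feasible" by (rule nonbad_feasible[OF p]) (use insert Xl nb in auto)
      from packable_add[OF insert.IH this] insert.prems
      have "packable feasible (\<lambda>r. loose_profile p (X1 \<union> Y) r + profile (home_large p s) r) (card (X1 \<union> Y) + 1)" by blast
      moreover have "loose_profile p (X1 \<union> insert s Y) = (\<lambda>r. loose_profile p (X1 \<union> Y) r + profile (home_large p s) r)"
        using f n by (intro ext) (simp add: loose_profile_def)
      ultimately show ?case using f n by simp
    qed
  qed
  from this[of "X - X1"] show ?thesis using X1 by (simp add: Un_absorb1)
qed

lemma good_mono: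
  assumes "p \<in> PP" "good p X" "X \<subseteq> Y" "Y \<subseteq> {..<l}"
  shows "good p Y"
  unfolding good_def
proof (intro conjI)
  show "packable feasible (loose_profile p Y) (card Y)"
    by (rule packable_extend[OF assms(1) _ assms(3,4)]) (use assms finite_subset in \<open>auto simp: good_def\<close>)
qed (use assms in \<open>auto simp: good_def\<close>)

definition TT :: "(bool \<times> (nat \<Rightarrow> nat)) set" where
  "TT = UNIV \<times> PiE_dflt {1..q*q} 0 (\<lambda>_. {..2*q})"

lemma finite_TT: "finite TT"
  unfolding TT_def by (intro finite_cartesian_product finite_PiE_dflt) auto

lemma card_home_large: "p \<in> PP \<Longrightarrow> s < l \<Longrightarrow> card (home_large p s) \<le> 2 * q"
proof -
  assume p: "p \<in> PP" and s: "s < l"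
  have "k * card (home_large p s) = (\<Sum>K\<in>home_large p s. k)" by simp
  also have "\<dots> \<le> (\<Sum>K\<in>home_large p s. q * card K)" by (rule sum_mono) (simp add: home_large_def large_def)
  also have "\<dots> \<le> (\<Sum>K\<in>{K \<in> C p. N p K = Some s}. q * card K)" using C_finite by (intro sum_mono2) (auto simp: home_large_def)
  also have "\<dots> = q * (\<Sum>K\<in>{K \<in> C p. N p K = Some s}. card K)" by (simp add: sum_distrib_left)
  also have "\<dots> \<le> q * (2 * k)" using home_load_any[OF p s] by (intro mult_le_mono2) linarith
  finally show "card (home_large p s) \<le> 2 * q" using k1 by simp
qed

lemma profile_home_large_le: "p \<in> PP \<Longrightarrow> s < l \<Longrightarrow> profile (home_large p s) r \<le> 2 * q"
proof -
  assume h: "p \<in> PP" "s < l"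
  have "profile (home_large p s) r \<le> card (home_large p s)" unfolding profile_def using home_large_finite by (intro card_mono) auto
  thus ?thesis using card_home_large[OF h] by linarith
qed

lemma server_type_TT: "p \<in> PP \<Longrightarrow> s < l \<Longrightarrow> server_type p s \<in> TT"
  using profile_zero[OF _ home_large_sub] profile_home_large_le by (simp add: server_type_def TT_def PiE_dflt_def)

lemma sum_by_type:
  assumes p: "p \<in> PP" and X: "X \<subseteq> {..<l}"
  shows "(\<Sum>s\<in>X. profile (home_large p s) r) = (\<Sum>a\<in>TT. card {s \<in> X. server_type p s = a} * snd a r)"
proof -
  have f: "finite X" using X finite_subset by blast
  have "(\<Sum>s\<in>X. profile (home_large p s) r) = (\<Sum>s\<in>X. snd (server_type p s) r)" by (simp add: server_type_def)
  also have "\<dots> = (\<Sum>a\<in>TT. \<Sum>s\<in>{s \<in> X. server_type p s = a}. snd (server_type p s) r)"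
    using f finite_TT server_type_TT[OF p] X by (intro sum.group[symmetric]) auto
  also have "\<dots> = (\<Sum>a\<in>TT. \<Sum>s\<in>{s \<in> X. server_type p s = a}. snd a r)" by (intro sum.cong) auto
  finally show ?thesis by simp
qed

lemma card_by_type:
  assumes p: "p \<in> PP" and X: "X \<subseteq> {..<l}"
  shows "card X = (\<Sum>a\<in>TT. card {s \<in> X. server_type p s = a})"
proof -
  have f: "finite X" using X finite_subset by blast
  have "(\<Sum>s\<in>X. 1::nat) = (\<Sum>a\<in>TT. \<Sum>s\<in>{s \<in> X. server_type p s = a}. 1)"
    using f finite_TT server_type_TT[OF p] X by (intro sum.group[symmetric]) auto
  thus ?thesis by simp
qed

lemma good_count_monotone:
  assumes p: "p \<in> PP"
  shows "count_monotone {..<l} TT (server_type p) (good p)"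
  unfolding count_monotone_def
proof (intro allI impI)
  fix X0 X assume X0: "X0 \<subseteq> {..<l}" and X: "X \<subseteq> {..<l}" and g: "good p X0"
    and le: "\<forall>a\<in>TT. card {s \<in> X0. server_type p s = a} \<le> card {s \<in> X. server_type p s = a}"
  have f: "finite X" "finite X0" using X X0 finite_subset by blast+
  have "\<forall>a\<in>TT. \<exists>Z. Z \<subseteq> {s \<in> X. server_type p s = a} \<and> card Z = card {s \<in> X0. server_type p s = a}"
    using le by (meson obtain_subset_with_card_n)
  from bchoice[OF this] obtain Z where Z: "\<And>a. a \<in> TT \<Longrightarrow> Z a \<subseteq> {s \<in> X. server_type p s = a}"
      "\<And>a. a \<in> TT \<Longrightarrow> card (Z a) = card {s \<in> X0. server_type p s = a}" by blast
  define X1 where "X1 = (\<Union>a\<in>TT. Z a)"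
  have X1X: "X1 \<subseteq> X" using Z(1) by (auto simp: X1_def)
  hence X1l: "X1 \<subseteq> {..<l}" using X by blast
  have cls: "{s \<in> X1. server_type p s = a} = Z a" if "a \<in> TT" for a using Z(1) that by (fastforce simp: X1_def)
  have cls0: "card {s \<in> X1. server_type p s = a} = card {s \<in> X0. server_type p s = a}" if "a \<in> TT" for a using cls[OF that] Z(2)[OF that] by simp
  have it1: "loose_profile p X1 = loose_profile p X0"
    by (intro ext) (simp add: loose_profile_def sum_by_type[OF p X1l] sum_by_type[OF p X0] cls0)
  have c1: "card X1 = card X0" unfolding card_by_type[OF p X1l] card_by_type[OF p X0] by (simp add: cls0)
  have bad1: "s \<in> X1" if s: "s < l" "bad p s" for s
  proof -
    let ?a = "server_type p s"
    have a: "?a \<in> TT" by (rule server_type_TT[OF p s(1)])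
    have sub: "{s \<in> {..<l}. server_type p s = ?a} \<subseteq> {s \<in> X0. server_type p s = ?a}"
    proof
      fix s' assume "s' \<in> {s \<in> {..<l}. server_type p s = ?a}"
      hence s': "s' < l" "server_type p s' = ?a" by auto
      hence "bad p s'" using s(2) by (simp add: server_type_def)
      thus "s' \<in> {s \<in> X0. server_type p s = ?a}" using g s' by (simp add: good_def)
    qed
    have "card {s \<in> {..<l}. server_type p s = ?a} \<le> card {s \<in> X1. server_type p s = ?a}"
      unfolding cls0[OF a] by (rule card_mono[OF _ sub]) (use f in simp)
    moreover have "{s \<in> X1. server_type p s = ?a} \<subseteq> {s \<in> {..<l}. server_type p s = ?a}" using X1l by blast
    ultimately have "{s \<in> X1. server_type p s = ?a} = {s \<in> {..<l}. server_type p s = ?a}" by (intro card_seteq) auto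
    moreover have "s \<in> {s \<in> {..<l}. server_type p s = ?a}" using s by simp
    ultimately show ?thesis by blast
  qed
  have "good p X1" unfolding good_def using X1l bad1 g it1 c1 by (simp add: good_def)
  thus "good p X" by (rule good_mono[OF p _ X1X X])
qed

end

section \<open>Comparison with a reference assignment\<close>

context housed
begin

definition reference :: "edge list \<Rightarrow> (nat \<Rightarrow> nat) \<Rightarrow> bool" where
  "reference p g \<longleftrightarrow> p \<in> PP \<and> valid_assignment V l (real k) (set p) g"

definition moved where "moved g = card {v \<in> V. g v \<noteq> f0 v}"
definition in_out where "in_out g s = card {v \<in> V. (g v = s) \<noteq> (f0 v = s)}"
definition touched where "touched g = {s. s < l \<and> k \<le> 16 * q * q * in_out g s}"

lemma reference_const:
  assumes "reference p g" "K \<in> C p" "u \<in> K" "v \<in> K"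
  shows "g u = g v" "g u < l"
proof -
  obtain s where "s < l" "\<forall>v\<in>K. g v = s"
    using assms(1,2) unfolding reference_def valid_assignment_def C_def by blast
  thus "g u = g v" "g u < l" using assms(3,4) by auto
qed

lemma C_coarser:
  assumes "p @ es \<in> PP" "K \<in> C p"
  shows "\<exists>K'\<in>C (p @ es). K \<subseteq> K'"
  using assms(1)
proof (induction es rule: rev_induct)
  case Nil thus ?case using assms(2) by (intro bexI[of _ K]) auto
next
  case (snoc e es)
  have q: "(p @ es) @ [e] \<in> PP" using snoc.prems by simp
  obtain K' where K': "K' \<in> C (p @ es)" "K \<subseteq> K'" using snoc.IH PP_closed[OF q] by blast
  from step_cases[OF q] have "\<exists>K''\<in>C ((p @ es) @ [e]). K' \<subseteq> K''"
  proof
    assume "C ((p @ es) @ [e]) = C (p @ es)" thus ?thesis using K' by auto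
  next
    assume "\<exists>A B. merge (p @ es) e A B"
    then obtain A B where "merge (p @ es) e A B" by blast
    note D = mergeD(5)[OF this q]
    show ?thesis
    proof (cases "K' \<in> {A, B}")
      case True thus ?thesis using D by auto
    next
      case False thus ?thesis using D K' by auto
    qed
  qed
  thus ?case using K' by auto
qed

lemma reference_take: "reference p g \<Longrightarrow> reference (take t p) g"
proof -
  assume r: "reference p g"
  hence p: "p \<in> PP" and v: "valid_assignment V l (real k) (set p) g" by (auto simp: reference_def)
  have "\<exists>s<l. \<forall>v\<in>K. g v = s" if K: "K \<in> components V (set (take t p))" for K
  proof -
    have "take t p @ drop t p \<in> PP" using p by simp
    from C_coarser[OF this, of K] K obtain K' where "K' \<in> C p" "K \<subseteq> K'" by (auto simp: C_def)
    moreover obtain s where "s < l" "\<forall>v\<in>K'. g v = s" using v calculation(1) unfolding valid_assignment_def C_def by blast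
    ultimately show ?thesis by blast
  qed
  thus ?thesis using v PP_take[OF p] unfolding reference_def valid_assignment_def by blast
qed

lemma sum_in_out:
  assumes r: "reference p g"
  shows "(\<Sum>s<l. in_out g s) = 2 * moved g"
proof -
  have gl: "g v < l" if "v \<in> V" for v using r that unfolding reference_def valid_assignment_def by blast
  have "(\<Sum>s<l. in_out g s) = (\<Sum>s<l. \<Sum>v\<in>V. if (g v = s) \<noteq> (f0 v = s) then 1 else 0)"
    unfolding in_out_def using fV by (intro sum.cong) (auto simp: sum.If_cases Int_def)
  also have "\<dots> = (\<Sum>v\<in>V. \<Sum>s<l. if (g v = s) \<noteq> (f0 v = s) then 1 else 0)" by (rule sum.swap)
  also have "\<dots> = (\<Sum>v\<in>V. if g v \<noteq> f0 v then 2 else 0)"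
  proof (rule sum.cong[OF refl])
    fix v assume v: "v \<in> V"
    have "(\<Sum>s<l. if (g v = s) \<noteq> (f0 v = s) then 1 else (0::nat)) = card {s. s < l \<and> (g v = s) \<noteq> (f0 v = s)}"
      by (simp add: sum.If_cases Int_def)
    also have "{s. s < l \<and> (g v = s) \<noteq> (f0 v = s)} = (if g v \<noteq> f0 v then {g v, f0 v} else {})"
      using gl[OF v] f0l[OF v] by auto
    also have "card \<dots> = (if g v \<noteq> f0 v then 2 else 0)" by simp
    finally show "(\<Sum>s<l. if (g v = s) \<noteq> (f0 v = s) then 1 else (0::nat)) = (if g v \<noteq> f0 v then 2 else 0)" .
  qed
  also have "\<dots> = 2 * moved g" using fV by (simp add: moved_def sum.If_cases Int_def)
  finally show ?thesis .
qed

lemma card_touched: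
  assumes "reference p g"
  shows "card (touched g) * k \<le> 32 * q * q * moved g"
proof -
  have "card (touched g) * k = (\<Sum>s\<in>touched g. k)" by simp
  also have "\<dots> \<le> (\<Sum>s\<in>touched g. 16 * q * q * in_out g s)" by (rule sum_mono) (simp add: touched_def)
  also have "\<dots> \<le> (\<Sum>s<l. 16 * q * q * in_out g s)" by (rule sum_mono2) (auto simp: touched_def)
  also have "\<dots> = 16 * q * q * (\<Sum>s<l. in_out g s)" by (simp add: sum_distrib_left)
  finally show ?thesis by (simp add: sum_in_out[OF assms])
qed

definition ref_server where "ref_server g K = g (SOME v. v \<in> K)"

lemma ref_server_eq: "reference p g \<Longrightarrow> K \<in> C p \<Longrightarrow> v \<in> K \<Longrightarrow> g v = ref_server g K"
  unfolding ref_server_def by (rule reference_const(1)) (auto intro: someI)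

lemma ref_server_l: "reference p g \<Longrightarrow> K \<in> C p \<Longrightarrow> ref_server g K < l"
proof -
  assume h: "reference p g" "K \<in> C p"
  then obtain v where "v \<in> K" using C_ne by blast
  thus ?thesis using ref_server_eq[OF h] reference_const(2)[OF h] by metis
qed

lemma in_out_split:
  assumes r: "reference p g"
  shows "in_out g s = (\<Sum>K\<in>C p. if ref_server g K = s then foreign K s else native K s)"
proof -
  have p: "p \<in> PP" using r by (simp add: reference_def)
  have "in_out g s = (\<Sum>K\<in>C p. card {v \<in> K. (g v = s) \<noteq> (f0 v = s)})" unfolding in_out_def by (rule C_partition_card[OF p, symmetric])
  also have "\<dots> = (\<Sum>K\<in>C p. if ref_server g K = s then foreign K s else native K s)"
  proof (rule sum.cong[OF refl])
    fix K assume K: "K \<in> C p"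
    have "{v \<in> K. (g v = s) \<noteq> (f0 v = s)} = (if ref_server g K = s then {v \<in> K. f0 v \<noteq> s} else {v \<in> K. f0 v = s})"
      using ref_server_eq[OF r K] by auto
    thus "card {v \<in> K. (g v = s) \<noteq> (f0 v = s)} = (if ref_server g K = s then foreign K s else native K s)"
      by (simp add: foreign_def native_def)
  qed
  finally show ?thesis .
qed

lemma in_out_ge:
  assumes "reference p g" "K \<in> C p"
  shows "(if ref_server g K = s then foreign K s else native K s) \<le> in_out g s"
  unfolding in_out_split[OF assms(1)] by (rule member_le_sum[OF assms(2)]) (auto simp: C_finite)

lemma native_le_foreign_home:
  assumes p: "p \<in> PP" "K \<in> C p" and n: "N p K \<noteq> Some s"
  shows "native K s \<le> 16 * q * foreign K s"
proof (cases "N p K")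
  case None
  have "card K \<le> 16 * q * foreign K s" by (rule okhomeD_None'[OF _ C_le_k[OF p]]) (use okN[OF p] None in simp)
  thus ?thesis using native_foreign[OF C_fin[OF p], of s] by linarith
next
  case (Some c)
  have "3 * card K \<le> 4 * native K c" by (rule okhomeD_Some(2)) (use okN[OF p] Some in simp)
  moreover have "native K c \<le> foreign K s" using native_le_foreign[OF C_fin[OF p]] n Some by auto
  ultimately have "native K s \<le> 3 * foreign K s" using native_foreign[OF C_fin[OF p], of s] by linarith
  also have "\<dots> \<le> 16 * q * foreign K s" using q1 by (intro mult_le_mono1) simp
  finally show ?thesis .
qed

lemma displaced_le_in_out:
  assumes r: "reference p g"
  shows "displaced p s \<le> 16 * q * in_out g s"
proof -
  have p: "p \<in> PP" using r by (simp add: reference_def)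
  have "(if N p K = Some s then foreign K s else native K s) \<le> 16 * q * (if ref_server g K = s then foreign K s else native K s)" if K: "K \<in> C p" for K
  proof -
    have q16: "x \<le> 16 * q * x" for x :: nat using q1 by simp
    show ?thesis
    proof (cases "N p K = Some s")
      case True
      have "3 * card K \<le> 4 * native K s" by (rule okhomeD_Some(2)) (use okN[OF p K] True in simp)
      hence "foreign K s \<le> native K s" using native_foreign[OF C_fin[OF p K], of s] by linarith
      hence "foreign K s \<le> 16 * q * native K s" using q16[of "native K s"] by (rule order_trans)
      thus ?thesis using True q16[of "foreign K s"] by auto
    next
      case False
      thus ?thesis using native_le_foreign_home[OF p K False] q16[of "native K s"] by auto
    qed
  qed
  hence "displaced p s \<le> (\<Sum>K\<in>C p. 16 * q * (if ref_server g K = s then foreign K s else native K s))" unfolding displaced_def by (rule sum_mono)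
  also have "\<dots> = 16 * q * in_out g s" by (simp only: in_out_split[OF r] sum_distrib_left)
  finally show ?thesis .
qed

lemma bad_touched:
  assumes r: "reference p g" and s: "s < l" "bad p s"
  shows "s \<in> touched g"
proof -
  obtain t where t: "k \<le> q * displaced (take t p) s" using s(2) by (auto simp: bad_def)
  also have "\<dots> \<le> q * (16 * q * in_out g s)" by (rule mult_le_mono2[OF displaced_le_in_out[OF reference_take[OF r]]])
  finally show ?thesis using s(1) by (simp add: touched_def algebra_simps)
qed

lemma large_home_ref_server:
  assumes r: "reference p g" and K: "K \<in> C p" "large K" and s: "s < l" "s \<notin> touched g"
  shows "N p K = Some s \<longleftrightarrow> ref_server g K = s"
proof
  have p: "p \<in> PP" using r by (simp add: reference_def)
  have lt: "16 * q * q * in_out g s < k" using s by (auto simp: touched_def)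
  have lt1: "16 * q * in_out g s < k"
  proof -
    have "16 * q * in_out g s \<le> 16 * q * q * in_out g s" using q1 by simp
    thus ?thesis using lt by linarith
  qed
  { assume n: "N p K = Some s"
    show "ref_server g K = s"
    proof (rule ccontr)
      assume "ref_server g K \<noteq> s"
      hence c: "native K s \<le> in_out g s" using in_out_ge[OF r K(1), of s] by simp
      have "3 * card K \<le> 4 * native K s" by (rule okhomeD_Some(2)) (use okN[OF p K(1)] n in simp)
      hence "card K \<le> 2 * in_out g s" using c by linarith
      hence "k \<le> 16 * q * in_out g s" by (rule large_foreign) (use K(2) in simp_all)
      thus False using lt1 by simp
    qed }
  { assume gK: "ref_server g K = s"
    show "N p K = Some s"
    proof (rule ccontr)
      assume n: "N p K \<noteq> Some s"
      have f: "foreign K s \<le> in_out g s" using in_out_ge[OF r K(1), of s] gK by simp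
      have "k \<le> 16 * q * foreign K s"
      proof (cases "N p K")
        case None
        thus ?thesis using okhomeD_None(1)[OF _ K(2)] okN[OF p K(1)] by simp
      next
        case (Some c)
        have "3 * card K \<le> 4 * native K c" by (rule okhomeD_Some(2)) (use okN[OF p K(1)] Some in simp)
        moreover have "native K c \<le> foreign K s" using native_le_foreign[OF C_fin[OF p K(1)]] n Some by auto
        ultimately have "card K \<le> 2 * foreign K s" by linarith
        thus ?thesis by (rule large_foreign) (use K(2) in simp_all)
      qed
      also have "\<dots> \<le> 16 * q * in_out g s" using f by (rule mult_le_mono2)
      finally show False using lt1 by simp
    qed }
qed

lemma label_counts:
  assumes "finite U" and c: "\<forall>s\<in>U. c s \<in> feasible"
  shows "items feasible (\<lambda>d. card {s \<in> U. c s = d}) r = (\<Sum>s\<in>U. c s r)" "(\<Sum>d\<in>feasible. card {s \<in> U. c s = d}) = card U"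
proof -
  have "items feasible (\<lambda>d. card {s \<in> U. c s = d}) r = (\<Sum>d\<in>feasible. \<Sum>s\<in>{s \<in> U. c s = d}. c s r)"
    unfolding items_def by (intro sum.cong) auto
  also have "\<dots> = (\<Sum>s\<in>U. c s r)" using assms(1) finite_feasible by (rule sum.group) (use c in auto)
  finally show "items feasible (\<lambda>d. card {s \<in> U. c s = d}) r = (\<Sum>s\<in>U. c s r)" .
  show "(\<Sum>d\<in>feasible. card {s \<in> U. c s = d}) = card U"
    using assms(1) finite_feasible by (rule sum_card_fibres) (use c in auto)
qed

lemma loose_profile_profile: "finite X \<Longrightarrow> loose_profile p X r = profile (free_large p \<union> (\<Union>s\<in>X. home_large p s)) r"
proof -
  assume fX: "finite X"
  have "profile (free_large p \<union> (\<Union>s\<in>X. home_large p s)) r = profile (free_large p) r + profile (\<Union>s\<in>X. home_large p s) r"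
    by (rule profile_Un) (use free_large_finite home_large_finite fX home_large_free_large_disj in blast)+
  also have "profile (\<Union>s\<in>X. home_large p s) r = (\<Sum>s\<in>X. profile (home_large p s) r)" by (rule profile_UN[OF fX home_large_finite home_large_disj])
  finally show ?thesis by (simp add: loose_profile_def)
qed

lemma touched_good:
  assumes r: "reference p g"
  shows "good p (touched g)"
proof -
  have p: "p \<in> PP" using r by (simp add: reference_def)
  have fX: "finite (touched g)" by (rule finite_subset[of _ "{..<l}"]) (auto simp: touched_def)
  define \<K> where "\<K> s = {K \<in> C p. large K \<and> ref_server g K = s}" for s
  have cC: "profile (\<K> s) \<in> feasible" if s: "s < l" for s
  proof (rule profile_in_feasible[OF p])
    show "\<K> s \<subseteq> C p" by (auto simp: \<K>_def)
    show "large K" if "K \<in> \<K> s" for K using that by (simp add: \<K>_def)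
    have "(\<Sum>K\<in>\<K> s. card K) = (\<Sum>K\<in>\<K> s. card {v \<in> K. g v = s})"
    proof (rule sum.cong[OF refl])
      fix K assume "K \<in> \<K> s"
      hence "{v \<in> K. g v = s} = K" using ref_server_eq[OF r] by (auto simp: \<K>_def)
      thus "card K = card {v \<in> K. g v = s}" by simp
    qed
    also have "\<dots> \<le> (\<Sum>K\<in>C p. card {v \<in> K. g v = s})" using C_finite by (intro sum_mono2) (auto simp: \<K>_def)
    also have "\<dots> = card {v \<in> V. g v = s}" by (rule C_partition_card[OF p])
    also have "\<dots> \<le> k" using r s unfolding reference_def valid_assignment_def by (metis of_nat_le_iff)
    finally have "q * (\<Sum>K\<in>\<K> s. card K) \<le> q * k" by (rule mult_le_mono2)
    thus "q * (\<Sum>K\<in>\<K> s. card K) \<le> q * k + k" by linarith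
  qed
  have "free_large p \<union> (\<Union>s\<in>touched g. home_large p s) = (\<Union>s\<in>touched g. \<K> s)"
  proof (rule set_eqI)
    fix K
    show "K \<in> free_large p \<union> (\<Union>s\<in>touched g. home_large p s) \<longleftrightarrow> K \<in> (\<Union>s\<in>touched g. \<K> s)"
    proof (cases "K \<in> C p \<and> large K")
      case False thus ?thesis by (auto simp: free_large_def home_large_def \<K>_def)
    next
      case True
      note h = large_home_ref_server[OF r conjunct1[OF True] conjunct2[OF True]]
      have gl: "ref_server g K < l" by (rule ref_server_l[OF r conjunct1[OF True]])
      have nl: "c < l" if "N p K = Some c" for c
        by (rule okhomeD_Some(1)) (use okN[OF p conjunct1[OF True]] that in simp)
      have "K \<in> free_large p \<union> (\<Union>s\<in>touched g. home_large p s) \<longleftrightarrow> (\<forall>c. N p K = Some c \<longrightarrow> c \<in> touched g)"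
        using True by (cases "N p K") (auto simp: free_large_def home_large_def)
      also have "\<dots> \<longleftrightarrow> ref_server g K \<in> touched g"
      proof
        assume a: "\<forall>c. N p K = Some c \<longrightarrow> c \<in> touched g"
        show "ref_server g K \<in> touched g"
        proof (rule ccontr)
          assume n: "ref_server g K \<notin> touched g"
          have "N p K = Some (ref_server g K)" using h[OF gl n] by simp
          thus False using a n by blast
        qed
      next
        assume a: "ref_server g K \<in> touched g"
        show "\<forall>c. N p K = Some c \<longrightarrow> c \<in> touched g"
        proof (intro allI impI, rule ccontr)
          fix c assume c: "N p K = Some c" "c \<notin> touched g"
          have "ref_server g K = c" using h[OF nl[OF c(1)] c(2)] c(1) by simp
          thus False using a c(2) by simp
        qed
      qed
      also have "\<dots> \<longleftrightarrow> K \<in> (\<Union>s\<in>touched g. \<K> s)" using True by (auto simp: \<K>_def)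
      finally show ?thesis .
    qed
  qed
  moreover have "profile (\<Union>s\<in>touched g. \<K> s) r = (\<Sum>s\<in>touched g. profile (\<K> s) r)" for r
    by (rule profile_UN[OF fX]) (use C_finite in \<open>auto simp: \<K>_def\<close>)
  ultimately have loose_profile: "loose_profile p (touched g) r = (\<Sum>s\<in>touched g. profile (\<K> s) r)" for r by (simp add: loose_profile_profile[OF fX])
  define P where "P = (\<lambda>c. card {s \<in> touched g. profile (\<K> s) = c})"
  have cX: "\<forall>s\<in>touched g. profile (\<K> s) \<in> feasible" using cC by (auto simp: touched_def)
  have 1: "items feasible P = loose_profile p (touched g)"
    unfolding P_def by (rule ext) (simp only: label_counts(1)[OF fX cX] loose_profile)
  have 2: "sum P feasible = card (touched g)" unfolding P_def by (rule label_counts(2)[OF fX cX])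
  have "packable feasible (loose_profile p (touched g)) (card (touched g))" unfolding packable_def using 1 2 by blast
  thus ?thesis unfolding good_def using bad_touched[OF r] by (auto simp: touched_def)
qed

lemma all_good: "p \<in> PP \<Longrightarrow> good p {..<l}"
proof -
  assume p: "p \<in> PP"
  then obtain g where "reference p g" using PP_valid unfolding reference_def by blast
  from touched_good[OF this] show ?thesis by (rule good_mono[OF p]) (auto simp: touched_def)
qed

definition natural_cost :: "edge list \<Rightarrow> real" where
  "natural_cost p = (case AB p of None \<Rightarrow> 0 | Some ab \<Rightarrow> natcost (fst ab) (snd ab) (N (butlast p) (fst ab)) (N (butlast p) (snd ab)))"

definition moved_potential where "moved_potential g p = (\<Sum>K\<in>C p. real (card {v \<in> K. g v \<noteq> f0 v}) * ln (card K))"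
definition slack_potential where "slack_potential p = (\<Sum>K\<in>C p. slack K (N p K))"

lemma natural_cost_step:
  assumes p: "p @ [e] \<in> PP" and r: "reference (p @ [e]) g"
  shows "natural_cost (p @ [e]) + slack_potential (p @ [e]) \<le> slack_potential p + 160 * real q * (moved_potential g (p @ [e]) - moved_potential g p)"
proof (cases rule: step_home[OF p])
  case 1 thus ?thesis by (simp add: natural_cost_def slack_potential_def moved_potential_def)
next
  case (2 A B)
  note D = mergeD[OF 2(2) p]
  have pP: "p \<in> PP" by (rule PP_closed[OF p])
  have s: "slack_potential (p @ [e]) + (slack A (N p A) + slack B (N p B)) = slack_potential p + slack (A \<union> B) (N (p @ [e]) (A \<union> B))"
    unfolding slack_potential_def by (rule sum_merge[OF 2(2) p]) (simp add: 2(4))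
  have n: "moved_potential g (p @ [e]) + (real (card {v \<in> A. g v \<noteq> f0 v}) * ln (card A) + real (card {v \<in> B. g v \<noteq> f0 v}) * ln (card B))
     = moved_potential g p + real (card {v \<in> A \<union> B. g v \<noteq> f0 v}) * ln (card (A \<union> B))"
    unfolding moved_potential_def by (rule sum_merge[OF 2(2) p]) simp
  have gc: "g u = g v" if "u \<in> A \<union> B" "v \<in> A \<union> B" for u v by (rule reference_const(1)[OF r D(14) that])
  have c: "real (cross A B) / real (card A + card B) \<le> moved_potential g (p @ [e]) - moved_potential g p"
    using cross_charge[where g = g, OF D(6,7,8,9,10) gc] n by linarith
  have "natcost A B (N p A) (N p B) + slack (A \<union> B) (newhome (A \<union> B) (N p B))
     \<le> slack A (N p A) + slack B (N p B) + 160 * real q * (real (cross A B) / real (card A + card B))"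
    by (rule natcost_slack[OF D(6,7,8,4,9,11,12) okN[OF pP D(1)] okN[OF pP D(2)]])
  also have "160 * real q * (real (cross A B) / real (card A + card B)) \<le> 160 * real q * (moved_potential g (p @ [e]) - moved_potential g p)"
    using c by (rule mult_left_mono) simp
  finally show ?thesis using s 2(3) by (simp add: natural_cost_def 2(1))
qed

lemma natural_cost_sum:
  assumes r: "reference p g"
  shows "(\<Sum>t<length p. natural_cost (take (Suc t) p)) \<le> 160 * real q * (real (moved g) * ln (real k))"
proof -
  have p: "p \<in> PP" using r by (simp add: reference_def)
  have "(\<Sum>t<m. natural_cost (take (Suc t) p)) + slack_potential (take m p) \<le> slack_potential [] + 160 * real q * (moved_potential g (take m p) - moved_potential g [])"
    if "m \<le> length p" for m using that
  proof (induction m)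
    case (Suc m)
    have e: "take (Suc m) p = take m p @ [p ! m]" using Suc.prems by (simp add: take_Suc_conv_app_nth)
    have "take m p @ [p ! m] \<in> PP" "reference (take m p @ [p ! m]) g" using PP_take[OF p, of "Suc m"] reference_take[OF r, of "Suc m"] e by simp_all
    from natural_cost_step[OF this] Suc show ?case by (simp add: e algebra_simps)
  qed simp
  from this[of "length p"] have 1: "(\<Sum>t<length p. natural_cost (take (Suc t) p)) + slack_potential p \<le> slack_potential [] + 160 * real q * (moved_potential g p - moved_potential g [])" by simp
  have s0: "slack_potential [] = 0"
    unfolding slack_potential_def by (intro sum.neutral) (simp add: N_def F0 slack_def)
  have s1: "slack_potential p \<ge> 0" unfolding slack_potential_def by (intro sum_nonneg slack_nonneg)
  have n0: "moved_potential g [] = 0" unfolding moved_potential_def C_Nil by (intro sum.neutral) auto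
  have "moved_potential g p \<le> (\<Sum>K\<in>C p. real (card {v \<in> K. g v \<noteq> f0 v}) * ln (real k))"
    unfolding moved_potential_def
  proof (rule sum_mono)
    fix K assume K: "K \<in> C p"
    have "ln (real (card K)) \<le> ln (real k)" using C_le_k[OF p K] C_pos[OF p K] by simp
    thus "real (card {v \<in> K. g v \<noteq> f0 v}) * ln (real (card K)) \<le> real (card {v \<in> K. g v \<noteq> f0 v}) * ln (real k)"
      by (rule mult_left_mono) simp
  qed
  also have "\<dots> = real (\<Sum>K\<in>C p. card {v \<in> K. g v \<noteq> f0 v}) * ln (real k)" by (simp add: sum_distrib_right)
  also have "(\<Sum>K\<in>C p. card {v \<in> K. g v \<noteq> f0 v}) = moved g" unfolding moved_def by (rule C_partition_card[OF p])
  finally have "160 * real q * moved_potential g p \<le> 160 * real q * (real (moved g) * ln (real k))" by (rule mult_left_mono) simp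
  thus ?thesis using 1 s0 s1 n0 by simp
qed

definition level :: "nat set \<Rightarrow> nat option \<Rightarrow> nat \<Rightarrow> nat" where
  "level K h s = (if \<not> large K then 0 else if h = Some s then size_class K else q * q + 1)"
definition level_potential where "level_potential p s = (\<Sum>K\<in>C p. native K s * level K (N p K) s)"

lemma large_mono: "finite B \<Longrightarrow> A \<subseteq> B \<Longrightarrow> large A \<Longrightarrow> large B"
  unfolding large_def by (meson card_mono mult_le_mono2 order_trans)

lemma home_persist:
  assumes m: "merge p e A B" "p @ [e] \<in> PP" and X: "X \<in> {A, B}" and lg: "large X"
    and N': "N (p @ [e]) (A \<union> B) = Some s"
  shows "N p X = Some s"
proof (rule ccontr)
  assume n: "N p X \<noteq> Some s"
  note D = mergeD[OF m]
  have pP: "p \<in> PP" by (rule PP_closed[OF m(2)])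
  have XC: "X \<in> C p" using X D(1,2) by blast
  have XK: "X \<subseteq> A \<union> B" using X by blast
  have fK: "finite (A \<union> B)" using D by simp
  have lK: "large (A \<union> B)" by (rule large_mono[OF fK XK lg])
  have "16 * q * foreign (A \<union> B) s < k"
    using okhomeD_Some(3)[OF _ lK, of s] okN[OF m(2) D(14)] N' by simp
  moreover have "foreign X s \<le> foreign (A \<union> B) s" by (rule foreign_mono[OF fK XK])
  hence "16 * q * foreign X s \<le> 16 * q * foreign (A \<union> B) s" by (rule mult_le_mono2)
  moreover have "k \<le> 16 * q * foreign X s"
  proof (cases "N p X")
    case None thus ?thesis using okhomeD_None(1)[OF _ lg] okN[OF pP XC] by simp
  next
    case (Some c)
    have "3 * card X \<le> 4 * native X c" by (rule okhomeD_Some(2)) (use okN[OF pP XC] Some in simp)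
    moreover have "native X c \<le> foreign X s" using native_le_foreign[OF C_fin[OF pP XC]] n Some by auto
    ultimately have "card X \<le> 2 * foreign X s" by linarith
    thus ?thesis by (rule large_foreign) (use lg in simp_all)
  qed
  ultimately show False by linarith
qed

lemma level_mono:
  assumes m: "merge p e A B" "p @ [e] \<in> PP" and X: "X \<in> {A, B}"
  shows "level X (N p X) s \<le> level (A \<union> B) (N (p @ [e]) (A \<union> B)) s"
proof (cases "large X")
  case False thus ?thesis by (simp add: level_def)
next
  case lg: True
  note D = mergeD[OF m]
  have pP: "p \<in> PP" by (rule PP_closed[OF m(2)])
  have XK: "X \<subseteq> A \<union> B" and fK: "finite (A \<union> B)" and XC: "X \<in> C p" using X D by auto
  have lK: "large (A \<union> B)" by (rule large_mono[OF fK XK lg])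
  show ?thesis
  proof (cases "N (p @ [e]) (A \<union> B) = Some s")
    case True
    have "N p X = Some s" by (rule home_persist[OF m X lg True])
    thus ?thesis using True lg lK size_class_mono[OF card_mono[OF fK XK]] by (simp add: level_def)
  next
    case False
    thus ?thesis using lK lg size_class_bounds(1)[OF pP XC] by (auto simp: level_def)
  qed
qed

lemma profile_merge:
  assumes m: "merge p e A B" "p @ [e] \<in> PP" and N': "\<And>K. K \<in> C p \<Longrightarrow> N (p @ [e]) K = N p K"
  shows "profile {K \<in> C (p @ [e]). large K \<and> N (p @ [e]) K = h} r
      + ((if large A \<and> N p A = h \<and> size_class A = r then 1 else 0) + (if large B \<and> N p B = h \<and> size_class B = r then 1 else 0))
    = profile {K \<in> C p. large K \<and> N p K = h} r
      + (if large (A \<union> B) \<and> N (p @ [e]) (A \<union> B) = h \<and> size_class (A \<union> B) = r then 1 else 0)"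
proof -
  have e: "profile {K \<in> C p. large K \<and> N p K = h} r = (\<Sum>K\<in>C p. if large K \<and> N p K = h \<and> size_class K = r then 1 else 0)" for p
    unfolding profile_def using C_finite by (simp add: sum.If_cases Int_def conj_assoc)
  show ?thesis unfolding e by (rule sum_merge[OF m]) (simp add: N')
qed

lemma type_change_level:
  assumes m: "merge p e A B" "p @ [e] \<in> PP" and N': "\<And>K. K \<in> C p \<Longrightarrow> N (p @ [e]) K = N p K"
    and ch: "profile {K \<in> C (p @ [e]). large K \<and> N (p @ [e]) K = h} \<noteq> profile {K \<in> C p. large K \<and> N p K = h}"
    and hN: "h = None \<or> h = Some s"
  defines "lv K h' \<equiv> (if \<not> large K then 0 else if h' = h then size_class K else if h = None then 0 else q * q + 1)"
  shows "(large A \<and> N p A = h \<and> lv A (N p A) < lv (A \<union> B) (N (p @ [e]) (A \<union> B))) \<or>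
         (large B \<and> N p B = h \<and> lv B (N p B) < lv (A \<union> B) (N (p @ [e]) (A \<union> B))) \<or>
         (large (A \<union> B) \<and> N (p @ [e]) (A \<union> B) = h \<and> \<not> (large A \<and> N p A = h) \<and> \<not> (large B \<and> N p B = h))
         \<or> h = None \<and> N (p @ [e]) (A \<union> B) \<noteq> None \<and> (large A \<and> N p A = None \<or> large B \<and> N p B = None)"
proof -
  note D = mergeD[OF m]
  have pP: "p \<in> PP" by (rule PP_closed[OF m(2)])
  let ?K = "A \<union> B"
  have fK: "finite ?K" using D by simp
  have lK: "large A \<or> large B \<Longrightarrow> large ?K" using large_mono[OF fK] by blast
  have rA: "size_class A \<in> {1..q*q}" "size_class B \<in> {1..q*q}" using size_class_bounds(1)[OF pP] D by blast+
  define a where "a \<longleftrightarrow> large A \<and> N p A = h"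
  define b where "b \<longleftrightarrow> large B \<and> N p B = h"
  define c where "c \<longleftrightarrow> large ?K \<and> N (p @ [e]) ?K = h"
  have cc: "large ?K \<and> N (p @ [e]) ?K = h \<longleftrightarrow> c" "large A \<and> N p A = h \<longleftrightarrow> a" "large B \<and> N p B = h \<longleftrightarrow> b"
    by (simp_all add: a_def b_def c_def)
  have eq: "profile {K \<in> C (p @ [e]). large K \<and> N (p @ [e]) K = h} r
      + ((if a \<and> size_class A = r then 1 else 0) + (if b \<and> size_class B = r then 1 else 0))
    = profile {K \<in> C p. large K \<and> N p K = h} r + (if c \<and> size_class ?K = r then 1 else 0)" for r
    using profile_merge[OF m N', of h r] by (simp only: conj_assoc[symmetric] cc)
  obtain r where r: "profile {K \<in> C (p @ [e]). large K \<and> N (p @ [e]) K = h} r \<noteq> profile {K \<in> C p. large K \<and> N p K = h} r"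
    using ch by (auto simp: fun_eq_iff)
  have abc: "a \<or> b \<or> c" using eq[of r] r by (auto split: if_splits)
  show ?thesis
  proof (cases "a \<or> b")
    case False thus ?thesis using abc by (auto simp: a_def b_def c_def)
  next
    case True
    hence lgK: "large ?K" using lK by (auto simp: a_def b_def)
    show ?thesis
    proof (cases "N (p @ [e]) ?K = h")
      case False
      show ?thesis
      proof (cases "h = None")
        case True thus ?thesis using \<open>a \<or> b\<close> False by (auto simp: a_def b_def)
      next
        case hn: False
        show ?thesis using True False hn lgK rA by (auto simp: a_def b_def lv_def)
      qed
    next
      case hK: True
      hence c: "c" using lgK by (simp add: c_def)
      have rl: "size_class A < size_class ?K" if "large B" using size_class_large_union[OF that, of A ?K] D(16) by simp
      have rl2: "size_class B < size_class ?K" if "large A" using size_class_large_union[OF that, of B ?K] D(16) by simp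
      show ?thesis
      proof (cases "a \<and> b")
        case True
        hence "large A" "N p A = h" "large B" by (auto simp: a_def b_def)
        thus ?thesis using rl hK lgK by (simp add: lv_def)
      next
        case nab: False
        show ?thesis
        proof (cases a)
          case True
          hence "size_class A \<noteq> size_class ?K" using eq[of r] r nab c by (auto split: if_splits)
          moreover have "size_class A \<le> size_class ?K" by (rule size_class_mono) (use D(16) in simp)
          ultimately show ?thesis using True hK lgK by (simp add: a_def lv_def)
        next
          case False
          hence b using \<open>a \<or> b\<close> by simp
          hence "size_class B \<noteq> size_class ?K" using eq[of r] r False c by (auto split: if_splits)
          moreover have "size_class B \<le> size_class ?K" by (rule size_class_mono) (use D(16) in simp)
          ultimately show ?thesis using \<open>b\<close> hK lgK by (simp add: b_def lv_def)
        qed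
      qed
    qed
  qed
qed

end

lemma count_by_potential:
  fixes \<phi> :: "nat \<Rightarrow> nat"
  assumes "\<And>t. t < n \<Longrightarrow> \<phi> t + (if Q t then c else 0) \<le> \<phi> (Suc t)"
  shows "\<phi> 0 + c * card {t. t < n \<and> Q t} \<le> \<phi> n"
  using assms
proof (induction n)
  case 0 thus ?case by simp
next
  case (Suc n)
  have "{t. t < Suc n \<and> Q t} = (if Q n then insert n {t. t < n \<and> Q t} else {t. t < n \<and> Q t})"
    by (auto simp: less_Suc_eq)
  hence "card {t. t < Suc n \<and> Q t} = card {t. t < n \<and> Q t} + (if Q n then 1 else 0)" by simp
  moreover have "\<phi> 0 + c * card {t. t < n \<and> Q t} \<le> \<phi> n" by (rule Suc.IH) (use Suc.prems in simp)
  moreover have "\<phi> n + (if Q n then c else 0) \<le> \<phi> (Suc n)" by (rule Suc.prems) simp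
  ultimately show ?case by (cases "Q n") simp_all
qed

context housed
begin

lemma take_Suc_PP:
  assumes "p \<in> PP" "t < length p"
  shows "take (Suc t) p = take t p @ [p ! t]" "take t p @ [p ! t] \<in> PP" "butlast (take (Suc t) p) = take t p"
proof -
  show e: "take (Suc t) p = take t p @ [p ! t]" using assms(2) by (rule take_Suc_conv_app_nth)
  show "take t p @ [p ! t] \<in> PP" using PP_take[OF assms(1), of "Suc t"] by (simp only: e)
  show "butlast (take (Suc t) p) = take t p" unfolding e by simp
qed

lemma level_le: "p \<in> PP \<Longrightarrow> K \<in> C p \<Longrightarrow> level K h s \<le> q * q + 1"
  using size_class_bounds(1)[of p K] by (auto simp: level_def)

lemma home_native:
  assumes "p \<in> PP" "K \<in> C p" "large K" "N p K = Some s"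
  shows "k \<le> 4 * q * native K s"
proof -
  have "3 * card K \<le> 4 * native K s" by (rule okhomeD_Some(2)) (use okN[OF assms(1,2)] assms(4) in simp)
  hence "card K \<le> 4 * native K s" by linarith
  hence "q * card K \<le> q * (4 * native K s)" by (rule mult_le_mono2)
  moreover have "k \<le> q * card K" using assms(3) by (simp only: large_def)
  ultimately have "k \<le> q * (4 * native K s)" by (rule order_trans[rotated])
  thus ?thesis by (simp only: mult.assoc mult.left_commute)
qed

lemma level_potential_step:
  assumes p: "p @ [e] \<in> PP"
  shows "4 * q * level_potential p s + (if profile (home_large (p @ [e]) s) \<noteq> profile (home_large p s) then k else 0) \<le> 4 * q * level_potential (p @ [e]) s"
proof (cases rule: step_home[OF p])
  case 1
  hence "home_large (p @ [e]) s = home_large p s" "level_potential (p @ [e]) s = level_potential p s" by (simp_all add: home_large_def level_potential_def)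
  thus ?thesis by simp
next
  case (2 A B)
  note D = mergeD[OF 2(2) p]
  have pP: "p \<in> PP" by (rule PP_closed[OF p])
  let ?K = "A \<union> B"
  let ?a = "level A (N p A) s" and ?b = "level B (N p B) s" and ?c = "level ?K (N (p @ [e]) ?K) s"
  have eq: "level_potential (p @ [e]) s + (native A s * ?a + native B s * ?b) = level_potential p s + native ?K s * ?c"
    unfolding level_potential_def by (rule sum_merge[OF 2(2) p]) (simp add: 2(4))
  have cK: "native ?K s = native A s + native B s" by (rule native_Un[OF D(6,7,8)])
  have le: "?a \<le> ?c" "?b \<le> ?c" by (rule level_mono[OF 2(2) p], simp)+
  have m: "native A s * ?a \<le> native A s * ?c" "native B s * ?b \<le> native B s * ?c" using le by simp_all
  have key: "4 * q * level_potential p s + k \<le> 4 * q * level_potential (p @ [e]) s"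
    if x: "k \<le> 4 * q * x" "x + native A s * ?a + native B s * ?b \<le> native A s * ?c + native B s * ?c" for x
  proof -
    have "level_potential p s + x \<le> level_potential (p @ [e]) s" using eq x(2) unfolding cK add_mult_distrib by linarith
    hence "4 * q * (level_potential p s + x) \<le> 4 * q * level_potential (p @ [e]) s" by (rule mult_le_mono2)
    thus ?thesis using x(1) by (simp add: algebra_simps)
  qed
  show ?thesis
  proof (cases "profile (home_large (p @ [e]) s) = profile (home_large p s)")
    case True
    have "level_potential p s \<le> level_potential (p @ [e]) s" using eq m unfolding cK add_mult_distrib by linarith
    thus ?thesis using True by simp
  next
    case False
    have ch: "profile {K \<in> C (p @ [e]). large K \<and> N (p @ [e]) K = Some s} \<noteq> profile {K \<in> C p. large K \<and> N p K = Some s}"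
      using False by (simp add: home_large_def)
    have lv: "(if \<not> large K then 0 else if h' = Some s then size_class K else if Some s = None then 0 else q * q + 1) = level K h' s" for K h'
      by (simp add: level_def)
    have tc: "(large A \<and> N p A = Some s \<and> ?a < ?c) \<or> (large B \<and> N p B = Some s \<and> ?b < ?c) \<or>
         (large ?K \<and> N (p @ [e]) ?K = Some s \<and> \<not> (large A \<and> N p A = Some s) \<and> \<not> (large B \<and> N p B = Some s))"
      using type_change_level[OF 2(2) p 2(4) ch, of s] unfolding lv by simp
    from tc have "4 * q * level_potential p s + k \<le> 4 * q * level_potential (p @ [e]) s"
    proof (elim disjE conjE)
      assume a: "large A" "N p A = Some s" "?a < ?c"
      show ?thesis
      proof (rule key[of "native A s"])
        show "k \<le> 4 * q * native A s" by (rule home_native[OF pP D(1) a(1,2)])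
        have "native A s * Suc ?a \<le> native A s * ?c" using a(3) by (intro mult_le_mono2) simp
        thus "native A s + native A s * ?a + native B s * ?b \<le> native A s * ?c + native B s * ?c" using m(2) unfolding mult_Suc_right by linarith
      qed
    next
      assume a: "large B" "N p B = Some s" "?b < ?c"
      show ?thesis
      proof (rule key[of "native B s"])
        show "k \<le> 4 * q * native B s" by (rule home_native[OF pP D(2) a(1,2)])
        have "native B s * Suc ?b \<le> native B s * ?c" using a(3) by (intro mult_le_mono2) simp
        thus "native B s + native A s * ?a + native B s * ?b \<le> native A s * ?c + native B s * ?c" using m(1) unfolding mult_Suc_right by linarith
      qed
    next
      assume a: "large ?K" "N (p @ [e]) ?K = Some s" "\<not> (large A \<and> N p A = Some s)" "\<not> (large B \<and> N p B = Some s)"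
      have nl: "\<not> large A" "\<not> large B" using home_persist[OF 2(2) p _ _ a(2)] a(3,4) by blast+
      show ?thesis
      proof (rule key[of "native ?K s"])
        show "k \<le> 4 * q * native ?K s" by (rule home_native[OF p D(14) a(1,2)])
        have "1 \<le> ?c" using size_class_bounds(1)[OF p D(14)] a(1,2) by (simp add: level_def)
        hence "native ?K s * 1 \<le> native ?K s * ?c" by (rule mult_le_mono2)
        thus "native ?K s + native A s * ?a + native B s * ?b \<le> native A s * ?c + native B s * ?c"
          using nl unfolding cK by (simp add: level_def add_mult_distrib)
      qed
    qed
    thus ?thesis using False by simp
  qed
qed

lemma sum_native: "p \<in> PP \<Longrightarrow> s < l \<Longrightarrow> (\<Sum>K\<in>C p. native K s) = k"
  using C_partition_card[of p "\<lambda>v. f0 v = s"] f0k[of s] by (simp add: native_def)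

lemma type_change_count:
  assumes p: "p \<in> PP" and s: "s < l"
  shows "card {t. t < length p \<and> profile (home_large (take (Suc t) p) s) \<noteq> profile (home_large (take t p) s)} \<le> 4 * q * (q * q + 1)"
    (is "card ?E \<le> _")
proof -
  have "4 * q * level_potential (take 0 p) s + k * card ?E \<le> 4 * q * level_potential (take (length p) p) s"
  proof (rule count_by_potential)
    fix t assume t: "t < length p"
    show "4 * q * level_potential (take t p) s + (if profile (home_large (take (Suc t) p) s) \<noteq> profile (home_large (take t p) s) then k else 0)
        \<le> 4 * q * level_potential (take (Suc t) p) s"
      unfolding take_Suc_PP(1)[OF p t] by (rule level_potential_step[OF take_Suc_PP(2)[OF p t]])
  qed
  hence "k * card ?E \<le> 4 * q * level_potential p s" by simp
  also have "level_potential p s \<le> (\<Sum>K\<in>C p. native K s * (q * q + 1))"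
    unfolding level_potential_def by (intro sum_mono mult_le_mono2 level_le[OF p])
  also have "\<dots> = k * (q * q + 1)" by (simp only: sum_native[OF p s] flip: sum_distrib_right)
  finally have "k * card ?E \<le> k * (4 * q * (q * q + 1))" by (simp add: algebra_simps)
  thus ?thesis using k1 by simp
qed

lemma bad_mono: "bad (take t p) s \<Longrightarrow> bad (take (Suc t) p) s"
proof -
  assume "bad (take t p) s"
  then obtain t' where t': "t' \<le> length (take t p)" "k \<le> q * displaced (take t' (take t p)) s" unfolding bad_def by blast
  have "t' \<le> length (take (Suc t) p)" "take t' (take (Suc t) p) = take t' (take t p)"
    using t'(1) by (auto simp: min_def split: if_splits)
  thus ?thesis unfolding bad_def using t'(2) by (intro exI[of _ t']) simp
qed

lemma bad_change_count: "card {t. t < length p \<and> bad (take (Suc t) p) s \<noteq> bad (take t p) s} \<le> 1"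
proof -
  have "(if bad (take 0 p) s then 1 else 0) + 1 * card {t. t < length p \<and> bad (take (Suc t) p) s \<noteq> bad (take t p) s}
    \<le> (if bad (take (length p) p) s then 1 else (0::nat))"
    by (rule count_by_potential) (use bad_mono in auto)
  moreover have "(if bad (take (length p) p) s then 1 else (0::nat)) \<le> 1" by simp
  ultimately show ?thesis by linarith
qed

definition home_potential where "home_potential p s = (\<Sum>K\<in>C p. real (native K s) * ln (card K))"

lemma W_step:
  assumes p: "p @ [e] \<in> PP" and s: "s < l"
  shows "real (W (p @ [e]) s) + 2 * home_potential p s \<le> real (W p s) + 2 * home_potential (p @ [e]) s"
proof (cases rule: step_home[OF p])
  case 1 thus ?thesis by (simp add: home_potential_def)
next
  case (2 A B)
  note D = mergeD[OF 2(2) p]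
  have pP: "p \<in> PP" by (rule PP_closed[OF p])
  let ?K = "A \<union> B"
  have eq: "home_potential (p @ [e]) s + (real (native A s) * ln (card A) + real (native B s) * ln (card B)) = home_potential p s + real (native ?K s) * ln (card ?K)"
    unfolding home_potential_def by (rule sum_merge[OF 2(2) p]) simp
  have cK: "real (native ?K s) = real (native A s) + real (native B s)" by (simp add: native_Un[OF D(6,7,8)])
  have pos: "1 \<le> card A" "1 \<le> card B" using C_pos[OF pP] D(1,2) by blast+
  have lB: "ln (real (card B)) \<le> ln (real (card ?K))" using pos D(16) by simp
  have "ln (2 * real (card A)) \<le> ln (real (card ?K))" using pos D(4,16) by simp
  hence lA: "ln 2 + ln (real (card A)) \<le> ln (real (card ?K))" using pos by (simp add: ln_mult)
  have l2: "2 / 3 \<le> ln (2::real)" by (rule ln2_ge_two_thirds)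
  have mA: "real (native A s) * (2 / 3 + ln (real (card A))) \<le> real (native A s) * ln (real (card ?K))"
    using lA l2 by (intro mult_left_mono) auto
  have mB: "real (native B s) * ln (real (card B)) \<le> real (native B s) * ln (real (card ?K))"
    using lB by (rule mult_left_mono) simp
  have up: "home_potential p s + 2 / 3 * real (native A s) \<le> home_potential (p @ [e]) s"
    using eq mA mB unfolding cK by (simp add: algebra_simps)
  show ?thesis
  proof (cases "N p A = Some s \<and> N p B = Some s")
    case True
    have "3 * card A \<le> 4 * native A s" by (rule okhomeD_Some(2)) (use okN[OF pP D(1)] True in simp)
    hence "real (card A) \<le> 4 / 3 * real (native A s)" by linarith
    thus ?thesis using up True by (simp add: 2(5))
  next
    case False
    hence "W (p @ [e]) s = W p s" unfolding 2(5) by auto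
    thus ?thesis using up by simp
  qed
qed

lemma W_mono: "p @ [e] \<in> PP \<Longrightarrow> W p s \<le> W (p @ [e]) s"
  by (cases rule: step_home[of p e]) auto

lemma W_Nil: "W [] s = 0"
  by (simp add: W_def F0)

lemma W_bound:
  assumes p: "p \<in> PP" and s: "s < l"
  shows "real (W p s) \<le> 2 * (real k * ln (real k))"
proof -
  have "real (W (take m p) s) \<le> 2 * home_potential (take m p) s" if "m \<le> length p" for m
    using that
  proof (induction m)
    case 0 show ?case by (auto simp: W_Nil home_potential_def C_Nil intro!: sum_nonneg)
  next
    case (Suc m)
    hence m: "m < length p" by simp
    show ?case unfolding take_Suc_PP(1)[OF p m]
      using W_step[OF take_Suc_PP(2)[OF p m] s] Suc by simp
  qed
  from this[of "length p"] have "real (W p s) \<le> 2 * home_potential p s" by simp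
  also have "home_potential p s \<le> (\<Sum>K\<in>C p. real (native K s) * ln (real k))"
    unfolding home_potential_def
  proof (intro sum_mono mult_left_mono)
    fix K assume K: "K \<in> C p"
    show "ln (real (card K)) \<le> ln (real k)" using C_le_k[OF p K] C_pos[OF p K] by simp
  qed simp
  also have "\<dots> = real k * ln (real k)" by (simp only: sum_native[OF p s] flip: sum_distrib_right of_nat_sum)
  finally show ?thesis by simp
qed

lemma W_change_count:
  assumes p: "p \<in> PP" and s: "s < l"
  shows "real (card {t. t < length p \<and> W (take (Suc t) p) s div k \<noteq> W (take t p) s div k}) \<le> 2 * ln (real k)"
    (is "real (card ?E) \<le> _")
proof -
  have "W (take 0 p) s div k + 1 * card ?E \<le> W (take (length p) p) s div k"
  proof (rule count_by_potential)
    fix t assume t: "t < length p"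
    have "W (take t p) s \<le> W (take (Suc t) p) s"
      unfolding take_Suc_PP(1)[OF p t] by (rule W_mono[OF take_Suc_PP(2)[OF p t]])
    hence "W (take t p) s div k \<le> W (take (Suc t) p) s div k" by (rule div_le_mono)
    thus "W (take t p) s div k + (if W (take (Suc t) p) s div k \<noteq> W (take t p) s div k then 1 else 0) \<le> W (take (Suc t) p) s div k"
      by simp
  qed
  hence "card ?E \<le> W p s div k" by simp
  hence "k * card ?E \<le> k * (W p s div k)" by (rule mult_le_mono2)
  hence "k * card ?E \<le> W p s" using times_div_less_eq_dividend by (rule order_trans)
  hence "real (k * card ?E) \<le> 2 * (real k * ln (real k))" using W_bound[OF p s] of_nat_le_iff order_trans by blast
  thus ?thesis using k1 by (simp add: field_simps)
qed

definition hits :: "real" where "hits = 1 + real (4 * q * (q * q + 1)) + 2 * ln (real k)"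

lemma hit_count:
  assumes p: "p \<in> PP" and s: "s < l"
  shows "real (card {t. t < length p \<and> s \<in> hit_servers (take (Suc t) p)}) \<le> hits"
proof -
  let ?A = "{t. t < length p \<and> bad (take (Suc t) p) s \<noteq> bad (take t p) s}"
  let ?B = "{t. t < length p \<and> profile (home_large (take (Suc t) p) s) \<noteq> profile (home_large (take t p) s)}"
  let ?D = "{t. t < length p \<and> W (take (Suc t) p) s div k \<noteq> W (take t p) s div k}"
  have "{t. t < length p \<and> s \<in> hit_servers (take (Suc t) p)} \<subseteq> ?A \<union> ?B \<union> ?D"
    using take_Suc_PP(3)[OF p] by (auto simp: hit_servers_def server_type_def)
  hence "card {t. t < length p \<and> s \<in> hit_servers (take (Suc t) p)} \<le> card (?A \<union> ?B \<union> ?D)" by (intro card_mono) auto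
  also have "\<dots> \<le> card (?A \<union> ?B) + card ?D" by (rule card_Un_le)
  finally have "card {t. t < length p \<and> s \<in> hit_servers (take (Suc t) p)} \<le> card ?A + card ?B + card ?D"
    using card_Un_le[of ?A ?B] by linarith
  hence "real (card {t. t < length p \<and> s \<in> hit_servers (take (Suc t) p)}) \<le> real (card ?A) + real (card ?B) + real (card ?D)" by linarith
  also have "\<dots> \<le> 1 + real (4 * q * (q * q + 1)) + 2 * ln (real k)"
    using bad_change_count[of p s] type_change_count[OF p s] W_change_count[OF p s] by (intro add_mono) linarith+
  finally show ?thesis by (simp add: hits_def)
qed

lemma hit_sum:
  assumes p: "p \<in> PP" and X: "X \<subseteq> {..<l}"
  shows "real (\<Sum>t<length p. card (X \<inter> hit_servers (take (Suc t) p))) \<le> hits * real (card X)"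
proof -
  have f: "finite X" using X finite_subset by blast
  have "(\<Sum>t<length p. card (X \<inter> hit_servers (take (Suc t) p))) = (\<Sum>t<length p. \<Sum>s\<in>X. if s \<in> hit_servers (take (Suc t) p) then 1 else 0)"
    using f by (intro sum.cong) (simp_all add: sum.If_cases)
  also have "\<dots> = (\<Sum>s\<in>X. \<Sum>t<length p. if s \<in> hit_servers (take (Suc t) p) then 1 else 0)" by (rule sum.swap)
  also have "\<dots> = (\<Sum>s\<in>X. card {t. t < length p \<and> s \<in> hit_servers (take (Suc t) p)})"
    by (intro sum.cong) (simp_all add: sum.If_cases Int_def)
  finally have "real (\<Sum>t<length p. card (X \<inter> hit_servers (take (Suc t) p))) = (\<Sum>s\<in>X. real (card {t. t < length p \<and> s \<in> hit_servers (take (Suc t) p)}))"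
    by simp
  also have "\<dots> \<le> (\<Sum>s\<in>X. hits)" by (rule sum_mono) (rule hit_count[OF p], use X in auto)
  finally show ?thesis by (simp add: mult.commute)
qed

definition free_change where "free_change p \<longleftrightarrow> p \<noteq> [] \<and> profile (free_large p) \<noteq> profile (free_large (butlast p))"
definition moved_in where "moved_in g K = card {v \<in> K. g v \<noteq> f0 v}"
definition free_level :: "nat set \<Rightarrow> nat option \<Rightarrow> nat" where "free_level K h = (if \<not> large K then 0 else if h = None then size_class K else 0)"
definition free_potential where "free_potential g p = (\<Sum>K\<in>C p. moved_in g K * free_level K (N p K))"

lemma free_large_moved_in:
  assumes r: "reference p g" and K: "K \<in> C p" "large K" "N p K = None"
  shows "k \<le> 16 * q * moved_in g K"
proof -
  have p: "p \<in> PP" using r by (simp add: reference_def)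
  have "{v \<in> K. g v \<noteq> f0 v} = {v \<in> K. f0 v \<noteq> ref_server g K}" using ref_server_eq[OF r K(1)] by auto
  hence "moved_in g K = foreign K (ref_server g K)" by (simp add: moved_in_def foreign_def)
  thus ?thesis using okhomeD_None(1)[OF _ K(2)] okN[OF p K(1)] K(3) by simp
qed

lemma free_level_mono:
  assumes m: "merge p e A B" "p @ [e] \<in> PP" and X: "X \<in> {A, B}"
  shows "free_level X (N p X) \<le> free_level (A \<union> B) (N (p @ [e]) (A \<union> B))"
proof (cases "large X \<and> N p X = None")
  case False thus ?thesis by (auto simp: free_level_def)
next
  case True
  note D = mergeD[OF m]
  have XK: "X \<subseteq> A \<union> B" and fK: "finite (A \<union> B)" using X D by auto
  have lK: "large (A \<union> B)" using large_mono[OF fK XK] True by blast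
  have "N (p @ [e]) (A \<union> B) = None"
  proof (cases "N (p @ [e]) (A \<union> B)")
    case (Some s)
    have "N p X = Some s" by (rule home_persist[OF m X _ Some]) (use True in simp)
    thus ?thesis using True by simp
  qed
  thus ?thesis using lK True size_class_mono[OF card_mono[OF fK XK]] by (simp add: free_level_def)
qed

lemma free_potential_step:
  assumes p: "p @ [e] \<in> PP" and r: "reference (p @ [e]) g"
  shows "16 * q * free_potential g p + (if profile (free_large (p @ [e])) \<noteq> profile (free_large p) then k else 0) \<le> 16 * q * free_potential g (p @ [e])"
proof (cases rule: step_home[OF p])
  case 1
  hence "free_large (p @ [e]) = free_large p" "free_potential g (p @ [e]) = free_potential g p" by (simp_all add: free_large_def free_potential_def)
  thus ?thesis by simp
next
  case (2 A B)
  note D = mergeD[OF 2(2) p]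
  have pP: "p \<in> PP" by (rule PP_closed[OF p])
  have rp: "reference p g" using reference_take[OF r, of "length p"] by simp
  let ?K = "A \<union> B"
  let ?a = "free_level A (N p A)" and ?b = "free_level B (N p B)" and ?c = "free_level ?K (N (p @ [e]) ?K)"
  have eq: "free_potential g (p @ [e]) + (moved_in g A * ?a + moved_in g B * ?b) = free_potential g p + moved_in g ?K * ?c"
    unfolding free_potential_def by (rule sum_merge[OF 2(2) p]) (simp add: 2(4))
  have "{v \<in> ?K. g v \<noteq> f0 v} = {v \<in> A. g v \<noteq> f0 v} \<union> {v \<in> B. g v \<noteq> f0 v}" by blast
  hence cK: "moved_in g ?K = moved_in g A + moved_in g B" using D(6,7,8) by (simp add: moved_in_def card_Un_disjoint disjoint_iff)
  have le: "?a \<le> ?c" "?b \<le> ?c" by (rule free_level_mono[OF 2(2) p], simp)+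
  have m: "moved_in g A * ?a \<le> moved_in g A * ?c" "moved_in g B * ?b \<le> moved_in g B * ?c" using le by simp_all
  have key: "16 * q * free_potential g p + k \<le> 16 * q * free_potential g (p @ [e])"
    if x: "k \<le> 16 * q * x" "x + moved_in g A * ?a + moved_in g B * ?b \<le> moved_in g A * ?c + moved_in g B * ?c" for x
  proof -
    have "free_potential g p + x \<le> free_potential g (p @ [e])" using eq x(2) unfolding cK add_mult_distrib by linarith
    hence "16 * q * (free_potential g p + x) \<le> 16 * q * free_potential g (p @ [e])" by (rule mult_le_mono2)
    thus ?thesis using x(1) by (simp add: algebra_simps)
  qed
  show ?thesis
  proof (cases "profile (free_large (p @ [e])) = profile (free_large p)")
    case True
    have "free_potential g p \<le> free_potential g (p @ [e])" using eq m unfolding cK add_mult_distrib by linarith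
    thus ?thesis using True by simp
  next
    case False
    have ch: "profile {K \<in> C (p @ [e]). large K \<and> N (p @ [e]) K = None} \<noteq> profile {K \<in> C p. large K \<and> N p K = None}"
      using False by (simp add: free_large_def)
    have lv: "(if \<not> large K then 0 else if h' = None then size_class K else if None = None then 0 else q * q + 1) = free_level K h'" for K and h' :: "nat option"
      by (simp add: free_level_def)
    have no: "\<not> (N (p @ [e]) ?K \<noteq> None \<and> (large A \<and> N p A = None \<or> large B \<and> N p B = None))"
      using home_persist[OF 2(2) p] by fastforce
    have tc: "(large A \<and> N p A = None \<and> ?a < ?c) \<or> (large B \<and> N p B = None \<and> ?b < ?c) \<or>
         (large ?K \<and> N (p @ [e]) ?K = None \<and> \<not> (large A \<and> N p A = None) \<and> \<not> (large B \<and> N p B = None))"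
      using type_change_level[OF 2(2) p 2(4) ch, of undefined] no unfolding lv by blast
    from tc have "16 * q * free_potential g p + k \<le> 16 * q * free_potential g (p @ [e])"
    proof (elim disjE conjE)
      assume a: "large A" "N p A = None" "?a < ?c"
      show ?thesis
      proof (rule key[of "moved_in g A"])
        show "k \<le> 16 * q * moved_in g A" by (rule free_large_moved_in[OF rp D(1) a(1,2)])
        have "moved_in g A * Suc ?a \<le> moved_in g A * ?c" using a(3) by (intro mult_le_mono2) simp
        thus "moved_in g A + moved_in g A * ?a + moved_in g B * ?b \<le> moved_in g A * ?c + moved_in g B * ?c" using m(2) unfolding mult_Suc_right by linarith
      qed
    next
      assume a: "large B" "N p B = None" "?b < ?c"
      show ?thesis
      proof (rule key[of "moved_in g B"])
        show "k \<le> 16 * q * moved_in g B" by (rule free_large_moved_in[OF rp D(2) a(1,2)])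
        have "moved_in g B * Suc ?b \<le> moved_in g B * ?c" using a(3) by (intro mult_le_mono2) simp
        thus "moved_in g B + moved_in g A * ?a + moved_in g B * ?b \<le> moved_in g A * ?c + moved_in g B * ?c" using m(1) unfolding mult_Suc_right by linarith
      qed
    next
      assume a: "large ?K" "N (p @ [e]) ?K = None" "\<not> (large A \<and> N p A = None)" "\<not> (large B \<and> N p B = None)"
      show ?thesis
      proof (rule key[of "moved_in g ?K"])
        show "k \<le> 16 * q * moved_in g ?K" by (rule free_large_moved_in[OF r D(14) a(1,2)])
        have "1 \<le> ?c" using size_class_bounds(1)[OF p D(14)] a(1,2) by (simp add: free_level_def)
        hence "moved_in g ?K * 1 \<le> moved_in g ?K * ?c" by (rule mult_le_mono2)
        moreover have "?a = 0" "?b = 0" using a(3,4) by (auto simp: free_level_def)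
        ultimately show "moved_in g ?K + moved_in g A * ?a + moved_in g B * ?b \<le> moved_in g A * ?c + moved_in g B * ?c"
          unfolding cK by (simp add: add_mult_distrib)
      qed
    qed
    thus ?thesis using False by simp
  qed
qed

lemma free_change_count:
  assumes r: "reference p g"
  shows "k * card {t. t < length p \<and> free_change (take (Suc t) p)} \<le> 16 * q * q * q * moved g"
proof -
  have p: "p \<in> PP" using r by (simp add: reference_def)
  let ?E = "{t. t < length p \<and> free_change (take (Suc t) p)}"
  have E: "free_change (take (Suc t) p) \<longleftrightarrow> profile (free_large (take t p @ [p ! t])) \<noteq> profile (free_large (take t p))" if "t < length p" for t
    using take_Suc_PP(1,3)[OF p that] by (simp add: free_change_def)
  have "16 * q * free_potential g (take 0 p) + k * card ?E \<le> 16 * q * free_potential g (take (length p) p)"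
  proof (rule count_by_potential)
    fix t assume t: "t < length p"
    have "reference (take t p @ [p ! t]) g" using reference_take[OF r, of "Suc t"] take_Suc_PP(1)[OF p t] by simp
    from free_potential_step[OF take_Suc_PP(2)[OF p t] this]
    show "16 * q * free_potential g (take t p) + (if free_change (take (Suc t) p) then k else 0) \<le> 16 * q * free_potential g (take (Suc t) p)"
      unfolding E[OF t] unfolding take_Suc_PP(1)[OF p t] .
  qed
  hence "k * card ?E \<le> 16 * q * free_potential g p" by simp
  also have "free_potential g p \<le> (\<Sum>K\<in>C p. moved_in g K * (q * q))"
    unfolding free_potential_def by (intro sum_mono mult_le_mono2) (use size_class_bounds(1)[OF p] in \<open>auto simp: free_level_def\<close>)
  also have "\<dots> = moved g * (q * q)"
    unfolding moved_in_def moved_def by (simp only: C_partition_card[OF p] flip: sum_distrib_right)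
  finally show ?thesis by (simp add: algebra_simps)
qed

end

section \<open>Placing the large components\<close>

context housed
begin

text \<open>
  This depends on \<open>q\<close> only, hence may enter the competitive ratio.
\<close>

definition repack_const :: nat where
  "repack_const = (SOME K. \<forall>P n b. packable feasible n b \<longrightarrow>
      (\<forall>r\<in>{1..q * q}. \<bar>int (n r) - int (items feasible P r)\<bar> \<le> int (2 * q + 2)) \<longrightarrow> \<bar>int b - int (sum P feasible)\<bar> \<le> int (2 * q + 2) \<longrightarrow>
      (\<exists>P''. items feasible P'' = n \<and> sum P'' feasible = b \<and> (\<Sum>c\<in>feasible. P c - P'' c) \<le> K))"

lemma repack_const:
  assumes "packable feasible n b" "\<forall>r\<in>{1..q * q}. \<bar>int (n r) - int (items feasible P r)\<bar> \<le> int (2 * q + 2)"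
    "\<bar>int b - int (sum P feasible)\<bar> \<le> int (2 * q + 2)"
  obtains P'' where "items feasible P'' = n" "sum P'' feasible = b" "(\<Sum>c\<in>feasible. P c - P'' c) \<le> repack_const"
proof -
  have "\<exists>K. \<forall>P n b. packable feasible n b \<longrightarrow>
      (\<forall>r\<in>{1..q * q}. \<bar>int (n r) - int (items feasible P r)\<bar> \<le> int (2 * q + 2)) \<longrightarrow> \<bar>int b - int (sum P feasible)\<bar> \<le> int (2 * q + 2) \<longrightarrow>
      (\<exists>P''. items feasible P'' = n \<and> sum P'' feasible = b \<and> (\<Sum>c\<in>feasible. P c - P'' c) \<le> K)"
    by (rule repacking[OF finite_feasible]) (simp_all add: feasible_def)
  from someI_ex[OF this] show ?thesis using assms that unfolding repack_const_def by blast
qed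

definition loose_large where "loose_large p X = {K \<in> C p. large K \<and> (\<forall>s. N p K = Some s \<longrightarrow> s \<in> X)}"

lemma loose_large_eq: "loose_large p X = free_large p \<union> (\<Union>s\<in>X. home_large p s)"
proof (rule set_eqI)
  fix K show "K \<in> loose_large p X \<longleftrightarrow> K \<in> free_large p \<union> (\<Union>s\<in>X. home_large p s)"
    by (cases "N p K") (auto simp: loose_large_def free_large_def home_large_def)
qed

lemma loose_large_sub: "loose_large p X \<subseteq> C p" and loose_large_finite: "finite (loose_large p X)"
  using C_finite by (auto simp: loose_large_def)

lemma loose_profile_loose_large: "finite X \<Longrightarrow> loose_profile p X r = profile (loose_large p X) r"
  by (simp only: loose_profile_profile loose_large_eq)

lemma merge_parts_profile:
  assumes m: "merge p e A B" "p @ [e] \<in> PP" and N': "\<And>K. K \<in> C p \<Longrightarrow> N (p @ [e]) K = N p K"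
  shows "profile (loose_large (p @ [e]) X) r + ((if A \<in> loose_large p X \<and> size_class A = r then 1 else 0) + (if B \<in> loose_large p X \<and> size_class B = r then 1 else 0))
     = profile (loose_large p X) r + (if A \<union> B \<in> loose_large (p @ [e]) X \<and> size_class (A \<union> B) = r then 1 else 0)"
proof -
  note D = mergeD[OF m]
  have e: "profile (loose_large p X) r = (\<Sum>K\<in>C p. if K \<in> loose_large p X \<and> size_class K = r then 1 else 0)" for p
  proof -
    have "{K \<in> loose_large p X. size_class K = r} = {K \<in> C p. K \<in> loose_large p X \<and> size_class K = r}" using loose_large_sub by blast
    thus ?thesis unfolding profile_def using C_finite by (simp add: sum.If_cases Int_def)
  qed
  show ?thesis unfolding e
  proof (rule sum_merge[OF m])
    fix K assume K: "K \<in> C p" "K \<noteq> A" "K \<noteq> B"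
    have "K \<in> C (p @ [e])" using K D(5) by simp
    hence "K \<in> loose_large (p @ [e]) X \<longleftrightarrow> K \<in> loose_large p X" using K N'[OF K(1)] by (simp add: loose_large_def)
    thus "(if K \<in> loose_large (p @ [e]) X \<and> size_class K = r then 1 else 0) = (if K \<in> loose_large p X \<and> size_class K = r then 1 else 0)" by simp
  qed
qed

lemma loose_large_change:
  assumes p: "p @ [e] \<in> PP"
  shows "\<bar>int (profile (loose_large (p @ [e]) X) r) - int (profile (loose_large p X) r)\<bar> \<le> 2"
proof (cases rule: step_home[OF p])
  case 1 thus ?thesis by (simp add: loose_large_def)
next
  case (2 A B)
  from merge_parts_profile[OF 2(2) p 2(4), of X r] show ?thesis by (simp split: if_splits)
qed

lemma shrink_counts:
  assumes p: "p \<in> PP" and g: "good p X" and Z: "finite Z" "Z \<subseteq> {..<l}" "X \<inter> Z = {}"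
    and P: "items feasible P = loose_profile p (X \<union> Z)" "sum P feasible = card (X \<union> Z)"
  shows "\<exists>P'. items feasible P' = loose_profile p X \<and> sum P' feasible = card X \<and> (\<Sum>c\<in>feasible. P c - P' c) \<le> repack_const * card Z"
  using Z P
proof (induction Z arbitrary: P rule: finite_induct)
  case empty thus ?case by (intro exI[of _ P]) simp
next
  case (insert s Z)
  have Xl: "X \<subseteq> {..<l}" using g by (simp add: good_def)
  have f: "finite (X \<union> Z)" using insert Xl finite_subset by auto
  have sn: "s \<notin> X \<union> Z" and sl: "s < l" using insert by auto
  have gZ: "good p (X \<union> Z)" by (rule good_mono[OF p g]) (use insert Xl in auto)
  have loose_profile: "items feasible P r = loose_profile p (X \<union> Z) r + profile (home_large p s) r" for r
    using insert.prems(3) f sn by (simp add: loose_profile_def)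
  have cd: "sum P feasible = card (X \<union> Z) + 1" using insert.prems(4) f sn by simp
  have d: "\<bar>int (loose_profile p (X \<union> Z) r) - int (items feasible P r)\<bar> \<le> int (2 * q + 2)" for r
    using profile_home_large_le[OF p sl, of r] unfolding loose_profile by simp
  have pk: "packable feasible (loose_profile p (X \<union> Z)) (card (X \<union> Z))" using gZ by (simp add: good_def)
  obtain P1 where P1: "items feasible P1 = loose_profile p (X \<union> Z)" "sum P1 feasible = card (X \<union> Z)" "(\<Sum>c\<in>feasible. P c - P1 c) \<le> repack_const"
    by (rule repack_const[OF pk, of P]) (use d cd in auto)
  obtain P2 where P2: "items feasible P2 = loose_profile p X" "sum P2 feasible = card X" "(\<Sum>c\<in>feasible. P1 c - P2 c) \<le> repack_const * card Z"
    using insert.IH[OF _ _ P1(1,2)] insert.prems by auto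
  have "(\<Sum>c\<in>feasible. P c - P2 c) \<le> (\<Sum>c\<in>feasible. (P c - P1 c) + (P1 c - P2 c))" by (rule sum_mono) simp
  also have "\<dots> \<le> repack_const * card (insert s Z)" using P1(3) P2(3) insert.hyps by (simp add: sum.distrib)
  finally show ?case using P2(1,2) by blast
qed

definition packed where
  "packed p X f \<longleftrightarrow> (\<forall>K\<in>loose_large p X. f K \<in> X) \<and> (\<forall>s\<in>X. profile {K \<in> loose_large p X. f K = s} \<in> feasible)"

lemma feasible_count: "c \<in> feasible \<Longrightarrow> (\<Sum>r\<in>{1..q*q}. c r) \<le> q * q + 3 * q"
proof -
  assume c: "c \<in> feasible"
  have "(\<Sum>r\<in>{1..q*q}. c r) \<le> (\<Sum>r\<in>{1..q*q}. r * c r)" by (rule sum_mono) simp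
  thus ?thesis using c by (simp add: feasible_def)
qed

lemma packed_extend:
  assumes p: "p \<in> PP" and g: "good p X" and X: "X \<subseteq> U" "U \<subseteq> {..<l}" and f: "packed p X f"
    and h: "\<forall>s<l. s \<notin> X \<longrightarrow> (\<forall>K\<in>home_large p s. f K = s)"
  shows "packed p U f"
proof -
  have new: "f K = s \<and> K \<in> home_large p s" if "K \<in> loose_large p U" "K \<notin> loose_large p X" "N p K = Some s" for K s
  proof -
    have "K \<in> home_large p s" using that by (simp add: loose_large_def home_large_def)
    moreover have "s \<in> U - X" using that by (auto simp: loose_large_def)
    ultimately show ?thesis using h X by auto
  qed
  have old: "loose_large p X \<subseteq> loose_large p U" using X by (auto simp: loose_large_def)
  have inU: "f K \<in> U" if K: "K \<in> loose_large p U" for K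
  proof (cases "K \<in> loose_large p X")
    case True thus ?thesis using f X by (auto simp: packed_def)
  next
    case False
    then obtain s where s: "N p K = Some s" "s \<notin> X" using K by (auto simp: loose_large_def)
    hence "s \<in> U" using K by (simp add: loose_large_def)
    thus ?thesis using new[OF K False s(1)] by simp
  qed
  have "profile {K \<in> loose_large p U. f K = s} \<in> feasible" if s: "s \<in> U" for s
  proof (cases "s \<in> X")
    case True
    have "{K \<in> loose_large p U. f K = s} = {K \<in> loose_large p X. f K = s}"
    proof
      show "{K \<in> loose_large p U. f K = s} \<subseteq> {K \<in> loose_large p X. f K = s}"
      proof
        fix K assume K: "K \<in> {K \<in> loose_large p U. f K = s}"
        show "K \<in> {K \<in> loose_large p X. f K = s}"
        proof (rule ccontr)
          assume n: "K \<notin> {K \<in> loose_large p X. f K = s}"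
          hence "K \<notin> loose_large p X" using K by simp
          then obtain s' where s': "N p K = Some s'" "s' \<notin> X" using K by (auto simp: loose_large_def)
          have "f K = s'" using new[of K s'] K n s' by simp
          thus False using K True s' by simp
        qed
      qed
      show "{K \<in> loose_large p X. f K = s} \<subseteq> {K \<in> loose_large p U. f K = s}" using old by blast
    qed
    thus ?thesis using f True by (simp add: packed_def)
  next
    case False
    have sl: "s < l" using s X by auto
    have "{K \<in> loose_large p U. f K = s} = home_large p s"
    proof
      show "{K \<in> loose_large p U. f K = s} \<subseteq> home_large p s"
      proof
        fix K assume K: "K \<in> {K \<in> loose_large p U. f K = s}"
        have n: "K \<notin> loose_large p X" using f False K by (auto simp: packed_def)
        then obtain s' where s': "N p K = Some s'" "s' \<notin> X" using K by (auto simp: loose_large_def)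
        have "f K = s' \<and> K \<in> home_large p s'" by (rule new) (use K n s' in auto)
        thus "K \<in> home_large p s" using K by simp
      qed
      show "home_large p s \<subseteq> {K \<in> loose_large p U. f K = s}" using h sl False s by (auto simp: home_large_def loose_large_def)
    qed
    moreover have "\<not> bad p s" using g sl False by (auto simp: good_def)
    ultimately show ?thesis using nonbad_feasible[OF p sl] by simp
  qed
  thus ?thesis using inU by (simp add: packed_def)
qed

lemma loose_large_lost:
  assumes p: "p @ [e] \<in> PP" and U: "U \<subseteq> {..<l}"
  shows "card (loose_large p U - loose_large (p @ [e]) X) \<le> 2 * q * card (U - X) + 2"
proof -
  have pP: "p \<in> PP" by (rule PP_closed[OF p])
  have fU: "finite (U - X)" using U finite_subset by blast
  have "\<exists>A B. loose_large p U - loose_large (p @ [e]) X \<subseteq> {A, B} \<union> (\<Union>s\<in>U - X. home_large p s)"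
  proof (cases rule: step_home[OF p])
    case 1
    have "loose_large p U - loose_large (p @ [e]) X \<subseteq> {A, B} \<union> (\<Union>s\<in>U - X. home_large p s)" for A B
      using 1 by (auto simp: loose_large_def home_large_def)
    thus ?thesis by (intro exI)
  next
    case (2 A B)
    have "loose_large p U - loose_large (p @ [e]) X \<subseteq> {A, B} \<union> (\<Union>s\<in>U - X. home_large p s)"
    proof
      fix K assume K: "K \<in> loose_large p U - loose_large (p @ [e]) X"
      show "K \<in> {A, B} \<union> (\<Union>s\<in>U - X. home_large p s)"
      proof (cases "K \<in> {A, B}")
        case False
        have KC: "K \<in> C p" "large K" using K by (auto simp: loose_large_def)
        hence "K \<in> C (p @ [e])" using False mergeD(5)[OF 2(2) p] by simp
        then obtain s where "N (p @ [e]) K = Some s" "s \<notin> X" using K KC by (auto simp: loose_large_def)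
        hence "N p K = Some s" "s \<notin> X" using 2(4)[OF KC(1)] by simp_all
        thus ?thesis using K by (auto simp: loose_large_def home_large_def)
      next
        case True thus ?thesis by (rule UnI1)
      qed
    qed
    thus ?thesis by (intro exI)
  qed
  then obtain A B where sub: "loose_large p U - loose_large (p @ [e]) X \<subseteq> {A, B} \<union> (\<Union>s\<in>U - X. home_large p s)" by (elim exE)
  have "card (loose_large p U - loose_large (p @ [e]) X) \<le> card ({A, B} \<union> (\<Union>s\<in>U - X. home_large p s))"
    by (rule card_mono[OF _ sub]) (use fU home_large_finite in auto)
  also have "\<dots> \<le> card {A, B} + card (\<Union>s\<in>U - X. home_large p s)" by (rule card_Un_le)
  also have "card (\<Union>s\<in>U - X. home_large p s) \<le> (\<Sum>s\<in>U - X. card (home_large p s))" by (rule card_UN_le[OF fU])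
  also have "\<dots> \<le> (\<Sum>s\<in>U - X. 2 * q)" by (rule sum_mono) (rule card_home_large[OF pP], use U in auto)
  finally have "card (loose_large p U - loose_large (p @ [e]) X) \<le> card {A, B} + 2 * q * card (U - X)" by (simp add: mult.commute)
  moreover have "card {A, B} \<le> 2" using card_insert_le_m1[of 2 "{B}" A] by simp
  ultimately show ?thesis by linarith
qed

lemma repack_step:
  assumes p: "p @ [e] \<in> PP" and g: "good p X" "good (p @ [e]) X'" and f: "packed p X f"
    and h: "\<forall>s<l. s \<notin> X \<longrightarrow> (\<forall>K\<in>home_large p s. f K = s)"
  shows "\<exists>f'. packed (p @ [e]) X' f' \<and>
     card {K \<in> loose_large (p @ [e]) X'. K \<notin> loose_large p (X \<union> X') \<or> f' K \<noteq> f K}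
       \<le> (q * q + 3 * q) * (repack_const * (card (X - X') + 1)) + (2 * q * card (X - X') + 2)"
proof -
  let ?p' = "p @ [e]" and ?U = "X \<union> X'"
  have pP: "p \<in> PP" by (rule PP_closed[OF p])
  have Xl: "X \<subseteq> {..<l}" "X' \<subseteq> {..<l}" "?U \<subseteq> {..<l}" using g by (auto simp: good_def)
  have fin: "finite X" "finite X'" "finite ?U" using Xl finite_subset by blast+
  have UX: "?U - X' = X - X'" by blast
  have pU: "packed p ?U f" by (rule packed_extend[OF pP g(1) _ Xl(3) f h]) simp
  define c where "c s = profile {K \<in> loose_large p ?U. f K = s}" for s
  have cC: "\<forall>s\<in>?U. c s \<in> feasible" using pU by (simp add: packed_def c_def)
  have csum: "(\<Sum>s\<in>?U. profile {K \<in> loose_large p ?U. f K = s} r) = profile (loose_large p ?U) r" for r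
  proof -
    have "(\<Sum>s\<in>?U. card {K \<in> {K \<in> loose_large p ?U. size_class K = r}. f K = s}) = card {K \<in> loose_large p ?U. size_class K = r}"
      by (rule sum_card_fibres) (use loose_large_finite fin pU in \<open>auto simp: packed_def\<close>)
    moreover have "{K \<in> {K \<in> loose_large p ?U. size_class K = r}. f K = s} = {K \<in> {K \<in> loose_large p ?U. f K = s}. size_class K = r}" for s by auto
    ultimately show ?thesis by (simp only: profile_def)
  qed
  define P0 where "P0 d = card {s \<in> ?U. c s = d}" for d
  have P0: "items feasible P0 r = profile (loose_large p ?U) r" "sum P0 feasible = card ?U" for r
    using label_counts[OF fin(3) cC] csum[of r] by (simp_all add: P0_def[abs_def] c_def)
  have gU: "good ?p' ?U" by (rule good_mono[OF p g(2) _ Xl(3)]) simp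
  have pk: "packable feasible (loose_profile ?p' ?U) (card ?U)" using gU by (simp add: good_def)
  have d: "\<bar>int (loose_profile ?p' ?U r) - int (items feasible P0 r)\<bar> \<le> int (2 * q + 2)" for r
    using loose_large_change[OF p, of ?U r] unfolding P0(1) loose_profile_loose_large[OF fin(3)] by linarith
  obtain P1 where P1: "items feasible P1 = loose_profile ?p' ?U" "sum P1 feasible = card ?U" "(\<Sum>c\<in>feasible. P0 c - P1 c) \<le> repack_const"
    by (rule repack_const[OF pk, of P0]) (use d P0(2) in auto)
  have UU: "X' \<union> (X - X') = ?U" by blast
  obtain P2 where P2: "items feasible P2 = loose_profile ?p' X'" "sum P2 feasible = card X'" "(\<Sum>c\<in>feasible. P1 c - P2 c) \<le> repack_const * card (X - X')"
    using shrink_counts[OF p g(2), of "X - X'" P1] P1 fin Xl unfolding UU by auto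
  have P02: "(\<Sum>c\<in>feasible. P0 c - P2 c) \<le> repack_const * (card (X - X') + 1)"
  proof -
    have "(\<Sum>c\<in>feasible. P0 c - P2 c) \<le> (\<Sum>c\<in>feasible. (P0 c - P1 c) + (P1 c - P2 c))" by (rule sum_mono) simp
    also have "\<dots> \<le> repack_const * (card (X - X') + 1)" using P1(3) P2(3) by (simp add: sum.distrib)
    finally show ?thesis .
  qed
  obtain c' where c': "\<forall>s\<in>X'. c' s \<in> feasible" "\<forall>d\<in>feasible. card {s \<in> X'. c' s = d} = P2 d"
     "card {s \<in> X'. c' s \<noteq> c s} \<le> (\<Sum>d\<in>feasible. card {s \<in> ?U. c s = d} - P2 d)"
    using labelling_with_counts[OF fin(3) finite_feasible, of c X' P2] cC P2(2) by auto
  have ceq: "c s = (\<lambda>r. card {K \<in> loose_large p ?U. f K = s \<and> size_class K = r})" for s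
    by (simp add: c_def profile_def fun_eq_iff conj_assoc)
  have tot: "(\<Sum>s\<in>X'. c' s r) = card {K \<in> loose_large ?p' X'. size_class K = r}" for r
  proof -
    have "(\<Sum>s\<in>X'. c' s r) = items feasible (\<lambda>d. card {s \<in> X'. c' s = d}) r" by (rule label_counts(1)[OF fin(2) c'(1), symmetric])
    also have "\<dots> = items feasible P2 r" unfolding items_def by (intro sum.cong) (use c'(2) in auto)
    also have "\<dots> = profile (loose_large ?p' X') r" by (simp only: P2(1) loose_profile_loose_large[OF fin(2)])
    finally show ?thesis by (simp only: profile_def)
  qed
  have rI: "size_class ` loose_large p ?U \<subseteq> {1..q*q}" "size_class ` loose_large ?p' X' \<subseteq> {1..q*q}"
    using size_class_bounds(1)[OF pP] size_class_bounds(1)[OF p] loose_large_sub by blast+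
  obtain f' where f': "\<forall>K\<in>loose_large ?p' X'. f' K \<in> X'" "\<forall>s\<in>X'. (\<lambda>r. card {K \<in> loose_large ?p' X'. f' K = s \<and> size_class K = r}) = c' s"
     "card {K \<in> loose_large ?p' X'. K \<notin> loose_large p ?U \<or> f' K \<noteq> f K} \<le>
       (q * q + 3 * q) * card {s \<in> X'. c' s \<noteq> (\<lambda>r. card {K \<in> loose_large p ?U. f K = s \<and> size_class K = r})} + card (loose_large p ?U - loose_large ?p' X')"
    using items_with_labels[OF loose_large_finite loose_large_finite fin(2) _ rI tot, of "q * q + 3 * q" f] feasible_count c'(1) by auto
  have "profile {K \<in> loose_large ?p' X'. f' K = s} = c' s" if "s \<in> X'" for s
    using bspec[OF f'(2) that] by (simp add: profile_def fun_eq_iff conj_assoc)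
  hence pk': "packed ?p' X' f'" using f'(1) c'(1) by (simp add: packed_def)
  have "card {s \<in> X'. c' s \<noteq> c s} \<le> repack_const * (card (X - X') + 1)" using c'(3) P02 unfolding P0_def by linarith
  hence "(q * q + 3 * q) * card {s \<in> X'. c' s \<noteq> c s} \<le> (q * q + 3 * q) * (repack_const * (card (X - X') + 1))" by (rule mult_le_mono2)
  moreover have "card (loose_large p ?U - loose_large ?p' X') \<le> 2 * q * card (X - X') + 2" using loose_large_lost[OF p Xl(3), of X'] unfolding UX .
  ultimately show ?thesis using pk' f'(3) unfolding ceq[symmetric] by (intro exI[of _ f']) linarith
qed

definition lift where
  "lift p f K = (case AB p of None \<Rightarrow> f K | Some ab \<Rightarrow> if K = fst ab \<union> snd ab then f (snd ab) else f K)"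

definition changes where
  "changes p X X' = card (X - X') + card (X' - X) + card (X \<inter> hit_servers p) + (if free_change p then 1 else 0)"

lemma keep_step:
  assumes p: "p @ [e] \<in> PP" and f: "packed p X f" and Xl: "X \<subseteq> {..<l}"
    and nH: "X \<inter> hit_servers (p @ [e]) = {}" and nF: "\<not> free_change (p @ [e])"
  shows "packed (p @ [e]) X (lift (p @ [e]) f)"
proof (cases rule: step_home[OF p])
  case 1
  have "loose_large (p @ [e]) X = loose_large p X" using 1 by (simp add: loose_large_def)
  moreover have "lift (p @ [e]) f = f" using 1 by (simp add: lift_def fun_eq_iff)
  ultimately show ?thesis using f by (simp add: packed_def)
next
  case (2 A B)
  note D = mergeD[OF 2(2) p]
  have pP: "p \<in> PP" by (rule PP_closed[OF p])
  let ?K = "A \<union> B" and ?L = "loose_large p X" and ?L' = "loose_large (p @ [e]) X"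
  have same: "profile {K \<in> C (p @ [e]). large K \<and> N (p @ [e]) K = h} = profile {K \<in> C p. large K \<and> N p K = h}"
    if h: "\<forall>s. h = Some s \<longrightarrow> s \<in> X" for h
  proof (cases h)
    case None thus ?thesis using nF by (simp add: free_change_def free_large_def)
  next
    case (Some s)
    hence s: "s \<in> X" "s < l" "s \<notin> hit_servers (p @ [e])" using h Xl nH by auto
    thus ?thesis using Some by (simp add: hit_servers_def server_type_def home_large_def)
  qed
  have eq: "(if large A \<and> N p A = h \<and> size_class A = r then 1 else 0) + (if large B \<and> N p B = h \<and> size_class B = r then 1 else 0)
     = (if large ?K \<and> N (p @ [e]) ?K = h \<and> size_class ?K = r then 1 else (0::nat))" if h: "\<forall>s. h = Some s \<longrightarrow> s \<in> X" for h r
    using profile_merge[OF 2(2) p 2(4), of h r] unfolding same[OF h] by linarith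
  have LL': "J \<in> ?L' \<longleftrightarrow> J \<in> ?L" if "J \<noteq> A" "J \<noteq> B" "J \<noteq> ?K" for J
    using that D(5) 2(4)[of J] by (auto simp: loose_large_def)
  have nAB: "A \<notin> ?L'" "B \<notin> ?L'" "?K \<notin> ?L"
  proof -
    have "A \<noteq> ?K" "B \<noteq> ?K" using D(1,2,15) by auto
    thus "A \<notin> ?L'" "B \<notin> ?L'" using D(5) by (auto simp: loose_large_def)
    show "?K \<notin> ?L" using D(15) by (simp add: loose_large_def)
  qed
  have lf: "lift (p @ [e]) f J = (if J = ?K then f B else f J)" for J by (simp add: lift_def 2(1))
  show ?thesis
  proof (cases "?K \<in> ?L'")
    case False
    have "A \<notin> ?L"
    proof
      assume A: "A \<in> ?L"
      hence "\<forall>s. N p A = Some s \<longrightarrow> s \<in> X" "large A" by (auto simp: loose_large_def)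
      from eq[OF this(1), of "size_class A"] this(2) have "large ?K \<and> N (p @ [e]) ?K = N p A" by (auto split: if_splits)
      thus False using False A D(14) by (auto simp: loose_large_def)
    qed
    moreover have "B \<notin> ?L"
    proof
      assume B: "B \<in> ?L"
      hence "\<forall>s. N p B = Some s \<longrightarrow> s \<in> X" "large B" by (auto simp: loose_large_def)
      from eq[OF this(1), of "size_class B"] this(2) have "large ?K \<and> N (p @ [e]) ?K = N p B" by (auto split: if_splits)
      thus False using False B D(14) by (auto simp: loose_large_def)
    qed
    ultimately have LE: "?L' = ?L" using LL' nAB False by (intro set_eqI) metis
    have "lift (p @ [e]) f J = f J" if "J \<in> ?L" for J using that nAB(3) lf by auto
    hence "{J \<in> ?L. lift (p @ [e]) f J = s} = {J \<in> ?L. f J = s}" "\<forall>J\<in>?L. lift (p @ [e]) f J = f J" for s by auto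
    thus ?thesis using f unfolding packed_def LE by simp
  next
    case True
    define h where "h = N (p @ [e]) ?K"
    have hX: "\<forall>s. h = Some s \<longrightarrow> s \<in> X" and lK: "large ?K" using True by (auto simp: loose_large_def h_def)
    have one: "(large A \<and> N p A = h \<and> size_class A = size_class ?K) \<noteq> (large B \<and> N p B = h \<and> size_class B = size_class ?K)"
      using eq[OF hX, of "size_class ?K"] lK by (simp add: h_def split: if_splits)
    have nA: "\<not> (large A \<and> size_class A = size_class ?K)"
    proof
      assume a: "large A \<and> size_class A = size_class ?K"
      have "large B" using a D(4) unfolding large_def by (meson mult_le_mono2 order_trans)
      from size_class_large_union[OF this, of A ?K] a D(16) show False by simp
    qed
    hence B: "large B" "N p B = h" "size_class B = size_class ?K" using one by blast+
    have lA: "\<not> large A" using size_class_large_union[of A B ?K] D(16) B(3) by auto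
    have BL: "B \<in> ?L" using B hX D(2) by (simp add: loose_large_def)
    have AL: "A \<notin> ?L" using lA by (simp add: loose_large_def)
    have KB: "?K \<noteq> B" using nAB(3) BL by auto
    have KA: "A \<noteq> ?K" using D(1,15) by auto
    have LE: "?L' = insert ?K (?L - {B})"
    proof (rule set_eqI)
      fix J
      consider "J = A" | "J = B" | "J = ?K" | "J \<noteq> A" "J \<noteq> B" "J \<noteq> ?K" by argo
      thus "J \<in> ?L' \<longleftrightarrow> J \<in> insert ?K (?L - {B})"
      proof cases
        case 1 show ?thesis unfolding 1 using nAB(1) AL KA by simp
      next
        case 2 show ?thesis unfolding 2 using nAB(2) KB by simp
      next
        case 3 show ?thesis unfolding 3 using True by simp
      next
        case 4 thus ?thesis using LL'[OF 4] by simp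
      qed
    qed
    have "lift (p @ [e]) f J \<in> X" if "J \<in> ?L'" for J
      using that f BL nAB(3) unfolding LE lf packed_def by auto
    moreover have "profile {J \<in> ?L'. lift (p @ [e]) f J = s} = profile {J \<in> ?L. f J = s}" for s
    proof
      fix r
      let ?Y' = "{J \<in> {J \<in> ?L'. lift (p @ [e]) f J = s}. size_class J = r}" and ?Y = "{J \<in> {J \<in> ?L. f J = s}. size_class J = r}"
      show "profile {J \<in> ?L'. lift (p @ [e]) f J = s} r = profile {J \<in> ?L. f J = s} r"
      proof (cases "f B = s \<and> size_class B = r")
        case True
        have Y1: "?Y' = insert ?K (?Y - {B})"
          using True B(3) KB nAB(3) unfolding LE lf by auto
        have Y2: "B \<in> ?Y" and Y3: "?K \<notin> ?Y" using True BL nAB(3) by auto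
        have Y4: "finite ?Y" using loose_large_finite by simp
        have "card ?Y' = Suc (card (?Y - {B}))" unfolding Y1 using Y3 Y4 by (intro card_insert_disjoint) auto
        also have "\<dots> = card ?Y" by (rule card_Suc_Diff1[OF Y4 Y2])
        finally show ?thesis unfolding profile_def .
      next
        case False
        have "?Y' = ?Y"
        proof (rule set_eqI)
          fix J
          consider "J = ?K" | "J = B" | "J \<noteq> B" "J \<noteq> ?K" by argo
          thus "J \<in> ?Y' \<longleftrightarrow> J \<in> ?Y"
          proof cases
            case 1 show ?thesis unfolding 1 using False B(3) nAB(3) lf[of ?K] by simp
          next
            case 2 show ?thesis unfolding 2 using False nAB(2) by simp
          next
            case 3
            hence "J \<in> ?L' \<longleftrightarrow> J \<in> ?L" unfolding LE by simp
            thus ?thesis using 3 lf[of J] by simp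
          qed
        qed
        thus ?thesis unfolding profile_def by (rule arg_cong)
      qed
    qed
    ultimately show ?thesis using f unfolding packed_def by simp
  qed
qed

definition relocation_const :: nat where "relocation_const = 2 * (q * q + 3 * q) * repack_const + 2 * q + 2"

lemma pack_step:
  assumes p: "p @ [e] \<in> PP" and g: "good p X" "good (p @ [e]) X'" and f: "packed p X f"
    and h: "\<forall>s<l. s \<notin> X \<longrightarrow> (\<forall>K\<in>home_large p s. f K = s)"
  shows "\<exists>f'. packed (p @ [e]) X' f' \<and>
     card {K \<in> loose_large (p @ [e]) X'. f' K \<noteq> lift (p @ [e]) f K} \<le> relocation_const * changes (p @ [e]) X X'"
proof (cases "changes (p @ [e]) X X' = 0")
  case True
  have Xl: "X \<subseteq> {..<l}" "X' \<subseteq> {..<l}" using g by (auto simp: good_def)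
  hence fin: "finite X" "finite X'" using finite_subset by blast+
  have "X - X' = {}" "X' - X = {}" "X \<inter> hit_servers (p @ [e]) = {}" "\<not> free_change (p @ [e])"
    using True fin by (auto simp: changes_def split: if_splits)
  moreover from this have "X' = X" by blast
  ultimately show ?thesis using keep_step[OF p f Xl(1)] by (intro exI[of _ "lift (p @ [e]) f"]) simp
next
  case False
  obtain f' where f': "packed (p @ [e]) X' f'"
     "card {K \<in> loose_large (p @ [e]) X'. K \<notin> loose_large p (X \<union> X') \<or> f' K \<noteq> f K}
       \<le> (q * q + 3 * q) * (repack_const * (card (X - X') + 1)) + (2 * q * card (X - X') + 2)"
    using repack_step[OF p g f h] by blast
  let ?n = "changes (p @ [e]) X X'"
  have lf: "lift (p @ [e]) f K = f K" if K: "K \<in> C p" for K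
  proof (cases rule: step_home[OF p])
    case 1 thus ?thesis by (simp add: lift_def)
  next
    case (2 A B)
    thus ?thesis using K mergeD(15)[OF 2(2) p] by (auto simp: lift_def)
  qed
  have "card {K \<in> loose_large (p @ [e]) X'. f' K \<noteq> lift (p @ [e]) f K} \<le> card {K \<in> loose_large (p @ [e]) X'. K \<notin> loose_large p (X \<union> X') \<or> f' K \<noteq> f K}"
  proof (rule card_mono)
    show "{K \<in> loose_large (p @ [e]) X'. f' K \<noteq> lift (p @ [e]) f K} \<subseteq> {K \<in> loose_large (p @ [e]) X'. K \<notin> loose_large p (X \<union> X') \<or> f' K \<noteq> f K}"
    proof
      fix K assume K: "K \<in> {K \<in> loose_large (p @ [e]) X'. f' K \<noteq> lift (p @ [e]) f K}"
      have "f' K \<noteq> f K" if L: "K \<in> loose_large p (X \<union> X')"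
      proof -
        have "K \<in> C p" using L loose_large_sub by blast
        from lf[OF this] show ?thesis using K by simp
      qed
      thus "K \<in> {K \<in> loose_large (p @ [e]) X'. K \<notin> loose_large p (X \<union> X') \<or> f' K \<noteq> f K}" using K by blast
    qed
  qed (use loose_large_finite in simp)
  also have "\<dots> \<le> (q * q + 3 * q) * (repack_const * (card (X - X') + 1)) + (2 * q * card (X - X') + 2)" by (rule f'(2))
  also have "\<dots> \<le> (q * q + 3 * q) * (repack_const * (2 * ?n)) + (2 * q * ?n + 2 * ?n)"
  proof -
    have c: "card (X - X') \<le> ?n" by (simp add: changes_def)
    have c1: "1 \<le> ?n" using False by linarith
    show ?thesis by (intro add_mono mult_le_mono2) (use c c1 in linarith)+
  qed
  also have "\<dots> = relocation_const * ?n" by (simp add: relocation_const_def algebra_simps)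
  finally show ?thesis using f'(1) by blast
qed

end

section \<open>Serving a request\<close>

locale rounded = housed l k q f0 V F for l k q f0 V F +
  fixes \<epsilon> :: real
  assumes eps: "0 < \<epsilon>" "\<epsilon> < 1 / 4" and qeps: "6 \<le> \<epsilon> * real q"
begin

definition comp_of where "comp_of p v = (adj (set p))\<^sup>* `` {v}"

lemma comp_of_C: "v \<in> V \<Longrightarrow> comp_of p v \<in> C p"
  by (simp add: comp_of_def C_def components_adj)

lemma comp_of_self: "v \<in> comp_of p v"
  by (simp add: comp_of_def)

lemma comp_of_eq: "v \<in> V \<Longrightarrow> K \<in> C p \<Longrightarrow> v \<in> K \<Longrightarrow> comp_of p v = K"
  using C_disj[OF comp_of_C[of v p], of K] comp_of_self[of v p] by blast

definition weight :: "nat set \<Rightarrow> real" where "weight K = real (card K)"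

definition join_moves where
  "join_moves p f = (case AB p of None \<Rightarrow> 0 | Some ab \<Rightarrow> if f (fst ab) \<noteq> f (snd ab) then weight (fst ab) else 0)"

lemma weight_nonneg: "\<forall>K\<in>S. 0 \<le> weight K"
  by (simp add: weight_def)

lemma move_cost:
  assumes p: "p @ [e] \<in> PP"
  shows "real (card {v \<in> V. f' (comp_of (p @ [e]) v) \<noteq> f (comp_of p v)})
    \<le> join_moves (p @ [e]) f + relocated weight (C (p @ [e])) (lift (p @ [e]) f) f'"
proof -
  let ?p' = "p @ [e]"
  have pP: "p \<in> PP" by (rule PP_closed[OF p])
  have "real (card {v \<in> V. f' (comp_of ?p' v) \<noteq> f (comp_of p v)}) = (\<Sum>K\<in>C ?p'. real (card {v \<in> K. f' (comp_of ?p' v) \<noteq> f (comp_of p v)}))"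
    unfolding C_partition_card[OF p, symmetric] by simp
  also have "\<dots> \<le> join_moves ?p' f + relocated weight (C ?p') (lift ?p' f) f'"
  proof (cases rule: step_home[OF p])
    case 1
    have "real (card {v \<in> K. f' (comp_of ?p' v) \<noteq> f (comp_of p v)}) \<le> (if lift ?p' f K \<noteq> f' K then weight K else 0)" if K: "K \<in> C ?p'" for K
    proof -
      have cm: "comp_of ?p' v = K" "comp_of p v = K" if v: "v \<in> K" for v
      proof -
        have vV: "v \<in> V" using C_sub[OF p K] v by blast
        show "comp_of ?p' v = K" by (rule comp_of_eq[OF vV K v])
        show "comp_of p v = K" by (rule comp_of_eq[OF vV _ v]) (use K 1(2) in simp)
      qed
      have "{v \<in> K. f' (comp_of ?p' v) \<noteq> f (comp_of p v)} = (if f K \<noteq> f' K then K else {})" using cm by auto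
      thus ?thesis using 1(1) by (simp add: lift_def weight_def)
    qed
    hence "(\<Sum>K\<in>C ?p'. real (card {v \<in> K. f' (comp_of ?p' v) \<noteq> f (comp_of p v)})) \<le> relocated weight (C ?p') (lift ?p' f) f'"
      unfolding relocated_def by (rule sum_mono)
    moreover have "join_moves ?p' f = 0" using 1(1) by (simp add: join_moves_def)
    ultimately show ?thesis by linarith
  next
    case (2 A B)
    note D = mergeD[OF 2(2) p]
    have j: "join_moves ?p' f = (if f A \<noteq> f B then weight A else 0)" by (simp add: join_moves_def 2(1))
    have "real (card {v \<in> K. f' (comp_of ?p' v) \<noteq> f (comp_of p v)})
       \<le> (if K = A \<union> B then join_moves ?p' f else 0) + (if lift ?p' f K \<noteq> f' K then weight K else 0)" if K: "K \<in> C ?p'" for K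
    proof -
      have cm': "comp_of ?p' v = K" if v: "v \<in> K" for v
        by (rule comp_of_eq[OF _ K v]) (use C_sub[OF p K] v in blast)
      show ?thesis
      proof (cases "K = A \<union> B")
        case False
        hence KC: "K \<in> C p" using K D(5) by auto
        have cm: "comp_of p v = K" if v: "v \<in> K" for v by (rule comp_of_eq[OF _ KC v]) (use C_sub[OF p K] v in blast)
        have "{v \<in> K. f' (comp_of ?p' v) \<noteq> f (comp_of p v)} = (if f K \<noteq> f' K then K else {})" using cm cm' by auto
        thus ?thesis using False by (simp add: lift_def weight_def 2(1))
      next
        case True
        have cA: "comp_of p v = A" if v: "v \<in> A" for v by (rule comp_of_eq[OF _ D(1) v]) (use C_sub[OF pP D(1)] v in blast)
        have cB: "comp_of p v = B" if v: "v \<in> B" for v by (rule comp_of_eq[OF _ D(2) v]) (use C_sub[OF pP D(2)] v in blast)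
        have lf: "lift ?p' f K = f B" using True by (simp add: lift_def 2(1))
        show ?thesis
        proof (cases "f B = f' K")
          case fB: True
          have "{v \<in> K. f' (comp_of ?p' v) \<noteq> f (comp_of p v)} \<subseteq> (if f A \<noteq> f B then A else {})"
          proof
            fix v assume v: "v \<in> {v \<in> K. f' (comp_of ?p' v) \<noteq> f (comp_of p v)}"
            hence vK: "v \<in> K" and ne: "f' K \<noteq> f (comp_of p v)" using cm' by auto
            have "v \<notin> B" using cB ne fB by auto
            hence vA: "v \<in> A" using vK True by blast
            thus "v \<in> (if f A \<noteq> f B then A else {})" using cA[OF vA] ne fB by auto
          qed
          hence "card {v \<in> K. f' (comp_of ?p' v) \<noteq> f (comp_of p v)} \<le> card (if f A \<noteq> f B then A else {})"
            using D(6) by (intro card_mono) auto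
          also have "real \<dots> = join_moves ?p' f" unfolding j by (simp add: weight_def)
          finally have "real (card {v \<in> K. f' (comp_of ?p' v) \<noteq> f (comp_of p v)}) \<le> join_moves ?p' f" by simp
          thus ?thesis using True by (simp add: weight_def)
        next
          case False
          have "card {v \<in> K. f' (comp_of ?p' v) \<noteq> f (comp_of p v)} \<le> card K" using C_fin[OF p K] by (intro card_mono) auto
          hence "real (card {v \<in> K. f' (comp_of ?p' v) \<noteq> f (comp_of p v)}) \<le> weight K" by (simp add: weight_def)
          moreover have "0 \<le> join_moves ?p' f" unfolding j by (simp add: weight_def)
          ultimately show ?thesis using False True lf by simp
        qed
      qed
    qed
    hence "(\<Sum>K\<in>C ?p'. real (card {v \<in> K. f' (comp_of ?p' v) \<noteq> f (comp_of p v)}))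
       \<le> (\<Sum>K\<in>C ?p'. (if K = A \<union> B then join_moves ?p' f else 0) + (if lift ?p' f K \<noteq> f' K then weight K else 0))" by (rule sum_mono)
    also have "\<dots> = join_moves ?p' f + relocated weight (C ?p') (lift ?p' f) f'"
      unfolding sum.distrib relocated_def using C_finite D(14) by (simp add: sum.delta)
    finally show ?thesis .
  qed
  finally show ?thesis .
qed

definition soft_cap :: real where "soft_cap = (1 + \<epsilon> / 2) * real k"
definition excess where "excess p f = overload weight (C p) l soft_cap f"
definition valid_state where
  "valid_state p X f \<longleftrightarrow> (\<forall>K\<in>C p. f K < l) \<and> (\<forall>s<l. s \<notin> X \<longrightarrow> (\<forall>K\<in>C p. N p K = Some s \<longrightarrow> f K = s)) \<and> packed p X f \<and>
     (\<forall>s<l. load weight (C p) f s \<le> (1 + \<epsilon>) * real k)"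

lemma overload_lift:
  assumes p: "p @ [e] \<in> PP" and f: "\<forall>K\<in>C p. f K < l"
  shows "excess (p @ [e]) (lift (p @ [e]) f) \<le> excess p f + join_moves (p @ [e]) f"
proof (cases rule: step_home[OF p])
  case 1
  hence "lift (p @ [e]) f = f" "join_moves (p @ [e]) f = 0" by (simp_all add: lift_def join_moves_def fun_eq_iff)
  thus ?thesis using 1(2) by (simp add: excess_def)
next
  case (2 A B)
  note D = mergeD[OF 2(2) p]
  let ?p' = "p @ [e]"
  have j: "join_moves ?p' f = (if f A \<noteq> f B then weight A else 0)" by (simp add: join_moves_def 2(1))
  have ld: "load weight (C p) f s = (\<Sum>K\<in>C p. if f K = s then weight K else 0)" for p f s
    unfolding load_def using C_finite by (rule sum.inter_filter)
  have lf: "lift ?p' f K = (if K = A \<union> B then f B else f K)" for K by (simp add: lift_def 2(1))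
  have E: "load weight (C ?p') (lift ?p' f) s + ((if f A = s then weight A else 0) + (if f B = s then weight B else 0))
     = load weight (C p) f s + (if lift ?p' f (A \<union> B) = s then weight (A \<union> B) else 0)" for s
    unfolding ld
  proof (rule sum_merge[OF 2(2) p])
    fix K assume "K \<in> C p"
    hence "K \<noteq> A \<union> B" using D(15) by auto
    thus "(if lift ?p' f K = s then weight K else 0) = (if f K = s then weight K else 0)" by (simp add: lf)
  qed
  have cAB: "weight (A \<union> B) = weight A + weight B" "0 \<le> weight A" using D(16) by (simp_all add: weight_def)
  have l1: "load weight (C ?p') (lift ?p' f) s \<le> load weight (C p) f s + (if s = f B then join_moves ?p' f else 0)" for s
    using E[of s] cAB by (simp add: j lf split: if_splits)
  have "max 0 (load weight (C ?p') (lift ?p' f) s - soft_cap) \<le> max 0 (load weight (C p) f s - soft_cap) + (if s = f B then join_moves ?p' f else 0)" for s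
  proof -
    have "0 \<le> (if s = f B then join_moves ?p' f else 0)" unfolding j by (simp add: weight_def)
    thus ?thesis using l1[of s] by linarith
  qed
  hence "excess ?p' (lift ?p' f) \<le> (\<Sum>s<l. max 0 (load weight (C p) f s - soft_cap) + (if s = f B then join_moves ?p' f else 0))"
    unfolding excess_def overload_def by (intro sum_mono)
  also have "\<dots> = excess p f + join_moves ?p' f" unfolding sum.distrib excess_def overload_def using f D(2) by simp
  finally show ?thesis .
qed

lemma natural_cost_nonneg: "0 \<le> natural_cost p"
  by (auto simp: natural_cost_def natcost_def split: option.splits)

lemma join_cost:
  assumes p: "p @ [e] \<in> PP" and I: "valid_state p X f" and X: "finite X"
  shows "join_moves (p @ [e]) f \<le> natural_cost (p @ [e]) + (\<Sum>s\<in>X. real (W (p @ [e]) s) - real (W p s))"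
proof -
  have Wn: "0 \<le> real (W (p @ [e]) s) - real (W p s)" for s using W_mono[OF p, of s] by simp
  hence Sn: "0 \<le> (\<Sum>s\<in>X. real (W (p @ [e]) s) - real (W p s))" by (intro sum_nonneg)
  show ?thesis
  proof (cases rule: step_home[OF p])
    case 1 thus ?thesis using Sn natural_cost_nonneg[of "p @ [e]"] by (simp add: join_moves_def)
  next
    case (2 A B)
    note D = mergeD[OF 2(2) p]
    have pP: "p \<in> PP" by (rule PP_closed[OF p])
    have j: "join_moves (p @ [e]) f \<le> weight A" by (simp add: join_moves_def 2(1) weight_def)
    have n: "natural_cost (p @ [e]) = natcost A B (N p A) (N p B)" by (simp add: natural_cost_def 2(1))
    show ?thesis
    proof (cases "N p A = N p B \<and> N p A \<noteq> None")
      case False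
      hence "weight A \<le> natural_cost (p @ [e])" unfolding n natcost_def by (auto simp: weight_def)
      thus ?thesis using j Sn by linarith
    next
      case True
      have "\<exists>s. N p A = Some s" using conjunct2[OF True] by simp
      then obtain s where sA: "N p A = Some s" by (elim exE)
      have s: "N p A = Some s" "N p B = Some s" using sA True by simp_all
      have sl: "s < l" by (rule okhomeD_Some(1)) (use okN[OF pP D(1)] s in simp)
      show ?thesis
      proof (cases "s \<in> X")
        case False
        have "f A = s" "f B = s" using I sl False s D(1,2) unfolding valid_state_def by blast+
        hence "join_moves (p @ [e]) f = 0" by (simp add: join_moves_def 2(1))
        thus ?thesis using Sn natural_cost_nonneg[of "p @ [e]"] by linarith
      next
        case sX: True
        have "weight A = real (W (p @ [e]) s) - real (W p s)" using s by (simp add: 2(5) weight_def)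
        also have "\<dots> \<le> (\<Sum>s\<in>X. real (W (p @ [e]) s) - real (W p s))" by (rule member_le_sum[OF sX]) (use X Wn in auto)
        finally show ?thesis using j natural_cost_nonneg[of "p @ [e]"] by linarith
      qed
    qed
  qed
qed

definition target :: "edge list \<Rightarrow> nat set \<Rightarrow> (nat set \<Rightarrow> nat) \<Rightarrow> (nat set \<Rightarrow> nat) \<Rightarrow> nat set \<Rightarrow> nat" where
  "target p X h g K = (if K \<in> loose_large p X then h K else
     (case N p K of None \<Rightarrow> g K | Some s \<Rightarrow> (if s \<in> X then g K else s)))"

lemma target_cost:
  assumes p: "p @ [e] \<in> PP" and I: "valid_state p X f" and X: "X \<subseteq> {..<l}"
    and h: "card {K \<in> loose_large (p @ [e]) X'. h K \<noteq> lift (p @ [e]) f K} \<le> relocation_const * n" and n: "card (X - X') \<le> n"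
  shows "relocated weight (C (p @ [e])) (lift (p @ [e]) f) (target (p @ [e]) X' h (lift (p @ [e]) f))
     \<le> natural_cost (p @ [e]) + real k * (real relocation_const + 2) * real n"
proof -
  let ?p' = "p @ [e]"
  let ?g = "lift ?p' f"
  let ?t = "target ?p' X' h ?g"
  let ?Y = "{K \<in> loose_large ?p' X'. h K \<noteq> ?g K}"
  have fX: "finite (X - X')" using X finite_subset by blast
  have pP: "p \<in> PP" by (rule PP_closed[OF p])
  have hl: "s < l" if "K \<in> C ?p'" "N ?p' K = Some s" for K s
    by (rule okhomeD_Some(1)) (use okN[OF p that(1)] that(2) in simp)
  have home: "?g K = s" if K: "K \<in> C p" "K \<in> C ?p'" "N p K = Some s" "s \<notin> X" "?g K = f K" for K s
  proof -
    have "s < l" by (rule okhomeD_Some(1)) (use okN[OF pP K(1)] K(3) in simp)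
    thus ?thesis using I K unfolding valid_state_def by simp
  qed
  define mg where "mg K = (if \<exists>A B. AB ?p' = Some (A, B) \<and> K = A \<union> B then natural_cost ?p' else 0)" for K
  have mg0: "0 \<le> mg K" for K using natural_cost_nonneg by (simp add: mg_def)
  have per: "(if ?g K \<noteq> ?t K then weight K else 0) \<le> (if K \<in> ?Y then real k else 0)
      + ((\<Sum>s\<in>X - X'. if N ?p' K = Some s then weight K else 0) + mg K)" if K: "K \<in> C ?p'" for K
  proof -
    have Kk: "weight K \<le> real k" using C_le_k[OF p K] by (simp add: weight_def)
    have s0: "0 \<le> (\<Sum>s\<in>X - X'. if N ?p' K = Some s then weight K else 0)" by (intro sum_nonneg) (simp add: weight_def)
    have y0: "0 \<le> (if K \<in> ?Y then real k else 0)" by simp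
    show ?thesis
    proof (cases "?g K = ?t K")
      case True thus ?thesis using s0 y0 mg0[of K] by simp
    next
      case ne: False
      show ?thesis
      proof (cases "K \<in> loose_large ?p' X'")
        case True
        hence "K \<in> ?Y" using ne by (simp add: target_def)
        thus ?thesis using ne Kk s0 mg0[of K] by simp
      next
        case False
        then obtain s where s: "N ?p' K = Some s" "s \<notin> X'" "?g K \<noteq> s" using ne by (auto simp: target_def split: option.splits if_splits)
        have "s \<in> X \<or> weight K \<le> mg K"
        proof (rule ccontr)
          assume "\<not> ?thesis"
          hence sX: "s \<notin> X" and big: "\<not> weight K \<le> mg K" by auto
          show False
          proof (cases rule: step_home[OF p])
            case 1
            have "?g K = s" by (rule home) (use 1 K s sX in \<open>auto simp: lift_def\<close>)
            thus False using s by simp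
          next
            case (2 A B)
            note D = mergeD[OF 2(2) p]
            show False
            proof (cases "K = A \<union> B")
              case False
              hence KC: "K \<in> C p" using K D(5) by auto
              have "?g K = s" by (rule home[OF KC K]) (use s sX 2 False KC in \<open>auto simp: lift_def\<close>)
              thus False using s by simp
            next
              case KAB: True
              have m: "mg K = natcost A B (N p A) (N p B)" using KAB by (simp add: mg_def 2(1) natural_cost_def)
              show False
              proof (cases "N p B")
                case None
                have "newhome (A \<union> B) (N p B) \<noteq> None" using s(1) 2(3) KAB by simp
                hence "weight K \<le> natcost A B (N p A) (N p B)" unfolding natcost_def KAB weight_def D(16) using None by auto
                hence "weight K \<le> mg K" by (simp only: m)
                thus False using big by simp
              next
                case (Some c)
                have "c = s" using s(1) 2(3) KAB by (auto simp: Some newhome_def split: if_splits)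
                hence NB: "N p B = Some s" using Some by simp
                have "s < l" using hl[OF K s(1)] .
                hence "f B = s" using I sX NB D(2) unfolding valid_state_def by blast
                thus False using s KAB by (simp add: lift_def 2(1))
              qed
            qed
          qed
        qed
        thus ?thesis
        proof
          assume "s \<in> X"
          hence "s \<in> X - X'" using s by simp
          hence "(if N ?p' K = Some s then weight K else 0) \<le> (\<Sum>s\<in>X - X'. if N ?p' K = Some s then weight K else 0)"
            by (rule member_le_sum) (use fX in \<open>auto simp: weight_def\<close>)
          thus ?thesis using s(1) ne y0 mg0[of K] by simp
        next
          assume "weight K \<le> mg K" thus ?thesis using ne s0 y0 by simp
        qed
      qed
    qed
  qed
  have YC: "?Y \<subseteq> C ?p'" using loose_large_sub by blast
  have "relocated weight (C ?p') ?g ?t \<le> (\<Sum>K\<in>C ?p'. (if K \<in> ?Y then real k else 0)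
      + ((\<Sum>s\<in>X - X'. if N ?p' K = Some s then weight K else 0) + mg K))"
    unfolding relocated_def by (rule sum_mono) (rule per)
  also have "\<dots> = (\<Sum>K\<in>C ?p'. if K \<in> ?Y then real k else 0)
      + ((\<Sum>K\<in>C ?p'. \<Sum>s\<in>X - X'. if N ?p' K = Some s then weight K else 0) + (\<Sum>K\<in>C ?p'. mg K))" by (simp only: sum.distrib)
  also have "\<dots> \<le> real k * real (relocation_const * n) + (2 * real k * real n + natural_cost ?p')"
  proof (intro add_mono)
    have "(\<Sum>K\<in>C ?p'. if K \<in> ?Y then real k else 0) = (\<Sum>K\<in>C ?p' \<inter> ?Y. real k)"
      by (rule sum.inter_restrict[OF C_finite, symmetric])
    also have "C ?p' \<inter> ?Y = ?Y" using YC by blast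
    also have "(\<Sum>K\<in>?Y. real k) = real k * real (card ?Y)" by simp
    also have "\<dots> \<le> real k * real (relocation_const * n)" using h by (intro mult_left_mono of_nat_mono) auto
    finally show "(\<Sum>K\<in>C ?p'. if K \<in> ?Y then real k else 0) \<le> real k * real (relocation_const * n)" .
    have "(\<Sum>K\<in>C ?p'. \<Sum>s\<in>X - X'. if N ?p' K = Some s then weight K else 0)
        = (\<Sum>s\<in>X - X'. \<Sum>K\<in>C ?p'. if N ?p' K = Some s then weight K else 0)" by (rule sum.swap)
    also have "\<dots> \<le> (\<Sum>s\<in>X - X'. 2 * real k)"
    proof (rule sum_mono)
      fix s assume s: "s \<in> X - X'"
      have "(\<Sum>K\<in>C ?p'. if N ?p' K = Some s then weight K else 0) = (\<Sum>K\<in>{K \<in> C ?p'. N ?p' K = Some s}. weight K)"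
        using C_finite by (rule sum.inter_filter[symmetric])
      also have "\<dots> = real (\<Sum>K\<in>{K \<in> C ?p'. N ?p' K = Some s}. card K)" by (simp add: weight_def)
      also have "\<dots> \<le> 2 * real k"
      proof -
        have "3 * (\<Sum>K\<in>{K \<in> C ?p'. N ?p' K = Some s}. card K) \<le> 4 * k" by (rule home_load_any[OF p]) (use s X in auto)
        hence "(\<Sum>K\<in>{K \<in> C ?p'. N ?p' K = Some s}. card K) \<le> 2 * k" by linarith
        hence "real (\<Sum>K\<in>{K \<in> C ?p'. N ?p' K = Some s}. card K) \<le> real (2 * k)" by (rule of_nat_mono)
        thus ?thesis by simp
      qed
      finally show "(\<Sum>K\<in>C ?p'. if N ?p' K = Some s then weight K else 0) \<le> 2 * real k" .
    qed
    also have "\<dots> \<le> 2 * real k * real n" using n by (simp add: mult.commute mult_right_mono)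
    finally show "(\<Sum>K\<in>C ?p'. \<Sum>s\<in>X - X'. if N ?p' K = Some s then weight K else 0) \<le> 2 * real k * real n" .
    show "(\<Sum>K\<in>C ?p'. mg K) \<le> natural_cost ?p'"
    proof (cases "AB ?p'")
      case None thus ?thesis using natural_cost_nonneg[of ?p'] by (simp add: mg_def)
    next
      case (Some ab)
      have "mg K = (if K = fst ab \<union> snd ab then natural_cost ?p' else 0)" for K by (cases ab) (simp add: mg_def Some)
      thus ?thesis using C_finite[of ?p'] natural_cost_nonneg[of ?p'] by simp
    qed
  qed
  finally show ?thesis by (simp add: algebra_simps)
qed

lemma card_V: "card V = l * k"
proof -
  have "(\<Sum>s<l. card {v \<in> V. f0 v = s}) = card V" by (rule sum_card_fibres) (use fV f0l in auto)
  thus ?thesis using f0k by simp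
qed

lemma total_weight: "p \<in> PP \<Longrightarrow> sum weight (C p) = real l * real k"
  using C_partition_card[of p "\<lambda>_. True"] card_V by (simp add: weight_def flip: of_nat_sum of_nat_mult)

lemma qk: "real k / real q \<le> \<epsilon> / 6 * real k"
proof -
  have q0: "real q > 0" using q1 by simp
  have "1 / real q \<le> \<epsilon> / 6" using qeps q0 by (simp add: field_simps)
  from mult_right_mono[OF this, of "real k"] show ?thesis by simp
qed

lemma base_load:
  assumes p: "p \<in> PP" and g: "good p X" and h: "packed p X h" and s: "s < l"
  shows "load weight (C p - {K \<in> C p. \<not> large K \<and> (\<forall>s. N p K = Some s \<longrightarrow> s \<in> X)}) (target p X h f1) s \<le> soft_cap"
    (is "load weight (C p - ?Sm) ?t s \<le> _")
proof -
  have q0: "real q > 0" using q1 by simp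
  have lim3: "soft_cap = real k + 3 * (\<epsilon> / 6 * real k)" by (simp add: soft_cap_def algebra_simps)
  have split: "K \<in> loose_large p X \<or> (\<exists>c. N p K = Some c \<and> c \<notin> X)" if "K \<in> C p - ?Sm" for K using that by (auto simp: loose_large_def)
  have tL: "?t K = h K \<and> h K \<in> X" if "K \<in> loose_large p X" for K using that h by (simp add: target_def packed_def)
  have tH: "?t K = c" if "N p K = Some c" "c \<notin> X" for K c using that by (auto simp: target_def loose_large_def)
  show ?thesis
  proof (cases "s \<in> X")
    case True
    have "{K \<in> C p - ?Sm. ?t K = s} \<subseteq> {K \<in> loose_large p X. h K = s}"
    proof
      fix K assume K: "K \<in> {K \<in> C p - ?Sm. ?t K = s}"
      hence "K \<in> loose_large p X \<or> (\<exists>c. N p K = Some c \<and> c \<notin> X)" using split by blast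
      thus "K \<in> {K \<in> loose_large p X. h K = s}"
      proof
        assume "K \<in> loose_large p X" thus ?thesis using tL[of K] K by simp
      next
        assume "\<exists>c. N p K = Some c \<and> c \<notin> X"
        then obtain c where "N p K = Some c" "c \<notin> X" by blast
        thus ?thesis using tH[of K c] K True by simp
      qed
    qed
    hence "load weight (C p - ?Sm) ?t s \<le> (\<Sum>K\<in>{K \<in> loose_large p X. h K = s}. weight K)"
      unfolding load_def by (intro sum_mono2) (use loose_large_finite in \<open>auto simp: weight_def\<close>)
    moreover have "real (q * q) * (\<Sum>K\<in>{K \<in> loose_large p X. h K = s}. weight K) \<le> real (k * (q * q + 3 * q))"
    proof -
      have sub: "{K \<in> loose_large p X. h K = s} \<subseteq> C p" using loose_large_sub by blast
      have "q * q * (\<Sum>K\<in>{K \<in> loose_large p X. h K = s}. card K) = (\<Sum>K\<in>{K \<in> loose_large p X. h K = s}. q * q * card K)" by (rule sum_distrib_left)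
      also have "\<dots> \<le> (\<Sum>K\<in>{K \<in> loose_large p X. h K = s}. k * size_class K)" by (rule sum_mono) (rule size_class_bounds(3)[OF p], use sub in blast)
      also have "\<dots> = k * (\<Sum>r\<in>{1..q*q}. r * profile {K \<in> loose_large p X. h K = s} r)" unfolding profile_sum[OF p sub] by (simp add: sum_distrib_left)
      also have "\<dots> \<le> k * (q * q + 3 * q)"
      proof (rule mult_le_mono2)
        have "profile {K \<in> loose_large p X. h K = s} \<in> feasible" using h True by (simp add: packed_def)
        thus "(\<Sum>r\<in>{1..q*q}. r * profile {K \<in> loose_large p X. h K = s} r) \<le> q * q + 3 * q" by (simp add: feasible_def)
      qed
      finally have "real (q * q * (\<Sum>K\<in>{K \<in> loose_large p X. h K = s}. card K)) \<le> real (k * (q * q + 3 * q))" by (rule of_nat_mono)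
      thus ?thesis by (simp add: weight_def)
    qed
    hence "real q * (real q * (\<Sum>K\<in>{K \<in> loose_large p X. h K = s}. weight K)) \<le> real q * (real k * real q + 3 * real k)"
      by (simp add: algebra_simps)
    hence "real q * (\<Sum>K\<in>{K \<in> loose_large p X. h K = s}. weight K) \<le> real k * real q + 3 * real k"
      using q0 by (simp only: mult_le_cancel_left_pos)
    hence "(\<Sum>K\<in>{K \<in> loose_large p X. h K = s}. weight K) \<le> real k + 3 * (real k / real q)"
      using q0 by (simp add: field_simps)
    ultimately show ?thesis using qk unfolding lim3 by linarith
  next
    case False
    have "{K \<in> C p - ?Sm. ?t K = s} \<subseteq> {K \<in> C p. N p K = Some s}"
    proof
      fix K assume K: "K \<in> {K \<in> C p - ?Sm. ?t K = s}"
      hence "K \<in> loose_large p X \<or> (\<exists>c. N p K = Some c \<and> c \<notin> X)" using split by blast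
      thus "K \<in> {K \<in> C p. N p K = Some s}"
      proof
        assume "K \<in> loose_large p X" thus ?thesis using tL[of K] K False by simp
      next
        assume "\<exists>c. N p K = Some c \<and> c \<notin> X"
        then obtain c where "N p K = Some c" "c \<notin> X" by blast
        thus ?thesis using tH[of K c] K by simp
      qed
    qed
    hence "load weight (C p - ?Sm) ?t s \<le> (\<Sum>K\<in>{K \<in> C p. N p K = Some s}. weight K)"
      unfolding load_def by (intro sum_mono2) (use C_finite in \<open>auto simp: weight_def\<close>)
    moreover have "q * (\<Sum>K\<in>{K \<in> C p. N p K = Some s}. card K) \<le> q * k + k"
      by (rule nonbad_load[OF p s]) (use g s False in \<open>auto simp: good_def\<close>)
    hence "real (q * (\<Sum>K\<in>{K \<in> C p. N p K = Some s}. card K)) \<le> real (q * k + k)" by (rule of_nat_mono)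
    hence "real q * (\<Sum>K\<in>{K \<in> C p. N p K = Some s}. weight K) \<le> real q * real k + real k" by (simp add: weight_def)
    hence "(\<Sum>K\<in>{K \<in> C p. N p K = Some s}. weight K) \<le> real k + real k / real q" using q0 by (simp add: field_simps)
    moreover have "0 \<le> \<epsilon> / 6 * real k" using eps by simp
    ultimately show ?thesis using qk unfolding lim3 by linarith
  qed
qed

definition remaining where "remaining p X = (\<Sum>s\<in>X. real k - real (W p s mod k))"

lemma remaining_step:
  assumes p: "p @ [e] \<in> PP" and X: "X \<subseteq> {..<l}" "X' \<subseteq> {..<l}"
  shows "(\<Sum>s\<in>X. real (W (p @ [e]) s) - real (W p s)) + remaining (p @ [e]) X' \<le> remaining p X + 2 * real k * real (changes (p @ [e]) X X')"
proof -
  let ?p' = "p @ [e]"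
  let ?H = "hit_servers ?p'"
  have fin: "finite X" "finite X'" using X finite_subset by blast+
  have mk: "real (w mod k) \<le> real k" for w using k1 by (simp add: less_imp_le)
  have jump: "W ?p' s \<le> W p s + k" for s
  proof (cases rule: step_home[OF p])
    case 1 thus ?thesis by simp
  next
    case (2 A B) thus ?thesis using mergeD(11)[OF 2(2) p] by simp
  qed
  have per: "real (W ?p' s) - real (W p s) + (if s \<in> X' then real k - real (W ?p' s mod k) else 0)
      \<le> (real k - real (W p s mod k)) + (if s \<in> ?H then 2 * real k else 0)" if s: "s \<in> X" for s
  proof (cases "W ?p' s div k = W p s div k")
    case True
    have "real (W ?p' s) = real (k * (W ?p' s div k)) + real (W ?p' s mod k)"
      "real (W p s) = real (k * (W p s div k)) + real (W p s mod k)" by (simp_all only: of_nat_add[symmetric] mult_div_mod_eq)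
    hence "real (W ?p' s) - real (W p s) = real (W ?p' s mod k) - real (W p s mod k)" unfolding True by linarith
    thus ?thesis using mk[of "W ?p' s"] by (auto split: if_splits)
  next
    case False
    have "s \<in> ?H" using False s X by (auto simp: hit_servers_def)
    moreover have "real (W ?p' s) \<le> real (W p s) + real k" using jump[of s] by linarith
    ultimately show ?thesis using mk[of "W p s"] mk[of "W ?p' s"] by (auto split: if_splits)
  qed
  have "remaining ?p' X' = (\<Sum>s\<in>X' \<inter> X. real k - real (W ?p' s mod k)) + (\<Sum>s\<in>X' - X. real k - real (W ?p' s mod k))"
    unfolding remaining_def using fin(2) by (rule sum.Int_Diff)
  moreover have "(\<Sum>s\<in>X' - X. real k - real (W ?p' s mod k)) \<le> (\<Sum>s\<in>X' - X. real k)" by (rule sum_mono) simp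
  moreover have "(\<Sum>s\<in>X' \<inter> X. real k - real (W ?p' s mod k)) = (\<Sum>s\<in>X. if s \<in> X' then real k - real (W ?p' s mod k) else 0)"
    unfolding Int_commute[of X' X] using fin(1) by (rule sum.inter_restrict)
  ultimately have a: "remaining ?p' X' \<le> (\<Sum>s\<in>X. if s \<in> X' then real k - real (W ?p' s mod k) else 0) + real (card (X' - X)) * real k" by simp
  have "(\<Sum>s\<in>X. real (W ?p' s) - real (W p s)) + (\<Sum>s\<in>X. if s \<in> X' then real k - real (W ?p' s mod k) else 0)
     = (\<Sum>s\<in>X. real (W ?p' s) - real (W p s) + (if s \<in> X' then real k - real (W ?p' s mod k) else 0))" by (simp only: sum.distrib)
  also have "\<dots> \<le> (\<Sum>s\<in>X. (real k - real (W p s mod k)) + (if s \<in> ?H then 2 * real k else 0))" by (rule sum_mono) (rule per)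
  also have "\<dots> = remaining p X + real (card (X \<inter> ?H)) * (2 * real k)"
    unfolding sum.distrib remaining_def using fin(1) by (simp add: sum.If_cases Int_def)
  finally have c: "(\<Sum>s\<in>X. real (W ?p' s) - real (W p s)) + (\<Sum>s\<in>X. if s \<in> X' then real k - real (W ?p' s mod k) else 0)
     \<le> remaining p X + real (card (X \<inter> ?H)) * (2 * real k)" .
  have nn: "0 \<le> real (card (X' - X)) * real k" by simp
  have dist: "(2 * real k) * (real (card (X \<inter> ?H)) + real (card (X' - X)))
    = real (card (X \<inter> ?H)) * (2 * real k) + 2 * (real (card (X' - X)) * real k)" by (simp add: algebra_simps)
  have b: "(\<Sum>s\<in>X. real (W ?p' s) - real (W p s)) + remaining ?p' X'
     \<le> remaining p X + (2 * real k) * (real (card (X \<inter> ?H)) + real (card (X' - X)))"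
    unfolding dist using a c nn by linarith
  have "real (card (X \<inter> ?H)) + real (card (X' - X)) \<le> real (changes ?p' X X')" by (simp add: changes_def)
  hence "(2 * real k) * (real (card (X \<inter> ?H)) + real (card (X' - X))) \<le> (2 * real k) * real (changes ?p' X X')" by (rule mult_left_mono) simp
  thus ?thesis using b by linarith
qed

definition state_potential where "state_potential p X f = 4 / \<epsilon> * excess p f + (1 + 4 / \<epsilon>) * remaining p X"

lemma serve_step:
  assumes p: "p @ [e] \<in> PP" and g: "good p X" "good (p @ [e]) X'" and I: "valid_state p X f"
  shows "\<exists>f'. valid_state (p @ [e]) X' f' \<and>
     real (card {v \<in> V. f' (comp_of (p @ [e]) v) \<noteq> f (comp_of p v)}) + state_potential (p @ [e]) X' f'
     \<le> state_potential p X f + (1 + 4 / \<epsilon>) * (2 * natural_cost (p @ [e]) + real k * (real relocation_const + 4) * real (changes (p @ [e]) X X'))"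
proof -
  let ?p' = "p @ [e]"
  let ?g = "lift ?p' f"
  have pP: "p \<in> PP" by (rule PP_closed[OF p])
  have Xl: "X \<subseteq> {..<l}" "X' \<subseteq> {..<l}" using g by (auto simp: good_def)
  have fX: "finite X" using Xl finite_subset by blast
  have k0: "real k > 0" using k1 by simp
  have pk: "packed p X f" and fl: "\<forall>K\<in>C p. f K < l" using I by (auto simp: valid_state_def)
  have hm: "\<forall>s<l. s \<notin> X \<longrightarrow> (\<forall>K\<in>home_large p s. f K = s)" using I unfolding valid_state_def home_large_def by blast
  obtain h where h: "packed ?p' X' h" "card {K \<in> loose_large ?p' X'. h K \<noteq> ?g K} \<le> relocation_const * changes ?p' X X'"
    using pack_step[OF p g pk hm] by blast
  let ?t = "target ?p' X' h ?g"
  define Sm where "Sm = {K \<in> C ?p'. \<not> large K \<and> (\<forall>s. N ?p' K = Some s \<longrightarrow> s \<in> X')}"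
  have gl: "?g K < l" if K: "K \<in> C ?p'" for K
  proof (cases rule: step_home[OF p])
    case 1 thus ?thesis using K fl by (simp add: lift_def)
  next
    case (2 A B)
    thus ?thesis using K fl mergeD(2,5)[OF 2(2) p] by (auto simp: lift_def)
  qed
  have tl: "\<forall>K\<in>C ?p'. ?t K < l"
  proof
    fix K assume K: "K \<in> C ?p'"
    have "s < l" if "N ?p' K = Some s" for s by (rule okhomeD_Some(1)) (use okN[OF p K] that in simp)
    thus "?t K < l" using gl[OF K] h(1) Xl(2) by (auto simp: target_def packed_def split: option.splits)
  qed
  have small: "\<forall>K\<in>Sm. weight K \<le> \<epsilon> / 2 * real k"
  proof
    fix K assume "K \<in> Sm"
    hence "q * card K < k" by (simp add: Sm_def large_def)
    hence "real (q * card K) \<le> real k" by linarith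
    hence "weight K \<le> real k / real q" using q1 by (simp add: weight_def field_simps)
    also have "\<dots> \<le> \<epsilon> / 6 * real k" by (rule qk)
    also have "\<dots> \<le> \<epsilon> / 2 * real k" using eps by (intro mult_right_mono) auto
    finally show "weight K \<le> \<epsilon> / 2 * real k" .
  qed
  have "\<exists>f'. (\<forall>K. K \<notin> Sm \<longrightarrow> f' K = ?t K) \<and> (\<forall>K\<in>C ?p'. f' K < l) \<and> (\<forall>s<l. load weight (C ?p') f' s \<le> (1 + \<epsilon>) * real k) \<and>
     relocated weight (C ?p') ?t f' \<le> 4 / \<epsilon> * (overload weight (C ?p') l ((1 + \<epsilon> / 2) * real k) ?t - overload weight (C ?p') l ((1 + \<epsilon> / 2) * real k) f')"
  proof (rule rebalance[OF C_finite weight_nonneg tl _ small _ _ l1 eps k0])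
    show "Sm \<subseteq> C ?p'" by (auto simp: Sm_def)
    show "\<forall>s<l. load weight (C ?p' - Sm) ?t s \<le> (1 + \<epsilon> / 2) * real k"
      using base_load[OF p g(2) h(1)] by (simp add: Sm_def soft_cap_def)
    show "sum weight (C ?p') \<le> real l * real k" by (simp add: total_weight[OF p])
  qed
  then obtain f' where f': "\<forall>K. K \<notin> Sm \<longrightarrow> f' K = ?t K" "\<forall>K\<in>C ?p'. f' K < l" "\<forall>s<l. load weight (C ?p') f' s \<le> (1 + \<epsilon>) * real k"
     "relocated weight (C ?p') ?t f' \<le> 4 / \<epsilon> * (excess ?p' ?t - excess ?p' f')"
    unfolding excess_def soft_cap_def by (elim exE conjE)
  have fL: "f' K = h K" if "K \<in> loose_large ?p' X'" for K
  proof -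
    have "K \<notin> Sm" using that by (simp add: Sm_def loose_large_def)
    thus ?thesis using f'(1) that by (simp add: target_def)
  qed
  have pk': "packed ?p' X' f'"
  proof -
    have "{K \<in> loose_large ?p' X'. f' K = s} = {K \<in> loose_large ?p' X'. h K = s}" for s using fL by auto
    thus ?thesis using h(1) fL unfolding packed_def by simp
  qed
  have hm': "f' K = s" if "s \<notin> X'" "K \<in> C ?p'" "N ?p' K = Some s" for s K
  proof -
    have "K \<notin> Sm" "K \<notin> loose_large ?p' X'" using that by (auto simp: Sm_def loose_large_def)
    thus ?thesis using f'(1) that by (simp add: target_def)
  qed
  have inv: "valid_state ?p' X' f'" unfolding valid_state_def using f'(2,3) pk' hm' by blast
  let ?n = "changes ?p' X X'"
  define R1 where "R1 = relocated weight (C ?p') ?g ?t"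
  have r1: "R1 \<le> natural_cost ?p' + real k * (real relocation_const + 2) * real ?n"
    unfolding R1_def by (rule target_cost[OF p I Xl(1) h(2)]) (simp add: changes_def)
  have j: "join_moves ?p' f \<le> natural_cost ?p' + (\<Sum>s\<in>X. real (W ?p' s) - real (W p s))" by (rule join_cost[OF p I fX])
  have o1: "excess ?p' ?g \<le> excess p f + join_moves ?p' f" by (rule overload_lift[OF p fl])
  have o2: "excess ?p' ?t \<le> excess ?p' ?g + R1" unfolding excess_def R1_def by (rule overload_relocated[OF C_finite weight_nonneg tl])
  have mc: "real (card {v \<in> V. f' (comp_of ?p' v) \<noteq> f (comp_of p v)}) \<le> join_moves ?p' f + relocated weight (C ?p') ?g f'" by (rule move_cost[OF p])
  have tr: "relocated weight (C ?p') ?g f' \<le> R1 + relocated weight (C ?p') ?t f'" unfolding R1_def by (rule relocated_triangle[OF weight_nonneg])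
  have wr: "(\<Sum>s\<in>X. real (W ?p' s) - real (W p s)) + remaining ?p' X' \<le> remaining p X + 2 * real k * real ?n" by (rule remaining_step[OF p Xl])
  have c0: "0 \<le> 4 / \<epsilon>" using eps by simp
  have tot: "join_moves ?p' f + R1 + remaining ?p' X' \<le> remaining p X + (2 * natural_cost ?p' + real k * (real relocation_const + 4) * real ?n)"
    using r1 j wr by (simp add: algebra_simps)
  have "4 / \<epsilon> * (excess ?p' ?t - excess ?p' f') \<le> 4 / \<epsilon> * (excess p f + (join_moves ?p' f + R1) - excess ?p' f')"
    by (rule mult_left_mono[OF _ c0]) (use o1 o2 in linarith)
  hence "real (card {v \<in> V. f' (comp_of ?p' v) \<noteq> f (comp_of p v)}) + 4 / \<epsilon> * excess ?p' f' \<le> 4 / \<epsilon> * excess p f + (1 + 4 / \<epsilon>) * (join_moves ?p' f + R1)"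
    using mc tr f'(4) by (simp add: algebra_simps)
  moreover have "(1 + 4 / \<epsilon>) * (join_moves ?p' f + R1 + remaining ?p' X') \<le> (1 + 4 / \<epsilon>) * (remaining p X + (2 * natural_cost ?p' + real k * (real relocation_const + 4) * real ?n))"
    by (rule mult_left_mono[OF tot]) (use c0 in linarith)
  ultimately have "real (card {v \<in> V. f' (comp_of ?p' v) \<noteq> f (comp_of p v)}) + state_potential ?p' X' f'
     \<le> state_potential p X f + (1 + 4 / \<epsilon>) * (2 * natural_cost ?p' + real k * (real relocation_const + 4) * real ?n)"
    unfolding state_potential_def by (simp add: distrib_left)
  thus ?thesis using inv by blast
qed

end

section \<open>Competitive ratio\<close>

context rounded
begin

lemma N_Nil: "N [] {v} = Some (f0 v)"
  by (simp add: N_def F0)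

lemma good_Nil: "good [] {}"
proof -
  have "displaced [] s = 0" for s
    unfolding displaced_def
  proof (intro sum.neutral ballI)
    fix K assume "K \<in> C []"
    then obtain v where v: "K = {v}" by (auto simp: C_Nil)
    have "f0 v = s \<Longrightarrow> {w \<in> {v}. f0 w \<noteq> s} = {}" "f0 v \<noteq> s \<Longrightarrow> {w \<in> {v}. f0 w = s} = {}" by auto
    thus "(if N [] K = Some s then foreign K s else native K s) = 0" by (auto simp: v N_Nil foreign_def native_def)
  qed
  hence b: "\<not> bad [] s" for s using k1 by (simp add: bad_def)
  have "free_large [] = {}" by (auto simp: free_large_def C_Nil N_Nil)
  hence i: "loose_profile [] {} = (\<lambda>r. 0)" by (simp add: loose_profile_def profile_def fun_eq_iff)
  have "items feasible (\<lambda>_. 0) = (\<lambda>r. 0)" by (simp add: items_def fun_eq_iff)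
  hence "packable feasible (\<lambda>r. 0) 0" unfolding packable_def by (intro exI[of _ "\<lambda>_. 0"]) simp
  thus ?thesis using b i by (simp add: good_def)
qed

lemma initial_state:
  defines "f \<equiv> \<lambda>K. f0 (the_elem K)"
  shows "valid_state [] {} f" "state_potential [] {} f = 0"
proof -
  have ld: "load weight (C []) f s = real k" if s: "s < l" for s
  proof -
    have "{K \<in> C []. f K = s} = (\<lambda>v. {v}) ` {v \<in> V. f0 v = s}" by (auto simp: C_Nil f_def)
    hence "load weight (C []) f s = (\<Sum>K\<in>(\<lambda>v. {v}) ` {v \<in> V. f0 v = s}. weight K)" by (simp only: load_def)
    also have "\<dots> = (\<Sum>v\<in>{v \<in> V. f0 v = s}. 1)" by (subst sum.reindex) (auto simp: weight_def)
    also have "\<dots> = real k" using f0k[OF s] by simp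
    finally show ?thesis .
  qed
  have le: "real k \<le> (1 + \<epsilon>) * real k" "real k \<le> soft_cap" using eps by (simp_all add: soft_cap_def algebra_simps)
  have "loose_large [] {} = {}" by (auto simp: loose_large_def C_Nil N_Nil)
  hence "packed [] {} f" by (simp add: packed_def)
  moreover have "f K < l" if "K \<in> C []" for K using that f0l by (auto simp: C_Nil f_def)
  moreover have "f K = s" if "K \<in> C []" "N [] K = Some s" for K s using that by (auto simp: C_Nil N_Nil f_def)
  ultimately show "valid_state [] {} f" using ld le by (simp add: valid_state_def)
  have "excess [] f = 0" unfolding excess_def overload_def using ld le(2) by (intro sum.neutral) auto
  thus "state_potential [] {} f = 0" by (simp add: state_potential_def remaining_def)
qed

lemma state_potential_nonneg: "0 \<le> state_potential p X f"
proof -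
  have "0 \<le> excess p f" unfolding excess_def overload_def by (intro sum_nonneg) simp
  moreover have "0 \<le> remaining p X" unfolding remaining_def by (intro sum_nonneg) (use k1 in \<open>simp add: less_imp_le\<close>)
  ultimately show ?thesis using eps by (simp add: state_potential_def)
qed

lemma valid_state_valid:
  assumes p: "p \<in> PP" and I: "valid_state p X f"
  shows "valid_assignment V l ((1 + \<epsilon>) * real k) (set p) (\<lambda>v. f (comp_of p v))"
  unfolding valid_assignment_def
proof (intro conjI ballI allI impI)
  fix v assume "v \<in> V" thus "f (comp_of p v) < l" using I comp_of_C by (simp add: valid_state_def)
next
  fix s assume s: "s < l"
  have "card {v \<in> V. f (comp_of p v) = s} = (\<Sum>K\<in>C p. card {v \<in> K. f (comp_of p v) = s})" by (rule C_partition_card[OF p, symmetric])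
  also have "\<dots> = (\<Sum>K\<in>C p. if f K = s then card K else 0)"
  proof (rule sum.cong[OF refl])
    fix K assume K: "K \<in> C p"
    have "comp_of p v = K" if v: "v \<in> K" for v by (rule comp_of_eq[OF _ K v]) (use C_sub[OF p K] v in blast)
    hence "{v \<in> K. f (comp_of p v) = s} = (if f K = s then K else {})" by auto
    thus "card {v \<in> K. f (comp_of p v) = s} = (if f K = s then card K else 0)" by simp
  qed
  also have "\<dots> = (\<Sum>K\<in>{K \<in> C p. f K = s}. card K)" using C_finite by (rule sum.inter_filter[symmetric])
  finally have "real (card {v \<in> V. f (comp_of p v) = s}) = load weight (C p) f s" by (simp add: load_def weight_def)
  thus "real (card {v \<in> V. f (comp_of p v) = s}) \<le> (1 + \<epsilon>) * real k" using I s by (simp add: valid_state_def)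
next
  fix K assume "K \<in> components V (set p)"
  hence K: "K \<in> C p" by (simp add: C_def)
  have "comp_of p v = K" if v: "v \<in> K" for v by (rule comp_of_eq[OF _ K v]) (use C_sub[OF p K] v in blast)
  thus "\<exists>s<l. \<forall>v\<in>K. f (comp_of p v) = s" using I K by (intro exI[of _ "f K"]) (simp add: valid_state_def)
qed

definition step_bound where
  "step_bound X \<sigma> t = 2 * natural_cost (take (Suc t) \<sigma>) + real k * (real relocation_const + 4) * real (changes (take (Suc t) \<sigma>) (X (take t \<sigma>)) (X (take (Suc t) \<sigma>)))"

lemma deterministic_algorithm:
  assumes X0: "X [] = {}" and X: "\<forall>p\<in>PP. X p \<subseteq> {..<l} \<and> (p \<noteq> [] \<longrightarrow> good p (X p))"
  shows "\<exists>A. (\<forall>p\<in>PP. valid_assignment V l ((1 + \<epsilon>) * real k) (set p) (A p)) \<and>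
     (\<forall>\<sigma>\<in>PP. real k * schedule_cost V k \<sigma> (run f0 A \<sigma>) \<le> (1 + 4 / \<epsilon>) * (\<Sum>t<length \<sigma>. step_bound X \<sigma> t))"
proof -
  have g: "good p (X p)" if "p \<in> PP" for p using X that good_Nil X0 by (cases "p = []") auto
  define c where "c = 1 + 4 / \<epsilon>"
  have "\<exists>G. G [] = (\<lambda>K. f0 (the_elem K)) \<and> (\<forall>p. p \<in> PP \<longrightarrow> valid_state p (X p) (G p)) \<and>
     (\<forall>p e. p @ [e] \<in> PP \<longrightarrow> real (card {v \<in> V. G (p @ [e]) (comp_of (p @ [e]) v) \<noteq> G p (comp_of p v)}) + state_potential (p @ [e]) (X (p @ [e])) (G (p @ [e]))
       \<le> state_potential p (X p) (G p) + c * (2 * natural_cost (p @ [e]) + real k * (real relocation_const + 4) * real (changes (p @ [e]) (X p) (X (p @ [e])))))"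
  proof (rule prefix_choice[where Q = "\<lambda>p. p \<in> PP" and I = "\<lambda>p f. valid_state p (X p) f"])
    show "valid_state [] (X []) (\<lambda>K. f0 (the_elem K))" unfolding X0 by (rule initial_state(1))
    fix p e assume p: "p @ [e] \<in> PP"
    show "p \<in> PP" by (rule PP_closed[OF p])
    fix f assume I: "valid_state p (X p) f"
    show "\<exists>f'. valid_state (p @ [e]) (X (p @ [e])) f' \<and> real (card {v \<in> V. f' (comp_of (p @ [e]) v) \<noteq> f (comp_of p v)}) + state_potential (p @ [e]) (X (p @ [e])) f'
       \<le> state_potential p (X p) f + c * (2 * natural_cost (p @ [e]) + real k * (real relocation_const + 4) * real (changes (p @ [e]) (X p) (X (p @ [e]))))"
      unfolding c_def by (rule serve_step[OF p g[OF PP_closed[OF p]] g[OF p] I])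
  qed
  then obtain G where G: "G [] = (\<lambda>K. f0 (the_elem K))" "\<forall>p. p \<in> PP \<longrightarrow> valid_state p (X p) (G p)"
     "\<forall>p e. p @ [e] \<in> PP \<longrightarrow> real (card {v \<in> V. G (p @ [e]) (comp_of (p @ [e]) v) \<noteq> G p (comp_of p v)}) + state_potential (p @ [e]) (X (p @ [e])) (G (p @ [e]))
       \<le> state_potential p (X p) (G p) + c * (2 * natural_cost (p @ [e]) + real k * (real relocation_const + 4) * real (changes (p @ [e]) (X p) (X (p @ [e]))))" by (elim exE conjE)
  define A where "A p v = G p (comp_of p v)" for p v
  have "valid_assignment V l ((1 + \<epsilon>) * real k) (set p) (A p)" if p: "p \<in> PP" for p
    unfolding A_def using G(2) p by (intro valid_state_valid) auto
  moreover have "real k * schedule_cost V k \<sigma> (run f0 A \<sigma>) \<le> c * (\<Sum>t<length \<sigma>. step_bound X \<sigma> t)" if s: "\<sigma> \<in> PP" for \<sigma>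
  proof -
    let ?m = "\<lambda>t. real (card {v \<in> V. A (take (Suc t) \<sigma>) v \<noteq> A (take t \<sigma>) v})"
    have st: "?m t + state_potential (take (Suc t) \<sigma>) (X (take (Suc t) \<sigma>)) (G (take (Suc t) \<sigma>))
        \<le> state_potential (take t \<sigma>) (X (take t \<sigma>)) (G (take t \<sigma>)) + c * step_bound X \<sigma> t" if t: "t < length \<sigma>" for t
    proof -
      note T = take_Suc_PP[OF s t]
      show ?thesis using spec[OF spec[OF G(3), of "take t \<sigma>"], of "\<sigma> ! t"] T(2) unfolding step_bound_def A_def T(1) by blast
    qed
    have "(\<Sum>t<m. ?m t) + state_potential (take m \<sigma>) (X (take m \<sigma>)) (G (take m \<sigma>)) \<le> c * (\<Sum>t<m. step_bound X \<sigma> t)" if "m \<le> length \<sigma>" for m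
      using that
    proof (induction m)
      case 0 show ?case using initial_state(2) by (simp add: X0 G(1))
    next
      case (Suc m)
      hence "(\<Sum>t<m. ?m t) + state_potential (take m \<sigma>) (X (take m \<sigma>)) (G (take m \<sigma>)) \<le> c * (\<Sum>t<m. step_bound X \<sigma> t)" by simp
      thus ?case using st[of m] Suc.prems by (simp add: distrib_left)
    qed
    from this[OF order_refl] have le: "(\<Sum>t<length \<sigma>. ?m t) \<le> c * (\<Sum>t<length \<sigma>. step_bound X \<sigma> t)"
      using state_potential_nonneg[of "take (length \<sigma>) \<sigma>" "X (take (length \<sigma>) \<sigma>)" "G (take (length \<sigma>) \<sigma>)"] by linarith
    have rn: "run f0 A \<sigma> t v = A (take t \<sigma>) v" if v: "v \<in> V" for t v
    proof (cases "t = 0")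
      case True
      have "comp_of [] v = {v}" using comp_of_C[OF v, of "[]"] comp_of_self[of v "[]"] by (auto simp: C_Nil)
      thus ?thesis using True by (simp add: run_def A_def G(1))
    next
      case False thus ?thesis by (simp add: run_def)
    qed
    have "{v \<in> V. run f0 A \<sigma> (Suc t) v \<noteq> run f0 A \<sigma> t v} = {v \<in> V. A (take (Suc t) \<sigma>) v \<noteq> A (take t \<sigma>) v}" for t
      using rn by (intro Collect_cong conj_cong refl) simp
    hence "schedule_cost V k \<sigma> (run f0 A \<sigma>) = (\<Sum>t<length \<sigma>. ?m t / real k)" by (simp only: schedule_cost_def)
    also have "\<dots> = (\<Sum>t<length \<sigma>. ?m t) / real k" by (simp only: sum_divide_distrib)
    finally show ?thesis using le k1 by simp
  qed
  ultimately show ?thesis unfolding c_def by blast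
qed

lemma moved_le_cost:
  assumes G: "valid_schedule V l (real k) f0 \<sigma> G" and s: "\<sigma> \<in> PP" "\<sigma> \<noteq> []"
  shows "reference \<sigma> (G (length \<sigma>))" "real (moved (G (length \<sigma>))) \<le> real k * schedule_cost V k \<sigma> G"
proof -
  have "length \<sigma> \<in> {1..length \<sigma>}" using s(2) by (simp add: Suc_le_eq)
  hence "valid_assignment V l (real k) (set (take (length \<sigma>) \<sigma>)) (G (length \<sigma>))" using G unfolding valid_schedule_def by blast
  thus "reference \<sigma> (G (length \<sigma>))" using s(1) by (simp add: reference_def)
  have "moved (G m) \<le> (\<Sum>t<m. card {v \<in> V. G (Suc t) v \<noteq> G t v})" for m
  proof (induction m)
    case 0 show ?case using G by (simp add: moved_def valid_schedule_def)
  next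
    case (Suc m)
    have "moved (G (Suc m)) \<le> card ({v \<in> V. G m v \<noteq> f0 v} \<union> {v \<in> V. G (Suc m) v \<noteq> G m v})"
      unfolding moved_def using fV by (intro card_mono) auto
    also have "\<dots> \<le> moved (G m) + card {v \<in> V. G (Suc m) v \<noteq> G m v}" unfolding moved_def by (rule card_Un_le)
    finally show ?case using Suc by simp
  qed
  hence "real (moved (G (length \<sigma>))) \<le> real (\<Sum>t<length \<sigma>. card {v \<in> V. G (Suc t) v \<noteq> G t v})" by (rule of_nat_mono)
  also have "\<dots> = real k * schedule_cost V k \<sigma> G"
    using k1 by (simp add: schedule_cost_def flip: sum_divide_distrib)
  finally show "real (moved (G (length \<sigma>))) \<le> real k * schedule_cost V k \<sigma> G" .
qed

lemma schedule_exists: "\<sigma> \<in> PP \<Longrightarrow> \<exists>G. valid_schedule V l (real k) f0 \<sigma> G"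
proof -
  assume s: "\<sigma> \<in> PP"
  then obtain g where "reference \<sigma> g" using PP_valid unfolding reference_def by blast
  hence "valid_assignment V l (real k) (set (take t \<sigma>)) g" for t using reference_take[of \<sigma> g t] by (simp add: reference_def)
  thus ?thesis unfolding valid_schedule_def by (intro exI[of _ "\<lambda>t. if t = 0 then f0 else g"]) simp
qed

definition ratio_const :: real where
  "ratio_const = (1 + 4 / \<epsilon>) * (320 * real q + (real relocation_const + 4) * (256000 * (real (card TT) + 1) * real (q * q) * (4 + real (4 * q * (q * q + 1)))
     + 16 * real (q * q * q)))"

lemma ratio_const_pos: "0 < ratio_const"
proof -
  have "0 < 320 * real q" using q1 by simp
  moreover have "0 \<le> (real relocation_const + 4) * (256000 * (real (card TT) + 1) * real (q * q) * (4 + real (4 * q * (q * q + 1))) + 16 * real (q * q * q))" by simp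
  ultimately have "0 < 320 * real q + (real relocation_const + 4) * (256000 * (real (card TT) + 1) * real (q * q) * (4 + real (4 * q * (q * q + 1))) + 16 * real (q * q * q))"
    by (rule add_pos_nonneg)
  moreover have "0 < 1 + 4 / \<epsilon>" using eps by (simp add: add_pos_nonneg)
  ultimately show ?thesis unfolding ratio_const_def by (intro mult_pos_pos)
qed

lemma covering:
  "\<exists>D :: (edge list \<Rightarrow> nat set) pmf. finite (set_pmf D) \<and>
    (\<forall>X\<in>set_pmf D. X [] = {} \<and> (\<forall>p\<in>PP. X p \<subseteq> {..<l} \<and> (p \<noteq> [] \<longrightarrow> good p (X p)))) \<and>
    (\<forall>\<sigma>\<in>PP. \<forall>Xs L. Xs \<subseteq> {..<l} \<longrightarrow> (\<forall>t\<in>{1..length \<sigma>}. good (take t \<sigma>) Xs) \<longrightarrow>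
      (\<Sum>t<length \<sigma>. card (Xs \<inter> hit_servers (take (Suc t) \<sigma>))) \<le> L * real (card Xs) \<longrightarrow>
      measure_pmf.expectation D (\<lambda>X. \<Sum>t<length \<sigma>.
        real (card (X (take t \<sigma>) - X (take (Suc t) \<sigma>)) + card (X (take (Suc t) \<sigma>) - X (take t \<sigma>))
          + card (X (take t \<sigma>) \<inter> hit_servers (take (Suc t) \<sigma>))))
      \<le> 8000 * (real (card TT) + 1) * real (card Xs) * (1 + ln (real (card {..<l})) + L))"
proof (rule randomized_covering)
  show "finite {..<l}" "{..<l} \<noteq> {}" using l1 by (auto simp: lessThan_empty_iff)
  show "finite TT" by (rule finite_TT)
  show "finite PP" by (rule finite_PP)
  show "\<And>p e. p @ [e] \<in> PP \<Longrightarrow> p \<in> PP" by (rule PP_closed)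
  show "\<And>p. p \<in> PP \<Longrightarrow> server_type p ` {..<l} \<subseteq> TT" using server_type_TT by blast
  show "\<And>p. hit_servers p \<subseteq> {..<l}" by (auto simp: hit_servers_def)
  show "\<And>p e s. p @ [e] \<in> PP \<Longrightarrow> s \<in> {..<l} \<Longrightarrow> s \<notin> hit_servers (p @ [e]) \<Longrightarrow> server_type (p @ [e]) s = server_type p s"
    by (simp add: hit_servers_def)
  show "\<And>p. p \<in> PP \<Longrightarrow> count_monotone {..<l} TT (server_type p) (good p)" by (rule good_count_monotone)
  show "\<And>p. p \<in> PP \<Longrightarrow> p \<noteq> [] \<Longrightarrow> good p {..<l}" by (rule all_good)
qed

theorem expected_cost:
  assumes lk: "1 \<le> ln (real k)"
  shows "\<exists>D. randomized_online_algorithm V l k \<epsilon> f0 D \<and> finite (set_pmf D) \<and>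
    (\<forall>\<sigma>\<in>PP. \<forall>g. reference \<sigma> g \<longrightarrow> real k * measure_pmf.expectation D (\<lambda>A. schedule_cost V k \<sigma> (run f0 A \<sigma>))
        \<le> ratio_const * (ln (real l) + ln (real k)) * real (moved g))"
proof -
  define \<Lambda> where "\<Lambda> = ln (real l) + ln (real k)"
  have ll: "0 \<le> ln (real l)" using l1 by simp
  have L1: "1 \<le> \<Lambda>" "ln (real k) \<le> \<Lambda>" using ll lk by (simp_all add: \<Lambda>_def)
  define c where "c = 1 + 4 / \<epsilon>"
  have c0: "0 \<le> c" using eps by (simp add: c_def)
  obtain D :: "(edge list \<Rightarrow> nat set) pmf" where fD: "finite (set_pmf D)"
    and DX: "\<forall>X\<in>set_pmf D. X [] = {} \<and> (\<forall>p\<in>PP. X p \<subseteq> {..<l} \<and> (p \<noteq> [] \<longrightarrow> good p (X p)))"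
    and DE: "\<forall>\<sigma>\<in>PP. \<forall>Xs L. Xs \<subseteq> {..<l} \<longrightarrow> (\<forall>t\<in>{1..length \<sigma>}. good (take t \<sigma>) Xs) \<longrightarrow>
      (\<Sum>t<length \<sigma>. card (Xs \<inter> hit_servers (take (Suc t) \<sigma>))) \<le> L * real (card Xs) \<longrightarrow>
      measure_pmf.expectation D (\<lambda>X. \<Sum>t<length \<sigma>.
        real (card (X (take t \<sigma>) - X (take (Suc t) \<sigma>)) + card (X (take (Suc t) \<sigma>) - X (take t \<sigma>))
          + card (X (take t \<sigma>) \<inter> hit_servers (take (Suc t) \<sigma>))))
      \<le> 8000 * (real (card TT) + 1) * real (card Xs) * (1 + ln (real (card {..<l})) + L)"
    using covering by (elim exE conjE)
  have "\<forall>X\<in>set_pmf D. \<exists>A. (\<forall>p\<in>PP. valid_assignment V l ((1 + \<epsilon>) * real k) (set p) (A p)) \<and>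
     (\<forall>\<sigma>\<in>PP. real k * schedule_cost V k \<sigma> (run f0 A \<sigma>) \<le> c * (\<Sum>t<length \<sigma>. step_bound X \<sigma> t))"
    unfolding c_def
  proof
    fix X assume "X \<in> set_pmf D"
    from bspec[OF DX this] show "\<exists>A. (\<forall>p\<in>PP. valid_assignment V l ((1 + \<epsilon>) * real k) (set p) (A p)) \<and>
     (\<forall>\<sigma>\<in>PP. real k * schedule_cost V k \<sigma> (run f0 A \<sigma>) \<le> (1 + 4 / \<epsilon>) * (\<Sum>t<length \<sigma>. step_bound X \<sigma> t))"
      by (elim conjE) (rule deterministic_algorithm)
  qed
  from bchoice[OF this] obtain alg where alg: "\<forall>X\<in>set_pmf D. (\<forall>p\<in>PP. valid_assignment V l ((1 + \<epsilon>) * real k) (set p) (alg X p)) \<and>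
     (\<forall>\<sigma>\<in>PP. real k * schedule_cost V k \<sigma> (run f0 (alg X) \<sigma>) \<le> c * (\<Sum>t<length \<sigma>. step_bound X \<sigma> t))" by (elim exE)
  define D' where "D' = map_pmf alg D"
  have "valid_schedule V l ((1 + \<epsilon>) * real k) f0 \<sigma> (run f0 A \<sigma>)" if s: "\<sigma> \<in> request_sequences V l k" and A: "A \<in> set_pmf D'" for \<sigma> A
  proof -
    obtain X where X: "X \<in> set_pmf D" "A = alg X" using A by (auto simp: D'_def)
    have "take t \<sigma> \<in> PP" for t using PP_take s by (simp add: PP_def)
    hence "valid_assignment V l ((1 + \<epsilon>) * real k) (set (take t \<sigma>)) (A (take t \<sigma>))" for t using bspec[OF alg X(1)] X(2) by blast
    thus ?thesis unfolding valid_schedule_def run_def by simp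
  qed
  hence r: "randomized_online_algorithm V l k \<epsilon> f0 D'" unfolding randomized_online_algorithm_def by blast
  have int: "integrable (measure_pmf D) h" for h :: "(edge list \<Rightarrow> nat set) \<Rightarrow> real"
    by (rule integrable_measure_pmf_finite[OF fD])
  have cost: "real k * measure_pmf.expectation D' (\<lambda>A. schedule_cost V k \<sigma> (run f0 A \<sigma>)) \<le> ratio_const * \<Lambda> * real (moved g)"
    if s: "\<sigma> \<in> PP" and g: "reference \<sigma> g" for \<sigma> g
  proof -
    define S where "S X = (\<Sum>t<length \<sigma>.
        real (card (X (take t \<sigma>) - X (take (Suc t) \<sigma>)) + card (X (take (Suc t) \<sigma>) - X (take t \<sigma>))
          + card (X (take t \<sigma>) \<inter> hit_servers (take (Suc t) \<sigma>))))" for X :: "edge list \<Rightarrow> nat set"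
    define n where "n = (\<Sum>t<length \<sigma>. natural_cost (take (Suc t) \<sigma>))"
    define fc where "fc = real (card {t. t < length \<sigma> \<and> free_change (take (Suc t) \<sigma>)})"
    define m where "m = real (moved g)"
    have m0: "0 \<le> m" by (simp add: m_def)
    have sb: "(\<Sum>t<length \<sigma>. step_bound X \<sigma> t) = 2 * n + real k * (real relocation_const + 4) * (S X + fc)" for X
    proof -
      have "(\<Sum>t<length \<sigma>. real (if free_change (take (Suc t) \<sigma>) then 1 else 0)) = fc"
        unfolding fc_def of_nat_sum[symmetric] by (simp add: sum.If_cases Int_def)
      hence "S X + fc = (\<Sum>t<length \<sigma>. real (changes (take (Suc t) \<sigma>) (X (take t \<sigma>)) (X (take (Suc t) \<sigma>))))"
        unfolding S_def changes_def by (simp add: sum.distrib)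
      thus ?thesis unfolding step_bound_def n_def by (simp add: sum.distrib sum_distrib_left)
    qed
    have "real k * measure_pmf.expectation D' (\<lambda>A. schedule_cost V k \<sigma> (run f0 A \<sigma>))
       = measure_pmf.expectation D (\<lambda>X. real k * schedule_cost V k \<sigma> (run f0 (alg X) \<sigma>))"
      by (simp add: D'_def)
    also have "\<dots> \<le> measure_pmf.expectation D (\<lambda>X. c * (2 * n + real k * (real relocation_const + 4) * (S X + fc)))"
    proof (rule integral_mono_AE[OF int int])
      show "AE X in measure_pmf D. real k * schedule_cost V k \<sigma> (run f0 (alg X) \<sigma>) \<le> c * (2 * n + real k * (real relocation_const + 4) * (S X + fc))"
        unfolding AE_measure_pmf_iff
      proof
        fix X assume X: "X \<in> set_pmf D"
        show "real k * schedule_cost V k \<sigma> (run f0 (alg X) \<sigma>) \<le> c * (2 * n + real k * (real relocation_const + 4) * (S X + fc))"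
          unfolding sb[symmetric] by (rule bspec[OF conjunct2[OF bspec[OF alg X]] s])
      qed
    qed
    also have "\<dots> = c * (2 * n + real k * (real relocation_const + 4) * (measure_pmf.expectation D S + fc))"
    proof -
      have e: "c * (2 * n + real k * (real relocation_const + 4) * (S X + fc)) = c * (2 * n + real k * (real relocation_const + 4) * fc) + c * (real k * (real relocation_const + 4)) * S X" for X
        by (simp add: algebra_simps)
      have "measure_pmf.expectation D (\<lambda>X. c * (2 * n + real k * (real relocation_const + 4) * fc) + c * (real k * (real relocation_const + 4)) * S X)
         = c * (2 * n + real k * (real relocation_const + 4) * fc) + c * (real k * (real relocation_const + 4)) * measure_pmf.expectation D S"
        by (subst Bochner_Integration.integral_add[OF int int]) simp
      thus ?thesis unfolding e by (simp add: algebra_simps)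
    qed
    also have "\<dots> \<le> c * ((320 * real q + (real relocation_const + 4) * (256000 * (real (card TT) + 1) * real (q * q) * (4 + real (4 * q * (q * q + 1)))
     + 16 * real (q * q * q))) * (\<Lambda> * m))"
    proof (rule mult_left_mono[OF _ c0])
      have n: "2 * n \<le> 320 * real q * (\<Lambda> * m)"
      proof -
        have "n \<le> 160 * real q * (m * ln (real k))" unfolding n_def m_def by (rule natural_cost_sum[OF g])
        also have "\<dots> \<le> 160 * real q * (m * \<Lambda>)" by (intro mult_left_mono) (use L1 m0 in auto)
        finally show ?thesis by (simp add: algebra_simps)
      qed
      have f: "real k * fc \<le> 16 * real (q * q * q) * (\<Lambda> * m)"
      proof -
        have "real (k * card {t. t < length \<sigma> \<and> free_change (take (Suc t) \<sigma>)}) \<le> real (16 * q * q * q * moved g)"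
          by (rule of_nat_mono[OF free_change_count[OF g]])
        hence "real k * fc \<le> 16 * real (q * q * q) * m" by (simp add: fc_def m_def)
        also have "\<dots> \<le> 16 * real (q * q * q) * (\<Lambda> * m)" by (intro mult_left_mono) (use L1 m0 in \<open>simp_all add: mult_left_mono[of 1 \<Lambda> m, simplified] mult_right_mono[of 1 \<Lambda> m, simplified]\<close>)
        finally show ?thesis .
      qed
      have E: "real k * measure_pmf.expectation D S \<le> 256000 * (real (card TT) + 1) * real (q * q) * (4 + real (4 * q * (q * q + 1))) * (\<Lambda> * m)"
      proof -
        have Xl: "touched g \<subseteq> {..<l}" by (auto simp: touched_def)
        have gd: "\<forall>t\<in>{1..length \<sigma>}. good (take t \<sigma>) (touched g)" using touched_good[OF reference_take[OF g]] by blast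
        have "measure_pmf.expectation D S \<le> 8000 * (real (card TT) + 1) * real (card (touched g)) * (1 + ln (real (card {..<l})) + hits)"
          unfolding S_def using DE s Xl gd hit_sum[OF s Xl] by blast
        also have "\<dots> \<le> 8000 * (real (card TT) + 1) * real (card (touched g)) * ((4 + real (4 * q * (q * q + 1))) * \<Lambda>)"
        proof (intro mult_left_mono)
          have "real (4 * q * (q * q + 1)) * 1 \<le> real (4 * q * (q * q + 1)) * \<Lambda>" using L1(1) by (intro mult_left_mono) auto
          moreover have "ln (real l) + ln (real k) = \<Lambda>" by (simp add: \<Lambda>_def)
          moreover have "(4 + real (4 * q * (q * q + 1))) * \<Lambda> = 4 * \<Lambda> + real (4 * q * (q * q + 1)) * \<Lambda>" by (rule distrib_right)
          ultimately show "1 + ln (real (card {..<l})) + hits \<le> (4 + real (4 * q * (q * q + 1))) * \<Lambda>"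
            unfolding hits_def card_lessThan using L1 by linarith
        qed auto
        finally have "real k * measure_pmf.expectation D S
          \<le> real k * (8000 * (real (card TT) + 1) * real (card (touched g)) * ((4 + real (4 * q * (q * q + 1))) * \<Lambda>))" by (rule mult_left_mono) simp
        also have "\<dots> = (8000 * (real (card TT) + 1) * ((4 + real (4 * q * (q * q + 1))) * \<Lambda>)) * real (card (touched g) * k)" by (simp only: of_nat_mult mult_ac)
        also have "\<dots> \<le> (8000 * (real (card TT) + 1) * ((4 + real (4 * q * (q * q + 1))) * \<Lambda>)) * real (32 * q * q * moved g)"
          by (intro mult_left_mono of_nat_mono card_touched[OF g]) (use L1 in \<open>auto intro!: mult_nonneg_nonneg\<close>)
        also have "\<dots> = 256000 * (real (card TT) + 1) * real (q * q) * (4 + real (4 * q * (q * q + 1))) * (\<Lambda> * m)"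
        proof -
          have "real (32 * q * q * moved g) = 32 * real (q * q) * m" by (simp add: m_def)
          thus ?thesis by (simp only: mult_ac)
        qed
        finally show ?thesis .
      qed
      have "(real relocation_const + 4) * (real k * measure_pmf.expectation D S + real k * fc)
         \<le> (real relocation_const + 4) * (256000 * (real (card TT) + 1) * real (q * q) * (4 + real (4 * q * (q * q + 1))) * (\<Lambda> * m) + 16 * real (q * q * q) * (\<Lambda> * m))"
        by (intro mult_left_mono add_mono E f) simp
      moreover have "real k * (real relocation_const + 4) * (measure_pmf.expectation D S + fc) = (real relocation_const + 4) * (real k * measure_pmf.expectation D S + real k * fc)"
        by (simp only: distrib_left mult_ac)
      ultimately show "2 * n + real k * (real relocation_const + 4) * (measure_pmf.expectation D S + fc)
        \<le> (320 * real q + (real relocation_const + 4) * (256000 * (real (card TT) + 1) * real (q * q) * (4 + real (4 * q * (q * q + 1))) + 16 * real (q * q * q))) * (\<Lambda> * m)"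
        using n unfolding distrib_right[of "320 * real q"] mult.assoc[of "real relocation_const + 4"] distrib_right[of _ _ "\<Lambda> * m"] by linarith
    qed
    also have "\<dots> = ratio_const * \<Lambda> * real (moved g)" unfolding ratio_const_def c_def m_def by (simp only: mult.assoc)
    finally show ?thesis .
  qed
  have "finite (set_pmf D')" using fD by (simp add: D'_def)
  thus ?thesis using r cost unfolding \<Lambda>_def by blast
qed

theorem competitive:
  assumes lk: "1 \<le> ln (real k)"
  shows "\<exists>D. randomized_online_algorithm V l k \<epsilon> f0 D \<and>
     competitive_ratio V l k f0 D \<le> ennreal (ratio_const * (ln (real l) + ln (real k)))"
proof -
  define \<Lambda> where "\<Lambda> = ln (real l) + ln (real k)"
  have L1: "0 < ratio_const * \<Lambda>" using ratio_const_pos lk l1 by (intro mult_pos_pos) (simp_all add: \<Lambda>_def add_nonneg_pos)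
  obtain D where r: "randomized_online_algorithm V l k \<epsilon> f0 D"
    and E: "\<forall>\<sigma>\<in>PP. \<forall>g. reference \<sigma> g \<longrightarrow> real k * measure_pmf.expectation D (\<lambda>A. schedule_cost V k \<sigma> (run f0 A \<sigma>)) \<le> ratio_const * \<Lambda> * real (moved g)"
    using expected_cost[OF lk] unfolding \<Lambda>_def by (elim exE conjE)
  have "ennreal (measure_pmf.expectation D (\<lambda>A. schedule_cost V k \<sigma> (run f0 A \<sigma>))) / ennreal (opt_cost V l k f0 \<sigma>) \<le> ennreal (ratio_const * \<Lambda>)"
    if s: "\<sigma> \<in> request_sequences V l k" for \<sigma>
  proof -
    let ?E = "measure_pmf.expectation D (\<lambda>A. schedule_cost V k \<sigma> (run f0 A \<sigma>))"
    let ?O = "opt_cost V l k f0 \<sigma>"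
    have sP: "\<sigma> \<in> PP" using s by (simp add: PP_def)
    have le: "?E \<le> ratio_const * \<Lambda> * schedule_cost V k \<sigma> G" if G: "valid_schedule V l (real k) f0 \<sigma> G" for G
    proof (cases "\<sigma> = []")
      case True thus ?thesis by (simp add: schedule_cost_def)
    next
      case False
      note M = moved_le_cost[OF G sP False]
      have "real k * ?E \<le> ratio_const * \<Lambda> * real (moved (G (length \<sigma>)))" using E sP M(1) by blast
      also have "\<dots> \<le> ratio_const * \<Lambda> * (real k * schedule_cost V k \<sigma> G)" using M(2) L1 by (intro mult_left_mono) auto
      also have "\<dots> = real k * (ratio_const * \<Lambda> * schedule_cost V k \<sigma> G)" by (simp only: mult_ac)
      finally show ?thesis using k1 by simp
    qed
    have "?E / (ratio_const * \<Lambda>) \<le> ?O" unfolding opt_cost_def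
    proof (rule cInf_greatest)
      show "{schedule_cost V k \<sigma> G |G. valid_schedule V l (real k) f0 \<sigma> G} \<noteq> {}" using schedule_exists[OF sP] by blast
      fix x assume "x \<in> {schedule_cost V k \<sigma> G |G. valid_schedule V l (real k) f0 \<sigma> G}"
      then obtain G where "x = schedule_cost V k \<sigma> G" "valid_schedule V l (real k) f0 \<sigma> G" by blast
      thus "?E / (ratio_const * \<Lambda>) \<le> x" using le L1 by (simp add: field_simps)
    qed
    hence EO: "?E \<le> ratio_const * \<Lambda> * ?O" using L1 by (simp add: field_simps)
    have E0: "0 \<le> ?E" by (intro integral_nonneg_AE) (simp add: schedule_cost_def sum_nonneg)
    show ?thesis
    proof (cases "?O > 0")
      case True
      hence "ennreal ?E / ennreal ?O = ennreal (?E / ?O)" using E0 by (intro divide_ennreal)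
      also have "\<dots> \<le> ennreal (ratio_const * \<Lambda>)" using EO True by (intro ennreal_leI) (simp add: field_simps)
      finally show ?thesis .
    next
      case False
      hence "ratio_const * \<Lambda> * ?O \<le> 0" using L1 by (simp add: mult_nonneg_nonpos)
      hence "?E = 0" using EO E0 by linarith
      thus ?thesis by simp
    qed
  qed
  hence "competitive_ratio V l k f0 D \<le> ennreal (ratio_const * \<Lambda>)" unfolding competitive_ratio_def by (rule SUP_least)
  thus ?thesis using r unfolding \<Lambda>_def by blast
qed

end

theorem theorem6p1:
  fixes \<epsilon> :: real
  assumes "0 < \<epsilon>" and "\<epsilon> < 1 / 4"
  shows "\<exists>C::real. C > 0 \<and>
    (\<forall>l k :: nat. l \<ge> 1 \<longrightarrow> k \<ge> 1 \<longrightarrow> (10 / real k) powr (1 / 4) \<le> \<epsilon> \<longrightarrow>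
      (\<forall>V f0. initial_assignment V l k f0 \<longrightarrow>
        (\<exists>D. randomized_online_algorithm V l k \<epsilon> f0 D \<and>
             competitive_ratio V l k f0 D \<le> ennreal (C * (ln (real l) + ln (real k))))))"
proof -
  define q where "q = nat \<lceil>6 / \<epsilon>\<rceil>"
  have qe: "6 / \<epsilon> \<le> real q" unfolding q_def by (rule real_nat_ceiling_ge)
  hence q6: "6 \<le> \<epsilon> * real q" using assms(1) by (simp add: field_simps)
  have q1: "1 \<le> q"
  proof (rule ccontr)
    assume "\<not> 1 \<le> q"
    hence "real q = 0" by simp
    thus False using q6 by simp
  qed
  have main: "\<exists>D. randomized_online_algorithm V l k \<epsilon> f0 D \<and>
       competitive_ratio V l k f0 D \<le> ennreal (max 1 (rounded.ratio_const q \<epsilon>) * (ln (real l) + ln (real k)))"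
    if h: "l \<ge> 1" "k \<ge> 1" "(10 / real k) powr (1 / 4) \<le> \<epsilon>" "initial_assignment V l k f0" for l k V f0
  proof -
    have k0: "0 < real k" using h(2) by simp
    have "((10 / real k) powr (1 / 4)) ^ 4 \<le> (1 / 4) ^ 4" using h(3) assms by (intro power_mono) auto
    moreover have "((10 / real k) powr (1 / 4)) ^ 4 = 10 / real k" using k0 by (simp add: powr_power)
    ultimately have "10 / real k \<le> 1 / 256" by (simp add: power_divide)
    hence k3: "3 \<le> real k" using k0 by (simp add: field_simps)
    have "exp 1 \<le> real k" using exp_le k3 by linarith
    hence lk: "1 \<le> ln (real k)" using k0 by (simp add: ln_ge_iff)
    interpret inst l k q f0 V
      by unfold_locales (use q1 h in \<open>auto simp: initial_assignment_def\<close>)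
    obtain F where F: "F [] = (\<lambda>K. Some (f0 (the_elem K)), \<lambda>_. 0, None)" "\<forall>p. p \<in> PP \<longrightarrow> (\<forall>K\<in>C p. okhome K (fst (F p) K))"
      "\<forall>p e. p @ [e] \<in> PP \<longrightarrow> home_step p e (F p) (F (p @ [e]))" using homes_exist by (elim exE conjE)
    interpret rounded l k q f0 V F \<epsilon>
      by unfold_locales (use F assms q6 in auto)
    obtain D where D: "randomized_online_algorithm V l k \<epsilon> f0 D" "competitive_ratio V l k f0 D \<le> ennreal (ratio_const * (ln (real l) + ln (real k)))"
      using competitive[OF lk] by blast
    have "ratio_const * (ln (real l) + ln (real k)) \<le> max 1 ratio_const * (ln (real l) + ln (real k))"
      using lk h(1) by (intro mult_right_mono) auto
    thus ?thesis using D by (meson ennreal_leI order_trans)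
  qed
  show ?thesis by (intro exI[of _ "max 1 (rounded.ratio_const q \<epsilon>)"] conjI allI impI main) simp
qed

end
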